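(* Let $\{\lambda_j\}_{j\in J}$, $J=\{n,\dots,n+N\}$, be a cluster of eigenvalues of $-\Delta_\gamma$ with $\lambda_{n-1}<\lambda_n$ and $\lambda_{n+N}<\lambda_{n+N+1}$, and let the discrete eigenvalues $\{\Lambda_j\}_{j=1}^{\dim\mathbb V_\#}$ be such that $\mu(J)<\infty$. Fix $i\in J$ and let $u_i\in H^1_\#(\gamma)$ be any eigenfunction associated with $\lambda_i$. Then for any $\alpha\in\mathbb R$, $$ \|u_i-\mathbf P u_i-\alpha\|_{\widetilde M}\le\|u_i-\mathbf Z u_i-\alpha\|_{\widetilde M}\le C(1+\mu(J))\|u_i-\mathbf G u_i-\alpha\|_{\widetilde M}+C(1+\mu(J))\,h^{k+1}\|u_i\|_{\widetilde M}, $$ with a constant $C$ of the type described in the context.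
   Context: Surface. $\gamma\subset\mathbb R^{D+1}$ is a connected, compact, orientable, $C^\infty$, $D$-dimensional embedded surface without boundary; $d$ is its signed distance function (negative inside), $\nu=\nabla d$, and $\mathcal N$ is a sufficiently narrow strip about $\gamma$ in which every $x$ is uniquely $x=\psi(x)+d(x)\nu(x)$ with $\psi(x)\in\gamma$ the closest-point projection. Approximate surface. $\overline\Gamma$ is a polyhedron with simplicial $D$-dimensional faces $\overline T\in\overline{\mathcal T}$. Fix $k\ge1$. On each $\overline T$ with degree-$k$ Lagrange nodes $x^1,\dots,x^{n_k}$ and basis functions $\phi_j$, set $L(x)=\sum_j L(x^j)\phi_j(x)$, where $|L(x^j)-\psi(x^j)|\le Ch^{k+1}$; $L:\overline\Gamma\to\Gamma:=L(\overline\Gamma)$ is a continuous bijection, $\mathcal T=\{L(\overline T)\}$, $h=\max_{T\in\mathcal T}\mathrm{diam}(T)$. Assume $\Gamma\subset\mathcal N$ and $\psi|_\Gamma:\Gamma\to\gamma$ is a bijection. With $F_T=L\circ\overline F_T$ ($\overline F_T$ the affine map from a reference simplex $\widehat T$ to $\overline T$), the shape-regularity constant $\rho$ is the largest number with $\rho\,\mathrm{diam}(T)|\xi|\le|DF_T(\hat x)\xi|\le\rho^{-1}\mathrm{diam}(T)|\xi|$ for all $T$, $\hat x\in\widehat T$, $\xi\in\mathbb R^D$; the quasi-uniformity constant $\eta$ is the smallest with $h\le\eta\min_T\mathrm{diam}(T)$. With $\mathbf N$ the unit normal of $\Gamma$, the following standing bounds hold: $\|d\|_{L_\infty(\Gamma)}\le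 Ch^{k+1}$, $\|\nu-\mathbf N\|_{L_\infty(\Gamma)}\le Ch^k$, $\|L-\psi\|_{W^{i,\infty}(\overline T)}\le Ch^{k+1-i}$ for $0\le i\le k+1$. Lifts and forms. Functions on $\Gamma$ and on $\gamma$ are identified through $\psi|_\Gamma$: $v$ on $\Gamma$ corresponds to $\tilde v=v\circ(\psi|_\Gamma)^{-1}$ on $\gamma$ (tildes are dropped). $\tilde a(u,v)=\int_\gamma\nabla_\gamma u\cdot\nabla_\gamma v\,d\sigma$, $\tilde m(u,v)=\int_\gamma uv\,d\sigma$; $\widetilde A(\tilde u,\tilde v)=\int_\Gamma\nabla_\Gamma u\cdot\nabla_\Gamma v\,d\Sigma$, $\widetilde M(\tilde u,\tilde v)=\int_\Gamma uv\,d\Sigma$; $\|\cdot\|_{\widetilde A},\|\cdot\|_{\widetilde M}$ are the associated (semi)norms. Finite elements. For $r\ge1$, $\mathbb V=\{V\in H^1(\Gamma): V=\overline V\circ L^{-1},\ \overline V|_{\overline T}\in\mathbb P^r(\overline T)\ \forall\overline T\}$ and $\mathbb V_\#=\{V\in\mathbb V:\int_\Gamma V\,d\Sigma=0\}$. Eigenproblems. $H^1_\#(\gamma)=\{v\in H^1(\gamma):\int_\gamma v\,d\sigma=0\}$; $0=\lambda_0<\lambda_1\le\lambda_2\le\dots$ are the eigenvalues of $-\Delta_\gamma$, and $u_i\in H^1_\#(\gamma)$ is an eigenfunction for $\lambda_i$, $i\ge1$, if $u_i\ne0$ and $\tilde a(u_i,v)=\lambda_i\tilde m(u_i,v)$ for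 all $v\in H^1_\#(\gamma)$. $0<\Lambda_1\le\dots\le\Lambda_{\dim\mathbb V_\#}$ and $\{U_j\}\subset\mathbb V_\#$ are the discrete eigenvalues and $\widetilde M$-orthonormal eigenfunctions: $\widetilde A(U_j,V)=\Lambda_j\widetilde M(U_j,V)$ for all $V\in\mathbb V_\#$. For $J=\{n,\dots,n+N\}$ ($n\ge1$, $N\ge0$, $n+N\le\dim\mathbb V_\#$), $\mathbb W_\#=\mathrm{span}\{U_j:j\in J\}$ and $\mu(J)=\max_{\ell\in J}\max_{j\in\{1,\dots,\dim\mathbb V_\#\}\setminus J}\left|\frac{\lambda_\ell}{\Lambda_j-\lambda_\ell}\right|$. Projections on $H^1(\gamma)$. $\mathbf Gv\in\mathbb V_\#$: $\widetilde A(\mathbf Gv,V)=\widetilde A(v,V)$ for all $V\in\mathbb V_\#$. $\mathbf Pv\in\mathbb W_\#$: $\widetilde M(\mathbf Pv,V)=\widetilde M(v,V)$ for all $V\in\mathbb W_\#$. $\mathbf Zv\in\mathbb W_\#$: $\widetilde A(\mathbf Zv,V)=\widetilde A(v,V)$ for all $V\in\mathbb W_\#$. Constants. $C$ depends only on $\gamma$ (including its Poincaré–Friedrichs constant), $D,k,r$, $\rho$, $\eta$ and the constants in the standing bounds, but not on $h$ nor otherwise on the spectrum of $-\Delta_\gamma$. *)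

theory Defs
  imports "HOL-Analysis.Analysis"
begin

text \<open>For open \<open>U\<close>. Quantifying over all fixed directions \<open>v\<close> makes \<open>smooth_on\<close> the usual notion
  of $C^\infty$.\<close>

primrec Ck_on :: "nat \<Rightarrow> ('a::euclidean_space \<Rightarrow> 'b::real_normed_vector) \<Rightarrow> 'a set \<Rightarrow> bool" where
  "Ck_on 0 f U \<longleftrightarrow> continuous_on U f"
| "Ck_on (Suc n) f U \<longleftrightarrow> (\<forall>x\<in>U. f differentiable (at x)) \<and>
     (\<forall>v. Ck_on n (\<lambda>x. frechet_derivative f (at x) v) U)"

definition smooth_on :: "('a::euclidean_space \<Rightarrow> 'b::real_normed_vector) \<Rightarrow> 'a set \<Rightarrow> bool" where
  "smooth_on f U \<longleftrightarrow> (\<forall>n. Ck_on n f U)"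

definition grad :: "('a::euclidean_space \<Rightarrow> real) \<Rightarrow> 'a \<Rightarrow> 'a" where
  "grad f x = (\<Sum>b\<in>Basis. frechet_derivative f (at x) b *\<^sub>R b)"

text \<open>The derivative is taken within \<open>S\<close>, so that maps given only on a closed simplex \<open>S\<close> are covered;
  for open \<open>S\<close> it is the ordinary derivative. \<open>area_density\<close> is the square root of the
  determinant of the first fundamental form.\<close>

definition area_density :: "(real^'n) set \<Rightarrow> (real^'n \<Rightarrow> real^'m) \<Rightarrow> real^'n \<Rightarrow> real" where
  "area_density S f x = sqrt (det (\<chi> i j.
     frechet_derivative f (at x within S) (axis i 1) \<bullet>
     frechet_derivative f (at x within S) (axis j 1)))"

definition local_param :: "(real^'m) set \<Rightarrow> (real^'n \<Rightarrow> real^'m) \<Rightarrow> (real^'n) set \<Rightarrow> bool" where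
  "local_param \<gamma> f U \<longleftrightarrow> open U \<and> smooth_on f U \<and>
     (\<forall>x\<in>U. inj (frechet_derivative f (at x))) \<and>
     openin (top_of_set \<gamma>) (f ` U) \<and> (\<exists>g. homeomorphism U (f ` U) f g)"

text \<open>The type argument carries the dimension \<open>D = CARD('n)\<close> of the surface.\<close>

definition smooth_closed_surface :: "'n::finite itself \<Rightarrow> (real^'m) set \<Rightarrow> bool" where
  "smooth_closed_surface TYPE('n) \<gamma> \<longleftrightarrow>
     \<gamma> \<noteq> {} \<and> connected \<gamma> \<and> compact \<gamma> \<and>
     (\<forall>p\<in>\<gamma>. \<exists>(f :: real^'n \<Rightarrow> real^'m) U. local_param \<gamma> f U \<and> p \<in> f ` U)"

definition orientable_surface :: "'n::finite itself \<Rightarrow> (real^'m) set \<Rightarrow> bool" where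
  "orientable_surface TYPE('n) \<gamma> \<longleftrightarrow>
     (\<exists>n. continuous_on \<gamma> n \<and> (\<forall>y\<in>\<gamma>. norm (n y) = 1) \<and>
       (\<forall>(f :: real^'n \<Rightarrow> real^'m) U. local_param \<gamma> f U \<longrightarrow>
          (\<forall>x\<in>U. \<forall>\<xi>. n (f x) \<bullet> frechet_derivative f (at x) \<xi> = 0)))"

text \<open>The Riemannian surface measure $d\sigma$, as a Borel measure on the space \<open>\<gamma>\<close>. It is the unique measure
  with this property, because \<open>\<gamma>\<close> is covered by countably many parametrised patches.\<close>

definition surface_measure :: "'n::finite itself \<Rightarrow> (real^'m) set \<Rightarrow> (real^'m) measure \<Rightarrow> bool" where
  "surface_measure TYPE('n) \<gamma> \<sigma> \<longleftrightarrow>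
     space \<sigma> = \<gamma> \<and> sets \<sigma> = sets (restrict_space borel \<gamma>) \<and>
     (\<forall>(f :: real^'n \<Rightarrow> real^'m) U. local_param \<gamma> f U \<longrightarrow>
       (\<forall>B\<in>sets borel. emeasure \<sigma> (f ` U \<inter> B) =
          (\<integral>\<^sup>+x. indicator U x * indicator B (f x) * ennreal (area_density U f x) \<partial>lborel)))"

definition sdist :: "(real^'m) set \<Rightarrow> real^'m \<Rightarrow> real" where
  "sdist \<gamma> x = (if x \<in> inside \<gamma> then - infdist x \<gamma> else infdist x \<gamma>)"

abbreviation nu :: "(real^'m) set \<Rightarrow> real^'m \<Rightarrow> real^'m" where
  "nu \<gamma> \<equiv> grad (sdist \<gamma>)"

definition strip :: "(real^'m) set \<Rightarrow> real \<Rightarrow> (real^'m) set" where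
  "strip \<gamma> \<delta> = {x. infdist x \<gamma> < \<delta>}"

definition narrow_strip :: "(real^'m) set \<Rightarrow> real \<Rightarrow> bool" where
  "narrow_strip \<gamma> \<delta> \<longleftrightarrow> \<delta> > 0 \<and> smooth_on (sdist \<gamma>) (strip \<gamma> \<delta>) \<and>
     (\<forall>x\<in>strip \<gamma> \<delta>. (\<exists>!p. p \<in> \<gamma> \<and> dist x p = infdist x \<gamma>) \<and>
        x = closest_point \<gamma> x + sdist \<gamma> x *\<^sub>R nu \<gamma> x)"

text \<open>A surface enters here through its surface measure \<open>\<mu>\<close> and a unit normal field \<open>n\<close> (only needed almost
  everywhere). \<open>H1 \<mu> n\<close> is the completion of the restrictions of smooth ambient functions \<open>w\<close>, whose
  tangential gradient is the tangential part of \<open>grad w\<close>. This covers both the smooth surface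
  and the piecewise smooth one.\<close>

definition tangential :: "('a::euclidean_space \<Rightarrow> 'a) \<Rightarrow> ('a \<Rightarrow> real) \<Rightarrow> 'a \<Rightarrow> 'a" where
  "tangential n w x = grad w x - (n x \<bullet> grad w x) *\<^sub>R n x"

definition square_integrable :: "'a measure \<Rightarrow> ('a \<Rightarrow> 'b::euclidean_space) \<Rightarrow> bool" where
  "square_integrable \<mu> f \<longleftrightarrow> f \<in> borel_measurable \<mu> \<and> integrable \<mu> (\<lambda>x. (norm (f x))\<^sup>2)"

definition weak_tgrad ::
  "'a::euclidean_space measure \<Rightarrow> ('a \<Rightarrow> 'a) \<Rightarrow> ('a \<Rightarrow> real) \<Rightarrow> ('a \<Rightarrow> 'a) \<Rightarrow> bool" where
  "weak_tgrad \<mu> n v g \<longleftrightarrow> square_integrable \<mu> v \<and> square_integrable \<mu> g \<and>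
     (\<exists>w :: nat \<Rightarrow> 'a \<Rightarrow> real. (\<forall>j. smooth_on (w j) UNIV) \<and>
        (\<lambda>j. LINT x|\<mu>. (w j x - v x)\<^sup>2) \<longlonglongrightarrow> 0 \<and>
        (\<lambda>j. LINT x|\<mu>. (norm (tangential n (w j) x - g x))\<^sup>2) \<longlonglongrightarrow> 0)"

definition H1 :: "'a::euclidean_space measure \<Rightarrow> ('a \<Rightarrow> 'a) \<Rightarrow> ('a \<Rightarrow> real) set" where
  "H1 \<mu> n = {v. \<exists>g. weak_tgrad \<mu> n v g}"

definition tgrad :: "'a::euclidean_space measure \<Rightarrow> ('a \<Rightarrow> 'a) \<Rightarrow> ('a \<Rightarrow> real) \<Rightarrow> 'a \<Rightarrow> 'a" where
  "tgrad \<mu> n v = (SOME g. weak_tgrad \<mu> n v g)"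

definition mass :: "'a measure \<Rightarrow> ('a \<Rightarrow> real) \<Rightarrow> ('a \<Rightarrow> real) \<Rightarrow> real" where
  "mass \<mu> u v = (LINT x|\<mu>. u x * v x)"

definition stiffness ::
  "'a::euclidean_space measure \<Rightarrow> ('a \<Rightarrow> 'a) \<Rightarrow> ('a \<Rightarrow> real) \<Rightarrow> ('a \<Rightarrow> real) \<Rightarrow> real" where
  "stiffness \<mu> n u v = (LINT x|\<mu>. tgrad \<mu> n u x \<bullet> tgrad \<mu> n v x)"

definition mass_norm :: "'a measure \<Rightarrow> ('a \<Rightarrow> real) \<Rightarrow> real" where
  "mass_norm \<mu> v = sqrt (mass \<mu> v v)"

definition H1_zero_mean :: "'a::euclidean_space measure \<Rightarrow> ('a \<Rightarrow> 'a) \<Rightarrow> ('a \<Rightarrow> real) set" where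
  "H1_zero_mean \<mu> n = {v \<in> H1 \<mu> n. (LINT x|\<mu>. v x) = 0}"

definition eigenfunction ::
  "'a::euclidean_space measure \<Rightarrow> ('a \<Rightarrow> 'a) \<Rightarrow> real \<Rightarrow> ('a \<Rightarrow> real) \<Rightarrow> bool" where
  "eigenfunction \<mu> n l u \<longleftrightarrow> u \<in> H1_zero_mean \<mu> n \<and> \<not> (AE x in \<mu>. u x = 0) \<and>
     (\<forall>v\<in>H1_zero_mean \<mu> n. stiffness \<mu> n u v = l * mass \<mu> u v)"

text \<open>\<open>lam\<close> lists the eigenvalues in increasing order and with multiplicity: the \<open>e j\<close> with \<open>lam j = t\<close> form an
  orthonormal basis of the eigenspace of \<open>t\<close>. The index \<open>0\<close> belongs to the constants.\<close>

definition laplace_eigenvalues ::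
  "'a::euclidean_space measure \<Rightarrow> ('a \<Rightarrow> 'a) \<Rightarrow> (nat \<Rightarrow> real) \<Rightarrow> bool" where
  "laplace_eigenvalues \<mu> n lam \<longleftrightarrow> mono lam \<and> lam 0 = 0 \<and> 0 < lam 1 \<and>
     (\<exists>e :: nat \<Rightarrow> 'a \<Rightarrow> real.
        (\<forall>j\<ge>1. eigenfunction \<mu> n (lam j) (e j)) \<and>
        (\<forall>i\<ge>1. \<forall>j\<ge>1. mass \<mu> (e i) (e j) = of_bool (i = j)) \<and>
        (\<forall>t. finite {j. 1 \<le> j \<and> lam j = t} \<and>
           (\<forall>u. eigenfunction \<mu> n t u \<longrightarrow>
              (\<exists>c. AE x in \<mu>. u x = (\<Sum>j | 1 \<le> j \<and> lam j = t. c j * e j x)))))"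

text \<open>A function on a \<open>D\<close>-simplex in $\mathbb R^{D+1}$ is a polynomial of degree at most \<open>r\<close> iff it is the
  restriction of such a polynomial in the ambient coordinates.\<close>

definition poly_on :: "nat \<Rightarrow> (real^'m) set \<Rightarrow> (real^'m \<Rightarrow> real) \<Rightarrow> bool" where
  "poly_on r T f \<longleftrightarrow> (\<exists>c :: ('m \<Rightarrow> nat) \<Rightarrow> real. \<forall>x\<in>T.
     f x = (\<Sum>a | sum a UNIV \<le> r. c a * (\<Prod>i\<in>UNIV. (x $ i) ^ a i)))"

definition lagrange_nodes :: "nat \<Rightarrow> 'a::euclidean_space set \<Rightarrow> 'a set" where
  "lagrange_nodes k T =
     {(\<Sum>v | v extreme_point_of T. (real (a v) / real k) *\<^sub>R v) | a :: 'a \<Rightarrow> nat.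
        (\<Sum>v | v extreme_point_of T. a v) = k}"

definition lagrange_interpolatory :: "nat \<Rightarrow> (real^'m) set \<Rightarrow> (real^'m \<Rightarrow> real^'m) \<Rightarrow> bool" where
  "lagrange_interpolatory k T L \<longleftrightarrow> (\<exists>\<phi> :: real^'m \<Rightarrow> real^'m \<Rightarrow> real.
     (\<forall>p\<in>lagrange_nodes k T. poly_on k T (\<phi> p) \<and>
        (\<forall>q\<in>lagrange_nodes k T. \<phi> p q = of_bool (p = q))) \<and>
     (\<forall>x\<in>T. L x = (\<Sum>p\<in>lagrange_nodes k T. \<phi> p x *\<^sub>R L p)))"

primrec iter_dir_deriv ::
  "'a::real_normed_vector list \<Rightarrow> ('a \<Rightarrow> 'b::real_normed_vector) \<Rightarrow> 'a \<Rightarrow> 'b" where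
  "iter_dir_deriv [] g = g"
| "iter_dir_deriv (\<tau> # \<tau>s) g =
     (\<lambda>x. vector_derivative (\<lambda>t. iter_dir_deriv \<tau>s g (x + t *\<^sub>R \<tau>)) (at 0))"

text \<open>The $W^{i,\infty}(T)$ norm of \<open>g\<close> on the flat simplex \<open>T\<close> is at most \<open>B\<close>. Only directions tangent to
  \<open>T\<close> are used, so that only the values of \<open>g\<close> on \<open>T\<close> matter.\<close>

definition W_inf_le :: "nat \<Rightarrow> 'a::euclidean_space set \<Rightarrow> ('a \<Rightarrow> 'b::real_normed_vector) \<Rightarrow> real \<Rightarrow> bool" where
  "W_inf_le i T g B \<longleftrightarrow> (\<forall>\<tau>s. length \<tau>s \<le> i \<and>
     (\<forall>\<tau>\<in>set \<tau>s. norm \<tau> = 1 \<and> \<tau> \<in> span {y - z | y z. y \<in> T \<and> z \<in> T}) \<longrightarrow>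
     (\<forall>x\<in>rel_interior T. norm (iter_dir_deriv \<tau>s g x) \<le> B))"

text \<open>\<open>faces\<close> are the flat simplices, \<open>Lmap\<close> is the map \<open>L\<close>, \<open>ref_map T\<close> is the affine map from the
  reference simplex onto \<open>T\<close>, and \<open>normal\<close> is the unit normal of the approximate surface.\<close>

record ('n, 'm) discrete_surface =
  faces :: "(real^'m) set set"
  Lmap :: "real^'m \<Rightarrow> real^'m"
  ref_map :: "(real^'m) set \<Rightarrow> real^'n \<Rightarrow> real^'m"
  normal :: "real^'m \<Rightarrow> real^'m"

definition ref_simplex :: "(real^'n) set" where
  "ref_simplex = convex hull (insert 0 Basis)"

definition polyhedron_of :: "('n::finite, 'm::finite) discrete_surface \<Rightarrow> (real^'m) set" where
  "polyhedron_of S = \<Union>(faces S)"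

definition Gamma :: "('n::finite, 'm::finite) discrete_surface \<Rightarrow> (real^'m) set" where
  "Gamma S = Lmap S ` polyhedron_of S"

definition elem_map ::
  "('n::finite, 'm::finite) discrete_surface \<Rightarrow> (real^'m) set \<Rightarrow> real^'n \<Rightarrow> real^'m" where
  "elem_map S T = Lmap S \<circ> ref_map S T"

definition elem_diam :: "('n::finite, 'm::finite) discrete_surface \<Rightarrow> (real^'m) set \<Rightarrow> real" where
  "elem_diam S T = diameter (Lmap S ` T)"

definition mesh_size :: "('n::finite, 'm::finite) discrete_surface \<Rightarrow> real" where
  "mesh_size S = Max (elem_diam S ` faces S)"

definition Gamma_measure :: "('n::finite, 'm::finite) discrete_surface \<Rightarrow> (real^'m) measure" where
  "Gamma_measure S = measure_of (Gamma S) (sets (restrict_space borel (Gamma S)))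
     (\<lambda>B. \<Sum>T\<in>faces S. \<integral>\<^sup>+x. indicator ref_simplex x * indicator B (elem_map S T x) *
        ennreal (area_density ref_simplex (elem_map S T) x) \<partial>lborel)"

definition shape_bounds :: "('n::finite, 'm::finite) discrete_surface \<Rightarrow> real \<Rightarrow> bool" where
  "shape_bounds S \<rho> \<longleftrightarrow> \<rho> > 0 \<and> (\<forall>T\<in>faces S. \<forall>x\<in>ref_simplex. \<forall>\<xi>.
     let D\<xi> = frechet_derivative (elem_map S T) (at x within ref_simplex) \<xi> in
       \<rho> * elem_diam S T * norm \<xi> \<le> norm D\<xi> \<and> norm D\<xi> \<le> inverse \<rho> * elem_diam S T * norm \<xi>)"

definition shape_regularity_constant :: "('n::finite, 'm::finite) discrete_surface \<Rightarrow> real \<Rightarrow> bool" where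
  "shape_regularity_constant S \<rho> \<longleftrightarrow> shape_bounds S \<rho> \<and> (\<forall>\<rho>'. shape_bounds S \<rho>' \<longrightarrow> \<rho>' \<le> \<rho>)"

definition quasi_uniformity_constant :: "('n::finite, 'm::finite) discrete_surface \<Rightarrow> real \<Rightarrow> bool" where
  "quasi_uniformity_constant S \<eta> \<longleftrightarrow>
     mesh_size S \<le> \<eta> * Min (elem_diam S ` faces S) \<and>
     (\<forall>\<eta>'. mesh_size S \<le> \<eta>' * Min (elem_diam S ` faces S) \<longrightarrow> \<eta> \<le> \<eta>')"

text \<open>Functions on \<open>\<gamma>\<close> and on \<open>Gamma S\<close> are identified through the closest-point projection, and this is
  used for Sobolev functions. The bijection is therefore taken to be bi-Lipschitz; the projection itself is
  Lipschitz on \<open>Gamma S\<close>, so only the inverse is mentioned.\<close>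

definition discrete_surface_of ::
  "(real^'m) set \<Rightarrow> real \<Rightarrow> nat \<Rightarrow> ('n::finite, 'm::finite) discrete_surface \<Rightarrow> bool" where
  "discrete_surface_of \<gamma> \<delta> k S \<longleftrightarrow>
     triangulation (faces S) \<and>
     (\<forall>T\<in>faces S. int CARD('n) simplex T \<and>
        (\<exists>A b. linear A \<and> ref_map S T = (\<lambda>x. A x + b)) \<and> ref_map S T ` ref_simplex = T \<and>
        lagrange_interpolatory k T (Lmap S)) \<and>
     continuous_on (polyhedron_of S) (Lmap S) \<and> inj_on (Lmap S) (polyhedron_of S) \<and>
     polyhedron_of S \<subseteq> strip \<gamma> \<delta> \<and> Gamma S \<subseteq> strip \<gamma> \<delta> \<and>
     bij_betw (closest_point \<gamma>) (Gamma S) \<gamma> \<and>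
     (\<exists>B. lipschitz_on B \<gamma> (inv_into (Gamma S) (closest_point \<gamma>))) \<and>
     normal S \<in> borel_measurable (restrict_space borel (Gamma S)) \<and>
     (\<forall>T\<in>faces S. \<forall>x\<in>interior ref_simplex. norm (normal S (elem_map S T x)) = 1 \<and>
        (\<forall>\<xi>. normal S (elem_map S T x) \<bullet>
           frechet_derivative (elem_map S T) (at x within ref_simplex) \<xi> = 0))"

definition standing_bounds ::
  "(real^'m) set \<Rightarrow> nat \<Rightarrow> real \<Rightarrow> ('n::finite, 'm::finite) discrete_surface \<Rightarrow> bool" where
  "standing_bounds \<gamma> k C S \<longleftrightarrow> (let h = mesh_size S in
     (\<forall>T\<in>faces S. \<forall>p\<in>lagrange_nodes k T. norm (Lmap S p - closest_point \<gamma> p) \<le> C * h ^ (k + 1)) \<and>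
     (\<forall>x\<in>Gamma S. \<bar>sdist \<gamma> x\<bar> \<le> C * h ^ (k + 1)) \<and>
     (\<forall>T\<in>faces S. \<forall>x\<in>interior ref_simplex.
        norm (nu \<gamma> (elem_map S T x) - normal S (elem_map S T x)) \<le> C * h ^ k) \<and>
     (\<forall>T\<in>faces S. \<forall>i\<le>k + 1.
        W_inf_le i T (\<lambda>x. Lmap S x - closest_point \<gamma> x) (C * h ^ (k + 1 - i))))"

abbreviation M_form :: "('n::finite, 'm::finite) discrete_surface \<Rightarrow> (real^'m \<Rightarrow> real) \<Rightarrow> (real^'m \<Rightarrow> real) \<Rightarrow> real"
  where "M_form S \<equiv> mass (Gamma_measure S)"

abbreviation A_form :: "('n::finite, 'm::finite) discrete_surface \<Rightarrow> (real^'m \<Rightarrow> real) \<Rightarrow> (real^'m \<Rightarrow> real) \<Rightarrow> real"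
  where "A_form S \<equiv> stiffness (Gamma_measure S) (normal S)"

abbreviation M_norm :: "('n::finite, 'm::finite) discrete_surface \<Rightarrow> (real^'m \<Rightarrow> real) \<Rightarrow> real"
  where "M_norm S \<equiv> mass_norm (Gamma_measure S)"

definition fe_space :: "nat \<Rightarrow> ('n::finite, 'm::finite) discrete_surface \<Rightarrow> (real^'m \<Rightarrow> real) set" where
  "fe_space r S = {V \<in> H1 (Gamma_measure S) (normal S). \<forall>T\<in>faces S. poly_on r T (V \<circ> Lmap S)}"

definition fe_space_zero_mean :: "nat \<Rightarrow> ('n::finite, 'm::finite) discrete_surface \<Rightarrow> (real^'m \<Rightarrow> real) set" where
  "fe_space_zero_mean r S = {V \<in> fe_space r S. (LINT x|Gamma_measure S. V x) = 0}"

text \<open>Span of finitely many functions on \<open>Gamma S\<close>; values off \<open>Gamma S\<close> are irrelevant throughout.\<close>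

definition span_on_Gamma ::
  "('n::finite, 'm::finite) discrete_surface \<Rightarrow> (nat \<Rightarrow> real^'m \<Rightarrow> real) \<Rightarrow> nat set \<Rightarrow> (real^'m \<Rightarrow> real) set" where
  "span_on_Gamma S U J = {W. \<exists>c. \<forall>x\<in>Gamma S. W x = (\<Sum>j\<in>J. c j * U j x)}"

text \<open>The orthonormal \<open>U 1, \<dots>, U d\<close> form a basis of the zero mean finite element space, so
  \<open>d\<close> is its dimension.\<close>

definition discrete_eigenpairs ::
  "nat \<Rightarrow> ('n::finite, 'm::finite) discrete_surface \<Rightarrow> nat \<Rightarrow> (nat \<Rightarrow> real) \<Rightarrow> (nat \<Rightarrow> real^'m \<Rightarrow> real) \<Rightarrow> bool" where
  "discrete_eigenpairs r S d \<Lambda> U \<longleftrightarrow>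
     (\<forall>j\<in>{1..d}. 0 < \<Lambda> j \<and> U j \<in> fe_space_zero_mean r S \<and>
        (\<forall>V\<in>fe_space_zero_mean r S. A_form S (U j) V = \<Lambda> j * M_form S (U j) V)) \<and>
     (\<forall>i\<in>{1..d}. \<forall>j\<in>{1..d}. M_form S (U i) (U j) = of_bool (i = j)) \<and>
     fe_space_zero_mean r S \<subseteq> span_on_Gamma S U {1..d} \<and>
     mono_on {1..d} \<Lambda>"

text \<open>Maximum over finite index sets in the extended reals: a vanishing denominator (with nonzero
  numerator) gives infinity, and an empty index set gives \<open>0\<close>.\<close>

definition cluster_mu :: "nat set \<Rightarrow> nat \<Rightarrow> (nat \<Rightarrow> real) \<Rightarrow> (nat \<Rightarrow> real) \<Rightarrow> ennreal" where
  "cluster_mu J d lam \<Lambda> = (SUP l\<in>J. SUP j\<in>{1..d} - J. ennreal \<bar>lam l\<bar> / ennreal \<bar>\<Lambda> j - lam l\<bar>)"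

definition form_projection ::
  "(('a \<Rightarrow> real) \<Rightarrow> ('a \<Rightarrow> real) \<Rightarrow> real) \<Rightarrow> ('a \<Rightarrow> real) set \<Rightarrow> ('a \<Rightarrow> real) \<Rightarrow> 'a \<Rightarrow> real" where
  "form_projection B X v = (SOME w. w \<in> X \<and> (\<forall>V\<in>X. B w V = B v V))"

end

theory Submission
  imports Defs
begin

text \<open>
  Write \<open>a\<^sub>j = A(u, U\<^sub>j) / \<Lambda>\<^sub>j\<close>, so that \<open>G u\<close> and \<open>Z u\<close> are the sums of \<open>a\<^sub>j U\<^sub>j\<close> over all \<open>j\<close> and over the
  cluster, and \<open>u - Z u - \<alpha> = E + R\<close> with \<open>E = u - G u - \<alpha>\<close> and \<open>R\<close> the sum of \<open>a\<^sub>j U\<^sub>j\<close> over \<open>j \<notin> J\<close>. The first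
  inequality is the best approximation property of \<open>P\<close>, the shift \<open>\<alpha>\<close> being orthogonal to all \<open>U\<^sub>j\<close>. For the
  second one, \<open>(\<Lambda>\<^sub>j - \<lambda>) a\<^sub>j = A(u, U\<^sub>j) - \<lambda> M(u, U\<^sub>j) + \<lambda> M(E, U\<^sub>j)\<close>, so with \<open>w\<close> the sum of
  \<open>\<lambda> / (\<Lambda>\<^sub>j - \<lambda>) a\<^sub>j U\<^sub>j\<close> over \<open>j \<notin> J\<close> one gets \<open>\<lambda> M(R, R) = (A(u, w) - \<lambda> M(u, w)) + \<lambda> M(E, w)\<close>, where \<open>w\<close> has
  mass norm at most \<open>\<mu> \<parallel>R\<parallel>\<close> and energy norm at most \<open>\<surd>\<lambda> (1 + \<mu>) \<parallel>R\<parallel>\<close>.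

  On \<open>\<gamma>\<close> the difference in brackets vanishes, because \<open>u\<close> is an eigenfunction. On the approximate surface it is a
  geometric consistency error: the derivative of the closest point projection distorts lengths by the distance
  function, which is \<open>O(h\<^sup>k\<^sup>+\<^sup>1)\<close>, and by the square of \<open>\<nu> - N\<close>, which is \<open>O(h\<^sup>2\<^sup>k)\<close>. Hence measures and tangential
  gradients agree up to a relative error \<open>O(h\<^sup>k\<^sup>+\<^sup>1)\<close> once \<open>h\<close> is small. For the remaining \<open>h\<close> the factor \<open>h\<^sup>k\<^sup>+\<^sup>1\<close> is
  bounded below and the stability of \<open>G\<close> suffices.
\<close>

section \<open>Smooth functions\<close>

text \<open>\<open>H1\<close> is a completion of ambient smooth functions and \<open>tgrad\<close> a
  chosen limit. Testing the eigenvalue equation on \<gamma> with a function given on \<Gamma> means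
  pushing it down along the inverse of the closest point projection, which is only Lipschitz across
  element boundaries; comparing energies means recognising the chosen gradient on \<Gamma>. The
  first is settled by mollifying Lipschitz functions that are differentiable almost everywhere, the
  second by closability of the derivative in the element charts. Two kinds of bounds coexist: those
  from the Lipschitz constant of that inverse depend on the mesh and serve only for integrability,
  injectivity and null sets, whereas the quantitative ones come from the standing bounds and the
  Hessian of the distance function, so that the constant is uniform. The consistency error is
  bounded by a multiple of \<open>sqrt l * sqrt (A w w) + l * nrm w\<close> times the norm of
  \<open>u\<close>; one root of \<lambda> comes from the energy of \<open>u\<close>, the other from
  that of \<open>w\<close>, so \<lambda> cancels and the constant does not see the spectrum.\<close>

lemma Ck_on_cong:
  assumes "open U" "\<And>x. x \<in> U \<Longrightarrow> f x = g x" "Ck_on n f U"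
  shows "Ck_on n g U"
  using assms
proof (induction n arbitrary: f g)
  case 0
  then show ?case by (simp cong: continuous_on_cong)
next
  case (Suc n)
  have d: "(g has_derivative frechet_derivative f (at x)) (at x)" if "x \<in> U" for x
    using has_derivative_transform_within_open[of f "frechet_derivative f (at x)" x UNIV U g] Suc.prems that
    by (simp add: frechet_derivative_works)
  then have e: "frechet_derivative g (at x) = frechet_derivative f (at x)" if "x \<in> U" for x
    using frechet_derivative_at[OF d[OF that]] by simp
  have "Ck_on n (\<lambda>x. frechet_derivative g (at x) v) U" for v
    by (rule Suc.IH[OF Suc.prems(1), of "\<lambda>x. frechet_derivative f (at x) v"]) (use Suc.prems(3) e in simp_all)
  with d show ?case by (auto simp: differentiable_def)
qed

lemma Ck_on_subset: "Ck_on n f U \<Longrightarrow> V \<subseteq> U \<Longrightarrow> Ck_on n f V"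
proof (induction n arbitrary: f)
  case 0
  then show ?case using continuous_on_subset by auto
next
  case (Suc n)
  then show ?case by (meson Ck_on.simps(2) subsetD)
qed

lemma Ck_on_SucD: "Ck_on (Suc n) f U \<Longrightarrow> Ck_on n f U"
proof (induction n arbitrary: f)
  case 0
  then show ?case
    by (auto intro!: continuous_at_imp_continuous_on differentiable_imp_continuous_within)
next
  case (Suc n)
  from Suc.prems have "\<forall>x\<in>U. f differentiable (at x)"
    and "Ck_on (Suc n) (\<lambda>x. frechet_derivative f (at x) v) U" for v
    unfolding Ck_on.simps(2)[of "Suc n"] by blast+
  then show ?case using Suc.IH unfolding Ck_on.simps(2)[of n] by blast
qed

lemma Ck_on_imp_continuous_on: "Ck_on n f U \<Longrightarrow> continuous_on U f"
  by (induction n) (auto dest: Ck_on_SucD simp del: Ck_on.simps(2))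

text \<open>Derivatives are unique, so any explicit \<open>f'\<close> may stand in for the chosen
  \<open>frechet_derivative\<close>.\<close>

lemma Ck_on_SucI:
  assumes "open U" "\<And>x. x \<in> U \<Longrightarrow> (f has_derivative f' x) (at x)"
    and "\<And>v. Ck_on n (\<lambda>x. f' x v) U"
  shows "Ck_on (Suc n) f U"
proof -
  have "f' x = frechet_derivative f (at x)" if "x \<in> U" for x
    using frechet_derivative_at[OF assms(2)[OF that]] .
  then have "Ck_on n (\<lambda>x. frechet_derivative f (at x) v) U" for v
    using Ck_on_cong[OF assms(1) _ assms(3)[of v]] by simp
  then show ?thesis using assms(2) by (auto simp: differentiable_def)
qed

lemma Ck_on_SucE:
  assumes "Ck_on (Suc n) f U"
  shows "x \<in> U \<Longrightarrow> (f has_derivative frechet_derivative f (at x)) (at x)"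
    and "Ck_on n (\<lambda>x. frechet_derivative f (at x) v) U"
  using assms by (auto simp: frechet_derivative_works)

lemma Ck_on_const: "open U \<Longrightarrow> Ck_on n (\<lambda>x. c) U"
proof (induction n arbitrary: c)
  case (Suc n)
  show ?case
    by (rule Ck_on_SucI[where f' = "\<lambda>x v. 0"]) (auto simp: Suc)
qed auto

lemma Ck_on_bounded_linear:
  assumes "bounded_linear f" "open U"
  shows "Ck_on n f U"
proof (cases n)
  case 0
  then show ?thesis using assms by (simp add: linear_continuous_on)
next
  case (Suc k)
  show ?thesis
    unfolding Suc using assms
    by (intro Ck_on_SucI[where f' = "\<lambda>x. f"] Ck_on_const bounded_linear_imp_has_derivative)
qed

lemma Ck_on_add:
  assumes "open U" "Ck_on n f U" "Ck_on n g U"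
  shows "Ck_on n (\<lambda>x. f x + g x) U"
  using assms(2,3)
proof (induction n arbitrary: f g)
  case 0
  then show ?case by (auto intro: continuous_on_add)
next
  case (Suc n)
  show ?case
    by (rule Ck_on_SucI[OF assms(1), where
          f' = "\<lambda>x v. frechet_derivative f (at x) v + frechet_derivative g (at x) v"])
      (use Suc in \<open>auto intro!: derivative_intros Suc.IH simp: frechet_derivative_works[symmetric]\<close>)
qed

lemma Ck_on_bilinear:
  assumes "bounded_bilinear p" "open U" "Ck_on n f U" "Ck_on n g U"
  shows "Ck_on n (\<lambda>x. p (f x) (g x)) U"
  using assms(3,4)
proof (induction n arbitrary: f g)
  case 0
  then show ?case by (auto intro: bounded_bilinear.continuous_on[OF assms(1)])
next
  case (Suc n)
  show ?case
  proof (rule Ck_on_SucI[OF assms(2), where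
          f' = "\<lambda>x v. p (f x) (frechet_derivative g (at x) v) + p (frechet_derivative f (at x) v) (g x)"])
    show "Ck_on n (\<lambda>x. p (f x) (frechet_derivative g (at x) v) + p (frechet_derivative f (at x) v) (g x)) U" for v
      using Suc.prems
      by (intro Ck_on_add assms(2) Suc.IH) (auto dest: Ck_on_SucD simp del: Ck_on.simps(2) intro: Ck_on_SucE)
  qed (use Suc.prems in \<open>auto intro!: bounded_bilinear.FDERIV[OF assms(1)] simp: frechet_derivative_works[symmetric]\<close>)
qed

lemmas Ck_on_scaleR = Ck_on_bilinear[OF bounded_bilinear_scaleR]
lemmas Ck_on_mult = Ck_on_bilinear[OF bounded_bilinear_mult]
lemmas Ck_on_inner = Ck_on_bilinear[OF bounded_bilinear_inner]

lemma Ck_on_sum: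
  assumes "open U" "\<And>i. i \<in> I \<Longrightarrow> Ck_on n (f i) U"
  shows "Ck_on n (\<lambda>x. \<Sum>i\<in>I. f i x) U"
  using assms(2)
  by (induction I rule: infinite_finite_induct) (auto intro!: Ck_on_const Ck_on_add assms(1))

lemma Ck_on_prod:
  fixes f :: "'i \<Rightarrow> 'a::euclidean_space \<Rightarrow> real"
  assumes "open U" "\<And>i. i \<in> I \<Longrightarrow> Ck_on n (f i) U"
  shows "Ck_on n (\<lambda>x. \<Prod>i\<in>I. f i x) U"
  using assms(2)
  by (induction I rule: infinite_finite_induct) (auto intro!: Ck_on_const Ck_on_mult assms(1))

text \<open>\<open>Ck_on\<close> controls derivatives in fixed directions only, while the chain rule
  evaluates the derivative of \<open>g\<close> in the moving direction \<open>?f' x v\<close>.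
  Expanding that direction in the basis turns the derivative into a finite sum of products, to each
  of which the induction hypothesis applies.\<close>

lemma Ck_on_compose:
  fixes f :: "'a::euclidean_space \<Rightarrow> 'b::euclidean_space" and g :: "'b \<Rightarrow> 'c::real_normed_vector"
  assumes "open U" "f ` U \<subseteq> V" "Ck_on n f U" "Ck_on n g V"
  shows "Ck_on n (\<lambda>x. g (f x)) U"
  using assms(3,4)
proof (induction n arbitrary: g)
  case 0
  then show ?case using assms(2) by (auto intro: continuous_on_compose2)
next
  case (Suc n)
  let ?f' = "\<lambda>x. frechet_derivative f (at x)" and ?g' = "\<lambda>y. frechet_derivative g (at y)"
  have f': "(f has_derivative ?f' x) (at x)" if "x \<in> U" for x
    using Ck_on_SucE(1)[OF Suc.prems(1)] that .
  have g': "(g has_derivative ?g' (f x)) (at (f x))" if "x \<in> U" for x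
    using Ck_on_SucE(1)[OF Suc.prems(2)] that assms(2) by blast
  have eq: "?g' (f x) (?f' x v) = (\<Sum>b\<in>Basis. (?f' x v \<bullet> b) *\<^sub>R ?g' (f x) b)" if "x \<in> U" for x v
  proof -
    interpret linear "?g' (f x)" using g'[OF that] has_derivative_linear by blast
    have "?g' (f x) (?f' x v) = ?g' (f x) (\<Sum>b\<in>Basis. (?f' x v \<bullet> b) *\<^sub>R b)"
      by (simp add: euclidean_representation)
    then show ?thesis by (simp only: sum scaleR)
  qed
  show ?case
  proof (rule Ck_on_SucI[OF assms(1), where f' = "\<lambda>x v. ?g' (f x) (?f' x v)"])
    show "((\<lambda>x. g (f x)) has_derivative (\<lambda>v. ?g' (f x) (?f' x v))) (at x)" if "x \<in> U" for x
      using has_derivative_compose[OF f' g'] that by blast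
    have "Ck_on n (\<lambda>x. \<Sum>b\<in>Basis. (?f' x v \<bullet> b) *\<^sub>R ?g' (f x) b) U" for v
      using Suc.prems
      by (intro Ck_on_sum Ck_on_scaleR Ck_on_inner Ck_on_const assms(1) Suc.IH)
        (auto dest: Ck_on_SucD simp del: Ck_on.simps(2) intro: Ck_on_SucE)
    then show "Ck_on n (\<lambda>x. ?g' (f x) (?f' x v)) U" for v
      by (rule Ck_on_cong[OF assms(1), rotated]) (simp add: eq)
  qed
qed

lemma smooth_on_frechet_derivative:
  "smooth_on f U \<Longrightarrow> smooth_on (\<lambda>x. frechet_derivative f (at x) v) U"
  unfolding smooth_on_def using Ck_on_SucE(2) by blast

lemma smooth_on_has_derivative:
  "smooth_on f U \<Longrightarrow> x \<in> U \<Longrightarrow> (f has_derivative frechet_derivative f (at x)) (at x)"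
  unfolding smooth_on_def using Ck_on_SucE(1) by blast

lemma smooth_on_imp_continuous_on: "smooth_on f U \<Longrightarrow> continuous_on U f"
  unfolding smooth_on_def using Ck_on_imp_continuous_on by blast

lemma smooth_on_subset: "smooth_on f U \<Longrightarrow> V \<subseteq> U \<Longrightarrow> smooth_on f V"
  unfolding smooth_on_def using Ck_on_subset by blast

lemma smooth_on_cong:
  "open U \<Longrightarrow> (\<And>x. x \<in> U \<Longrightarrow> f x = g x) \<Longrightarrow> smooth_on f U \<Longrightarrow> smooth_on g U"
  unfolding smooth_on_def using Ck_on_cong by blast

lemma smooth_on_const: "open U \<Longrightarrow> smooth_on (\<lambda>x. c) U"
  unfolding smooth_on_def by (simp add: Ck_on_const)

lemma smooth_on_bounded_linear: "bounded_linear f \<Longrightarrow> open U \<Longrightarrow> smooth_on f U"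
  unfolding smooth_on_def by (simp add: Ck_on_bounded_linear)

lemma smooth_on_add:
  "open U \<Longrightarrow> smooth_on f U \<Longrightarrow> smooth_on g U \<Longrightarrow> smooth_on (\<lambda>x. f x + g x) U"
  unfolding smooth_on_def by (simp add: Ck_on_add)

lemma smooth_on_scaleR:
  "open U \<Longrightarrow> smooth_on f U \<Longrightarrow> smooth_on g U \<Longrightarrow> smooth_on (\<lambda>x. f x *\<^sub>R g x) U"
  unfolding smooth_on_def by (simp add: Ck_on_scaleR)

lemma smooth_on_mult:
  fixes f g :: "'a::euclidean_space \<Rightarrow> real"
  shows "open U \<Longrightarrow> smooth_on f U \<Longrightarrow> smooth_on g U \<Longrightarrow> smooth_on (\<lambda>x. f x * g x) U"
  unfolding smooth_on_def by (simp add: Ck_on_mult)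

lemma smooth_on_inner:
  "open U \<Longrightarrow> smooth_on f U \<Longrightarrow> smooth_on g U \<Longrightarrow> smooth_on (\<lambda>x. f x \<bullet> g x) U"
  unfolding smooth_on_def by (simp add: Ck_on_inner)

lemma smooth_on_diff:
  assumes "open U" "smooth_on f U" "smooth_on g U"
  shows "smooth_on (\<lambda>x. f x - g x) U"
  using smooth_on_add[OF assms(1,2) smooth_on_scaleR[OF assms(1) smooth_on_const[OF assms(1), of "-1"] assms(3)]]
  by simp

lemma smooth_on_sum:
  "open U \<Longrightarrow> (\<And>i. i \<in> I \<Longrightarrow> smooth_on (f i) U) \<Longrightarrow> smooth_on (\<lambda>x. \<Sum>i\<in>I. f i x) U"
  unfolding smooth_on_def by (simp add: Ck_on_sum)

lemma smooth_on_prod: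
  fixes f :: "'i \<Rightarrow> 'a::euclidean_space \<Rightarrow> real"
  shows "open U \<Longrightarrow> (\<And>i. i \<in> I \<Longrightarrow> smooth_on (f i) U) \<Longrightarrow> smooth_on (\<lambda>x. \<Prod>i\<in>I. f i x) U"
  unfolding smooth_on_def by (simp add: Ck_on_prod)

lemma smooth_on_power:
  fixes f :: "'a::euclidean_space \<Rightarrow> real"
  shows "open U \<Longrightarrow> smooth_on f U \<Longrightarrow> smooth_on (\<lambda>x. f x ^ k) U"
  by (induction k) (auto intro!: smooth_on_const smooth_on_mult)

lemma smooth_on_compose:
  fixes f :: "'a::euclidean_space \<Rightarrow> 'b::euclidean_space"
  shows "open U \<Longrightarrow> f ` U \<subseteq> V \<Longrightarrow> smooth_on f U \<Longrightarrow> smooth_on g V \<Longrightarrow> smooth_on (\<lambda>x. g (f x)) U"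
  unfolding smooth_on_def using Ck_on_compose by blast

lemma smooth_on_grad: "open U \<Longrightarrow> smooth_on f U \<Longrightarrow> smooth_on (grad f) U"
  unfolding grad_def
  by (intro smooth_on_sum smooth_on_scaleR smooth_on_frechet_derivative smooth_on_const) auto

lemma grad_inner:
  assumes "f differentiable (at x)"
  shows "grad f x \<bullet> v = frechet_derivative f (at x) v"
proof -
  interpret linear "frechet_derivative f (at x)"
    using assms by (rule linear_frechet_derivative)
  have "frechet_derivative f (at x) v = frechet_derivative f (at x) (\<Sum>b\<in>Basis. (v \<bullet> b) *\<^sub>R b)"
    by (simp add: euclidean_representation)
  then show ?thesis
    by (simp add: sum scaleR grad_def inner_sum_left inner_sum_right inner_commute mult.commute)
qed

lemma grad_eqI:
  assumes "(f has_derivative (\<lambda>v. g \<bullet> v)) (at x)"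
  shows "grad f x = g"
  using euclidean_representation[of g]
  by (simp add: grad_def frechet_derivative_at[OF assms, symmetric])

lemma has_derivative_along_line:
  fixes G :: "'a::real_normed_vector \<Rightarrow> real"
  assumes "(G has_derivative G') (at x)"
  shows "((\<lambda>t. G (x + t *\<^sub>R v)) has_field_derivative G' v) (at 0)"
proof -
  have "((\<lambda>t. x + t *\<^sub>R v) has_derivative (\<lambda>t. t *\<^sub>R v)) (at 0)"
    by (auto intro!: derivative_eq_intros)
  moreover have "(G has_derivative G') (at (x + 0 *\<^sub>R v))"
    using assms by simp
  ultimately have "((\<lambda>t. G (x + t *\<^sub>R v)) has_derivative (\<lambda>t. G' (t *\<^sub>R v))) (at 0)"
    by (rule has_derivative_compose)
  moreover have "G' (t *\<^sub>R v) = G' v * t" for t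
    using has_derivative_linear[OF assms] by (simp add: linear_cmul)
  ultimately show ?thesis by (simp add: has_field_derivative_def)
qed

section \<open>Smooth bumps and vanishing integrals of derivatives\<close>

text \<open>The power in the denominator makes the family closed under differentiation, up to linear
  combinations, so smoothness follows by one induction for all \<open>k\<close>.\<close>

definition exp_bump :: "nat \<Rightarrow> real \<Rightarrow> real" where
  "exp_bump k t = (if t > 0 then exp (- 1 / t) / t ^ k else 0)"


lemma exp_bump_has_field_derivative:
  "(exp_bump k has_field_derivative exp_bump (k + 2) t - real k * exp_bump (k + 1) t) (at t)"
proof -
  consider "t > 0" | "t < 0" | "t = 0" by linarith
  then show ?thesis
  proof cases
    case 1
    have D: "((\<lambda>t. exp (- 1 / t) / t ^ k) has_field_derivative
        exp_bump (k + 2) t - real k * exp_bump (k + 1) t) (at t)"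
    proof (cases k)
      case 0
      then show ?thesis
        using 1 by (auto intro!: derivative_eq_intros simp: exp_bump_def field_simps power2_eq_square)
    next
      case (Suc l)
      have "((\<lambda>t. exp (- 1 / t)) has_field_derivative exp (- 1 / t) / t\<^sup>2) (at t)"
        using 1 by (auto intro!: derivative_eq_intros simp: field_simps power2_eq_square)
      moreover have "t ^ k \<noteq> 0" using 1 by simp
      ultimately show ?thesis
        by (rule DERIV_cong[OF DERIV_divide[OF _ DERIV_pow]])
          (use 1 in \<open>simp add: Suc exp_bump_def field_simps power2_eq_square\<close>)
    qed
    have E: "\<forall>\<^sub>F s in nhds t. exp_bump k s = exp (- 1 / s) / s ^ k"
      using eventually_nhds_in_open[of "{0<..}" t] 1 by (auto elim!: eventually_mono simp: exp_bump_def)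
    show ?thesis
      using DERIV_cong_ev[OF refl E refl] D by (rule iffD2)
  next
    case 2
    have E: "\<forall>\<^sub>F s in nhds t. exp_bump k s = 0"
      using eventually_nhds_in_open[of "{..<0}" t] 2 by (auto elim!: eventually_mono simp: exp_bump_def)
    have D: "((\<lambda>s. 0) has_field_derivative exp_bump (k + 2) t - real k * exp_bump (k + 1) t) (at t)"
      using 2 by (auto simp: exp_bump_def)
    show ?thesis
      using DERIV_cong_ev[OF refl E refl] D by (rule iffD2)
  next
    case 3
    \<comment> \<open>The exponent is \<open>Suc k\<close> because the difference quotient at the
      origin contributes one more factor \<open>1 / t\<close>.\<close>
    have "((\<lambda>y::real. y ^ Suc k / exp y) \<longlongrightarrow> 0) at_top"
      by (rule tendsto_power_div_exp_0)
    then have "((\<lambda>t::real. inverse t ^ Suc k / exp (inverse t)) \<longlongrightarrow> 0) (at_right 0)"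
      using filterlim_compose[OF _ filterlim_inverse_at_top_right] by fast
    then have "((\<lambda>t. exp_bump k t / t) \<longlongrightarrow> 0) (at_right 0)"
      by (rule Lim_transform_eventually)
        (auto simp: eventually_at_right_field exp_bump_def field_simps exp_minus intro!: exI[of _ 1])
    moreover have "((\<lambda>t. exp_bump k t / t) \<longlongrightarrow> 0) (at_left 0)"
      by (rule Lim_transform_eventually[OF tendsto_const])
        (auto simp: eventually_at_left_field exp_bump_def intro!: exI[of _ "-1"])
    ultimately have "((\<lambda>t. exp_bump k t / t) \<longlongrightarrow> 0) (at 0)"
      by (simp add: filterlim_split_at)
    then show ?thesis
      using 3 by (simp add: DERIV_def exp_bump_def)
  qed
qed

lemma smooth_on_exp_bump: "smooth_on (exp_bump k) UNIV"
proof -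
  have "Ck_on n (exp_bump k) UNIV" for n
  proof (induction n arbitrary: k)
    case 0
    show ?case
      using DERIV_isCont[OF exp_bump_has_field_derivative] by (auto intro!: continuous_at_imp_continuous_on)
  next
    case (Suc n)
    have "Ck_on n (\<lambda>t. (exp_bump (k + 2) t + (- real k) * exp_bump (k + 1) t) * v) UNIV" for v
      by (intro Ck_on_mult Ck_on_add Ck_on_const Suc) auto
    then show ?case
      by (intro Ck_on_SucI[where f' = "\<lambda>t v. (exp_bump (k + 2) t - real k * exp_bump (k + 1) t) * v"])
        (use exp_bump_has_field_derivative in \<open>auto simp: has_field_derivative_def\<close>)
  qed
  then show ?thesis by (simp add: smooth_on_def)
qed

text \<open>Translation invariance of the Lebesgue integral makes the integrals of the difference
  quotients vanish.\<close>

lemma integral_frechet_derivative_eq_0: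
  fixes G :: "'a::euclidean_space \<Rightarrow> real"
  assumes lip: "L-lipschitz_on UNIV G" and supp: "\<And>x. norm x > R \<Longrightarrow> G x = 0"
    and diff: "\<And>x. (G has_derivative G' x) (at x)"
  shows "integrable lborel (\<lambda>x. G' x v)" "(LINT x|lborel. G' x v) = 0"
proof -
  define q where "q j x = (G (x + inverse (real (Suc j)) *\<^sub>R v) - G x) * real (Suc j)" for j x
  have contG: "continuous_on UNIV G"
    using lip lipschitz_on_continuous_on by blast
  have [measurable]: "G \<in> borel_measurable borel"
    using contG by (rule borel_measurable_continuous_onI)
  have qm [measurable]: "q j \<in> borel_measurable lborel" for j
    unfolding q_def by measurable
  have intG: "integrable lborel (\<lambda>x. G (x + a))" for a
  proof -
    have "integrable lborel (\<lambda>x. indicator (cball 0 (\<bar>R\<bar> + norm a)) x *\<^sub>R G (x + a))"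
      by (rule borel_integrable_compact)
        (auto intro!: continuous_intros continuous_on_compose2[OF contG])
    moreover have "indicator (cball 0 (\<bar>R\<bar> + norm a)) x *\<^sub>R G (x + a) = G (x + a)" for x
    proof (cases "norm x \<le> \<bar>R\<bar> + norm a")
      case False
      then have "norm (x + a) > R" using norm_triangle_ineq4[of "x + a" a] by simp
      then show ?thesis by (simp add: supp)
    qed (simp add: indicator_def)
    ultimately show ?thesis by (simp only:)
  qed
  have q0: "(LINT x|lborel. q j x) = 0" for j
  proof -
    let ?a = "inverse (real (Suc j)) *\<^sub>R v"
    have "(LINT x|lborel. G (x + ?a)) = (LINT x|lborel. G x)"
      using lborel_distr_plus[of ?a] integral_distr[of "(+) ?a" lborel borel G]
      by (simp add: add.commute)
    then show ?thesis
      using intG[of ?a] intG[of 0] by (simp add: q_def Bochner_Integration.integral_diff)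
  qed
  \<comment> \<open>The steps are at most 1, so a quotient can be nonzero only within distance
    \<open>norm v\<close> of the support; there the Lipschitz constant bounds it. This gives one
    integrable majorant for all \<open>j\<close>.\<close>
  have bound: "norm (q j x) \<le> indicator (cball 0 (\<bar>R\<bar> + norm v)) x *\<^sub>R (L * norm v)" for j x
  proof (cases "norm x \<le> \<bar>R\<bar> + norm v")
    case True
    have "\<bar>G (x + inverse (real (Suc j)) *\<^sub>R v) - G x\<bar> \<le> L * (inverse (real (Suc j)) * norm v)"
      using lipschitz_onD[OF lip, of "x + inverse (real (Suc j)) *\<^sub>R v" x] by (simp add: dist_norm)
    then have "norm (q j x) \<le> L * (inverse (real (Suc j)) * norm v) * real (Suc j)"
      unfolding q_def real_norm_def abs_mult by (intro mult_mono) auto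
    also have "\<dots> = L * norm v" by (simp add: field_simps del: of_nat_Suc)
    finally show ?thesis using True by simp
  next
    case False
    have "norm (inverse (real (Suc j)) *\<^sub>R v) \<le> norm v"
      by (simp add: field_simps)
    then have "norm (x + inverse (real (Suc j)) *\<^sub>R v) > R"
      using False norm_triangle_ineq4[of "x + inverse (real (Suc j)) *\<^sub>R v" "inverse (real (Suc j)) *\<^sub>R v"]
      by simp
    moreover have "norm x > R" using False norm_ge_zero[of v] by linarith
    ultimately show ?thesis using False by (simp add: q_def supp)
  qed
  have lim: "(\<lambda>j. q j x) \<longlonglongrightarrow> G' x v" for x
  proof -
    have "((\<lambda>t. (G (x + t *\<^sub>R v) - G x) / t) \<longlongrightarrow> G' x v) (at 0)"
      using has_derivative_along_line[OF diff[of x], of v] by (simp add: DERIV_def)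
    then have "((\<lambda>j. (G (x + inverse (real (Suc j)) *\<^sub>R v) - G x) / inverse (real (Suc j))) \<longlonglongrightarrow> G' x v)"
      by (rule filterlim_compose)
        (use LIMSEQ_inverse_real_of_nat in \<open>auto simp: filterlim_at\<close>)
    then show ?thesis by (simp add: q_def field_simps)
  qed
  have w: "integrable lborel (\<lambda>x. indicator (cball 0 (\<bar>R\<bar> + norm v)) (x::'a) *\<^sub>R (L * norm v))"
    by (rule borel_integrable_compact) auto
  have G'm: "(\<lambda>x. G' x v) \<in> borel_measurable lborel"
    using borel_measurable_LIMSEQ_metric[of q, OF qm lim] by simp
  have l: "AE x in lborel. (\<lambda>j. q j x) \<longlonglongrightarrow> G' x v" and b: "\<And>j. AE x in lborel. norm (q j x) \<le> indicator (cball 0 (\<bar>R\<bar> + norm v)) x *\<^sub>R (L * norm v)"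
    using lim bound by auto
  show "integrable lborel (\<lambda>x. G' x v)"
    by (rule integrable_dominated_convergence[OF G'm qm w l b])
  have "(\<lambda>j. LINT x|lborel. q j x) \<longlonglongrightarrow> (LINT x|lborel. G' x v)"
    by (rule integral_dominated_convergence[OF G'm qm w l b])
  then show "(LINT x|lborel. G' x v) = 0"
    by (simp add: q0 LIMSEQ_const_iff)
qed

section \<open>Mollification\<close>

lemma smooth_on_bounded_derivative:
  fixes f :: "'a::euclidean_space \<Rightarrow> 'b::real_normed_vector"
  assumes "smooth_on f U" "compact K" "K \<subseteq> U"
  obtains B where "B > 0" "\<And>x v. x \<in> K \<Longrightarrow> norm (frechet_derivative f (at x) v) \<le> B * norm v"
proof -
  let ?D = "\<lambda>b x. frechet_derivative f (at x) b"
  have "\<exists>C. \<forall>x\<in>K. norm (?D b x) \<le> C" for b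
  proof -
    have "continuous_on K (?D b)"
      using smooth_on_imp_continuous_on[OF smooth_on_frechet_derivative[OF assms(1)]] assms(3)
      by (rule continuous_on_subset)
    then have "bounded (?D b ` K)"
      using compact_continuous_image[OF _ assms(2)] compact_imp_bounded by blast
    then show ?thesis by (auto simp: bounded_iff)
  qed
  then obtain C where C: "\<And>b x. x \<in> K \<Longrightarrow> norm (?D b x) \<le> C b"
    by metis
  have C': "norm (?D b x) \<le> \<bar>C b\<bar>" if "x \<in> K" for b x
    using C[OF that, of b] by linarith
  \<comment> \<open>The extra 1 keeps the bound positive when all directional bounds vanish.\<close>
  define B where "B = (\<Sum>b\<in>Basis. \<bar>C b\<bar>) + 1"
  have "norm (?D v x) \<le> B * norm v" if "x \<in> K" for x v
  proof -
    interpret linear "frechet_derivative f (at x)"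
      using smooth_on_has_derivative[OF assms(1)] assms(3) that has_derivative_linear by blast
    have "?D v x = ?D (\<Sum>b\<in>Basis. (v \<bullet> b) *\<^sub>R b) x"
      by (simp add: euclidean_representation)
    also have "\<dots> = (\<Sum>b\<in>Basis. (v \<bullet> b) *\<^sub>R ?D b x)"
      by (simp only: sum scaleR)
    also have "norm \<dots> \<le> (\<Sum>b\<in>Basis. norm v * \<bar>C b\<bar>)"
      using C'[OF that] Basis_le_norm[of _ v]
      by (intro order.trans[OF norm_sum] sum_mono) (auto intro!: mult_mono intro: order.trans)
    also have "\<dots> \<le> B * norm v"
      by (simp add: B_def sum_distrib_left[symmetric] field_simps)
    finally show ?thesis .
  qed
  moreover have "B > 0" unfolding B_def by (smt (verit) sum_nonneg abs_ge_zero)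
  ultimately show ?thesis using that by blast
qed

lemma smooth_on_lipschitz_convex:
  fixes f :: "'a::euclidean_space \<Rightarrow> 'b::real_normed_vector"
  assumes "smooth_on f U" "compact K" "convex K" "K \<subseteq> U"
  obtains L where "L-lipschitz_on K f"
proof -
  obtain B where B: "B > 0" "\<And>x v. x \<in> K \<Longrightarrow> norm (frechet_derivative f (at x) v) \<le> B * norm v"
    using smooth_on_bounded_derivative[OF assms(1,2,4)] by blast
  have "norm (f x - f y) \<le> B * norm (x - y)" if "x \<in> K" "y \<in> K" for x y
    using that assms B
    by (intro differentiable_bound[OF assms(3), where f' = "\<lambda>x. frechet_derivative f (at x)"])
      (auto intro!: has_derivative_at_withinI smooth_on_has_derivative[OF assms(1)] onorm_le)
  then have "B-lipschitz_on K f"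
    using B(1) by (intro lipschitz_onI) (auto simp: dist_norm)
  then show ?thesis using that by blast
qed

lemma smooth_compact_support_lipschitz:
  fixes G :: "'a::euclidean_space \<Rightarrow> real"
  assumes "smooth_on G UNIV" "\<And>x. norm x > R \<Longrightarrow> G x = 0"
  obtains L where "L-lipschitz_on UNIV G"
proof -
  obtain B where B: "B > 0"
    "\<And>x v. x \<in> cball 0 R \<Longrightarrow> norm (frechet_derivative G (at x) v) \<le> B * norm v"
    using smooth_on_bounded_derivative[OF assms(1), of "cball 0 R"] by auto
  have "frechet_derivative G (at x) = (\<lambda>v. 0)" if "norm x > R" for x
  proof -
    have "open {x::'a. norm x > R}" by (simp add: open_Collect_less continuous_on_norm)
    then have "(G has_derivative (\<lambda>v. 0)) (at x)"
      using that assms(2)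
      by (intro has_derivative_transform_within_open[OF has_derivative_const[of 0 "at x"]]) auto
    then show ?thesis by (rule frechet_derivative_at[symmetric])
  qed
  then have "norm (frechet_derivative G (at x) v) \<le> B * norm v" for x v
    using B by (cases "norm x \<le> R") auto
  then have "norm (G x - G y) \<le> B * norm (x - y)" for x y
    using smooth_on_has_derivative[OF assms(1)]
    by (intro differentiable_bound[of UNIV, where f' = "\<lambda>x. frechet_derivative G (at x)"])
      (auto intro!: onorm_le)
  then have "B-lipschitz_on UNIV G"
    using B(1) by (intro lipschitz_onI) (auto simp: dist_norm)
  then show ?thesis using that by blast
qed

text \<open>The variable \<open>x\<close> sits only in the kernel, so differentiating costs
  smoothness of \<open>K\<close> alone and \<open>F\<close> need only be continuous. The minus sign
  is the inner derivative of \<open>y - x\<close>.\<close>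

lemma integral_kernel_has_derivative:
  fixes K F :: "'a::euclidean_space \<Rightarrow> real"
  assumes cF: "continuous_on UNIV F" and K: "Ck_on (Suc 0) K UNIV"
  shows "((\<lambda>x. integral (cbox a b) (\<lambda>y. K (y - x) * F y)) has_derivative
    (\<lambda>v. - integral (cbox a b) (\<lambda>y. frechet_derivative K (at (y - x)) v * F y))) (at x)"
proof -
  let ?K' = "\<lambda>x. frechet_derivative K (at x)"
  have K': "(K has_derivative ?K' x) (at x)" for x
    using Ck_on_SucE(1)[OF K] by simp
  have cK': "continuous_on UNIV (\<lambda>x. ?K' x v)" for v
    using Ck_on_imp_continuous_on[OF Ck_on_SucE(2)[OF K]] .
  have cK: "continuous_on UNIV K"
    using Ck_on_imp_continuous_on[OF K] .
  define D where "D x y = Blinfun (\<lambda>v. - ?K' (y - x) v * F y)" for x y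
  have D: "blinfun_apply (D x y) = (\<lambda>v. - ?K' (y - x) v * F y)" for x y
    unfolding D_def
    by (intro bounded_linear_Blinfun_apply bounded_linear_mult_const bounded_linear_minus
        has_derivative_bounded_linear[OF K'])
  have "((\<lambda>x. integral (cbox a b) (\<lambda>y. K (y - x) * F y)) has_derivative
      blinfun_apply (integral (cbox a b) (D x))) (at x)"
  proof (rule leibniz_rule[where U = UNIV, simplified])
    show "((\<lambda>x. K (y - x) * F y) has_derivative blinfun_apply (D x y)) (at x)" for x y
    proof -
      have "((\<lambda>x. y - x) has_derivative (\<lambda>v. - v)) (at x)"
        by (auto intro!: derivative_eq_intros)
      from has_derivative_compose[OF this K', THEN has_derivative_mult_left, of "F y"]
      show ?thesis
        using has_derivative_linear[OF K'] by (simp add: D linear_neg)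
    qed
    show "(\<lambda>y. K (y - x) * F y) integrable_on cbox a b" for x
      by (intro integrable_continuous continuous_intros continuous_on_compose2[OF cK]
          continuous_on_compose2[OF cF]) auto
    show "continuous_on (UNIV \<times> cbox a b) (\<lambda>(x, y). D x y)"
      unfolding split_beta
      by (rule continuous_on_blinfun_componentwise)
        (auto simp: D intro!: continuous_intros continuous_on_compose2[OF cK']
          continuous_on_compose2[OF cF])
  qed
  moreover have "blinfun_apply (integral (cbox a b) (D x)) =
      (\<lambda>v. - integral (cbox a b) (\<lambda>y. ?K' (y - x) v * F y))"
  proof (rule ext)
    fix v
    have "D x integrable_on cbox a b"
      by (intro integrable_continuous continuous_on_blinfun_componentwise)
        (auto simp: D intro!: continuous_intros continuous_on_compose2[OF cK']
          continuous_on_compose2[OF cF])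
    from blinfun_apply_integral[OF this, of v]
    show "blinfun_apply (integral (cbox a b) (D x)) v = - integral (cbox a b) (\<lambda>y. ?K' (y - x) v * F y)"
      by (simp add: D)
  qed
  ultimately show ?thesis by simp
qed

lemma Ck_on_integral_kernel:
  fixes K F :: "'a::euclidean_space \<Rightarrow> real"
  assumes "continuous_on UNIV F" "Ck_on n K UNIV"
  shows "Ck_on n (\<lambda>x. integral (cbox a b) (\<lambda>y. K (y - x) * F y)) UNIV"
  using assms(2)
proof (induction n arbitrary: K)
  case 0
  then show ?case
    using assms(1)
    by (auto simp: split_beta intro!: integral_continuous_on_param continuous_intros
        continuous_on_compose2[of UNIV K] continuous_on_compose2[of UNIV F])
next
  case (Suc n)
  have "Ck_on (Suc 0) K UNIV"
    using Suc.prems by (auto dest: Ck_on_imp_continuous_on)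
  note d = integral_kernel_has_derivative[OF assms(1) this, of a b]
  have "Ck_on n (\<lambda>x. (- 1) * integral (cbox a b) (\<lambda>y. frechet_derivative K (at (y - x)) v * F y)) UNIV" for v
    by (intro Ck_on_mult Ck_on_const Suc.IH Ck_on_SucE(2)[OF Suc.prems]) auto
  then show ?case
    by (intro Ck_on_SucI[OF _ d]) auto
qed

text \<open>Written in the squared norm, which is smooth at the origin as well, and left
  unnormalised: the division by \<open>bump_mass\<close> happens in \<open>mollify\<close>.\<close>

definition bump_kernel :: "real \<Rightarrow> 'a::euclidean_space \<Rightarrow> real" where
  "bump_kernel e z = exp_bump 0 (1 - (z \<bullet> z) / e\<^sup>2)"

lemma smooth_on_bump_kernel: "smooth_on (bump_kernel e) UNIV"
proof -
  have "smooth_on (\<lambda>z::'a. 1 - inverse (e\<^sup>2) * (z \<bullet> z)) UNIV"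
    by (intro smooth_on_diff smooth_on_mult smooth_on_const smooth_on_inner
        smooth_on_bounded_linear bounded_linear_ident) auto
  from smooth_on_compose[OF open_UNIV _ this smooth_on_exp_bump, of 0] show ?thesis
    by (simp add: bump_kernel_def[abs_def] field_simps)
qed

lemma bump_kernel_nonneg: "bump_kernel e z \<ge> 0"
  by (simp add: bump_kernel_def exp_bump_def)

lemma bump_kernel_eq_0:
  assumes "e > 0" "norm z \<ge> e"
  shows "bump_kernel e z = 0"
proof -
  have "e\<^sup>2 \<le> z \<bullet> z" using assms power_mono[of e "norm z" 2] by (simp add: power2_norm_eq_inner)
  then show ?thesis using assms by (simp add: bump_kernel_def exp_bump_def field_simps)
qed

lemma bump_kernel_lower:
  assumes "e > 0" "norm z \<le> e / 2"
  shows "bump_kernel e z \<ge> exp (- 4 / 3)"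
proof -
  have "z \<bullet> z \<le> (e / 2)\<^sup>2" using assms power_mono[of "norm z" "e/2" 2] by (simp add: power2_norm_eq_inner)
  \<comment> \<open>On the half ball the argument of the bump is at least 3/4, whence the exponent
    4/3.\<close>
  then have t: "1 - (z \<bullet> z) / e\<^sup>2 \<ge> 3 / 4" using assms by (simp add: field_simps power2_eq_square)
  then have "1 / (1 - (z \<bullet> z) / e\<^sup>2) \<le> 1 / (3 / 4)"
    by (intro divide_left_mono) auto
  then have "exp (- 4 / 3) \<le> exp (- 1 / (1 - (z \<bullet> z) / e\<^sup>2))"
    by simp
  moreover have "0 < 1 - (z \<bullet> z) / e\<^sup>2"
    using t by linarith
  ultimately show ?thesis by (simp add: bump_kernel_def exp_bump_def del: exp_le_cancel_iff)
qed

text \<open>With \<open>u = 1 / t\<close> the value is \<open>u * u * exp (- u)\<close>, and the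
  quadratic Taylor term of the exponential gives the 2.\<close>

lemma exp_bump_2_le: "\<bar>exp_bump 2 t\<bar> \<le> 2"
proof (cases "t > 0")
  case True
  define u where "u = 1 / t"
  have "u > 0" using True by (simp add: u_def)
  then have "u\<^sup>2 / 2 \<le> exp u"
    using exp_lower_Taylor_quadratic[of u] by linarith
  moreover have "exp_bump 2 t = u\<^sup>2 * inverse (exp u)"
    using True by (simp add: exp_bump_def u_def exp_minus divide_inverse power_inverse mult.commute)
  ultimately have "exp_bump 2 t \<le> 2"
    by (simp add: divide_inverse[symmetric] divide_le_eq)
  then show ?thesis by (simp add: exp_bump_def)
qed (simp add: exp_bump_def)

lemma bump_kernel_has_derivative:
  "(bump_kernel e has_derivative (\<lambda>v. exp_bump 2 (1 - (z \<bullet> z) / e\<^sup>2) * (- 2 * (z \<bullet> v) / e\<^sup>2))) (at z)"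
proof -
  have "((\<lambda>z. 1 - (z \<bullet> z) / e\<^sup>2) has_derivative (\<lambda>v. - 2 * (z \<bullet> v) / e\<^sup>2)) (at z)"
  proof -
    have "((\<lambda>z. z \<bullet> z) has_derivative (\<lambda>v. 2 * (z \<bullet> v))) (at z)"
      by (auto intro!: derivative_eq_intros simp: inner_commute)
    from has_derivative_diff[OF has_derivative_const[of 1]
        bounded_linear.has_derivative[OF bounded_linear_divide[of "e\<^sup>2"] this]]
    show ?thesis by simp
  qed
  moreover have "(exp_bump 0 has_derivative (\<lambda>u. exp_bump 2 t * u)) (at t)" for t
    using exp_bump_has_field_derivative[of 0 t]
    by (simp add: has_field_derivative_def numeral_2_eq_2)
  ultimately show ?thesis
    unfolding bump_kernel_def[abs_def] by (rule has_derivative_compose)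
qed

lemma bump_kernel_derivative_bound:
  assumes "e > 0"
  shows "\<bar>frechet_derivative (bump_kernel e) (at z) v\<bar> \<le> indicator (cball 0 e) z * (4 * norm v / e)"
proof -
  have eq: "frechet_derivative (bump_kernel e) (at z) v = exp_bump 2 (1 - (z \<bullet> z) / e\<^sup>2) * (- 2 * (z \<bullet> v) / e\<^sup>2)"
    using frechet_derivative_at[OF bump_kernel_has_derivative[of e z]] by metis
  show ?thesis
  proof (cases "norm z \<le> e")
    case True
    have "\<bar>z \<bullet> v\<bar> \<le> e * norm v"
      using Cauchy_Schwarz_ineq2[of z v] mult_right_mono[OF True, of "norm v"] by simp
    then have "\<bar>- 2 * (z \<bullet> v) / e\<^sup>2\<bar> \<le> 2 * norm v / e"
      using assms by (simp add: abs_mult field_simps power2_eq_square)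
    \<comment> \<open>The 4 is a product: 2 from \<open>exp_bump_2_le\<close> and 2 from
      differentiating the squared norm.\<close>
    then have "\<bar>exp_bump 2 (1 - (z \<bullet> z) / e\<^sup>2)\<bar> * \<bar>- 2 * (z \<bullet> v) / e\<^sup>2\<bar> \<le> 2 * (2 * norm v / e)"
      by (intro mult_mono exp_bump_2_le) auto
    then show ?thesis using True by (simp add: eq abs_mult)
  next
    case False
    then have "e\<^sup>2 \<le> z \<bullet> z" using assms power_mono[of e "norm z" 2] by (simp add: power2_norm_eq_inner)
    then have "exp_bump 2 (1 - (z \<bullet> z) / e\<^sup>2) = 0" using assms by (simp add: exp_bump_def field_simps)
    then show ?thesis using assms by (simp add: eq)
  qed
qed

lemma integrable_lborel_compact_support:
  fixes g :: "'a::euclidean_space \<Rightarrow> real"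
  assumes "continuous_on UNIV g" "\<And>y. y \<notin> cball x r \<Longrightarrow> g y = 0"
  shows "integrable lborel g"
proof -
  have "integrable lborel (\<lambda>y. indicator (cball x r) y *\<^sub>R g y)"
    using assms by (intro borel_integrable_compact) (auto intro: continuous_on_subset)
  moreover have "(\<lambda>y. indicator (cball x r) y *\<^sub>R g y) = g"
    using assms by (auto simp: indicator_def fun_eq_iff)
  ultimately show ?thesis by simp
qed

definition bump_mass :: "real \<Rightarrow> 'a::euclidean_space itself \<Rightarrow> real" where
  "bump_mass e _ = (LINT z|lborel. bump_kernel e (z::'a))"

lemma continuous_bump_kernel: "continuous_on UNIV (bump_kernel e)"
  by (rule smooth_on_imp_continuous_on[OF smooth_on_bump_kernel])

lemma bump_kernel_shift:
  fixes x :: "'a::euclidean_space"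
  assumes "e > 0"
  shows "integrable lborel (\<lambda>y. bump_kernel e (y - x))"
    "(LINT y|lborel. bump_kernel e (y - x)) = bump_mass e TYPE('a)"
proof -
  show "integrable lborel (\<lambda>y. bump_kernel e (y - x))"
    by (rule integrable_lborel_compact_support[where x = x and r = e])
      (use assms in \<open>auto intro!: bump_kernel_eq_0 continuous_intros
         continuous_on_compose2[OF continuous_bump_kernel] simp: dist_norm norm_minus_commute\<close>)
  have [measurable]: "bump_kernel e \<in> borel_measurable borel"
    by (rule borel_measurable_continuous_onI[OF continuous_bump_kernel])
  show "(LINT y|lborel. bump_kernel e (y - x)) = bump_mass e TYPE('a)"
    using lborel_distr_plus[of "- x"] integral_distr[of "(+) (- x)" lborel borel "bump_kernel e"]
    by (simp add: bump_mass_def)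
qed

text \<open>The kernel is bounded below on the half ball, whose content is that of the full ball up
  to a factor depending on the dimension alone. This is what makes the derivative estimate for
  \<open>mollify\<close> independent of the radius.\<close>

lemma bump_mass_lower:
  assumes "e > 0"
  shows "bump_mass e TYPE('a::euclidean_space) \<ge> exp (- 4 / 3) * measure lborel (cball (0::'a) (e / 2))"
    and "bump_mass e TYPE('a) > 0"
proof -
  have "(LINT z|lborel. indicator (cball (0::'a) (e / 2)) z * exp (- 4 / 3)) \<le> bump_mass e TYPE('a)"
    unfolding bump_mass_def
  proof (rule integral_mono)
    show "integrable lborel (\<lambda>z. indicator (cball (0::'a) (e / 2)) z * exp (- 4 / 3 :: real))"
      using borel_integrable_compact[of "cball (0::'a) (e / 2)" "\<lambda>z. exp (- 4 / 3) :: real"] by simp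
    show "integrable lborel (bump_kernel e :: 'a \<Rightarrow> real)"
      using bump_kernel_shift(1)[OF assms, of "0::'a"] by simp
    show "indicator (cball (0::'a) (e / 2)) z * exp (- 4 / 3) \<le> bump_kernel e z" for z
      using bump_kernel_lower[OF assms, of z] by (auto simp: indicator_def bump_kernel_nonneg)
  qed
  then show 1: "bump_mass e TYPE('a::euclidean_space) \<ge> exp (- 4 / 3) * measure lborel (cball (0::'a) (e / 2))"
    by (simp add: mult.commute)
  show "bump_mass e TYPE('a) > 0"
    by (rule less_le_trans[OF _ 1]) (use assms in simp)
qed

definition mollify :: "real \<Rightarrow> ('a::euclidean_space \<Rightarrow> real) \<Rightarrow> 'a \<Rightarrow> real" where
  "mollify e F x = (LINT y|lborel. bump_kernel e (y - x) * F y) / bump_mass e TYPE('a)"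

locale compactly_supported =
  fixes F :: "'a::euclidean_space \<Rightarrow> real" and R :: real
  assumes cont: "continuous_on UNIV F" and supp: "\<And>x. norm x > R \<Longrightarrow> F x = 0"
begin

lemma lborel_integral_kernel:
  assumes "continuous_on UNIV K" "cball 0 R \<subseteq> cbox a b"
  shows "(LINT y|lborel. K (y - x) * F y) = integral (cbox a b) (\<lambda>y. K (y - x) * F y)"
proof -
  have eq: "indicator (cbox a b) y *\<^sub>R (K (y - x) * F y) = K (y - x) * F y" for y
    using assms(2) supp[of y] by (cases "norm y \<le> R") (auto simp: indicator_def subset_iff)
  have "continuous_on UNIV (\<lambda>y. K (y - x) * F y)"
    by (auto intro!: continuous_intros continuous_on_compose2[OF assms(1)] cont)
  then have "set_integrable lborel (cbox a b) (\<lambda>y. K (y - x) * F y)"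
    unfolding set_integrable_def
    by (intro borel_integrable_compact) (auto intro: continuous_on_subset)
  from set_borel_integral_eq_integral(2)[OF this] show ?thesis
    by (simp only: set_lebesgue_integral_def eq)
qed

lemma smooth_on_mollify:
  assumes "e > 0"
  shows "smooth_on (mollify e F) UNIV"
proof -
  obtain a where ab: "cball 0 R \<subseteq> cbox (-a) (a::'a)"
    using bounded_subset_cbox_symmetric[OF bounded_cball, of 0 R] by blast
  have "mollify e F = (\<lambda>x. integral (cbox (-a) a) (\<lambda>y. bump_kernel e (y - x) * F y) * inverse (bump_mass e TYPE('a)))"
    by (auto simp: mollify_def fun_eq_iff lborel_integral_kernel[OF continuous_bump_kernel ab] divide_inverse)
  moreover have "smooth_on (\<lambda>x. integral (cbox (-a) a) (\<lambda>y. bump_kernel e (y - x) * F y) * inverse (bump_mass e TYPE('a))) UNIV"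
    unfolding smooth_on_def
    by (intro allI Ck_on_mult Ck_on_integral_kernel Ck_on_const cont)
      (use smooth_on_bump_kernel[of e] in \<open>auto simp: smooth_on_def\<close>)
  ultimately show ?thesis by simp
qed

lemma frechet_derivative_mollify:
  assumes "e > 0"
  shows "frechet_derivative (mollify e F) (at x) v =
    - (LINT y|lborel. frechet_derivative (bump_kernel e) (at (y - x)) v * F y) / bump_mass e TYPE('a)"
proof -
  obtain a where ab: "cball 0 R \<subseteq> cbox (-a) (a::'a)"
    using bounded_subset_cbox_symmetric[OF bounded_cball, of 0 R] by blast
  let ?K' = "\<lambda>x. frechet_derivative (bump_kernel e) (at x)"
  have K: "Ck_on (Suc 0) (bump_kernel e) UNIV"
    using smooth_on_bump_kernel unfolding smooth_on_def by blast
  have cK': "continuous_on UNIV (\<lambda>x. ?K' x v)"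
    using smooth_on_imp_continuous_on[OF smooth_on_frechet_derivative[OF smooth_on_bump_kernel]] .
  have eq: "mollify e F = (\<lambda>x. integral (cbox (-a) a) (\<lambda>y. bump_kernel e (y - x) * F y) * inverse (bump_mass e TYPE('a)))"
    by (auto simp: mollify_def fun_eq_iff lborel_integral_kernel[OF continuous_bump_kernel ab] divide_inverse)
  have "(mollify e F has_derivative (\<lambda>v. - integral (cbox (-a) a) (\<lambda>y. ?K' (y - x) v * F y)
      * inverse (bump_mass e TYPE('a)))) (at x)"
    unfolding eq by (intro has_derivative_mult_left integral_kernel_has_derivative[OF cont K])
  from fun_cong[OF frechet_derivative_at[OF this], of v] show ?thesis
    by (simp add: lborel_integral_kernel[OF cK' ab] divide_inverse)
qed

text \<open>Affine functions are reproduced exactly, because the integral of a compactly supported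
  derivative vanishes. For the first order remainder the factor \<open>e\<close> in its size cancels
  the \<open>1 / e\<close> of the kernel derivative. With \<open>F' = 0\<close> this bounds the
  gradients of mollified Lipschitz functions uniformly; with the true derivative it gives
  convergence at every point of differentiability.\<close>

lemma mollify_derivative_estimate:
  assumes e: "e > 0" and lin: "linear F'"
    and est: "\<And>y. norm (y - x) \<le> e \<Longrightarrow> \<bar>F y - F x - F' (y - x)\<bar> \<le> \<eta> * norm (y - x)"
  shows "\<bar>frechet_derivative (mollify e F) (at x) v - F' v\<bar> \<le> 4 * 2 ^ DIM('a) * exp (4 / 3) * \<eta> * norm v"
proof -
  let ?K = "bump_kernel e" and ?Z = "bump_mass e TYPE('a)"
  let ?K' = "\<lambda>x. frechet_derivative ?K (at x)"
  have cK': "continuous_on UNIV (\<lambda>x. ?K' x v)"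
    using smooth_on_imp_continuous_on[OF smooth_on_frechet_derivative[OF smooth_on_bump_kernel]] .
  have Z: "?Z > 0" using bump_mass_lower[OF e] by simp
  have eta: "\<eta> \<ge> 0"
  proof -
    obtain b :: 'a where b: "b \<in> Basis" using nonempty_Basis by blast
    have "\<bar>F (x + e *\<^sub>R b) - F x - F' (e *\<^sub>R b)\<bar> \<le> \<eta> * e"
      using est[of "x + e *\<^sub>R b"] e b by simp
    then show ?thesis using e by (metis abs_ge_zero order.trans zero_le_mult_iff less_eq_real_def not_less)
  qed
  interpret F': bounded_linear F' using lin linear_conv_bounded_linear by blast
  define r where "r y = F y - F x - F' (y - x)" for y
  have cr: "continuous_on UNIV r"
    unfolding r_def by (intro continuous_intros cont F'.continuous_on)
  define T where "T y = F x + F' (y - x)" for y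
  have cT: "continuous_on UNIV T"
    unfolding T_def by (intro continuous_intros F'.continuous_on)
  have K'0: "?K' z v = 0" if "norm z > e" for z
    using bump_kernel_derivative_bound[OF e, of z v] that by simp
  have int: "integrable lborel (\<lambda>y. ?K' (y - x) v * g y)" if "continuous_on UNIV g" for g
    by (rule integrable_lborel_compact_support[where x = x and r = e])
      (use that e K'0 in \<open>auto intro!: continuous_intros continuous_on_compose2[OF cK'] simp: dist_norm norm_minus_commute\<close>)
  define G where "G y = ?K (y - x) * T y" for y
  have sG: "smooth_on G UNIV"
  proof -
    have "smooth_on (\<lambda>y. ?K (y - x)) UNIV"
      by (rule smooth_on_compose[OF open_UNIV subset_UNIV smooth_on_diff[OF open_UNIV
              smooth_on_bounded_linear[OF bounded_linear_ident open_UNIV]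
              smooth_on_const[OF open_UNIV]] smooth_on_bump_kernel])
    moreover have "smooth_on (\<lambda>y. (F x - F' x) + F' y) UNIV"
      by (rule smooth_on_add[OF open_UNIV smooth_on_const[OF open_UNIV]
            smooth_on_bounded_linear[OF F'.bounded_linear open_UNIV]])
    then have "smooth_on T UNIV"
      by (simp add: T_def[abs_def] F'.diff algebra_simps)
    ultimately show ?thesis
      unfolding G_def[abs_def] by (rule smooth_on_mult[OF open_UNIV])
  qed
  have G0: "G y = 0" if "norm y > norm x + e" for y
    using bump_kernel_eq_0[OF e, of "y - x"] norm_triangle_sub[of y x] that by (simp add: G_def)
  obtain L where L: "L-lipschitz_on UNIV G"
    using smooth_compact_support_lipschitz[OF sG G0] by blast
  have dG: "(G has_derivative (\<lambda>v. ?K' (y - x) v * T y + ?K (y - x) * F' v)) (at y)" for y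
  proof -
    have "((\<lambda>y. ?K (y - x)) has_derivative ?K' (y - x)) (at y)"
    proof -
      have "((\<lambda>y. y - x) has_derivative (\<lambda>v. v)) (at y)"
        by (auto intro!: derivative_eq_intros)
      from has_derivative_compose[OF this smooth_on_has_derivative[OF smooth_on_bump_kernel UNIV_I]]
      show ?thesis .
    qed
    moreover have "(T has_derivative F') (at y)"
      unfolding T_def F'.diff
      by (auto intro!: derivative_eq_intros bounded_linear_imp_has_derivative[OF F'.bounded_linear])
    ultimately show ?thesis
      unfolding G_def by (auto intro!: derivative_eq_intros)
  qed
  \<comment> \<open>The integrand is the derivative of the kernel times the Taylor polynomial
    \<open>T\<close>; the product rule then trades the kernel derivative against \<open>T\<close>
    for the kernel against \<open>F' v\<close>.\<close>
  have "(LINT y|lborel. ?K' (y - x) v * T y + ?K (y - x) * F' v) = 0"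
    by (rule integral_frechet_derivative_eq_0(2)[OF L G0 dG])
  then have T: "(LINT y|lborel. ?K' (y - x) v * T y) = - ?Z * F' v"
    using int[OF cT] bump_kernel_shift[OF e, of x] by simp
  have "(LINT y|lborel. ?K' (y - x) v * F y) = (LINT y|lborel. ?K' (y - x) v * T y + ?K' (y - x) v * r y)"
    by (simp add: T_def r_def algebra_simps)
  also have "\<dots> = - ?Z * F' v + (LINT y|lborel. ?K' (y - x) v * r y)"
    using int[OF cT] int[OF cr] T by simp
  finally have "\<bar>frechet_derivative (mollify e F) (at x) v - F' v\<bar> = \<bar>LINT y|lborel. ?K' (y - x) v * r y\<bar> / ?Z"
    using Z unfolding frechet_derivative_mollify[OF e] by (simp add: field_simps)
  also have "\<bar>LINT y|lborel. ?K' (y - x) v * r y\<bar> \<le> (LINT y|lborel. indicator (cball x e) y * (4 * norm v * \<eta>))"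
  proof (rule order.trans[OF integral_abs_bound], rule integral_mono)
    show "integrable lborel (\<lambda>y. \<bar>?K' (y - x) v * r y\<bar>)" using int[OF cr] by simp
    show "integrable lborel (\<lambda>y. indicator (cball x e) y * (4 * norm v * \<eta>))"
      using borel_integrable_compact[of "cball x e" "\<lambda>y. 4 * norm v * \<eta>"] by simp
    show "\<bar>?K' (y - x) v * r y\<bar> \<le> indicator (cball x e) y * (4 * norm v * \<eta>)" for y
    proof (cases "norm (y - x) \<le> e")
      case True
      have "\<bar>r y\<bar> \<le> \<eta> * e"
        using est[OF True] mult_left_mono[OF True eta] by (simp add: r_def)
      then have "\<bar>?K' (y - x) v\<bar> * \<bar>r y\<bar> \<le> (4 * norm v / e) * (\<eta> * e)"
        using bump_kernel_derivative_bound[OF e, of "y - x" v] True e by (intro mult_mono) auto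
      then show ?thesis using True e by (simp add: abs_mult dist_norm norm_minus_commute)
    qed (use K'0 eta in auto)
  qed
  also have "\<dots> = measure lborel (cball x e) * (4 * norm v * \<eta>)"
    by simp
  \<comment> \<open>Halving the radius costs \<open>2 ^ DIM('a)\<close>; the half ball is then
    traded for the kernel mass at the price of \<open>exp (4 / 3)\<close>, and the mass
    cancels.\<close>
  also have "measure lborel (cball x e) = 2 ^ DIM('a) * measure lborel (cball (0::'a) (e / 2))"
    using e by (simp add: content_cball power_divide)
  also have "2 ^ DIM('a) * measure lborel (cball (0::'a) (e / 2)) * (4 * norm v * \<eta>) / ?Z
      \<le> 2 ^ DIM('a) * (exp (4 / 3) * ?Z) * (4 * norm v * \<eta>) / ?Z"
    using bump_mass_lower[OF e, where 'a = 'a] Z eta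
    by (intro divide_right_mono mult_right_mono mult_left_mono) (auto simp: exp_minus field_simps)
  also have "\<dots> = 4 * 2 ^ DIM('a) * exp (4 / 3) * \<eta> * norm v"
    using Z by simp
  finally show ?thesis using Z by (simp add: divide_right_mono)
qed

lemma mollify_approx:
  assumes e: "e > 0" and lip: "L-lipschitz_on UNIV F"
  shows "\<bar>mollify e F x - F x\<bar> \<le> L * e"
proof -
  let ?K = "bump_kernel e" and ?Z = "bump_mass e TYPE('a)"
  have Z: "?Z > 0" using bump_mass_lower[OF e] by simp
  have int: "integrable lborel (\<lambda>y. ?K (y - x) * g y)" if "continuous_on UNIV g" for g
    by (rule integrable_lborel_compact_support[where x = x and r = e])
      (use that e in \<open>auto intro!: continuous_intros bump_kernel_eq_0
         continuous_on_compose2[OF continuous_bump_kernel] simp: dist_norm norm_minus_commute\<close>)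
  have i1: "integrable lborel (\<lambda>y. ?K (y - x) * (F y - F x))"
    by (intro int continuous_intros cont)
  have "(LINT y|lborel. ?K (y - x) * (F y - F x)) = (LINT y|lborel. ?K (y - x) * F y) - ?Z * F x"
    using int[OF cont] bump_kernel_shift[OF e, of x] by (simp add: right_diff_distrib)
  then have "\<bar>mollify e F x - F x\<bar> = \<bar>LINT y|lborel. ?K (y - x) * (F y - F x)\<bar> / ?Z"
    using Z by (simp add: mollify_def field_simps)
  also have "\<bar>LINT y|lborel. ?K (y - x) * (F y - F x)\<bar> \<le> (LINT y|lborel. ?K (y - x) * (L * e))"
  proof (rule order.trans[OF integral_abs_bound], rule integral_mono)
    show "integrable lborel (\<lambda>y. \<bar>?K (y - x) * (F y - F x)\<bar>)" using i1 by simp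
    show "integrable lborel (\<lambda>y. ?K (y - x) * (L * e))"
      using bump_kernel_shift[OF e, of x] by simp
    show "\<bar>?K (y - x) * (F y - F x)\<bar> \<le> ?K (y - x) * (L * e)" for y
    proof (cases "norm (y - x) \<le> e")
      case True
      have "\<bar>F y - F x\<bar> \<le> L * e"
        using lipschitz_onD[OF lip, of y x] mult_left_mono[OF True lipschitz_on_nonneg[OF lip]]
        by (simp add: dist_norm)
      then show ?thesis
        by (simp add: abs_mult bump_kernel_nonneg mult_left_mono)
    qed (use bump_kernel_eq_0[OF e, of "y - x"] in auto)
  qed
  also have "\<dots> = ?Z * (L * e)"
    using bump_kernel_shift[OF e, of x] by simp
  finally show ?thesis using Z by (simp add: divide_right_mono)
qed

end

section \<open>Square integrable functions and weak tangential gradients\<close>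

lemma square_integrable_measurable:
  "square_integrable M f \<Longrightarrow> f \<in> borel_measurable M"
  by (simp add: square_integrable_def)

lemma square_integrable_add:
  fixes f g :: "'a \<Rightarrow> 'b::euclidean_space"
  assumes "square_integrable M f" "square_integrable M g"
  shows "square_integrable M (\<lambda>x. f x + g x)"
    and "(LINT x|M. (norm (f x + g x))\<^sup>2) \<le> 2 * (LINT x|M. (norm (f x))\<^sup>2) + 2 * (LINT x|M. (norm (g x))\<^sup>2)"
proof -
  have [measurable]: "f \<in> borel_measurable M" "g \<in> borel_measurable M"
    using assms by (auto simp: square_integrable_def)
  have le: "(norm (f x + g x))\<^sup>2 \<le> 2 * (norm (f x))\<^sup>2 + 2 * (norm (g x))\<^sup>2" for x
  proof -
    have "(norm (f x + g x))\<^sup>2 \<le> (norm (f x) + norm (g x))\<^sup>2"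
      by (intro power_mono norm_triangle_ineq) auto
    also have "\<dots> \<le> 2 * (norm (f x))\<^sup>2 + 2 * (norm (g x))\<^sup>2"
      using zero_le_power2[of "norm (f x) - norm (g x)"] by (simp add: power2_eq_square algebra_simps)
    finally show ?thesis .
  qed
  have i: "integrable M (\<lambda>x. 2 * (norm (f x))\<^sup>2 + 2 * (norm (g x))\<^sup>2)"
    using assms by (simp add: square_integrable_def)
  have j: "integrable M (\<lambda>x. (norm (f x + g x))\<^sup>2)"
    by (rule Bochner_Integration.integrable_bound[OF i]) (use le in auto)
  then show "square_integrable M (\<lambda>x. f x + g x)"
    by (simp add: square_integrable_def)
  have "(LINT x|M. (norm (f x + g x))\<^sup>2) \<le> (LINT x|M. 2 * (norm (f x))\<^sup>2 + 2 * (norm (g x))\<^sup>2)"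
    by (rule integral_mono[OF j i le])
  also have "\<dots> = 2 * (LINT x|M. (norm (f x))\<^sup>2) + 2 * (LINT x|M. (norm (g x))\<^sup>2)"
    using assms by (simp add: square_integrable_def)
  finally show "(LINT x|M. (norm (f x + g x))\<^sup>2) \<le> 2 * (LINT x|M. (norm (f x))\<^sup>2) + 2 * (LINT x|M. (norm (g x))\<^sup>2)" .
qed

lemma square_integrable_scaleR:
  fixes f :: "'a \<Rightarrow> 'b::euclidean_space"
  shows "square_integrable M f \<Longrightarrow> square_integrable M (\<lambda>x. c *\<^sub>R f x)"
  by (auto simp: square_integrable_def power_mult_distrib)

lemma square_integrable_mult:
  fixes f :: "'a \<Rightarrow> real"
  shows "square_integrable M f \<Longrightarrow> square_integrable M (\<lambda>x. c * f x)"
  using square_integrable_scaleR[of M f c] by simp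

lemma square_integrable_diff:
  fixes f g :: "'a \<Rightarrow> 'b::euclidean_space"
  assumes "square_integrable M f" "square_integrable M g"
  shows "square_integrable M (\<lambda>x. f x - g x)"
  using square_integrable_add(1)[OF assms(1) square_integrable_scaleR[OF assms(2), of "-1"]] by simp

lemma square_integrable_inner:
  fixes f g :: "'a \<Rightarrow> 'b::euclidean_space"
  assumes "square_integrable M f" "square_integrable M g"
  shows "integrable M (\<lambda>x. f x \<bullet> g x)"
proof (rule Bochner_Integration.integrable_bound)
  show "integrable M (\<lambda>x. (norm (f x))\<^sup>2 + (norm (g x))\<^sup>2)"
    using assms by (simp add: square_integrable_def)
  show "(\<lambda>x. f x \<bullet> g x) \<in> borel_measurable M"
    using assms by (auto simp: square_integrable_def)
  have "\<bar>f x \<bullet> g x\<bar> \<le> (norm (f x))\<^sup>2 + (norm (g x))\<^sup>2" for x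
    using Cauchy_Schwarz_ineq2[of "f x" "g x"] zero_le_power2[of "norm (f x) - norm (g x)"]
      mult_nonneg_nonneg[OF norm_ge_zero norm_ge_zero, of "f x" "g x"]
    by (simp add: power2_eq_square algebra_simps)
  then show "AE x in M. norm (f x \<bullet> g x) \<le> norm ((norm (f x))\<^sup>2 + (norm (g x))\<^sup>2)"
    by auto
qed

lemma square_integrable_times:
  fixes f g :: "'a \<Rightarrow> real"
  assumes "square_integrable M f" "square_integrable M g"
  shows "integrable M (\<lambda>x. f x * g x)"
  using square_integrable_inner[OF assms] by simp

lemma integral_inner_Cauchy_Schwarz:
  fixes f g :: "'a \<Rightarrow> 'b::euclidean_space"
  assumes f: "square_integrable M f" and g: "square_integrable M g"
  shows "\<bar>LINT x|M. f x \<bullet> g x\<bar> \<le> sqrt (LINT x|M. (norm (f x))\<^sup>2) * sqrt (LINT x|M. (norm (g x))\<^sup>2)"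
proof -
  let ?A = "LINT x|M. (norm (f x))\<^sup>2" and ?B = "LINT x|M. f x \<bullet> g x" and ?C = "LINT x|M. (norm (g x))\<^sup>2"
  have pos: "0 \<le> ?A - 2 * t * ?B + t\<^sup>2 * ?C" for t
  proof -
    have "0 \<le> (LINT x|M. (norm (f x - t *\<^sub>R g x))\<^sup>2)" by simp
    also have "(\<lambda>x. (norm (f x - t *\<^sub>R g x))\<^sup>2) = (\<lambda>x. (norm (f x))\<^sup>2 - 2 * t * (f x \<bullet> g x) + t\<^sup>2 * (norm (g x))\<^sup>2)"
      unfolding power2_norm_eq_inner
      by (simp add: fun_eq_iff inner_diff_left inner_diff_right inner_commute power2_eq_square algebra_simps)
    also have "(LINT x|M. (norm (f x))\<^sup>2 - 2 * t * (f x \<bullet> g x) + t\<^sup>2 * (norm (g x))\<^sup>2) = ?A - 2 * t * ?B + t\<^sup>2 * ?C"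
      using f g square_integrable_inner[OF f g] by (simp add: square_integrable_def)
    finally show ?thesis .
  qed
  have "?B\<^sup>2 \<le> ?A * ?C"
  proof (cases "?C = 0")
    case True
    have "?B = 0"
    proof (rule ccontr)
      assume "?B \<noteq> 0"
      \<comment> \<open>For \<open>?C = 0\<close> the quadratic polynomial is affine in
        \<open>t\<close>, and this \<open>t\<close> gives it the value -1.\<close>
      then show False using pos[of "(?A + 1) / (2 * ?B)"] True by simp
    qed
    then show ?thesis using True by simp
  next
    case False
    then have C: "?C > 0" by (simp add: order_less_le)
    have "?A - 2 * (?B / ?C) * ?B + (?B / ?C)\<^sup>2 * ?C = ?A - ?B\<^sup>2 / ?C"
      using C by (simp add: power2_eq_square field_simps)
    then have "?B\<^sup>2 / ?C \<le> ?A" using pos[of "?B / ?C"] by simp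
    then show ?thesis using C by (simp add: field_simps)
  qed
  then have "sqrt (?B\<^sup>2) \<le> sqrt (?A * ?C)" by (rule real_sqrt_le_mono)
  then show ?thesis by (simp add: real_sqrt_mult)
qed

lemma tendsto_integral_inner:
  fixes f g :: "'a \<Rightarrow> 'b::euclidean_space"
  assumes f: "square_integrable M f" and fj: "\<And>j. square_integrable M (fj j)"
    and lim: "(\<lambda>j. LINT x|M. (norm (fj j x - f x))\<^sup>2) \<longlonglongrightarrow> 0" and g: "square_integrable M g"
  shows "(\<lambda>j. LINT x|M. fj j x \<bullet> g x) \<longlonglongrightarrow> (LINT x|M. f x \<bullet> g x)"
proof -
  have "(\<lambda>j. sqrt (LINT x|M. (norm (fj j x - f x))\<^sup>2) * sqrt (LINT x|M. (norm (g x))\<^sup>2)) \<longlonglongrightarrow> sqrt 0 * sqrt (LINT x|M. (norm (g x))\<^sup>2)"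
    by (intro tendsto_intros lim)
  then have lim0: "(\<lambda>j. sqrt (LINT x|M. (norm (fj j x - f x))\<^sup>2) * sqrt (LINT x|M. (norm (g x))\<^sup>2)) \<longlonglongrightarrow> 0"
    by simp
  have bound: "norm (LINT x|M. (fj j x - f x) \<bullet> g x)
      \<le> sqrt (LINT x|M. (norm (fj j x - f x))\<^sup>2) * sqrt (LINT x|M. (norm (g x))\<^sup>2)" for j
    unfolding real_norm_def by (rule integral_inner_Cauchy_Schwarz[OF square_integrable_diff[OF fj f] g])
  have "(\<lambda>j. LINT x|M. (fj j x - f x) \<bullet> g x) \<longlonglongrightarrow> 0"
    by (rule Lim_null_comparison[OF always_eventually[OF allI[OF bound]] lim0])
  moreover have "(LINT x|M. (fj j x - f x) \<bullet> g x) = (LINT x|M. fj j x \<bullet> g x) - (LINT x|M. f x \<bullet> g x)" for j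
    using square_integrable_inner[OF fj g] square_integrable_inner[OF f g] by (simp add: inner_diff_left)
  ultimately show ?thesis by (simp add: LIM_zero_iff)
qed

lemma tendsto_integral_norm_sq:
  fixes f :: "'a \<Rightarrow> 'b::euclidean_space"
  assumes f: "square_integrable M f" and fj: "\<And>j. square_integrable M (fj j)"
    and lim: "(\<lambda>j. LINT x|M. (norm (fj j x - f x))\<^sup>2) \<longlonglongrightarrow> 0"
  shows "(\<lambda>j. LINT x|M. (norm (fj j x))\<^sup>2) \<longlonglongrightarrow> (LINT x|M. (norm (f x))\<^sup>2)"
proof -
  have eq: "(LINT x|M. (norm (fj j x))\<^sup>2) = (LINT x|M. (norm (fj j x - f x))\<^sup>2) + 2 * (LINT x|M. fj j x \<bullet> f x) - (LINT x|M. (norm (f x))\<^sup>2)" for j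
  proof -
    have "(norm (fj j x))\<^sup>2 = (norm (fj j x - f x))\<^sup>2 + 2 * (fj j x \<bullet> f x) - (norm (f x))\<^sup>2" for x
      by (simp add: power2_norm_eq_inner inner_diff_left inner_diff_right inner_commute)
    then show ?thesis
      using square_integrable_inner[OF fj[of j] f] square_integrable_diff[OF fj[of j] f] f
      by (simp add: square_integrable_def)
  qed
  have "(\<lambda>j. (LINT x|M. (norm (fj j x - f x))\<^sup>2) + 2 * (LINT x|M. fj j x \<bullet> f x) - (LINT x|M. (norm (f x))\<^sup>2))
      \<longlonglongrightarrow> 0 + 2 * (LINT x|M. f x \<bullet> f x) - (LINT x|M. (norm (f x))\<^sup>2)"
    by (intro tendsto_intros lim tendsto_integral_inner[OF f fj lim f])
  moreover have "(LINT x|M. f x \<bullet> f x) = (LINT x|M. (norm (f x))\<^sup>2)"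
    by (simp add: power2_norm_eq_inner)
  ultimately show ?thesis unfolding eq by simp
qed

lemma grad_linear_combination:
  assumes "v differentiable (at x)" "w differentiable (at x)"
  shows "grad (\<lambda>x. a * v x + b * w x) x = a *\<^sub>R grad v x + b *\<^sub>R grad w x"
proof (rule grad_eqI)
  have "(v has_derivative (\<lambda>h. grad v x \<bullet> h)) (at x)" "(w has_derivative (\<lambda>h. grad w x \<bullet> h)) (at x)"
    using assms by (simp_all add: grad_inner frechet_derivative_works[symmetric])
  then have "((\<lambda>x. a * v x + b * w x) has_derivative (\<lambda>h. a * (grad v x \<bullet> h) + b * (grad w x \<bullet> h))) (at x)"
    by (intro has_derivative_add has_derivative_mult_right)
  moreover have "(\<lambda>h. a * (grad v x \<bullet> h) + b * (grad w x \<bullet> h)) = (\<bullet>) (a *\<^sub>R grad v x + b *\<^sub>R grad w x)"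
    by (rule ext) (simp add: inner_add_left)
  ultimately show "((\<lambda>x. a * v x + b * w x) has_derivative (\<bullet>) (a *\<^sub>R grad v x + b *\<^sub>R grad w x)) (at x)"
    by simp
qed

lemma tangential_linear_combination:
  assumes "v differentiable (at x)" "w differentiable (at x)"
  shows "tangential n (\<lambda>x. a * v x + b * w x) x = a *\<^sub>R tangential n v x + b *\<^sub>R tangential n w x"
  unfolding tangential_def grad_linear_combination[OF assms]
  by (simp add: inner_add_right scaleR_add_left scaleR_diff_right scaleR_add_right algebra_simps)

lemma smooth_on_differentiable: "smooth_on w UNIV \<Longrightarrow> w differentiable (at x)"
  using smooth_on_has_derivative[of w UNIV x] differentiableI by blast

section \<open>An abstract surface and its weak tangential gradients\<close>

text \<open>Instantiated both by \<gamma> with \<open>nu \<gamma>\<close> and by \<Gamma> with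
  \<open>normal S\<close>. The normal is a unit vector only almost everywhere, as it may be
  undefined on the edges of elements.\<close>

locale surface_space = finite_measure \<mu> for \<mu> :: "'a::euclidean_space measure" +
  fixes X :: "'a set" and n :: "'a \<Rightarrow> 'a"
  assumes space_\<mu>: "space \<mu> = X" and sets_\<mu>: "sets \<mu> = sets (restrict_space borel X)"
    and compact_X: "compact X"
    and n_measurable: "n \<in> borel_measurable \<mu>" and n_unit: "AE x in \<mu>. norm (n x) = 1"
begin

lemma measurable_restrict: "f \<in> borel_measurable borel \<Longrightarrow> f \<in> borel_measurable \<mu>"
  unfolding measurable_cong_sets[OF sets_\<mu> refl] by (rule measurable_restrict_space1)

lemma measurable_continuous: 
  fixes f :: "'a \<Rightarrow> 'b::euclidean_space"
  shows "continuous_on UNIV f \<Longrightarrow> f \<in> borel_measurable \<mu>"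
  by (intro measurable_restrict borel_measurable_continuous_onI)

lemma square_integrable_bounded:
  fixes f :: "'a \<Rightarrow> 'b::euclidean_space"
  assumes "f \<in> borel_measurable \<mu>" "AE x in \<mu>. norm (f x) \<le> B"
  shows "square_integrable \<mu> f"
proof -
  have "AE x in \<mu>. norm ((norm (f x))\<^sup>2) \<le> B\<^sup>2"
    using assms(2) by eventually_elim (simp add: power_mono)
  then show ?thesis
    using assms(1) by (auto simp: square_integrable_def intro!: integrable_const_bound)
qed

lemma square_integrable_continuous:
  fixes f :: "'a \<Rightarrow> 'b::euclidean_space"
  assumes "continuous_on UNIV f"
  shows "square_integrable \<mu> f"
proof -
  have "bounded (f ` X)"
    using compact_continuous_image[OF continuous_on_subset[OF assms] compact_X] compact_imp_bounded by blast
  then obtain B where "\<And>x. x \<in> X \<Longrightarrow> norm (f x) \<le> B"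
    by (auto simp: bounded_iff)
  then show ?thesis
    using space_\<mu> by (intro square_integrable_bounded[where B = B] measurable_continuous assms) auto
qed

lemma norm_tangential_le: "norm (n x) = 1 \<Longrightarrow> norm (tangential n w x) \<le> 2 * norm (grad w x)"
proof -
  assume n: "norm (n x) = 1"
  have "norm (tangential n w x) \<le> norm (grad w x) + \<bar>n x \<bullet> grad w x\<bar> * norm (n x)"
    unfolding tangential_def by (rule order.trans[OF norm_triangle_ineq4]) simp
  also have "\<bar>n x \<bullet> grad w x\<bar> \<le> norm (grad w x)"
    using Cauchy_Schwarz_ineq2[of "n x" "grad w x"] n by simp
  finally show ?thesis using n by simp
qed

lemma continuous_grad: "smooth_on w UNIV \<Longrightarrow> continuous_on UNIV (grad w)"
  by (intro smooth_on_imp_continuous_on smooth_on_grad) auto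

lemma tangential_measurable:
  assumes "smooth_on w UNIV"
  shows "tangential n w \<in> borel_measurable \<mu>"
proof -
  note [measurable] = measurable_continuous[OF continuous_grad[OF assms]] n_measurable
  show ?thesis unfolding tangential_def[abs_def] by measurable
qed

lemma square_integrable_tangential:
  assumes "smooth_on w UNIV"
  shows "square_integrable \<mu> (tangential n w)"
proof -
  have s: "square_integrable \<mu> (grad w)"
    by (intro square_integrable_continuous continuous_grad assms)
  have "integrable \<mu> (\<lambda>x. (norm (tangential n w x))\<^sup>2)"
  proof (rule Bochner_Integration.integrable_bound)
    show "integrable \<mu> (\<lambda>x. 4 * (norm (grad w x))\<^sup>2)"
      using s by (simp add: square_integrable_def)
    show "(\<lambda>x. (norm (tangential n w x))\<^sup>2) \<in> borel_measurable \<mu>"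
      using tangential_measurable[OF assms] by simp
    show "AE x in \<mu>. norm ((norm (tangential n w x))\<^sup>2) \<le> norm (4 * (norm (grad w x))\<^sup>2)"
      using n_unit
    proof eventually_elim
      case (elim x)
      then have "(norm (tangential n w x))\<^sup>2 \<le> (2 * norm (grad w x))\<^sup>2"
        by (intro power_mono norm_tangential_le) auto
      then show ?case by (simp add: power_mult_distrib)
    qed
  qed
  then show ?thesis using tangential_measurable[OF assms] by (simp add: square_integrable_def)
qed

lemma square_integrable_smooth: "smooth_on w UNIV \<Longrightarrow> square_integrable \<mu> w"
  by (intro square_integrable_continuous smooth_on_imp_continuous_on)

lemma weak_tgrad_smooth:
  assumes "smooth_on w UNIV"
  shows "weak_tgrad \<mu> n w (tangential n w)"
  unfolding weak_tgrad_def
  using square_integrable_smooth[OF assms] square_integrable_tangential[OF assms] assms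
  by (auto intro!: exI[of _ "\<lambda>j. w"])

lemma weak_tgradE:
  assumes "weak_tgrad \<mu> n v g"
  obtains w where "\<And>j. smooth_on (w j) UNIV"
    "(\<lambda>j. LINT x|\<mu>. (norm (w j x - v x))\<^sup>2) \<longlonglongrightarrow> 0"
    "(\<lambda>j. LINT x|\<mu>. (norm (tangential n (w j) x - g x))\<^sup>2) \<longlonglongrightarrow> 0"
  using assms unfolding weak_tgrad_def by auto

lemma weak_tgradD:
  assumes "weak_tgrad \<mu> n v g"
  shows "square_integrable \<mu> v" "square_integrable \<mu> g"
  using assms by (auto simp: weak_tgrad_def)

lemma weak_tgrad_linear_combination:
  assumes "weak_tgrad \<mu> n v g" "weak_tgrad \<mu> n v' g'"
  shows "weak_tgrad \<mu> n (\<lambda>x. a * v x + b * v' x) (\<lambda>x. a *\<^sub>R g x + b *\<^sub>R g' x)"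
proof -
  obtain w where w: "\<And>j. smooth_on (w j) UNIV"
    "(\<lambda>j. LINT x|\<mu>. (norm (w j x - v x))\<^sup>2) \<longlonglongrightarrow> 0"
    "(\<lambda>j. LINT x|\<mu>. (norm (tangential n (w j) x - g x))\<^sup>2) \<longlonglongrightarrow> 0"
    by (rule weak_tgradE[OF assms(1)]) (rule that)
  obtain w' where w': "\<And>j. smooth_on (w' j) UNIV"
    "(\<lambda>j. LINT x|\<mu>. (norm (w' j x - v' x))\<^sup>2) \<longlonglongrightarrow> 0"
    "(\<lambda>j. LINT x|\<mu>. (norm (tangential n (w' j) x - g' x))\<^sup>2) \<longlonglongrightarrow> 0"
    by (rule weak_tgradE[OF assms(2)]) (rule that)
  note sq = weak_tgradD[OF assms(1)] weak_tgradD[OF assms(2)]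
  have conv: "(\<lambda>j. LINT x|\<mu>. (norm ((a *\<^sub>R f j x + b *\<^sub>R f' j x) - (a *\<^sub>R h x + b *\<^sub>R h' x)))\<^sup>2) \<longlonglongrightarrow> 0"
    if f: "\<And>j. square_integrable \<mu> (f j)" and f': "\<And>j. square_integrable \<mu> (f' j)"
      and h: "square_integrable \<mu> h" and h': "square_integrable \<mu> h'"
      and l: "(\<lambda>j. LINT x|\<mu>. (norm (f j x - h x))\<^sup>2) \<longlonglongrightarrow> 0"
      and l': "(\<lambda>j. LINT x|\<mu>. (norm (f' j x - h' x))\<^sup>2) \<longlonglongrightarrow> 0"
    for f f' :: "nat \<Rightarrow> 'a \<Rightarrow> 'c::euclidean_space" and h h'
  proof -
    have e: "(a *\<^sub>R f j x + b *\<^sub>R f' j x) - (a *\<^sub>R h x + b *\<^sub>R h' x) = a *\<^sub>R (f j x - h x) + b *\<^sub>R (f' j x - h' x)" for j x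
      by (simp add: scaleR_diff_right algebra_simps)
    have bound: "(LINT x|\<mu>. (norm ((a *\<^sub>R f j x + b *\<^sub>R f' j x) - (a *\<^sub>R h x + b *\<^sub>R h' x)))\<^sup>2)
      \<le> 2 * (a\<^sup>2 * (LINT x|\<mu>. (norm (f j x - h x))\<^sup>2)) + 2 * (b\<^sup>2 * (LINT x|\<mu>. (norm (f' j x - h' x))\<^sup>2))" for j
      unfolding e using square_integrable_add(2)[OF square_integrable_scaleR[OF square_integrable_diff[OF f[of j] h], of a]
          square_integrable_scaleR[OF square_integrable_diff[OF f'[of j] h'], of b]]
      by (simp add: power_mult_distrib)
    have lim0: "(\<lambda>j. 2 * (a\<^sup>2 * (LINT x|\<mu>. (norm (f j x - h x))\<^sup>2)) + 2 * (b\<^sup>2 * (LINT x|\<mu>. (norm (f' j x - h' x))\<^sup>2))) \<longlonglongrightarrow> 2 * (a\<^sup>2 * 0) + 2 * (b\<^sup>2 * 0)"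
      by (intro tendsto_intros l l')
    have bound': "norm (LINT x|\<mu>. (norm ((a *\<^sub>R f j x + b *\<^sub>R f' j x) - (a *\<^sub>R h x + b *\<^sub>R h' x)))\<^sup>2) \<le> 2 * (a\<^sup>2 * (LINT x|\<mu>. (norm (f j x - h x))\<^sup>2)) + 2 * (b\<^sup>2 * (LINT x|\<mu>. (norm (f' j x - h' x))\<^sup>2))" for j
      using bound[of j] by simp
    show ?thesis
      by (rule Lim_null_comparison[OF always_eventually[OF allI[OF bound']]]) (use lim0 in simp)
  qed
  have "(\<lambda>j. LINT x|\<mu>. ((a * w j x + b * w' j x) - (a * v x + b * v' x))\<^sup>2) \<longlonglongrightarrow> 0"
    using conv[of w w' v v'] w w' sq by (simp add: square_integrable_smooth)
  moreover have "(\<lambda>j. LINT x|\<mu>. (norm (tangential n (\<lambda>x. a * w j x + b * w' j x) x - (a *\<^sub>R g x + b *\<^sub>R g' x)))\<^sup>2) \<longlonglongrightarrow> 0"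
    using conv[of "\<lambda>j. tangential n (w j)" "\<lambda>j. tangential n (w' j)" g g'] w w' sq
    by (simp add: square_integrable_tangential tangential_linear_combination smooth_on_differentiable)
  moreover have "smooth_on (\<lambda>x. a * w j x + b * w' j x) UNIV" for j
    by (intro smooth_on_add smooth_on_mult smooth_on_const w w') auto
  moreover have "square_integrable \<mu> (\<lambda>x. a * v x + b * v' x)"
    by (intro square_integrable_add square_integrable_mult sq)
  moreover have "square_integrable \<mu> (\<lambda>x. a *\<^sub>R g x + b *\<^sub>R g' x)"
    by (intro square_integrable_add square_integrable_scaleR sq)
  ultimately show ?thesis
    unfolding weak_tgrad_def by (auto intro!: exI[of _ "\<lambda>j x. a * w j x + b * w' j x"])
qed

text \<open>A diagonal choice: each pair is approximated by a smooth function up to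
  \<open>1 / (j + 1)\<close>, and the chosen functions inherit the limit of the pairs.\<close>

lemma weak_tgrad_limit:
  assumes "\<And>j. weak_tgrad \<mu> n (v j) (g j)" "square_integrable \<mu> v'" "square_integrable \<mu> g'"
    and "(\<lambda>j. LINT x|\<mu>. (norm (v j x - v' x))\<^sup>2) \<longlonglongrightarrow> 0"
    and "(\<lambda>j. LINT x|\<mu>. (norm (g j x - g' x))\<^sup>2) \<longlonglongrightarrow> 0"
  shows "weak_tgrad \<mu> n v' g'"
proof -
  have ex: "\<exists>w. smooth_on w UNIV \<and> (LINT x|\<mu>. (norm (w x - v j x))\<^sup>2) < inverse (real (Suc j)) \<and>
      (LINT x|\<mu>. (norm (tangential n w x - g j x))\<^sup>2) < inverse (real (Suc j))" for j
  proof -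
    obtain w where w: "\<And>i. smooth_on (w i) UNIV"
      "(\<lambda>i. LINT x|\<mu>. (norm (w i x - v j x))\<^sup>2) \<longlonglongrightarrow> 0"
      "(\<lambda>i. LINT x|\<mu>. (norm (tangential n (w i) x - g j x))\<^sup>2) \<longlonglongrightarrow> 0"
      by (rule weak_tgradE[OF assms(1)[of j]]) (rule that)
    have p: "0 < inverse (real (Suc j))" by simp
    have "\<forall>\<^sub>F i in sequentially. (LINT x|\<mu>. (norm (w i x - v j x))\<^sup>2) < inverse (real (Suc j)) \<and>
      (LINT x|\<mu>. (norm (tangential n (w i) x - g j x))\<^sup>2) < inverse (real (Suc j))"
      using order_tendstoD(2)[OF w(2) p] order_tendstoD(2)[OF w(3) p] by eventually_elim simp
    then obtain i where "(LINT x|\<mu>. (norm (w i x - v j x))\<^sup>2) < inverse (real (Suc j)) \<and>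
      (LINT x|\<mu>. (norm (tangential n (w i) x - g j x))\<^sup>2) < inverse (real (Suc j))"
      using eventually_happens'[OF sequentially_bot] by blast
    then show ?thesis using w(1) by blast
  qed
  obtain w where w0: "\<forall>j. smooth_on (w j) UNIV \<and> (LINT x|\<mu>. (norm (w j x - v j x))\<^sup>2) < inverse (real (Suc j)) \<and>
      (LINT x|\<mu>. (norm (tangential n (w j) x - g j x))\<^sup>2) < inverse (real (Suc j))"
    using choice[OF allI[OF ex]] by (rule exE)
  have w: "smooth_on (w j) UNIV"
    "(LINT x|\<mu>. (norm (w j x - v j x))\<^sup>2) < inverse (real (Suc j))"
    "(LINT x|\<mu>. (norm (tangential n (w j) x - g j x))\<^sup>2) < inverse (real (Suc j))" for j
    using spec[OF w0, of j] by (simp_all del: of_nat_Suc)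
  have conv: "(\<lambda>j. LINT x|\<mu>. (norm (f j x - h x))\<^sup>2) \<longlonglongrightarrow> 0"
    if f: "\<And>j. square_integrable \<mu> (f j)" and f': "\<And>j. square_integrable \<mu> (f' j)"
      and h: "square_integrable \<mu> h"
      and l: "\<And>j. (LINT x|\<mu>. (norm (f j x - f' j x))\<^sup>2) < inverse (real (Suc j))"
      and l': "(\<lambda>j. LINT x|\<mu>. (norm (f' j x - h x))\<^sup>2) \<longlonglongrightarrow> 0"
    for f f' :: "nat \<Rightarrow> 'a \<Rightarrow> 'c::euclidean_space" and h
  proof -
    have bound: "(LINT x|\<mu>. (norm (f j x - h x))\<^sup>2) \<le> 2 * inverse (real (Suc j)) + 2 * (LINT x|\<mu>. (norm (f' j x - h x))\<^sup>2)" for j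
      using square_integrable_add(2)[OF square_integrable_diff[OF f[of j] f'[of j]] square_integrable_diff[OF f'[of j] h]] l[of j]
      by (simp del: of_nat_Suc)
    have lim0: "(\<lambda>j. 2 * inverse (real (Suc j)) + 2 * (LINT x|\<mu>. (norm (f' j x - h x))\<^sup>2)) \<longlonglongrightarrow> 2 * 0 + 2 * 0"
      by (intro tendsto_intros l' LIMSEQ_inverse_real_of_nat)
    have bound': "norm (LINT x|\<mu>. (norm (f j x - h x))\<^sup>2) \<le> 2 * inverse (real (Suc j)) + 2 * (LINT x|\<mu>. (norm (f' j x - h x))\<^sup>2)" for j
      using bound[of j] by simp
    show ?thesis
      by (rule Lim_null_comparison[OF always_eventually[OF allI[OF bound']]]) (use lim0 in simp)
  qed
  note sq = weak_tgradD[OF assms(1)]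
  have "(\<lambda>j. LINT x|\<mu>. (norm (w j x - v' x))\<^sup>2) \<longlonglongrightarrow> 0"
    by (rule conv[of w v]) (use w sq assms in \<open>auto intro: square_integrable_smooth\<close>)
  moreover have "(\<lambda>j. LINT x|\<mu>. (norm (tangential n (w j) x - g' x))\<^sup>2) \<longlonglongrightarrow> 0"
    by (rule conv[of "\<lambda>j. tangential n (w j)" g]) (use w sq assms in \<open>auto intro: square_integrable_tangential\<close>)
  ultimately show ?thesis
    unfolding weak_tgrad_def using w(1) assms(2,3) by auto
qed

lemma weak_tgrad_cong:
  assumes "weak_tgrad \<mu> n v g" "\<And>x. x \<in> X \<Longrightarrow> v x = v' x"
  shows "weak_tgrad \<mu> n v' g"
proof -
  have m: "v \<in> borel_measurable \<mu> \<longleftrightarrow> v' \<in> borel_measurable \<mu>"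
    using assms(2) by (intro measurable_cong) (simp add: space_\<mu>)
  have i: "integrable \<mu> (\<lambda>x. (norm (v x))\<^sup>2) \<longleftrightarrow> integrable \<mu> (\<lambda>x. (norm (v' x))\<^sup>2)"
    using assms(2) by (intro Bochner_Integration.integrable_cong) (simp_all add: space_\<mu>)
  have "(LINT x|\<mu>. (w x - v x)\<^sup>2) = (LINT x|\<mu>. (w x - v' x)\<^sup>2)" for w
    using assms(2) by (intro Bochner_Integration.integral_cong) (simp_all add: space_\<mu>)
  with assms(1) m i show ?thesis
    by (simp add: weak_tgrad_def square_integrable_def)
qed

text \<open>Mollifications have gradients bounded by a multiple of the Lipschitz constant and
  converging at every point of differentiability, so dominated convergence on the finite measure
  yields the limit in L2. Differentiability almost everywhere for \<open>\<mu>\<close> is an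
  assumption of its own, since \<open>\<mu>\<close> may live on a null set of the ambient space,
  where Rademacher's theorem gives no information.\<close>

lemma lipschitz_weak_tgrad:
  assumes lip: "L-lipschitz_on UNIV F" and supp: "\<And>x. norm x > R \<Longrightarrow> F x = 0"
    and diff: "AE x in \<mu>. F differentiable (at x)"
  obtains g where "weak_tgrad \<mu> n F g" "AE x in \<mu>. g x = tangential n F x"
proof -
  have cF: "continuous_on UNIV F" using lip lipschitz_on_continuous_on by blast
  interpret compactly_supported F R using cF supp by unfold_locales
  define e where "e j = inverse (real (Suc j))" for j
  have e: "e j > 0" for j by (simp add: e_def)
  have e0: "e \<longlonglongrightarrow> 0" unfolding e_def by (rule LIMSEQ_inverse_real_of_nat)
  define w where "w j = mollify (e j) F" for j
  have w: "smooth_on (w j) UNIV" for j unfolding w_def by (rule smooth_on_mollify[OF e])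
  define c where "c = 4 * 2 ^ DIM('a) * exp (4 / 3 :: real)"
  have c: "c > 0" by (simp add: c_def)
  have L: "L \<ge> 0" using lip by (rule lipschitz_on_nonneg)
  have gb: "norm (grad (w j) x) \<le> c * L" for j x
  proof -
    have "\<bar>frechet_derivative (w j) (at x) v - 0\<bar> \<le> 4 * 2 ^ DIM('a) * exp (4 / 3) * L * norm v" for v
      unfolding w_def
      by (rule mollify_derivative_estimate[OF e])
        (use lipschitz_onD[OF lip] in \<open>auto simp: dist_norm linear_iff\<close>)
    then have "\<bar>grad (w j) x \<bullet> grad (w j) x\<bar> \<le> c * L * norm (grad (w j) x)"
      unfolding grad_inner[OF smooth_on_differentiable[OF w]] by (simp add: c_def)
    then have "norm (grad (w j) x) * norm (grad (w j) x) \<le> c * L * norm (grad (w j) x)"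
      by (simp add: power2_norm_eq_inner[symmetric] power2_eq_square)
    then show ?thesis
      using c L by (cases "norm (grad (w j) x) = 0") (auto simp: mult_le_cancel_right)
  qed
  have gl: "(\<lambda>j. grad (w j) x) \<longlonglongrightarrow> grad F x" if d: "F differentiable (at x)" for x
  proof -
    let ?F' = "frechet_derivative F (at x)"
    have "(\<lambda>j. frechet_derivative (w j) (at x) v) \<longlonglongrightarrow> ?F' v" for v
    proof (rule LIMSEQ_I)
      fix r :: real assume r: "r > 0"
      define N where "N = norm v + 1"
      have N: "N > 0" using norm_ge_zero[of v] unfolding N_def by linarith
      \<comment> \<open>Makes the mollification error at most \<open>c * \<eta> * N = r / 2\<close>;
        the 1 in \<open>N\<close> covers \<open>v = 0\<close>.\<close>
      define \<eta> where "\<eta> = r / (2 * c * N)"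
      have eta: "\<eta> > 0" using r c N by (simp add: \<eta>_def)
      have F': "(F has_derivative ?F') (at x)" using d by (simp add: frechet_derivative_works)
      then obtain d where d: "d > 0" "\<And>y. norm (y - x) < d \<Longrightarrow> norm (F y - F x - ?F' (y - x)) \<le> \<eta> * norm (y - x)"
        using eta unfolding has_derivative_at_alt by blast
      obtain j0 where j0: "\<And>j. j \<ge> j0 \<Longrightarrow> e j < d"
        using order_tendstoD(2)[OF e0 d(1)] unfolding eventually_sequentially by blast
      have "norm (frechet_derivative (w j) (at x) v - ?F' v) < r" if "j \<ge> j0" for j
      proof -
        have "\<bar>frechet_derivative (w j) (at x) v - ?F' v\<bar> \<le> 4 * 2 ^ DIM('a) * exp (4 / 3) * \<eta> * norm v"
          unfolding w_def
        proof (rule mollify_derivative_estimate[OF e has_derivative_linear[OF F']])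
          show "\<bar>F y - F x - ?F' (y - x)\<bar> \<le> \<eta> * norm (y - x)" if "norm (y - x) \<le> e j" for y
            using d(2)[of y] that j0[OF \<open>j \<ge> j0\<close>] by simp
        qed
        also have "\<dots> \<le> c * \<eta> * N"
          using c eta unfolding c_def N_def by (intro mult_left_mono) auto
        also have "\<dots> = r / 2"
          using c N by (simp add: \<eta>_def)
        finally show ?thesis using r by simp
      qed
      then show "\<exists>no. \<forall>j\<ge>no. norm (frechet_derivative (w j) (at x) v - ?F' v) < r" by blast
    qed
    then show ?thesis unfolding grad_def by (intro tendsto_intros)
  qed
  \<comment> \<open>Taken as a pointwise limit to be measurable; at points of differentiability it
    is the tangential gradient.\<close>
  define g where "g x = lim (\<lambda>j. tangential n (w j) x)" for x
  have tl: "(\<lambda>j. tangential n (w j) x) \<longlonglongrightarrow> tangential n F x" if "F differentiable (at x)" for x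
    unfolding tangential_def by (intro tendsto_intros gl that)
  have g: "g x = tangential n F x" if "F differentiable (at x)" for x
    unfolding g_def using tl[OF that] by (rule limI)
  have gm: "g \<in> borel_measurable \<mu>"
    unfolding g_def[abs_def] by (rule borel_measurable_lim_metric) (rule tangential_measurable[OF w])
  have tb: "AE x in \<mu>. norm (tangential n (w j) x) \<le> 2 * (c * L)" for j
    using n_unit by eventually_elim (use gb norm_tangential_le in \<open>fastforce intro: order.trans\<close>)
  have "AE x in \<mu>. \<forall>j. norm (tangential n (w j) x) \<le> 2 * (c * L)"
    using tb by (simp add: AE_all_countable)
  then have gbd: "AE x in \<mu>. norm (g x) \<le> 2 * (c * L)"
    using diff
  proof eventually_elim
    case (elim x)
    then show ?case using Lim_bounded[OF tendsto_norm[OF tl]] g by simp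
  qed
  have sg: "square_integrable \<mu> g"
    by (rule square_integrable_bounded[OF gm gbd])
  have "(\<lambda>j. LINT x|\<mu>. (norm (tangential n (w j) x - g x))\<^sup>2) \<longlonglongrightarrow> (LINT x|\<mu>. 0)"
  proof (rule integral_dominated_convergence[where w = "\<lambda>x. (4 * (c * L))\<^sup>2"])
    show "(\<lambda>x. (norm (tangential n (w j) x - g x))\<^sup>2) \<in> borel_measurable \<mu>" for j
      using gm tangential_measurable[OF w] by simp
    show "AE x in \<mu>. (\<lambda>j. (norm (tangential n (w j) x - g x))\<^sup>2) \<longlonglongrightarrow> 0"
      using diff
    proof eventually_elim
      case (elim x)
      have "(\<lambda>j. (norm (tangential n (w j) x - g x))\<^sup>2) \<longlonglongrightarrow> (norm (tangential n F x - g x))\<^sup>2"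
        by (intro tendsto_intros tl elim)
      then show ?case using g[OF elim] by simp
    qed
    show "AE x in \<mu>. norm ((norm (tangential n (w j) x - g x))\<^sup>2) \<le> (4 * (c * L))\<^sup>2" for j
      using tb[of j] gbd
    proof eventually_elim
      case (elim x)
      then have "norm (tangential n (w j) x - g x) \<le> 4 * (c * L)"
        using norm_triangle_ineq4[of "tangential n (w j) x" "g x"] by linarith
      from power_mono[OF this norm_ge_zero, of 2] show ?case by simp
    qed
  qed simp_all
  moreover have "(\<lambda>j. LINT x|\<mu>. (w j x - F x)\<^sup>2) \<longlonglongrightarrow> 0"
  proof (rule Lim_null_comparison)
    have "(LINT x|\<mu>. (w j x - F x)\<^sup>2) \<le> (L * e j)\<^sup>2 * measure \<mu> (space \<mu>)" for j
    proof -
      have "(LINT x|\<mu>. (w j x - F x)\<^sup>2) \<le> (LINT x|\<mu>. (L * e j)\<^sup>2)"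
      proof (rule integral_mono)
        show "integrable \<mu> (\<lambda>x. (w j x - F x)\<^sup>2)"
          using square_integrable_continuous[of "\<lambda>x. w j x - F x"] smooth_on_imp_continuous_on[OF w] cF
          by (auto simp: square_integrable_def intro: continuous_on_diff)
        show "(w j x - F x)\<^sup>2 \<le> (L * e j)\<^sup>2" for x
          using mollify_approx[OF e lip, of j x] power_mono[of "\<bar>w j x - F x\<bar>" "L * e j" 2]
          by (simp add: w_def)
      qed simp
      then show ?thesis by (simp add: mult.commute)
    qed
    then show "\<forall>\<^sub>F j in sequentially. norm (LINT x|\<mu>. (w j x - F x)\<^sup>2) \<le> (L * e j)\<^sup>2 * measure \<mu> (space \<mu>)"
      by auto
    have "(\<lambda>j. (L * e j)\<^sup>2 * measure \<mu> (space \<mu>)) \<longlonglongrightarrow> (L * 0)\<^sup>2 * measure \<mu> (space \<mu>)"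
      by (intro tendsto_intros e0)
    then show "(\<lambda>j. (L * e j)\<^sup>2 * measure \<mu> (space \<mu>)) \<longlonglongrightarrow> 0" by simp
  qed
  ultimately have "weak_tgrad \<mu> n F g"
    unfolding weak_tgrad_def using sg square_integrable_continuous[OF cF] w by auto
  moreover have "AE x in \<mu>. g x = tangential n F x"
    using diff by eventually_elim (rule g)
  ultimately show ?thesis using that by blast
qed

end

section \<open>Gram determinants\<close>

lemma matrix_positive_definite_invertible:
  fixes B :: "real^'n^'n"
  assumes "\<And>x. x \<noteq> 0 \<Longrightarrow> 0 < x \<bullet> (B *v x)"
  shows "det B \<noteq> 0"
proof -
  have "x = 0" if "B *v x = 0" for x
    using assms[of x] that by (cases "x = 0") auto
  then have "\<exists>C. C ** B = mat 1"
    using matrix_left_invertible_ker[of B] by blast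
  then have "invertible B"
    using invertible_left_inverse by blast
  then show ?thesis using invertible_det_nz by blast
qed

lemma det_bound_entries:
  fixes A :: "real^'n^'n"
  assumes "\<And>i j. \<bar>A $ i $ j\<bar> \<le> M"
  shows "\<bar>det A\<bar> \<le> real (card {p. p permutes (UNIV :: 'n set)}) * M ^ CARD('n)"
proof -
  have "\<bar>det A\<bar> \<le> (\<Sum>p\<in>{p. p permutes (UNIV :: 'n set)}. \<bar>of_int (sign p) * (\<Prod>i\<in>UNIV. A $ i $ p i)\<bar>)"
    unfolding det_def by (rule sum_abs)
  also have "\<dots> \<le> (\<Sum>p\<in>{p. p permutes (UNIV :: 'n set)}. M ^ CARD('n))"
  proof (rule sum_mono)
    fix p
    have "\<bar>of_int (sign p) * (\<Prod>i\<in>UNIV. A $ i $ p i)\<bar> = (\<Prod>i\<in>UNIV. \<bar>A $ i $ p i\<bar>)"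
      by (simp add: abs_mult abs_prod sign_def)
    also have "\<dots> \<le> (\<Prod>i\<in>(UNIV :: 'n set). M)"
      by (rule prod_mono) (use assms in auto)
    finally show "\<bar>of_int (sign p) * (\<Prod>i\<in>UNIV. A $ i $ p i)\<bar> \<le> M ^ CARD('n)" by simp
  qed
  finally show ?thesis by simp
qed

text \<open>Along the segment from the identity to \<open>B\<close> every matrix has a positive
  definite quadratic form, hence a nonzero determinant, so the determinant keeps the sign it has at
  the identity.\<close>

lemma det_positive_definite_pos:
  fixes B :: "real^'n^'n"
  assumes "\<And>x. x \<noteq> 0 \<Longrightarrow> 0 < x \<bullet> (B *v x)"
  shows "0 < det B"
proof (rule ccontr)
  assume "\<not> 0 < det B"
  define M where "M t = (\<chi> i j. (1 - t) * (mat 1 :: real^'n^'n) $ i $ j + t * B $ i $ j)" for t :: real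
  have M: "M t *v x = (1 - t) *\<^sub>R x + t *\<^sub>R (B *v x)" for t x
  proof -
    have "M t = (1 - t) *\<^sub>R mat 1 + t *\<^sub>R B" by (simp add: M_def vec_eq_iff)
    then show ?thesis
      by (simp add: matrix_vector_mult_add_rdistrib scaleR_matrix_vector_assoc[symmetric])
  qed
  have pd: "0 < x \<bullet> (M t *v x)" if "0 \<le> t" "t \<le> 1" "x \<noteq> 0" for t x
  proof -
    have "0 < (1 - t) * (x \<bullet> x) + t * (x \<bullet> (B *v x))"
    proof (cases "t = 0")
      case False
      then have "0 < t * (x \<bullet> (B *v x))" using that assms[of x] by simp
      moreover have "0 \<le> (1 - t) * (x \<bullet> x)" using that by simp
      ultimately show ?thesis by linarith
    qed (use that in simp)
    then show ?thesis by (simp add: M inner_add_right)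
  qed
  have cont: "continuous_on {0..1} (\<lambda>t. det (M t))"
    unfolding det_def M_def by (simp add: continuous_intros)
  have M01: "M 0 = mat 1" "M 1 = B" by (simp_all add: M_def vec_eq_iff)
  have "\<exists>t\<ge>0. t \<le> 1 \<and> det (M t) = 0"
    using IVT2'[OF _ _ _ cont, of 0] M01 \<open>\<not> 0 < det B\<close> by auto
  then obtain t where "0 \<le> t" "t \<le> 1" "det (M t) = 0" by blast
  then show False
    using matrix_positive_definite_invertible[of "M t"] pd[of t] by blast
qed

text \<open>The matrix \<open>R = B\<^sup>-\<^sup>1 A\<close> is a contraction for the inner product of \<open>B\<close>, so the determinants of
  its powers stay bounded.\<close>

lemma det_mono_positive_definite:
  fixes A B :: "real^'n^'n"
  assumes sym: "\<And>x y. x \<bullet> (A *v y) = y \<bullet> (A *v x)"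
    and psd: "\<And>x. 0 \<le> x \<bullet> (A *v x)"
    and le: "\<And>x. x \<bullet> (A *v x) \<le> x \<bullet> (B *v x)"
    and pd: "\<And>x. x \<noteq> 0 \<Longrightarrow> 0 < x \<bullet> (B *v x)"
  shows "det A \<le> det B"
proof -
  have dB: "0 < det B" by (rule det_positive_definite_pos[OF pd])
  then obtain Bi where Bi: "B ** Bi = mat 1"
    using invertible_det_nz[of B] unfolding invertible_def by auto
  define R where "R = Bi ** A"
  have BR: "B ** R = A" by (simp add: R_def matrix_mul_assoc Bi)
  have step: "(R *v x) \<bullet> (B *v (R *v x)) \<le> x \<bullet> (B *v x)" for x
  proof -
    define y where "y = R *v x"
    have By: "B *v y = A *v x" by (simp add: y_def matrix_vector_mul_assoc BR)
    \<comment> \<open>In this square the cross term is \<open>y \<bullet> (B *v y)\<close>, because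
      \<open>B *v y = A *v x\<close>; bounding both forms of \<open>A\<close> by those of
      \<open>B\<close> leaves the contraction property.\<close>
    have "0 \<le> (x - y) \<bullet> (A *v (x - y))" by (rule psd)
    also have "\<dots> = x \<bullet> (A *v x) - 2 * (y \<bullet> (A *v x)) + y \<bullet> (A *v y)"
      using sym[of x y] by (simp add: matrix_vector_mult_diff_distrib inner_diff_left inner_diff_right)
    also have "\<dots> \<le> x \<bullet> (B *v x) - 2 * (y \<bullet> (B *v y)) + y \<bullet> (B *v y)"
      using le[of x] le[of y] By by simp
    finally show ?thesis by (simp add: y_def)
  qed
  define P where "P k = (((**) R) ^^ k) (mat 1)" for k
  have P: "P 0 = mat 1" "P (Suc k) = R ** P k" for k by (simp_all add: P_def)
  have detP: "det (P k) = det R ^ k" for k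
    by (induction k) (simp_all add: P det_mul)
  have q: "(P k *v x) \<bullet> (B *v (P k *v x)) \<le> x \<bullet> (B *v x)" for k x
  proof (induction k)
    case (Suc k)
    then show ?case
      using step[of "P k *v x"] by (simp add: P matrix_vector_mul_assoc[symmetric])
  qed (simp add: P)
  obtain c where c: "c > 0" "\<And>x. c * (norm x)\<^sup>2 \<le> x \<bullet> (B *v x)"
  proof -
    have "continuous_on (sphere 0 1) (\<lambda>x. x \<bullet> (B *v x))"
      by (intro continuous_intros linear_continuous_on matrix_vector_mul_bounded_linear)
    moreover have "sphere (0::real^'n) 1 \<noteq> {}" by simp
    ultimately obtain z where z: "z \<in> sphere 0 1" "\<And>x. x \<in> sphere 0 1 \<Longrightarrow> z \<bullet> (B *v z) \<le> x \<bullet> (B *v x)"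
      using continuous_attains_inf[OF compact_sphere] by blast
    have "(z \<bullet> (B *v z)) * (norm x)\<^sup>2 \<le> x \<bullet> (B *v x)" for x
    proof (cases "x = 0")
      case False
      have "z \<bullet> (B *v z) \<le> (x /\<^sub>R norm x) \<bullet> (B *v (x /\<^sub>R norm x))"
        using False by (intro z) simp
      also have "\<dots> = (x \<bullet> (B *v x)) / (norm x)\<^sup>2"
        by (simp add: matrix_vector_mult_scaleR power2_eq_square field_simps)
      finally show ?thesis using False by (simp add: field_simps)
    qed simp
    moreover have "0 < z \<bullet> (B *v z)" using z(1) by (intro pd) auto
    ultimately show ?thesis using that by blast
  qed
  define M where "M = (\<Sum>j\<in>(UNIV::'n set). sqrt ((axis j 1 \<bullet> (B *v axis j 1)) / c))"
  have ent: "\<bar>P k $ i $ j\<bar> \<le> M" for k i j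
  proof -
    have "P k $ i $ j = (P k *v axis j 1) $ i"
      by (simp add: matrix_vector_mult_basis column_def)
    then have "\<bar>P k $ i $ j\<bar> \<le> norm (P k *v axis j 1)"
      by (simp add: component_le_norm_cart)
    also have "\<dots> \<le> sqrt ((axis j 1 \<bullet> (B *v axis j 1)) / c)"
    proof (rule real_le_rsqrt)
      have "c * (norm (P k *v axis j 1))\<^sup>2 \<le> axis j 1 \<bullet> (B *v axis j 1)"
        using c(2) q order.trans by blast
      then show "(norm (P k *v axis j 1))\<^sup>2 \<le> (axis j 1 \<bullet> (B *v axis j 1)) / c"
        using c(1) by (simp add: field_simps)
    qed
    also have "\<dots> \<le> M"
      unfolding M_def
    proof (rule member_le_sum)
      show "0 \<le> sqrt ((axis x 1 \<bullet> (B *v axis x 1)) / c)" for x :: 'n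
        using pd[of "axis x 1"] c(1) by simp
    qed auto
    finally show ?thesis .
  qed
  define K where "K = real (card {p. p permutes (UNIV :: 'n set)}) * M ^ CARD('n)"
  have bd: "\<bar>det R\<bar> ^ k \<le> K" for k
    using det_bound_entries[of "P k" M, OF ent] by (simp add: K_def detP power_abs)
  have "\<bar>det R\<bar> \<le> 1"
  proof (rule ccontr)
    assume "\<not> \<bar>det R\<bar> \<le> 1"
    then obtain k where "K < \<bar>det R\<bar> ^ k" using real_arch_pow[of "\<bar>det R\<bar>" K] by auto
    then show False using bd[of k] by simp
  qed
  moreover have "det A = det B * det R" using BR det_mul[of B R] by simp
  ultimately show ?thesis using dB by (simp add: abs_le_iff)
qed

definition gram :: "(real^'n \<Rightarrow> real^'m) \<Rightarrow> real^'n^'n" where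
  "gram A = (\<chi> i j. A (axis i 1) \<bullet> A (axis j 1))"

lemma inner_gram:
  assumes "linear A"
  shows "x \<bullet> (gram A *v y) = A x \<bullet> A y"
proof -
  have rep: "A z = (\<Sum>i\<in>UNIV. z $ i *\<^sub>R A (axis i 1))" for z
  proof -
    have "A z = A (\<Sum>i\<in>UNIV. z $ i *\<^sub>R axis i 1)"
      by (simp add: basis_expansion[of z, unfolded scalar_mult_eq_scaleR])
    then show ?thesis by (simp only: linear_sum[OF assms] linear_cmul[OF assms])
  qed
  have comp: "(gram A *v y) $ i = A (axis i 1) \<bullet> A y" for i
    by (subst rep[of y]) (simp add: gram_def matrix_vector_mult_def inner_sum_right mult.commute)
  have "x \<bullet> (gram A *v y) = (\<Sum>i\<in>UNIV. x $ i * (A (axis i 1) \<bullet> A y))"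
    by (simp add: inner_vec_def comp)
  also have "\<dots> = (\<Sum>i\<in>UNIV. x $ i *\<^sub>R A (axis i 1)) \<bullet> A y"
    by (simp add: inner_sum_left)
  also have "\<dots> = A x \<bullet> A y"
    by (simp only: rep[of x, symmetric])
  finally show ?thesis .
qed

lemma det_gram_scaleR:
  fixes A :: "real^'n \<Rightarrow> real^'m"
  shows "det (gram (\<lambda>x. c *\<^sub>R A x)) = (c\<^sup>2) ^ CARD('n) * det (gram A)"
proof -
  have "gram (\<lambda>x. c *\<^sub>R A x) = (\<chi> i. c\<^sup>2 *s gram A $ i)"
    by (simp add: gram_def vec_eq_iff power2_eq_square)
  then show ?thesis using det_rows_mul[of "\<lambda>i. c\<^sup>2" "\<lambda>i. gram A $ i"] by simp
qed

lemma det_gram_mono: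
  fixes A B :: "real^'n \<Rightarrow> real^'m"
  assumes "linear A" "linear B" "inj B" "\<And>x. norm (A x) \<le> norm (B x)"
  shows "det (gram A) \<le> det (gram B)"
proof (rule det_mono_positive_definite)
  show "0 < x \<bullet> (gram B *v x)" if "x \<noteq> 0" for x
    using that linear_injective_0[OF assms(2)] assms(3) by (auto simp: inner_gram assms)
  show "x \<bullet> (gram A *v x) \<le> x \<bullet> (gram B *v x)" for x
    using power_mono[OF assms(4) norm_ge_zero, of x 2]
    by (simp add: inner_gram assms(1,2) power2_norm_eq_inner)
qed (auto simp: inner_gram assms(1) inner_commute)

lemma det_gram_pos:
  fixes A :: "real^'n \<Rightarrow> real^'m"
  assumes "linear A" "inj A"
  shows "0 < det (gram A)"
  by (rule det_positive_definite_pos)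
    (use assms linear_injective_0[of A] in \<open>auto simp: inner_gram\<close>)

text \<open>Scaling a map by \<open>c\<close> scales the root of its Gram determinant by
  \<open>c\<close> to the dimension. The length bounds say that \<open>B\<close> lies between two
  multiples of \<open>A\<close>, so \<open>det_gram_mono\<close> applies on both sides.\<close>

lemma sqrt_det_gram_bounds:
  fixes A B :: "real^'n \<Rightarrow> real^'m"
  assumes A: "linear A" "inj A" and B: "linear B" and c: "c > 0"
    and le: "\<And>x. c * norm (A x) \<le> norm (B x)" "\<And>x. norm (B x) \<le> C * norm (A x)"
  shows "c ^ CARD('n) * sqrt (det (gram A)) \<le> sqrt (det (gram B))"
    and "sqrt (det (gram B)) \<le> C ^ CARD('n) * sqrt (det (gram A))"
proof -
  have z: "A x = 0 \<Longrightarrow> x = 0" for x using A linear_injective_0 by blast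
  have injB: "inj B"
    unfolding linear_injective_0[OF B]
  proof (intro allI impI)
    fix x assume "B x = 0"
    then show "x = 0" using le(1)[of x] c z[of x] by (simp add: mult_le_0_iff)
  qed
  \<comment> \<open>Any nonzero vector serves to see that \<open>C\<close> is positive.\<close>
  define x0 :: "real^'n" where "x0 = axis undefined 1"
  have x0: "x0 \<noteq> 0" by (simp add: x0_def)
  have "0 < C * norm (A x0)"
    using le[of x0] c z x0 by (smt (verit) mult_pos_pos zero_less_norm_iff)
  then have C: "C > 0" by (simp add: zero_less_mult_iff)
  have sq: "sqrt ((t\<^sup>2) ^ CARD('n) * d) = t ^ CARD('n) * sqrt d" if "t > 0" for t d
    using that by (simp add: real_sqrt_mult real_sqrt_power)
  have "det (gram (\<lambda>x. c *\<^sub>R A x)) \<le> det (gram B)"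
    using le(1) c A B injB by (intro det_gram_mono) (auto intro: linear_compose_scale_right)
  then have "sqrt (det (gram (\<lambda>x. c *\<^sub>R A x))) \<le> sqrt (det (gram B))" by (rule real_sqrt_le_mono)
  then show "c ^ CARD('n) * sqrt (det (gram A)) \<le> sqrt (det (gram B))"
    by (simp only: det_gram_scaleR sq[OF c])
  have "inj (\<lambda>x. C *\<^sub>R A x)" using C A(2) by (simp add: inj_on_def)
  then have "det (gram B) \<le> det (gram (\<lambda>x. C *\<^sub>R A x))"
    using le(2) C A B by (intro det_gram_mono) (auto intro: linear_compose_scale_right)
  then have "sqrt (det (gram B)) \<le> sqrt (det (gram (\<lambda>x. C *\<^sub>R A x)))" by (rule real_sqrt_le_mono)
  then show "sqrt (det (gram B)) \<le> C ^ CARD('n) * sqrt (det (gram A))"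
    by (simp only: det_gram_scaleR sq[OF C])
qed

lemma area_density_eq:
  "area_density S f x = sqrt (det (gram (frechet_derivative f (at x within S))))"
  by (simp add: area_density_def gram_def)

text \<open>By dimension the range of \<open>A\<close> is the whole hyperplane orthogonal to
  \<open>N\<close>; so \<open>v\<close> lies in the range and is orthogonal to itself.\<close>

lemma orthogonal_to_hyperplane_eq_0:
  fixes A :: "real^'n \<Rightarrow> 'a::euclidean_space"
  assumes "linear A" "inj A" "DIM('a) = CARD('n) + 1"
    and N: "norm N = 1" "\<And>\<xi>. N \<bullet> A \<xi> = 0" and v: "v \<bullet> N = 0" "\<And>\<xi>. v \<bullet> A \<xi> = 0"
  shows "v = 0"
proof -
  have N0: "N \<noteq> 0" using N by auto
  have "dim (range A) = CARD('n)"
    using dim_image_eq[OF assms(1), of UNIV] assms(2) by simp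
  moreover have "dim {x. N \<bullet> x = 0} = CARD('n)"
    using dim_hyperplane[OF N0] assms(3) by simp
  moreover have "range A \<subseteq> {x. N \<bullet> x = 0}" using N by auto
  ultimately have "range A = {x. N \<bullet> x = 0}"
    by (intro subspace_dim_equal) (auto simp: subspace_hyperplane linear_subspace_image assms(1))
  then have "v \<in> range A" using v(1) by (simp add: inner_commute)
  then obtain \<xi> where "v = A \<xi>" by blast
  then have "v \<bullet> v = 0" using v(2)[of \<xi>] by simp
  then show ?thesis by simp
qed

section \<open>Gluing smooth functions and testing against boxes\<close>

lemma Ck_on_Un:
  assumes "open U" "open V" "Ck_on n f U" "Ck_on n f V"
  shows "Ck_on n f (U \<union> V)"
  using assms(3,4)
proof (induction n arbitrary: f)
  case 0
  then show ?case using assms by (auto intro: continuous_on_open_Un)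
next
  case (Suc n)
  then show ?case by auto
qed

text \<open>The positive and the negative part of \<open>h\<close> define two measures that agree on
  boxes, a generator of the Borel sets stable under intersection; equal measures have almost
  everywhere equal densities.\<close>

lemma box_integrals_zero_imp_AE_zero:
  fixes h :: "'a::euclidean_space \<Rightarrow> real"
  assumes h: "integrable lborel h"
    and z: "\<And>a b. (LINT x|lborel. indicator (box a b) x * h x) = 0"
  shows "AE x in lborel. h x = 0"
proof -
  have hm [measurable]: "h \<in> borel_measurable borel" using h by auto
  define P where "P x = max 0 (h x)" for x
  define Q where "Q x = max 0 (- h x)" for x
  have [measurable]: "P \<in> borel_measurable borel" "Q \<in> borel_measurable borel"
    unfolding P_def[abs_def] Q_def[abs_def] by measurable
  have iP: "integrable lborel P" and iQ: "integrable lborel Q"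
    unfolding P_def[abs_def] Q_def[abs_def] using h by (auto intro!: integrable_max)
  have hPQ: "h x = P x - Q x" for x by (simp add: P_def Q_def)
  have pos: "0 \<le> P x" "0 \<le> Q x" for x by (simp_all add: P_def Q_def)
  have em: "emeasure (density lborel (\<lambda>x. ennreal (f x))) (box a b) = ennreal (LINT x|lborel. indicator (box a b) x * f x)"
    if "integrable lborel f" "\<And>x. 0 \<le> f x" "f \<in> borel_measurable borel" for f a b
  proof -
    have i: "integrable lborel (\<lambda>x. indicator (box a b) x * f x)"
      using that(1) integrable_mult_indicator[of "box a b" lborel f] by simp
    have "emeasure (density lborel (\<lambda>x. ennreal (f x))) (box a b) = (\<integral>\<^sup>+x. ennreal (f x) * indicator (box a b) x \<partial>lborel)"
      using that(3) by (subst emeasure_density) auto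
    also have "\<dots> = (\<integral>\<^sup>+x. ennreal (indicator (box a b) x * f x) \<partial>lborel)"
      by (intro nn_integral_cong) (auto simp: indicator_def)
    also have "\<dots> = ennreal (LINT x|lborel. indicator (box a b) x * f x)"
      using i that(2) by (intro nn_integral_eq_integral) auto
    finally show ?thesis .
  qed
  have eqPQ: "(LINT x|lborel. indicator (box a b) x * P x) = (LINT x|lborel. indicator (box a b) x * Q x)" for a b
  proof -
    have "integrable lborel (\<lambda>x. indicator (box a b) x * P x)" "integrable lborel (\<lambda>x. indicator (box a b) x * Q x)"
      using integrable_mult_indicator[of "box a b" lborel P] integrable_mult_indicator[of "box a b" lborel Q] iP iQ by simp_all
    then have "(LINT x|lborel. indicator (box a b) x * P x) - (LINT x|lborel. indicator (box a b) x * Q x)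
      = (LINT x|lborel. indicator (box a b) x * P x - indicator (box a b) x * Q x)" by simp
    also have "\<dots> = (LINT x|lborel. indicator (box a b) x * h x)"
      by (simp add: hPQ right_diff_distrib)
    finally show ?thesis using z[of a b] by simp
  qed
  let ?E = "range (\<lambda>(a, b). box a b :: 'a set)"
  have eq: "density lborel (\<lambda>x. ennreal (P x)) = density lborel (\<lambda>x. ennreal (Q x))"
  proof (rule measure_eqI_generator_eq)
    show "Int_stable ?E" by (auto simp: Int_stable_def box_Int_box)
    show "?E \<subseteq> Pow UNIV" by simp
    show "sets (density lborel (\<lambda>x. ennreal (P x))) = sigma_sets UNIV ?E"
      "sets (density lborel (\<lambda>x. ennreal (Q x))) = sigma_sets UNIV ?E"
      by (simp_all add: borel_eq_box)
    let ?A = "\<lambda>k::nat. box (- (real k *\<^sub>R One)) (real k *\<^sub>R One) :: 'a set"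
    show "range ?A \<subseteq> ?E" "(\<Union>k. ?A k) = UNIV"
      unfolding UN_box_eq_UNIV by auto
    show "emeasure (density lborel (\<lambda>x. ennreal (P x))) (?A k) \<noteq> \<infinity>" for k
      using em[OF iP pos(1)] by simp
    fix X assume "X \<in> ?E"
    then show "emeasure (density lborel (\<lambda>x. ennreal (P x))) X = emeasure (density lborel (\<lambda>x. ennreal (Q x))) X"
      using em[OF iP pos(1)] em[OF iQ pos(2)] eqPQ by auto
  qed
  have "AE x in lborel. ennreal (P x) = ennreal (Q x)"
    by (rule sigma_finite_measure.density_unique[OF sigma_finite_lborel _ _ eq]) auto
  then show ?thesis
    by eventually_elim (use pos in \<open>simp add: hPQ\<close>)
qed

section \<open>Uniqueness of the weak tangential gradient\<close>

text \<open>Positive exactly on the open box but not constant there; the powers taken in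
  \<open>weak_derivative_zero\<close> repair this.\<close>

definition box_bump :: "'a::euclidean_space \<Rightarrow> 'a \<Rightarrow> 'a \<Rightarrow> real" where
  "box_bump a b x = (\<Prod>i\<in>Basis. exp_bump 0 (x \<bullet> i - a \<bullet> i) * exp_bump 0 (b \<bullet> i - x \<bullet> i))"

lemma exp_bump_0_bounds: "0 \<le> exp_bump 0 t" "exp_bump 0 t \<le> 1"
  by (auto simp: exp_bump_def)

lemma smooth_on_box_bump: "smooth_on (box_bump a b) UNIV"
proof -
  have i: "smooth_on (\<lambda>x. x \<bullet> i) UNIV" for i :: 'a
    by (rule smooth_on_bounded_linear[OF bounded_linear_inner_left open_UNIV])
  have "smooth_on (\<lambda>x. exp_bump 0 (x \<bullet> i - a \<bullet> i) * exp_bump 0 (b \<bullet> i - x \<bullet> i)) UNIV" for i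
    by (intro smooth_on_mult[OF open_UNIV] smooth_on_compose[OF open_UNIV subset_UNIV _ smooth_on_exp_bump]
        smooth_on_diff[OF open_UNIV] i smooth_on_const[OF open_UNIV])
  then show ?thesis
    unfolding box_bump_def[abs_def] by (intro smooth_on_prod[OF open_UNIV])
qed

lemma box_bump_bounds: "0 \<le> box_bump a b x" "box_bump a b x \<le> 1"
  unfolding box_bump_def using exp_bump_0_bounds
  by (auto intro!: prod_nonneg prod_le_1 mult_le_one)

lemma box_bump_pos: "x \<in> box a b \<Longrightarrow> 0 < box_bump a b x"
  unfolding box_bump_def by (rule prod_pos) (auto simp: exp_bump_def mem_box)

lemma box_bump_eq_0:
  assumes "x \<notin> box a b"
  shows "box_bump a b x = 0"
proof -
  obtain i where "i \<in> Basis" "\<not> (a \<bullet> i < x \<bullet> i \<and> x \<bullet> i < b \<bullet> i)"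
    using assms by (auto simp: mem_box)
  then show ?thesis
    unfolding box_bump_def by (intro prod_zero) (auto simp: exp_bump_def)
qed

text \<open>Closability of the derivative. The cutoffs \<open>1 - (1 - q)\<^sup>N\<close> increase to the indicator of a box.\<close>

lemma weak_derivative_zero:
  fixes f :: "nat \<Rightarrow> 'a::euclidean_space \<Rightarrow> real"
  assumes U: "open U" "cbox a b \<subseteq> U" and f: "\<And>j. smooth_on (f j) U"
    and h: "integrable lborel (\<lambda>x. indicator (cbox a b) x * h x)"
    and l1: "(\<lambda>j. LINT x|lborel. indicator (cbox a b) x * \<bar>f j x\<bar>) \<longlonglongrightarrow> 0"
    and l2: "(\<lambda>j. LINT x|lborel. indicator (cbox a b) x * \<bar>frechet_derivative (f j) (at x) v - h x\<bar>) \<longlonglongrightarrow> 0"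
  shows "AE x in lborel. x \<in> box a b \<longrightarrow> h x = 0"
proof -
  let ?I = "\<lambda>x. indicator (cbox a b) x :: real"
  let ?f' = "\<lambda>j x. frechet_derivative (f j) (at x) v"
  have hm: "(\<lambda>x. ?I x * h x) \<in> borel_measurable lborel"
    by (rule borel_measurable_integrable[OF h])
  have cont_int: "integrable lborel (\<lambda>x. ?I x * g x)" if "continuous_on (cbox a b) g" for g
    using borel_integrable_compact[OF compact_cbox that] by simp
  have cf: "continuous_on (cbox a b) (f j)" for j
    using continuous_on_subset[OF smooth_on_imp_continuous_on[OF f] U(2)] .
  have cf': "continuous_on (cbox a b) (?f' j)" for j
    using continuous_on_subset[OF smooth_on_imp_continuous_on[OF smooth_on_frechet_derivative[OF f]] U(2)] .
  have zero: "(LINT x|lborel. indicator (box p q) x * h x) = 0" if pq: "box p q \<subseteq> box a b" for p q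
  proof (cases "box p q = {}")
    case False
    have sub: "cbox p q \<subseteq> cbox a b"
    proof -
      have ne: "box a b \<noteq> {}" using pq False by auto
      show ?thesis
        using closure_mono[OF pq] unfolding closure_box[OF False] closure_box[OF ne] .
    qed
    define \<phi> where "\<phi> N x = 1 - (1 - box_bump p q x) ^ N" for N :: nat and x
    have s\<phi>: "smooth_on (\<phi> N) UNIV" for N
      unfolding \<phi>_def[abs_def]
      by (intro smooth_on_diff[OF open_UNIV] smooth_on_const[OF open_UNIV] smooth_on_power[OF open_UNIV] smooth_on_box_bump)
    have b\<phi>: "0 \<le> \<phi> N x" "\<phi> N x \<le> 1" for N x
      using box_bump_bounds[of p q x] by (auto simp: \<phi>_def power_le_one)
    have z\<phi>: "\<phi> N x = 0" if "x \<notin> cbox p q" for N x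
    proof -
      have "x \<notin> box p q" using that box_subset_cbox[of p q] by blast
      then show ?thesis by (simp add: \<phi>_def box_bump_eq_0)
    qed
    have c\<phi>: "continuous_on A (\<phi> N)" for A N
      by (rule continuous_on_subset[OF smooth_on_imp_continuous_on[OF s\<phi>] subset_UNIV])
    have cf\<phi>': "continuous_on A (\<lambda>x. frechet_derivative (\<phi> N) (at x) v)" for A N
      by (rule continuous_on_subset[OF smooth_on_imp_continuous_on[OF smooth_on_frechet_derivative[OF s\<phi>]] subset_UNIV])
    have N: "(LINT x|lborel. ?I x * (h x * \<phi> N x)) = 0" for N
    proof -
      let ?\<phi>' = "\<lambda>x. frechet_derivative (\<phi> N) (at x) v"
      obtain B where B: "\<And>x. x \<in> cbox a b \<Longrightarrow> \<bar>?\<phi>' x\<bar> \<le> B"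
        using compact_imp_bounded[OF compact_continuous_image[OF cf\<phi>' compact_cbox]]
        unfolding bounded_iff by fastforce
      have hphi: "integrable lborel (\<lambda>x. ?I x * (h x * \<phi> N x))"
      proof (rule Bochner_Integration.integrable_bound[OF h])
        have "(\<lambda>x. (?I x * h x) * \<phi> N x) \<in> borel_measurable lborel"
          by (rule borel_measurable_times[OF hm]) (use borel_measurable_continuous_onI[OF c\<phi>[of UNIV N]] in simp)
        then show "(\<lambda>x. ?I x * (h x * \<phi> N x)) \<in> borel_measurable lborel" by (simp add: mult.assoc)
        show "AE x in lborel. norm (?I x * (h x * \<phi> N x)) \<le> norm (?I x * h x)"
          using b\<phi>[of N] by (intro AE_I2) (auto simp: abs_mult indicator_def mult_left_le)
      qed
      have main: "(LINT x|lborel. ?I x * (?f' j x * \<phi> N x)) + (LINT x|lborel. ?I x * (f j x * ?\<phi>' x)) = 0" for j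
      proof -
        \<comment> \<open>Extension by zero is smooth: \<open>U\<close> and the complement of the
          smaller closed box are open, cover the space, and the two descriptions of \<open>G\<close>
          agree where they meet.\<close>
        define G where "G x = (if x \<in> U then f j x * \<phi> N x else 0)" for x
        have oc: "open (- cbox p q)" by (simp add: open_Compl closed_cbox)
        have s1: "smooth_on G U"
          by (rule smooth_on_cong[OF U(1) _ smooth_on_mult[OF U(1) f smooth_on_subset[OF s\<phi> subset_UNIV]]])
            (simp add: G_def)
        have s2: "smooth_on G (- cbox p q)"
          by (rule smooth_on_cong[OF oc _ smooth_on_const[OF oc, of 0]]) (auto simp: G_def z\<phi>)
        have UU: "U \<union> - cbox p q = UNIV" using sub U(2) by auto
        have sG: "smooth_on G UNIV"
          using s1 s2 Ck_on_Un[OF U(1) oc] unfolding smooth_on_def UU by blast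
        obtain R where R: "\<forall>x\<in>cbox p q. norm x \<le> R"
          using bounded_cbox[of p q] unfolding bounded_iff by (rule exE)
        have G0: "G x = 0" if "norm x > R" for x
          using R that z\<phi>[of x N] by (cases "x \<in> cbox p q") (auto simp: G_def)
        obtain L where L: "L-lipschitz_on UNIV G"
          using smooth_compact_support_lipschitz[OF sG G0] by blast
        have "(LINT x|lborel. frechet_derivative G (at x) v) = 0"
          by (rule integral_frechet_derivative_eq_0(2)[OF L G0 smooth_on_has_derivative[OF sG UNIV_I]])
        moreover have "frechet_derivative G (at x) v = ?I x * (?f' j x * \<phi> N x) + ?I x * (f j x * ?\<phi>' x)" for x
        proof (cases "x \<in> cbox a b")
          case True
          then have xU: "x \<in> U" using U(2) by blast
          have "((\<lambda>x. f j x * \<phi> N x) has_derivative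
              (\<lambda>v. f j x * frechet_derivative (\<phi> N) (at x) v + frechet_derivative (f j) (at x) v * \<phi> N x)) (at x)"
            by (rule has_derivative_mult[OF smooth_on_has_derivative[OF f xU] smooth_on_has_derivative[OF s\<phi> UNIV_I]])
          then have "(G has_derivative
              (\<lambda>v. f j x * frechet_derivative (\<phi> N) (at x) v + frechet_derivative (f j) (at x) v * \<phi> N x)) (at x)"
            by (rule has_derivative_transform_within_open[OF _ U(1) xU]) (simp add: G_def)
          from fun_cong[OF frechet_derivative_at[OF this], of v] show ?thesis using True by simp
        next
          case False
          then have xc: "x \<in> - cbox p q" using sub by auto
          have "(G has_derivative (\<lambda>v. 0)) (at x)"
            by (rule has_derivative_transform_within_open[OF has_derivative_const[of 0] oc xc]) (auto simp: G_def z\<phi>)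
          from fun_cong[OF frechet_derivative_at[OF this], of v] show ?thesis using False by simp
        qed
        ultimately show ?thesis
          using cont_int[OF continuous_on_mult[OF cf' c\<phi>], of j N] cont_int[OF continuous_on_mult[OF cf cf\<phi>'], of j N] by simp
      qed
      \<comment> \<open>Integration by parts allows two terms with vanishing sum of integrals to be
        subtracted. What remains are the differences \<open>h - f'\<close> and the functions
        \<open>f\<close>, both small in L1; the cutoff is fixed here, so its derivative bound
        \<open>B\<close> does no harm.\<close>
      have bound: "norm (LINT x|lborel. ?I x * (h x * \<phi> N x)) \<le>
        (LINT x|lborel. ?I x * \<bar>?f' j x - h x\<bar>) + \<bar>B\<bar> * (LINT x|lborel. ?I x * \<bar>f j x\<bar>)" for j
      proof -
        have i1: "integrable lborel (\<lambda>x. ?I x * (?f' j x * \<phi> N x))"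
          by (intro cont_int continuous_on_mult cf' c\<phi>)
        have i2: "integrable lborel (\<lambda>x. ?I x * (f j x * ?\<phi>' x))"
          by (intro cont_int continuous_on_mult cf cf\<phi>')
        have i3: "integrable lborel (\<lambda>x. ?I x * \<bar>?f' j x - h x\<bar>)"
        proof -
          have "integrable lborel (\<lambda>x. \<bar>?I x * ?f' j x - ?I x * h x\<bar>)"
            using cont_int[OF cf'[of j]] h by (intro integrable_abs Bochner_Integration.integrable_diff)
          then show ?thesis by (simp add: right_diff_distrib[symmetric] abs_mult)
        qed
        have i4: "integrable lborel (\<lambda>x. ?I x * \<bar>f j x\<bar>)"
          by (intro cont_int continuous_on_rabs cf)
        have split: "(LINT x|lborel. ?I x * (h x * \<phi> N x)) =
          (LINT x|lborel. ?I x * (h x * \<phi> N x) - ?I x * (?f' j x * \<phi> N x) - ?I x * (f j x * ?\<phi>' x))"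
          using main[of j] hphi i1 i2 by simp
        have "norm (LINT x|lborel. ?I x * (h x * \<phi> N x) - ?I x * (?f' j x * \<phi> N x) - ?I x * (f j x * ?\<phi>' x)) \<le> (LINT x|lborel. ?I x * \<bar>?f' j x - h x\<bar> + \<bar>B\<bar> * (?I x * \<bar>f j x\<bar>))"
          unfolding real_norm_def
        proof (rule order.trans[OF integral_abs_bound], rule integral_mono)
          show "integrable lborel (\<lambda>x. \<bar>?I x * (h x * \<phi> N x) - ?I x * (?f' j x * \<phi> N x) - ?I x * (f j x * ?\<phi>' x)\<bar>)"
            by (intro integrable_abs Bochner_Integration.integrable_diff hphi i1 i2)
          show "integrable lborel (\<lambda>x. ?I x * \<bar>?f' j x - h x\<bar> + \<bar>B\<bar> * (?I x * \<bar>f j x\<bar>))"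
            by (intro Bochner_Integration.integrable_add integrable_mult_right i3 i4)
          show "\<bar>?I x * (h x * \<phi> N x) - ?I x * (?f' j x * \<phi> N x) - ?I x * (f j x * ?\<phi>' x)\<bar>
              \<le> ?I x * \<bar>?f' j x - h x\<bar> + \<bar>B\<bar> * (?I x * \<bar>f j x\<bar>)" for x
          proof (cases "x \<in> cbox a b")
            case True
            have "\<bar>(h x - ?f' j x) * \<phi> N x\<bar> \<le> \<bar>?f' j x - h x\<bar>"
              using b\<phi>[of N x] by (simp add: abs_mult abs_minus_commute mult_left_le)
            moreover have "\<bar>f j x * ?\<phi>' x\<bar> \<le> \<bar>B\<bar> * \<bar>f j x\<bar>"
              using mult_right_mono[of "\<bar>?\<phi>' x\<bar>" "\<bar>B\<bar>" "\<bar>f j x\<bar>"] B[OF True] by (simp add: abs_mult mult.commute)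
            moreover have "h x * \<phi> N x - ?f' j x * \<phi> N x - f j x * ?\<phi>' x = (h x - ?f' j x) * \<phi> N x - f j x * ?\<phi>' x"
              by (simp add: algebra_simps)
            ultimately show ?thesis using True by simp
          qed simp
        qed
        also have "\<dots> = (LINT x|lborel. ?I x * \<bar>?f' j x - h x\<bar>) + \<bar>B\<bar> * (LINT x|lborel. ?I x * \<bar>f j x\<bar>)"
          using i3 i4 by simp
        finally show ?thesis unfolding split .
      qed
      have lim: "(\<lambda>j. (LINT x|lborel. ?I x * \<bar>?f' j x - h x\<bar>) + \<bar>B\<bar> * (LINT x|lborel. ?I x * \<bar>f j x\<bar>)) \<longlonglongrightarrow> 0 + \<bar>B\<bar> * 0"
        by (intro tendsto_intros l1 l2)
      have "norm (LINT x|lborel. ?I x * (h x * \<phi> N x)) \<le> 0 + \<bar>B\<bar> * 0"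
        by (rule LIMSEQ_le_const[OF lim]) (rule exI, rule allI, rule impI, rule bound)
      then show ?thesis by simp
    qed
    have "(\<lambda>N. LINT x|lborel. ?I x * (h x * \<phi> N x)) \<longlonglongrightarrow> (LINT x|lborel. indicator (box p q) x * h x)"
    proof (rule integral_dominated_convergence[where w = "\<lambda>x. norm (?I x * h x)"])
      have e: "indicator (box p q) x * h x = indicator (box p q) x * (?I x * h x)" for x
        using pq box_subset_cbox[of a b] by (auto simp: indicator_def)
      show "(\<lambda>x. indicator (box p q) x * h x) \<in> borel_measurable lborel"
        unfolding e by (rule borel_measurable_times[OF _ hm]) simp
      show "(\<lambda>x. ?I x * (h x * \<phi> N x)) \<in> borel_measurable lborel" for N
      proof -
        have "(\<lambda>x. (?I x * h x) * \<phi> N x) \<in> borel_measurable lborel"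
          by (rule borel_measurable_times[OF hm]) (use borel_measurable_continuous_onI[OF c\<phi>[of UNIV N]] in simp)
        then show ?thesis by (simp add: mult.assoc)
      qed
      show "integrable lborel (\<lambda>x. norm (?I x * h x))" using h by (rule integrable_norm)
      show "AE x in lborel. (\<lambda>N. ?I x * (h x * \<phi> N x)) \<longlonglongrightarrow> indicator (box p q) x * h x"
      proof (rule AE_I2)
        fix x
        have "(\<lambda>N. \<phi> N x) \<longlonglongrightarrow> indicator (box p q) x"
        proof (cases "x \<in> box p q")
          case True
          have "(\<lambda>N. (1 - box_bump p q x) ^ N) \<longlonglongrightarrow> 0"
            using box_bump_pos[OF True] box_bump_bounds[of p q x] by (intro LIMSEQ_power_zero) auto
          from tendsto_diff[OF tendsto_const[of 1] this] show ?thesis using True by (simp add: \<phi>_def)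
        qed (simp add: \<phi>_def box_bump_eq_0)
        then have "(\<lambda>N. ?I x * (h x * \<phi> N x)) \<longlonglongrightarrow> ?I x * (h x * indicator (box p q) x)"
          by (intro tendsto_intros)
        moreover have "?I x * (h x * indicator (box p q) x) = indicator (box p q) x * h x"
          using e[of x] by (simp add: mult_ac)
        ultimately show "(\<lambda>N. ?I x * (h x * \<phi> N x)) \<longlonglongrightarrow> indicator (box p q) x * h x" by simp
      qed
      show "AE x in lborel. norm (?I x * (h x * \<phi> N x)) \<le> norm (?I x * h x)" for N
        using b\<phi>[of N] by (intro AE_I2) (auto simp: abs_mult indicator_def mult_left_le)
    qed
    then show ?thesis by (simp add: N LIMSEQ_const_iff)
  qed simp
  have hb: "integrable lborel (\<lambda>x. indicator (box a b) x * h x)"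
  proof -
    have "integrable lborel (\<lambda>x. indicator (box a b) x *\<^sub>R (?I x * h x))"
      by (rule integrable_mult_indicator[OF _ h]) simp
    moreover have "indicator (box a b) x *\<^sub>R (?I x * h x) = indicator (box a b) x * h x" for x
      using box_subset_cbox[of a b] by (auto simp: indicator_def)
    ultimately show ?thesis by (simp only:)
  qed
  have "AE x in lborel. indicator (box a b) x * h x = 0"
  proof (rule box_integrals_zero_imp_AE_zero[OF hb])
    fix c d
    \<comment> \<open>Intersecting a test box with \<open>box a b\<close> gives again a box, now
      inside \<open>box a b\<close>, where \<open>zero\<close> applies.\<close>
    obtain p q where pq: "box c d \<inter> box a b = box p q" by (auto simp: box_Int_box)
    have e: "indicator (box c d) x * (indicator (box a b) x * h x) = indicator (box p q) x * h x" for x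
      unfolding pq[symmetric] by (simp add: indicator_inter_arith mult.assoc)
    have "box p q \<subseteq> box a b" using pq by blast
    from zero[OF this] show "(LINT x|lborel. indicator (box c d) x * (indicator (box a b) x * h x)) = 0"
      unfolding e .
  qed
  then show ?thesis by eventually_elim (auto simp: indicator_def)
qed

text \<open>Tangential gradients of smooth functions are orthogonal to \<open>n\<close>, so the
  normal component of \<open>g\<close> is bounded by its distance to them, which tends to
  zero.\<close>

lemma (in surface_space) weak_tgrad_normal:
  assumes "weak_tgrad \<mu> n v g"
  shows "AE x in \<mu>. n x \<bullet> g x = 0"
proof -
  obtain w where w: "\<And>j. smooth_on (w j) UNIV"
    "(\<lambda>j. LINT x|\<mu>. (norm (w j x - v x))\<^sup>2) \<longlonglongrightarrow> 0"
    "(\<lambda>j. LINT x|\<mu>. (norm (tangential n (w j) x - g x))\<^sup>2) \<longlonglongrightarrow> 0"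
    by (rule weak_tgradE[OF assms]) (rule that)
  have sg: "square_integrable \<mu> g" by (rule weak_tgradD(2)[OF assms])
  note m [measurable] = n_measurable square_integrable_measurable[OF sg]
  have mm: "(\<lambda>x. (n x \<bullet> g x)\<^sup>2) \<in> borel_measurable \<mu>" by measurable
  have i0: "integrable \<mu> (\<lambda>x. (n x \<bullet> g x)\<^sup>2)"
  proof (rule Bochner_Integration.integrable_bound)
    show "integrable \<mu> (\<lambda>x. (norm (g x))\<^sup>2)" using sg by (simp add: square_integrable_def)
    show "AE x in \<mu>. norm ((n x \<bullet> g x)\<^sup>2) \<le> norm ((norm (g x))\<^sup>2)"
      using n_unit
    proof eventually_elim
      case (elim x)
      have "\<bar>n x \<bullet> g x\<bar> \<le> norm (g x)" using Cauchy_Schwarz_ineq2[of "n x" "g x"] elim by simp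
      then show ?case using power_mono[of "\<bar>n x \<bullet> g x\<bar>" "norm (g x)" 2] by simp
    qed
  qed (rule mm)
  have "(LINT x|\<mu>. (n x \<bullet> g x)\<^sup>2) \<le> (LINT x|\<mu>. (norm (tangential n (w j) x - g x))\<^sup>2)" for j
  proof (rule integral_mono_AE[OF i0])
    show "integrable \<mu> (\<lambda>x. (norm (tangential n (w j) x - g x))\<^sup>2)"
      using square_integrable_diff[OF square_integrable_tangential[OF w(1)] sg] by (simp add: square_integrable_def)
    show "AE x in \<mu>. (n x \<bullet> g x)\<^sup>2 \<le> (norm (tangential n (w j) x - g x))\<^sup>2"
      using n_unit
    proof eventually_elim
      case (elim x)
      have nn: "n x \<bullet> n x = 1" using elim by (simp add: dot_square_norm)
      have "n x \<bullet> tangential n (w j) x = 0"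
        by (simp add: tangential_def inner_diff_right nn)
      then have "\<bar>n x \<bullet> g x\<bar> = \<bar>n x \<bullet> (tangential n (w j) x - g x)\<bar>"
        by (simp add: inner_diff_right)
      also have "\<dots> \<le> norm (tangential n (w j) x - g x)"
        using Cauchy_Schwarz_ineq2[of "n x" "tangential n (w j) x - g x"] elim by simp
      finally show ?case using power_mono[of "\<bar>n x \<bullet> g x\<bar>" "norm (tangential n (w j) x - g x)" 2] by simp
    qed
  qed
  then have "(LINT x|\<mu>. (n x \<bullet> g x)\<^sup>2) \<le> 0"
    using LIMSEQ_le_const[OF w(3)] by blast
  then have "(LINT x|\<mu>. (n x \<bullet> g x)\<^sup>2) = 0" by (simp add: order.antisym)
  then have "AE x in \<mu>. (n x \<bullet> g x)\<^sup>2 = 0"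
    using integral_nonneg_eq_0_iff_AE[OF i0] by simp
  then show ?thesis by eventually_elim simp
qed

text \<open>The difference of two gradients is a weak gradient of the zero function. Read in the
  chart, its components along the coordinate directions are L1 limits of derivatives of functions
  tending to zero, so they vanish by closability; the normal component vanishes by
  \<open>weak_tgrad_normal\<close>, and together they exhaust the space. The inequality
  \<open>int\<close> carries smallness from \<open>\<mu>\<close> to the parameter domain.\<close>

lemma (in surface_space) weak_tgrad_unique_patch:
  fixes F :: "real^'n \<Rightarrow> 'a" and J :: "real^'n \<Rightarrow> real"
  assumes dim: "DIM('a) = CARD('n) + 1" and K: "open K" and F: "smooth_on F K" and FX: "F ` K \<subseteq> X"
    and inj: "\<And>s. s \<in> K \<Longrightarrow> inj (frechet_derivative F (at s))"
    and N: "\<And>s \<xi>. s \<in> K \<Longrightarrow> n (F s) \<bullet> frechet_derivative F (at s) \<xi> = 0"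
    and nN: "\<And>s. s \<in> K \<Longrightarrow> norm (n (F s)) = 1"
    and J: "continuous_on K J" "\<And>s. s \<in> K \<Longrightarrow> 0 < J s"
    and int: "\<And>f::'a \<Rightarrow> ennreal. f \<in> borel_measurable \<mu> \<Longrightarrow>
      (\<integral>\<^sup>+s. indicator K s * f (F s) * ennreal (J s) \<partial>lborel) \<le> (\<integral>\<^sup>+x. f x \<partial>\<mu>)"
    and g: "weak_tgrad \<mu> n v g" "weak_tgrad \<mu> n v g'"
  shows "AE s in lborel. s \<in> K \<longrightarrow> g (F s) = g' (F s)"
proof -
  define \<delta> where "\<delta> x = g x - g' x" for x
  have wt: "weak_tgrad \<mu> n (\<lambda>x. 0) \<delta>"
    using weak_tgrad_linear_combination[OF g, of 1 "-1"] by (simp add: \<delta>_def[abs_def])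
  obtain w where w: "\<And>j. smooth_on (w j) UNIV"
    "(\<lambda>j. LINT x|\<mu>. (norm (w j x - 0))\<^sup>2) \<longlonglongrightarrow> 0"
    "(\<lambda>j. LINT x|\<mu>. (norm (tangential n (w j) x - \<delta> x))\<^sup>2) \<longlonglongrightarrow> 0"
    by (rule weak_tgradE[OF wt]) (rule that)
  have s\<delta>: "square_integrable \<mu> \<delta>" by (rule weak_tgradD(2)[OF wt])
  have [measurable]: "K \<in> sets borel" using K by simp
  have cF: "continuous_on K F" using smooth_on_imp_continuous_on[OF F] .
  have mF: "F \<in> measurable (restrict_space borel K) \<mu>"
    unfolding measurable_cong_sets[OF refl sets_\<mu>]
    by (rule measurable_restrict_space2)
      (use FX in \<open>auto simp: space_restrict_space intro!: borel_measurable_continuous_on_restrict cF\<close>)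
  have meas: "(\<lambda>s. indicator K s *\<^sub>R f (F s)) \<in> borel_measurable borel"
    if "f \<in> borel_measurable \<mu>" for f :: "'a \<Rightarrow> 'c::{real_normed_vector, second_countable_topology}"
    using measurable_compose[OF mF that] borel_measurable_restrict_space_iff[of K borel "\<lambda>s. f (F s)"] by simp
  have mJ: "(\<lambda>s. indicator K s *\<^sub>R J s) \<in> borel_measurable borel"
    using borel_measurable_continuous_on_restrict[OF J(1)] borel_measurable_restrict_space_iff[of K borel J] by simp
  \<comment> \<open>Null sets of \<open>\<mu>\<close> pull back to null sets because the area
    density \<open>J\<close> is positive on \<open>K\<close>.\<close>
  have AEtr: "AE s in lborel. s \<in> K \<longrightarrow> P (F s)" if P: "AE x in \<mu>. P x" for P
  proof -
    obtain A where A: "{x \<in> space \<mu>. \<not> P x} \<subseteq> A" "emeasure \<mu> A = 0" "A \<in> sets \<mu>"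
      by (rule AE_E[OF P]) (rule that)
    have "(\<integral>\<^sup>+s. indicator K s * indicator A (F s) * ennreal (J s) \<partial>lborel) \<le> (\<integral>\<^sup>+x. indicator A x \<partial>\<mu>)"
      using A(3) by (intro int) auto
    then have z: "(\<integral>\<^sup>+s. indicator K s * indicator A (F s) * ennreal (J s) \<partial>lborel) = 0"
      using A(2,3) by simp
    have m1: "(\<lambda>s. indicator K s *\<^sub>R (indicator A (F s) :: real)) \<in> borel_measurable borel"
      by (rule meas) (use A(3) in auto)
    have "(\<lambda>s. ennreal ((indicator K s *\<^sub>R (indicator A (F s) :: real)) * (indicator K s *\<^sub>R J s))) \<in> borel_measurable borel"
      using m1 mJ by measurable
    moreover have "(\<lambda>s. ennreal ((indicator K s *\<^sub>R (indicator A (F s) :: real)) * (indicator K s *\<^sub>R J s)))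
        = (\<lambda>s. indicator K s * indicator A (F s) * ennreal (J s))"
      by (auto simp: fun_eq_iff indicator_def)
    ultimately have "AE s in lborel. indicator K s * indicator A (F s) * ennreal (J s) = 0"
      using z by (subst (asm) nn_integral_0_iff_AE) simp_all
    then show ?thesis
    proof eventually_elim
      case (elim s)
      show ?case
      proof (intro impI)
        assume s: "s \<in> K"
        then have "F s \<notin> A" using elim J(2)[OF s] by (auto simp: indicator_def ennreal_eq_0_iff split: if_splits)
        moreover have "F s \<in> space \<mu>" using FX s space_\<mu> by auto
        ultimately show "P (F s)" using A(1) by blast
      qed
    qed
  qed
  have nd: "AE x in \<mu>. n x \<bullet> \<delta> x = 0"
    by (rule weak_tgrad_normal[OF wt])
  \<comment> \<open>On a finite measure space convergence in L2 implies convergence in L1, the mode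
    that \<open>weak_derivative_zero\<close> asks for.\<close>
  have L1: "integrable \<mu> (\<lambda>x. norm (f x)) \<and>
      (LINT x|\<mu>. norm (f x)) \<le> sqrt (LINT x|\<mu>. (norm (f x))\<^sup>2) * sqrt (measure \<mu> (space \<mu>))"
    if "square_integrable \<mu> f" for f :: "'a \<Rightarrow> 'c::euclidean_space"
  proof -
    have s: "square_integrable \<mu> (\<lambda>x. norm (f x))"
      using that unfolding square_integrable_def by (auto intro: borel_measurable_norm)
    have s1: "square_integrable \<mu> (\<lambda>x. 1::real)" by (simp add: square_integrable_def)
    show ?thesis
      using square_integrable_inner[OF s s1] integral_inner_Cauchy_Schwarz[OF s s1] by simp
  qed
  have box: "AE s in lborel. s \<in> box a b \<longrightarrow> \<delta> (F s) \<bullet> frechet_derivative F (at s) e = 0"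
    if ab: "cbox a b \<subseteq> K" and ne: "cbox a b \<noteq> {}" for a b e
  proof -
    let ?I = "\<lambda>s. indicator (cbox a b) s :: real"
    \<comment> \<open>On a compact box the density is bounded below by a positive minimum, which
      turns the weighted integral into an unweighted one.\<close>
    obtain z where z: "z \<in> cbox a b" "\<And>s. s \<in> cbox a b \<Longrightarrow> J z \<le> J s"
      using continuous_attains_inf[OF compact_cbox ne continuous_on_subset[OF J(1) ab]] by blast
    define c where "c = J z"
    have c: "c > 0" using z(1) ab J(2) by (auto simp: c_def)
    have tr: "integrable lborel (\<lambda>s. ?I s * f (F s)) \<and> (LINT s|lborel. ?I s * f (F s)) \<le> (1 / c) * (LINT x|\<mu>. f x)"
      if f: "integrable \<mu> f" "\<And>x. 0 \<le> f x" for f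
    proof -
      have "(\<lambda>s. indicator (cbox a b) s * (indicator K s *\<^sub>R f (F s))) \<in> borel_measurable borel"
        using meas[of f] f(1) by (intro borel_measurable_times) auto
      moreover have "(\<lambda>s. indicator (cbox a b) s * (indicator K s *\<^sub>R f (F s))) = (\<lambda>s. ?I s * f (F s))"
        using ab by (auto simp: fun_eq_iff indicator_def)
      ultimately have m: "(\<lambda>s. ?I s * f (F s)) \<in> borel_measurable lborel" by simp
      have "(\<integral>\<^sup>+s. ennreal (?I s * f (F s)) \<partial>lborel) \<le> (\<integral>\<^sup>+s. indicator K s * ennreal ((1 / c) * f (F s)) * ennreal (J s) \<partial>lborel)"
      proof (rule nn_integral_mono)
        fix s
        show "ennreal (?I s * f (F s)) \<le> indicator K s * ennreal ((1 / c) * f (F s)) * ennreal (J s)"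
        proof (cases "s \<in> cbox a b")
          case True
          then have sK: "s \<in> K" using ab by blast
          have "f (F s) \<le> f (F s) * (J s / c)"
            using z(2)[OF True] c f(2)[of "F s"] by (intro mult_le_cancel_left1[THEN iffD2]) (auto simp: c_def)
          then show ?thesis
            using True sK c f(2)[of "F s"] J(2)[OF sK] by (simp add: ennreal_mult[symmetric] mult_ac)
        qed simp
      qed
      also have "\<dots> \<le> (\<integral>\<^sup>+x. ennreal ((1 / c) * f x) \<partial>\<mu>)"
        using f(1) by (intro int) auto
      also have "\<dots> = ennreal ((1 / c) * (LINT x|\<mu>. f x))"
        using f c by (subst nn_integral_eq_integral) auto
      finally have le: "(\<integral>\<^sup>+s. ennreal (?I s * f (F s)) \<partial>lborel) \<le> ennreal ((1 / c) * (LINT x|\<mu>. f x))" .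
      have i: "integrable lborel (\<lambda>s. ?I s * f (F s))"
        by (rule integrableI_nonneg[OF m]) (use f(2) le in \<open>auto intro: le_less_trans\<close>)
      then have "ennreal (LINT s|lborel. ?I s * f (F s)) \<le> ennreal ((1 / c) * (LINT x|\<mu>. f x))"
        using le f(2) by (subst (asm) nn_integral_eq_integral) auto
      then show ?thesis
        using i f c by (subst (asm) ennreal_le_iff) (auto intro!: mult_nonneg_nonneg integral_nonneg)
    qed
    obtain B where B: "B > 0" "\<And>s \<xi>. s \<in> cbox a b \<Longrightarrow> norm (frechet_derivative F (at s) \<xi>) \<le> B * norm \<xi>"
      using smooth_on_bounded_derivative[OF F compact_cbox ab] by blast
    define B' where "B' = B * norm e"
    have B': "B' \<ge> 0" "\<And>s. s \<in> cbox a b \<Longrightarrow> norm (frechet_derivative F (at s) e) \<le> B'"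
      using B by (auto simp: B'_def)
    have mDF: "(\<lambda>s. ?I s *\<^sub>R frechet_derivative F (at s) e) \<in> borel_measurable borel"
      using borel_measurable_continuous_on_indicator[of "cbox a b" "\<lambda>s. frechet_derivative F (at s) e"]
        continuous_on_subset[OF smooth_on_imp_continuous_on[OF smooth_on_frechet_derivative[OF F]] ab] by simp
    have mh: "(\<lambda>s. ?I s * (f (F s) \<bullet> frechet_derivative F (at s) e)) \<in> borel_measurable lborel"
      if "f \<in> borel_measurable \<mu>" for f :: "'a \<Rightarrow> 'a"
    proof -
      have "(\<lambda>s. (indicator K s *\<^sub>R f (F s)) \<bullet> (?I s *\<^sub>R frechet_derivative F (at s) e)) \<in> borel_measurable borel"
        using meas[OF that] mDF by (intro borel_measurable_inner)
      moreover have "(\<lambda>s. (indicator K s *\<^sub>R f (F s)) \<bullet> (?I s *\<^sub>R frechet_derivative F (at s) e))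
          = (\<lambda>s. ?I s * (f (F s) \<bullet> frechet_derivative F (at s) e))"
        using ab by (auto simp: fun_eq_iff indicator_def)
      ultimately show ?thesis by simp
    qed
    have hb: "\<bar>?I s * (f (F s) \<bullet> frechet_derivative F (at s) e)\<bar> \<le> B' * (?I s * norm (f (F s)))" for f :: "'a \<Rightarrow> 'a" and s
    proof (cases "s \<in> cbox a b")
      case True
      have "\<bar>f (F s) \<bullet> frechet_derivative F (at s) e\<bar> \<le> norm (f (F s)) * norm (frechet_derivative F (at s) e)"
        by (rule Cauchy_Schwarz_ineq2)
      also have "\<dots> \<le> norm (f (F s)) * B'" using B'(2)[OF True] by (intro mult_left_mono) auto
      finally show ?thesis using True by (simp add: mult.commute)
    qed simp
    have ih: "integrable lborel (\<lambda>s. ?I s * (f (F s) \<bullet> frechet_derivative F (at s) e))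
        \<and> (LINT s|lborel. \<bar>?I s * (f (F s) \<bullet> frechet_derivative F (at s) e)\<bar>) \<le> B' * ((1 / c) * (LINT x|\<mu>. norm (f x)))"
      if f: "square_integrable \<mu> f" for f :: "'a \<Rightarrow> 'a"
    proof -
      have t: "integrable lborel (\<lambda>s. ?I s * norm (f (F s)))" "(LINT s|lborel. ?I s * norm (f (F s))) \<le> (1 / c) * (LINT x|\<mu>. norm (f x))"
        using tr[of "\<lambda>x. norm (f x)"] L1[OF f] by auto
      have i: "integrable lborel (\<lambda>s. ?I s * (f (F s) \<bullet> frechet_derivative F (at s) e))"
        by (rule Bochner_Integration.integrable_bound[OF integrable_mult_right[OF t(1), of B'] mh[OF square_integrable_measurable[OF f]]])
          (use hb[of _ f] B' in \<open>auto intro!: AE_I2 intro: order.trans\<close>)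
      have "(LINT s|lborel. \<bar>?I s * (f (F s) \<bullet> frechet_derivative F (at s) e)\<bar>) \<le> (LINT s|lborel. B' * (?I s * norm (f (F s))))"
        by (rule integral_mono[OF integrable_abs[OF i] integrable_mult_right[OF t(1)]]) (rule hb)
      also have "\<dots> \<le> B' * ((1 / c) * (LINT x|\<mu>. norm (f x)))"
        unfolding integral_mult_right_zero by (rule mult_left_mono[OF t(2) B'(1)])
      finally show ?thesis using i by blast
    qed
    show ?thesis
    proof (rule weak_derivative_zero[OF K ab, where f = "\<lambda>j s. w j (F s)" and v = e])
      show "smooth_on (\<lambda>s. w j (F s)) K" for j
        by (rule smooth_on_compose[OF K subset_UNIV F w(1)])
      show "integrable lborel (\<lambda>s. ?I s * (\<delta> (F s) \<bullet> frechet_derivative F (at s) e))"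
        using ih[OF s\<delta>] by blast
      have sw: "square_integrable \<mu> (w j)" for j by (rule square_integrable_smooth[OF w(1)])
      have b1: "norm (LINT s|lborel. ?I s * \<bar>w j (F s)\<bar>) \<le> (1 / c) * (sqrt (LINT x|\<mu>. (norm (w j x - 0))\<^sup>2) * sqrt (measure \<mu> (space \<mu>)))" for j
      proof -
        have "(LINT s|lborel. ?I s * \<bar>w j (F s)\<bar>) \<le> (1 / c) * (LINT x|\<mu>. \<bar>w j x\<bar>)"
          using tr[of "\<lambda>x. \<bar>w j x\<bar>"] L1[OF sw[of j]] by simp
        also have "\<dots> \<le> (1 / c) * (sqrt (LINT x|\<mu>. (norm (w j x - 0))\<^sup>2) * sqrt (measure \<mu> (space \<mu>)))"
          using L1[OF sw[of j]] c by (intro mult_left_mono) auto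
        finally show ?thesis by (simp add: integral_nonneg)
      qed
      have z1: "(\<lambda>j. (1 / c) * (sqrt (LINT x|\<mu>. (norm (w j x - 0))\<^sup>2) * sqrt (measure \<mu> (space \<mu>)))) \<longlonglongrightarrow> (1 / c) * (sqrt 0 * sqrt (measure \<mu> (space \<mu>)))"
        by (intro tendsto_intros w(2))
      show "(\<lambda>j. LINT s|lborel. ?I s * \<bar>w j (F s)\<bar>) \<longlonglongrightarrow> 0"
        by (rule Lim_null_comparison[OF always_eventually[OF allI[OF b1]]]) (use z1 in simp)
      have std: "square_integrable \<mu> (\<lambda>x. tangential n (w j) x - \<delta> x)" for j
        by (rule square_integrable_diff[OF square_integrable_tangential[OF w(1)] s\<delta>])
      have eq: "?I s * \<bar>frechet_derivative (\<lambda>s. w j (F s)) (at s) e - \<delta> (F s) \<bullet> frechet_derivative F (at s) e\<bar>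
          = \<bar>?I s * ((tangential n (w j) (F s) - \<delta> (F s)) \<bullet> frechet_derivative F (at s) e)\<bar>" for j s
      proof (cases "s \<in> cbox a b")
        case True
        then have sK: "s \<in> K" using ab by blast
        from frechet_derivative_at[OF has_derivative_compose[OF smooth_on_has_derivative[OF F sK] smooth_on_has_derivative[OF w(1) UNIV_I]]]
        have "frechet_derivative (\<lambda>s. w j (F s)) (at s) e = frechet_derivative (w j) (at (F s)) (frechet_derivative F (at s) e)"
          by (simp add: fun_eq_iff)
        also have "\<dots> = grad (w j) (F s) \<bullet> frechet_derivative F (at s) e"
          by (rule grad_inner[OF smooth_on_differentiable[OF w(1)], symmetric])
        \<comment> \<open>Directions tangent to the chart do not see the normal part of the
          gradient.\<close>
        also have "\<dots> = tangential n (w j) (F s) \<bullet> frechet_derivative F (at s) e"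
          using N[OF sK, of e] by (simp add: tangential_def inner_diff_left)
        finally show ?thesis using True by (simp add: inner_diff_left)
      qed simp
      have b2: "norm (LINT s|lborel. ?I s * \<bar>frechet_derivative (\<lambda>s. w j (F s)) (at s) e - \<delta> (F s) \<bullet> frechet_derivative F (at s) e\<bar>)
        \<le> B' * ((1 / c) * (sqrt (LINT x|\<mu>. (norm (tangential n (w j) x - \<delta> x))\<^sup>2) * sqrt (measure \<mu> (space \<mu>))))" for j
      proof -
        have "(LINT s|lborel. \<bar>?I s * ((tangential n (w j) (F s) - \<delta> (F s)) \<bullet> frechet_derivative F (at s) e)\<bar>)
          \<le> B' * ((1 / c) * (LINT x|\<mu>. norm (tangential n (w j) x - \<delta> x)))"
          using ih[OF std[of j]] by blast
        also have "\<dots> \<le> B' * ((1 / c) * (sqrt (LINT x|\<mu>. (norm (tangential n (w j) x - \<delta> x))\<^sup>2) * sqrt (measure \<mu> (space \<mu>))))"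
          using L1[OF std[of j]] c B'(1) by (intro mult_left_mono) auto
        finally show ?thesis unfolding eq by (simp add: integral_nonneg)
      qed
      have z2: "(\<lambda>j. B' * ((1 / c) * (sqrt (LINT x|\<mu>. (norm (tangential n (w j) x - \<delta> x))\<^sup>2) * sqrt (measure \<mu> (space \<mu>)))))
          \<longlonglongrightarrow> B' * ((1 / c) * (sqrt 0 * sqrt (measure \<mu> (space \<mu>))))"
        by (intro tendsto_intros w(3))
      show "(\<lambda>j. LINT s|lborel. ?I s * \<bar>frechet_derivative (\<lambda>s. w j (F s)) (at s) e - \<delta> (F s) \<bullet> frechet_derivative F (at s) e\<bar>) \<longlonglongrightarrow> 0"
        by (rule Lim_null_comparison[OF always_eventually[OF allI[OF b2]]]) (use z2 in simp)
    qed
  qed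
  \<comment> \<open>\<open>K\<close> is a countable union of closed boxes whose boundaries are
    null.\<close>
  have AEb: "AE s in lborel. s \<in> K \<longrightarrow> \<delta> (F s) \<bullet> frechet_derivative F (at s) e = 0" for e
  proof -
    obtain \<D> where D: "countable \<D>" "\<D> \<subseteq> Pow K" "\<And>Y. Y \<in> \<D> \<Longrightarrow> \<exists>a b. Y = cbox a b" "\<Union>\<D> = K"
      by (rule open_countable_Union_open_cbox[OF K]) (rule that)
    have D0: "AE s in lborel. s \<in> Y \<longrightarrow> \<delta> (F s) \<bullet> frechet_derivative F (at s) e = 0" if Y: "Y \<in> \<D>" for Y
    proof -
      obtain a b where ab: "Y = cbox a b" using D(3)[OF Y] by blast
      have sub: "cbox a b \<subseteq> K" using D(2) Y ab by blast
      have "cbox a b - box a b \<in> null_sets lborel"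
        using negligible_frontier_interval[of a b] by (simp add: negligible_iff_null_sets null_sets_completion_iff)
      then have "AE s in lborel. s \<notin> cbox a b - box a b" by (rule AE_not_in)
      moreover have "AE s in lborel. s \<in> box a b \<longrightarrow> \<delta> (F s) \<bullet> frechet_derivative F (at s) e = 0"
        using box[OF sub, of e] by (cases "cbox a b = {}") (use box_subset_cbox[of a b] in auto)
      ultimately show ?thesis unfolding ab by eventually_elim auto
    qed
    have "AE s in lborel. \<forall>Y\<in>\<D>. s \<in> Y \<longrightarrow> \<delta> (F s) \<bullet> frechet_derivative F (at s) e = 0"
      by (subst AE_ball_countable[OF D(1)]) (rule ballI, rule D0)
    then show ?thesis using D(4) by (auto elim!: eventually_mono)
  qed
  have "AE s in lborel. \<forall>e\<in>Basis. s \<in> K \<longrightarrow> \<delta> (F s) \<bullet> frechet_derivative F (at s) e = 0"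
    using AEb by (subst AE_ball_countable) (auto intro: countable_finite)
  then show ?thesis
    using AEtr[OF nd]
  proof eventually_elim
    case (elim s)
    show ?case
    proof (intro impI)
      assume s: "s \<in> K"
      let ?A = "frechet_derivative F (at s)"
      have lin: "linear ?A" using has_derivative_linear[OF smooth_on_has_derivative[OF F s]] .
      have "\<delta> (F s) \<bullet> ?A \<xi> = 0" for \<xi>
      proof -
        have "?A \<xi> = ?A (\<Sum>b\<in>Basis. (\<xi> \<bullet> b) *\<^sub>R b)" by (simp add: euclidean_representation)
        also have "\<dots> = (\<Sum>b\<in>Basis. (\<xi> \<bullet> b) *\<^sub>R ?A b)"
          by (simp only: linear_sum[OF lin] linear_cmul[OF lin])
        finally show ?thesis using elim(1) s by (simp add: inner_sum_right)
      qed
      then have "\<delta> (F s) = 0"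
        using elim(2) s
        by (intro orthogonal_to_hyperplane_eq_0[OF lin inj[OF s] dim nN[OF s] N[OF s]]) (auto simp: inner_commute)
      then show "g (F s) = g' (F s)" by (simp add: \<delta>_def)
    qed
  qed
qed

section \<open>The tubular neighbourhood\<close>

lemma has_derivative_directional:
  fixes f :: "'a::real_normed_vector \<Rightarrow> 'b::real_normed_vector"
  assumes "(f has_derivative f') (at s)"
  shows "((\<lambda>t. (f (s + t *\<^sub>R \<xi>) - f s) /\<^sub>R t) \<longlongrightarrow> f' \<xi>) (at 0)"
proof -
  have "((\<lambda>t. s + t *\<^sub>R \<xi>) has_derivative (\<lambda>t. t *\<^sub>R \<xi>)) (at 0)"
    by (auto intro!: derivative_eq_intros)
  moreover have "(f has_derivative f') (at (s + 0 *\<^sub>R \<xi>))"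
    using assms by simp
  ultimately have "((\<lambda>t. f (s + t *\<^sub>R \<xi>)) has_derivative (\<lambda>t. f' (t *\<^sub>R \<xi>))) (at 0)"
    by (rule has_derivative_compose)
  then have "(\<lambda>t. norm (f (s + t *\<^sub>R \<xi>) - f s - f' (t *\<^sub>R \<xi>)) / norm t) \<midarrow>0\<rightarrow> 0"
    by (simp add: has_derivative_at)
  moreover have "\<forall>\<^sub>F t in at 0. norm (f (s + t *\<^sub>R \<xi>) - f s - f' (t *\<^sub>R \<xi>)) / norm t =
      norm ((f (s + t *\<^sub>R \<xi>) - f s) /\<^sub>R t - f' \<xi>)"
  proof -
    have "norm (f (s + t *\<^sub>R \<xi>) - f s - f' (t *\<^sub>R \<xi>)) / norm t = norm ((f (s + t *\<^sub>R \<xi>) - f s) /\<^sub>R t - f' \<xi>)"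
      if "t \<noteq> 0" for t :: real
    proof -
      have "(f (s + t *\<^sub>R \<xi>) - f s) /\<^sub>R t - f' \<xi> = (f (s + t *\<^sub>R \<xi>) - f s - f' (t *\<^sub>R \<xi>)) /\<^sub>R t"
        using that linear_cmul[OF has_derivative_linear[OF assms], of t \<xi>] by (simp add: scaleR_diff_right)
      then show ?thesis by (simp add: divide_inverse mult.commute)
    qed
    then show ?thesis by (simp add: eventually_at_filter)
  qed
  ultimately have "(\<lambda>t. norm ((f (s + t *\<^sub>R \<xi>) - f s) /\<^sub>R t - f' \<xi>)) \<midarrow>0\<rightarrow> 0"
    by (rule Lim_transform_eventually)
  then have "(\<lambda>t. (f (s + t *\<^sub>R \<xi>) - f s) /\<^sub>R t - f' \<xi>) \<midarrow>0\<rightarrow> 0"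
    by (rule tendsto_norm_zero_cancel)
  then show ?thesis by (rule LIM_zero_cancel)
qed

text \<open>Pass to the limit in the difference quotients. This turns the Lipschitz bound for the
  inverse projection into a lower bound for the derivative of the lifted element maps.\<close>

lemma derivative_norm_le:
  fixes f :: "'a::real_normed_vector \<Rightarrow> 'b::real_normed_vector"
    and g :: "'a \<Rightarrow> 'c::real_normed_vector"
  assumes f: "(f has_derivative f') (at s)" and g: "(g has_derivative g') (at s)"
    and U: "open U" "s \<in> U" and le: "\<And>z. z \<in> U \<Longrightarrow> norm (f z - f s) \<le> B * norm (g z - g s)"
  shows "norm (f' \<xi>) \<le> B * norm (g' \<xi>)"
proof (rule tendsto_le)
  show "((\<lambda>t. norm ((f (s + t *\<^sub>R \<xi>) - f s) /\<^sub>R t)) \<longlongrightarrow> norm (f' \<xi>)) (at 0)"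
    by (rule tendsto_norm[OF has_derivative_directional[OF f]])
  show "((\<lambda>t. B * norm ((g (s + t *\<^sub>R \<xi>) - g s) /\<^sub>R t)) \<longlongrightarrow> B * norm (g' \<xi>)) (at 0)"
    by (rule tendsto_mult[OF tendsto_const tendsto_norm[OF has_derivative_directional[OF g]]])
  have "((\<lambda>t. s + t *\<^sub>R \<xi>) \<longlongrightarrow> s + 0 *\<^sub>R \<xi>) (at 0)"
    by (intro tendsto_intros)
  then have "\<forall>\<^sub>F t in at 0. s + t *\<^sub>R \<xi> \<in> U"
    using topological_tendstoD[OF _ U(1)] U(2) by simp
  then show "\<forall>\<^sub>F t in at 0. norm ((f (s + t *\<^sub>R \<xi>) - f s) /\<^sub>R t) \<le> B * norm ((g (s + t *\<^sub>R \<xi>) - g s) /\<^sub>R t)"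
  proof eventually_elim
    case (elim t)
    have "\<bar>inverse t\<bar> * norm (f (s + t *\<^sub>R \<xi>) - f s) \<le> \<bar>inverse t\<bar> * (B * norm (g (s + t *\<^sub>R \<xi>) - g s))"
      by (rule mult_left_mono[OF le[OF elim]]) simp
    then show ?case by (simp add: mult_ac)
  qed
qed simp

text \<open>Near \<open>x0\<close> the map differs from its linearisation, which expands by
  \<open>B\<close>, only by a map with Lipschitz constant \<open>B / 2\<close>.\<close>

lemma immersion_locally_expanding:
  fixes f :: "'a::euclidean_space \<Rightarrow> 'b::euclidean_space"
  assumes U: "open U" "x0 \<in> U" and f: "smooth_on f U" and inj: "inj (frechet_derivative f (at x0))"
  obtains r c where "r > 0" "c > 0" "ball x0 r \<subseteq> U"
    "\<And>x y. x \<in> ball x0 r \<Longrightarrow> y \<in> ball x0 r \<Longrightarrow> c * norm (x - y) \<le> norm (f x - f y)"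
proof -
  let ?D = "\<lambda>x. frechet_derivative f (at x)"
  have D: "(f has_derivative ?D x) (at x)" if "x \<in> U" for x
    by (rule smooth_on_has_derivative[OF f that])
  have lin: "linear (?D x)" if "x \<in> U" for x by (rule has_derivative_linear[OF D[OF that]])
  obtain B where B: "B > 0" "\<And>v. B * norm v \<le> norm (?D x0 v)"
    using linear_inj_bounded_below_pos[OF lin[OF U(2)] inj] by blast
  define q where "q x = (\<Sum>b\<in>Basis. norm (?D x b - ?D x0 b))" for x
  have cq: "continuous_on U q"
    unfolding q_def[abs_def]
    by (intro continuous_on_sum continuous_on_norm continuous_on_diff continuous_on_const
        smooth_on_imp_continuous_on[OF smooth_on_frechet_derivative[OF f]])
  have q0: "q x0 = 0" by (simp add: q_def)
  have "open (U \<inter> q -` {..<B / 2})"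
    using continuous_open_preimage[OF cq U(1) open_lessThan] .
  moreover have "x0 \<in> U \<inter> q -` {..<B / 2}" using U(2) q0 B(1) by simp
  ultimately obtain r where r: "r > 0" "ball x0 r \<subseteq> U \<inter> q -` {..<B / 2}"
    using openE by blast
  define g where "g x = f x - ?D x0 x" for x
  have "norm (g x - g y) \<le> (B / 2) * norm (x - y)" if "x \<in> ball x0 r" "y \<in> ball x0 r" for x y
  proof (rule differentiable_bound[OF convex_ball, of x0 r g "\<lambda>x v. ?D x v - ?D x0 v"])
    fix z assume z: "z \<in> ball x0 r"
    then have zU: "z \<in> U" and qz: "q z < B / 2" using r(2) by auto
    have bl: "bounded_linear (?D x0)" by (rule has_derivative_bounded_linear[OF D[OF U(2)]])
    show "(g has_derivative (\<lambda>v. ?D z v - ?D x0 v)) (at z within ball x0 r)"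
      unfolding g_def[abs_def]
      by (rule has_derivative_diff[OF has_derivative_at_withinI[OF D[OF zU]] bounded_linear_imp_has_derivative[OF bl]])
    show "onorm (\<lambda>v. ?D z v - ?D x0 v) \<le> B / 2"
    proof (rule onorm_le)
      fix v
      have l: "linear (\<lambda>v. ?D z v - ?D x0 v)"
        by (rule linear_compose_sub[OF lin[OF zU] lin[OF U(2)]])
      have "?D z v - ?D x0 v = (\<lambda>v. ?D z v - ?D x0 v) (\<Sum>b\<in>Basis. (v \<bullet> b) *\<^sub>R b)"
        by (simp add: euclidean_representation)
      also have "\<dots> = (\<Sum>b\<in>Basis. (v \<bullet> b) *\<^sub>R (?D z b - ?D x0 b))"
        by (simp only: linear_sum[OF l] linear_cmul[OF l])
      finally have e: "?D z v - ?D x0 v = (\<Sum>b\<in>Basis. (v \<bullet> b) *\<^sub>R (?D z b - ?D x0 b))" .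
      have "norm (?D z v - ?D x0 v) \<le> (\<Sum>b\<in>Basis. norm v * norm (?D z b - ?D x0 b))"
        unfolding e
        by (rule order.trans[OF norm_sum sum_mono]) (simp add: Basis_le_norm mult_right_mono)
      also have "\<dots> = norm v * q z" by (simp add: q_def sum_distrib_left)
      also have "\<dots> \<le> norm v * (B / 2)" by (rule mult_left_mono) (use qz in auto)
      finally show "norm (?D z v - ?D x0 v) \<le> B / 2 * norm v" by (simp add: mult.commute)
    qed
  qed (use that in auto)
  then have g: "norm (g x - g y) \<le> (B / 2) * norm (x - y)" if "x \<in> ball x0 r" "y \<in> ball x0 r" for x y
    using that by blast
  have "B / 2 * norm (x - y) \<le> norm (f x - f y)" if "x \<in> ball x0 r" "y \<in> ball x0 r" for x y
  proof -
    have "f x - f y = ?D x0 (x - y) + (g x - g y)"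
      using linear_diff[OF lin[OF U(2)], of x y] by (simp add: g_def)
    then have "norm (?D x0 (x - y)) \<le> norm (f x - f y) + norm (g x - g y)"
      by (metis add_diff_cancel_right' norm_triangle_ineq4)
    then show ?thesis using g[OF that] B(2)[of "x - y"] by linarith
  qed
  then show ?thesis using r B(1) by (intro that[of r "B / 2"]) auto
qed

locale narrow_tube =
  fixes \<gamma> :: "(real^'m) set" and \<delta> :: real
  assumes compact_\<gamma>: "compact \<gamma>" and nonempty: "\<gamma> \<noteq> {}" and narrow: "narrow_strip \<gamma> \<delta>"
begin

abbreviation cp :: "real^'m \<Rightarrow> real^'m" where "cp \<equiv> closest_point \<gamma>"
abbreviation sd :: "real^'m \<Rightarrow> real" where "sd \<equiv> sdist \<gamma>"

lemma delta_pos: "\<delta> > 0" using narrow by (simp add: narrow_strip_def)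

lemma open_strip: "open (strip \<gamma> \<delta>)"
  unfolding strip_def by (intro open_Collect_less continuous_intros)

lemma subset_strip: "\<gamma> \<subseteq> strip \<gamma> \<delta>"
  using delta_pos by (auto simp: strip_def)

lemma cp_in: "cp x \<in> \<gamma>"
  by (rule closest_point_in_set[OF compact_imp_closed[OF compact_\<gamma>] nonempty])

lemma dist_cp: "dist x (cp x) = infdist x \<gamma>"
proof (rule order.antisym)
  show "dist x (cp x) \<le> infdist x \<gamma>"
    using closest_point_exists(2)[OF compact_imp_closed[OF compact_\<gamma>] nonempty, of x] nonempty
    by (simp add: infdist_notempty cINF_greatest)
qed (rule infdist_le[OF cp_in])

lemma abs_sdist: "\<bar>sd x\<bar> = infdist x \<gamma>"
  by (simp add: sdist_def infdist_nonneg)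

lemma sdist_on: "x \<in> \<gamma> \<Longrightarrow> sd x = 0"
  using abs_sdist[of x] by simp

lemma cp_on: "x \<in> \<gamma> \<Longrightarrow> cp x = x"
  by (rule closest_point_self)

lemma smooth_sdist: "smooth_on sd (strip \<gamma> \<delta>)"
  using narrow by (simp add: narrow_strip_def)

lemma smooth_nu: "smooth_on (nu \<gamma>) (strip \<gamma> \<delta>)"
  by (rule smooth_on_grad[OF open_strip smooth_sdist])

lemma cp_eq: "x \<in> strip \<gamma> \<delta> \<Longrightarrow> cp x = x - sd x *\<^sub>R nu \<gamma> x"
  using narrow by (auto simp: narrow_strip_def algebra_simps)

lemma smooth_cp: "smooth_on cp (strip \<gamma> \<delta>)"
proof (rule smooth_on_cong[OF open_strip])
  show "smooth_on (\<lambda>x. x - sd x *\<^sub>R nu \<gamma> x) (strip \<gamma> \<delta>)"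
    by (intro smooth_on_diff[OF open_strip] smooth_on_scaleR[OF open_strip] smooth_sdist smooth_nu
        smooth_on_bounded_linear[OF bounded_linear_ident open_strip])
qed (simp add: cp_eq)

lemma cp_strip: "cp x \<in> strip \<gamma> \<delta>" using cp_in subset_strip by blast

abbreviation Dcp :: "real^'m \<Rightarrow> real^'m \<Rightarrow> real^'m" where
  "Dcp x \<equiv> frechet_derivative cp (at x)"
abbreviation Dnu :: "real^'m \<Rightarrow> real^'m \<Rightarrow> real^'m" where
  "Dnu x \<equiv> frechet_derivative (nu \<gamma>) (at x)"

lemma Dsdist: "x \<in> strip \<gamma> \<delta> \<Longrightarrow> (sd has_derivative (\<lambda>\<xi>. nu \<gamma> x \<bullet> \<xi>)) (at x)"
proof -
  assume x: "x \<in> strip \<gamma> \<delta>"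
  note d = smooth_on_has_derivative[OF smooth_sdist x]
  have "frechet_derivative sd (at x) = (\<lambda>\<xi>. nu \<gamma> x \<bullet> \<xi>)"
    using grad_inner[OF differentiableI[OF d]] by (simp add: fun_eq_iff)
  then show ?thesis using d by simp
qed

text \<open>The first two terms project along \<open>nu\<close>, and \<open>Dnu\<close> is the
  Hessian of the distance function. Every quantitative bound on the distortion of lengths and
  gradients starts from this formula.\<close>

lemma Dcp_eq:
  assumes x: "x \<in> strip \<gamma> \<delta>"
  shows "Dcp x \<xi> = \<xi> - (nu \<gamma> x \<bullet> \<xi>) *\<^sub>R nu \<gamma> x - sd x *\<^sub>R Dnu x \<xi>"
proof -
  have "((\<lambda>x. x - sd x *\<^sub>R nu \<gamma> x) has_derivative
      (\<lambda>\<xi>. \<xi> - (sd x *\<^sub>R Dnu x \<xi> + (nu \<gamma> x \<bullet> \<xi>) *\<^sub>R nu \<gamma> x))) (at x)"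
    by (rule has_derivative_diff[OF has_derivative_ident
          has_derivative_scaleR[OF Dsdist[OF x] smooth_on_has_derivative[OF smooth_nu x]]])
  then have "(cp has_derivative (\<lambda>\<xi>. \<xi> - (sd x *\<^sub>R Dnu x \<xi> + (nu \<gamma> x \<bullet> \<xi>) *\<^sub>R nu \<gamma> x))) (at x)"
    by (rule has_derivative_transform_within_open[OF _ open_strip x]) (simp add: cp_eq)
  from fun_cong[OF frechet_derivative_at[OF this], of \<xi>] show ?thesis by (simp add: algebra_simps)
qed

text \<open>Differentiate the signed distance along the projection, which is constantly
  zero.\<close>

lemma nu_Dcp:
  assumes x: "x \<in> strip \<gamma> \<delta>"
  shows "nu \<gamma> (cp x) \<bullet> Dcp x \<xi> = 0"
proof -
  have "((\<lambda>x. sd (cp x)) has_derivative (\<lambda>\<xi>. nu \<gamma> (cp x) \<bullet> Dcp x \<xi>)) (at x)"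
    by (rule has_derivative_compose[OF smooth_on_has_derivative[OF smooth_cp x] Dsdist[OF cp_strip]])
  moreover have "(\<lambda>x. sd (cp x)) = (\<lambda>x. 0)" by (simp add: sdist_on cp_in)
  ultimately have "((\<lambda>x::real^'m. 0::real) has_derivative (\<lambda>\<xi>. nu \<gamma> (cp x) \<bullet> Dcp x \<xi>)) (at x)" by simp
  from has_derivative_unique[OF this has_derivative_const] show ?thesis by (simp add: fun_eq_iff)
qed

lemma compact_tube: "e > 0 \<Longrightarrow> compact {x. infdist x \<gamma> \<le> e}"
  by (rule compact_infdist_le[OF nonempty compact_\<gamma>])

lemma segment_in_tube:
  assumes "y \<in> closed_segment x (cp x)"
  shows "infdist y \<gamma> \<le> infdist x \<gamma>"
proof -
  have "infdist y \<gamma> \<le> dist y (cp x)" by (rule infdist_le[OF cp_in])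
  also have "\<dots> \<le> dist x (cp x)"
    using dist_in_closed_segment[OF assms] by (simp add: dist_commute)
  finally show ?thesis by (simp add: dist_cp)
qed

text \<open>By \<open>cp_eq\<close> the distance to the closest point is
  \<open>\<bar>sd x\<bar> * norm (nu \<gamma> x)\<close>; dividing by it is possible off the surface
  only.\<close>

lemma norm_nu_off: "x \<in> strip \<gamma> \<delta> \<Longrightarrow> sd x \<noteq> 0 \<Longrightarrow> norm (nu \<gamma> x) = 1"
proof -
  assume x: "x \<in> strip \<gamma> \<delta>" and sx: "sd x \<noteq> 0"
  have "dist x (cp x) = \<bar>sd x\<bar> * norm (nu \<gamma> x)"
    by (simp add: dist_norm cp_eq[OF x])
  then have "\<bar>sd x\<bar> * norm (nu \<gamma> x) = \<bar>sd x\<bar> * 1"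
    by (simp add: dist_cp abs_sdist)
  then show ?thesis using sx by simp
qed

text \<open>Where \<open>\<nu> \<noteq> 0\<close>, the distance function does not vanish along the ray in direction \<open>\<nu>\<close>, and off
  the surface \<open>\<nu>\<close> has length \<open>1\<close>.\<close>

lemma norm_nu_on:
  assumes y: "y \<in> \<gamma>" and nz: "nu \<gamma> y \<noteq> 0"
  shows "norm (nu \<gamma> y) = 1"
proof -
  have ys: "y \<in> strip \<gamma> \<delta>" using y subset_strip by blast
  let ?p = "\<lambda>t::real. y + t *\<^sub>R nu \<gamma> y"
  have "((\<lambda>t. (sd (?p t) - sd y) /\<^sub>R t) \<longlongrightarrow> nu \<gamma> y \<bullet> nu \<gamma> y) (at 0)"
    by (rule has_derivative_directional[OF Dsdist[OF ys]])
  then have "\<forall>\<^sub>F t in at 0. (sd (?p t) - sd y) /\<^sub>R t \<noteq> 0"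
    by (rule tendsto_imp_eventually_ne) (use nz in simp)
  then have ev: "\<forall>\<^sub>F t in at 0. sd (?p t) \<noteq> 0"
    by eventually_elim (use sdist_on[OF y] in auto)
  have pt: "(?p \<longlongrightarrow> y + 0 *\<^sub>R nu \<gamma> y) (at 0)" by (intro tendsto_intros)
  then have "\<forall>\<^sub>F t in at 0. ?p t \<in> strip \<gamma> \<delta>"
    using topological_tendstoD[OF _ open_strip] ys by simp
  with ev have ev1: "\<forall>\<^sub>F t in at 0. 1 = norm (nu \<gamma> (?p t))"
    by eventually_elim (simp add: norm_nu_off)
  have "isCont (nu \<gamma>) y"
    using continuous_on_interior[OF smooth_on_imp_continuous_on[OF smooth_nu]] ys interior_open[OF open_strip] by simp
  then have "((\<lambda>t. nu \<gamma> (?p t)) \<longlongrightarrow> nu \<gamma> y) (at 0)"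
    by (rule isCont_tendsto_compose) (use pt in simp)
  then have "((\<lambda>t. norm (nu \<gamma> (?p t))) \<longlongrightarrow> norm (nu \<gamma> y)) (at 0)"
    by (rule tendsto_norm)
  moreover have "((\<lambda>t. norm (nu \<gamma> (?p t))) \<longlongrightarrow> 1) (at 0)"
    by (rule Lim_transform_eventually[OF tendsto_const ev1])
  ultimately show ?thesis using tendsto_unique[of "at (0::real)"] by simp
qed

text \<open>The closed tube of half width is compact inside the strip, so \<open>H\<close> depends
  on \<gamma> and \<delta> alone. The last bound is the mean value inequality along the segment to
  the closest point, which stays in the tube.\<close>

lemma Dnu_bound:
  obtains H where "H > 0" "\<And>x \<xi>. infdist x \<gamma> \<le> \<delta> / 2 \<Longrightarrow> norm (Dnu x \<xi>) \<le> H * norm \<xi>"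
    "\<And>x. infdist x \<gamma> \<le> \<delta> / 2 \<Longrightarrow> norm (nu \<gamma> x - nu \<gamma> (cp x)) \<le> H * \<bar>sd x\<bar>"
proof -
  let ?X = "{x. infdist x \<gamma> \<le> \<delta> / 2}"
  have sub: "?X \<subseteq> strip \<gamma> \<delta>" using delta_pos by (auto simp: strip_def)
  obtain H where H: "H > 0" "\<And>x \<xi>. x \<in> ?X \<Longrightarrow> norm (Dnu x \<xi>) \<le> H * norm \<xi>"
    using smooth_on_bounded_derivative[OF smooth_nu compact_tube sub] delta_pos by auto
  have "norm (nu \<gamma> x - nu \<gamma> (cp x)) \<le> H * \<bar>sd x\<bar>" if x: "x \<in> ?X" for x
  proof -
    have seg: "y \<in> ?X" if "y \<in> closed_segment x (cp x)" for y
      using segment_in_tube[OF that] x by simp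
    have "norm (nu \<gamma> x - nu \<gamma> (cp x)) \<le> H * norm (x - cp x)"
    proof (rule differentiable_bound[OF convex_closed_segment, of x "cp x" "nu \<gamma>" Dnu])
      fix y assume y: "y \<in> closed_segment x (cp x)"
      show "(nu \<gamma> has_derivative Dnu y) (at y within closed_segment x (cp x))"
      proof -
        have "y \<in> strip \<gamma> \<delta>" using seg[OF y] sub by blast
        from has_derivative_at_withinI[OF smooth_on_has_derivative[OF smooth_nu this]] show ?thesis .
      qed
      show "onorm (Dnu y) \<le> H" by (rule onorm_le) (rule H(2)[OF seg[OF y]])
    qed auto
    then show ?thesis using dist_cp[of x] by (simp add: dist_norm abs_sdist)
  qed
  then show ?thesis using H that by simp
qed

end

section \<open>Polynomial elements and the reference simplex\<close>

lemma poly_on_smooth: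
  assumes "poly_on r T f"
  obtains g where "smooth_on g UNIV" "\<And>x. x \<in> T \<Longrightarrow> f x = g x"
proof -
  obtain c where c: "\<forall>x\<in>T. f x = (\<Sum>a | sum a UNIV \<le> r. c a * (\<Prod>i\<in>UNIV. (x $ i) ^ a i))"
    using assms unfolding poly_on_def by (rule exE)
  have "smooth_on (\<lambda>x::real^'a. \<Sum>a | sum a UNIV \<le> r. c a * (\<Prod>i\<in>UNIV. (x $ i) ^ a i)) UNIV"
    by (intro smooth_on_sum[OF open_UNIV] smooth_on_mult[OF open_UNIV] smooth_on_const[OF open_UNIV]
        smooth_on_prod[OF open_UNIV] smooth_on_power[OF open_UNIV]
        smooth_on_bounded_linear[OF bounded_linear_vec_nth open_UNIV])
  then show ?thesis using c that by blast
qed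

text \<open>The Lagrange basis polynomials extend to the ambient space, hence so does the
  interpolant; this gives smoothness up to the boundary of the simplex.\<close>

lemma lagrange_interpolatory_smooth:
  assumes "lagrange_interpolatory k T L"
  obtains G where "smooth_on G UNIV" "\<And>x. x \<in> T \<Longrightarrow> L x = G x"
proof -
  obtain \<phi> where \<phi>: "\<forall>p\<in>lagrange_nodes k T. poly_on k T (\<phi> p) \<and>
        (\<forall>q\<in>lagrange_nodes k T. \<phi> p q = of_bool (p = q))"
      "\<forall>x\<in>T. L x = (\<Sum>p\<in>lagrange_nodes k T. \<phi> p x *\<^sub>R L p)"
    using assms unfolding lagrange_interpolatory_def by blast
  have "\<exists>g. smooth_on g UNIV \<and> (\<forall>x\<in>T. \<phi> p x = g x)" if "p \<in> lagrange_nodes k T" for p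
  proof -
    have "poly_on k T (\<phi> p)" using \<phi>(1) that by blast
    then obtain g where "smooth_on g UNIV" "\<And>x. x \<in> T \<Longrightarrow> \<phi> p x = g x"
      by (rule poly_on_smooth) (rule that)
    then show ?thesis by blast
  qed
  then obtain g where g: "\<forall>p\<in>lagrange_nodes k T. smooth_on (g p) UNIV \<and> (\<forall>x\<in>T. \<phi> p x = g p x)"
    using bchoice[of "lagrange_nodes k T" "\<lambda>p g. smooth_on g UNIV \<and> (\<forall>x\<in>T. \<phi> p x = g x)"] by blast
  have "smooth_on (\<lambda>x. \<Sum>p\<in>lagrange_nodes k T. g p x *\<^sub>R L p) UNIV"
    by (intro smooth_on_sum[OF open_UNIV] smooth_on_scaleR[OF open_UNIV] smooth_on_const[OF open_UNIV])
      (use g in blast)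
  moreover have "L x = (\<Sum>p\<in>lagrange_nodes k T. g p x *\<^sub>R L p)" if "x \<in> T" for x
  proof -
    have "(\<Sum>p\<in>lagrange_nodes k T. \<phi> p x *\<^sub>R L p) = (\<Sum>p\<in>lagrange_nodes k T. g p x *\<^sub>R L p)"
      by (rule sum.cong) (use g that in auto)
    then show ?thesis using \<phi>(2) that by simp
  qed
  ultimately show ?thesis by (rule that)
qed

lemma compact_ref_simplex: "compact (ref_simplex :: (real^'n) set)"
  unfolding ref_simplex_def by (intro finite_imp_compact_convex_hull) simp

lemma convex_ref_simplex: "convex (ref_simplex :: (real^'n) set)"
  unfolding ref_simplex_def by (rule convex_convex_hull)

lemma interior_ref_simplex_nonempty: "interior (ref_simplex :: (real^'n) set) \<noteq> {}"
proof -
  obtain a :: "real^'n" where "a \<in> interior (convex hull (insert 0 Basis))"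
    by (rule interior_std_simplex_nonempty)
  then show ?thesis by (auto simp: ref_simplex_def)
qed

section \<open>Lifted elements\<close>

text \<open>One mesh with its qualitative properties: constants obtained here may depend on it. The
  uniform ones are isolated in \<open>close_mesh\<close>.\<close>

locale lifted_mesh = narrow_tube \<gamma> \<delta> for \<gamma> :: "(real^'m) set" and \<delta> :: real +
  fixes \<sigma> :: "(real^'m) measure" and k :: nat and S :: "('n::finite, 'm) discrete_surface" and \<rho> :: real
  assumes dim: "CARD('m) = CARD('n) + 1"
    and charts: "\<And>p. p \<in> \<gamma> \<Longrightarrow> \<exists>(f :: real^'n \<Rightarrow> real^'m) U. local_param \<gamma> f U \<and> p \<in> f ` U"
    and surf: "surface_measure TYPE('n) \<gamma> \<sigma>"
    and dsurf: "discrete_surface_of \<gamma> \<delta> k S"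
    and shape: "shape_bounds S \<rho>"
begin

abbreviation R :: "(real^'n) set" where "R \<equiv> ref_simplex"
abbreviation K :: "(real^'n) set" where "K \<equiv> interior ref_simplex"
abbreviation F :: "(real^'m) set \<Rightarrow> real^'n \<Rightarrow> real^'m" where "F \<equiv> elem_map S"
abbreviation \<Phi> :: "(real^'m) set \<Rightarrow> real^'n \<Rightarrow> real^'m" where "\<Phi> T \<equiv> \<lambda>s. cp (F T s)"
abbreviation \<iota> :: "real^'m \<Rightarrow> real^'m" where "\<iota> \<equiv> inv_into (Gamma S) cp"
abbreviation DF :: "(real^'m) set \<Rightarrow> real^'n \<Rightarrow> real^'n \<Rightarrow> real^'m" where
  "DF T s \<equiv> frechet_derivative (F T) (at s)"

lemma triang: "triangulation (faces S)"
  and Lmap_inj: "inj_on (Lmap S) (polyhedron_of S)"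
  and Gamma_strip: "Gamma S \<subseteq> strip \<gamma> \<delta>"
  and cp_bij: "bij_betw cp (Gamma S) \<gamma>"
  and inv_lip: "\<exists>B. lipschitz_on B \<gamma> \<iota>"
  and normal_meas: "normal S \<in> borel_measurable (restrict_space borel (Gamma S))"
  using dsurf unfolding discrete_surface_of_def by blast+

lemma face:
  assumes "T \<in> faces S"
  shows "int CARD('n) simplex T" "\<exists>A b. linear A \<and> ref_map S T = (\<lambda>x. A x + b)"
    "ref_map S T ` R = T" "lagrange_interpolatory k T (Lmap S)"
  using dsurf assms unfolding discrete_surface_of_def by blast+

lemma normal:
  assumes "T \<in> faces S" "s \<in> K"
  shows "norm (normal S (F T s)) = 1"
    "normal S (F T s) \<bullet> frechet_derivative (F T) (at s within R) \<xi> = 0"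
  using dsurf assms unfolding discrete_surface_of_def by blast+

lemma finite_faces: "finite (faces S)"
  using triang by (simp add: triangulation_def)

lemma at_K: "s \<in> K \<Longrightarrow> at s within R = at s"
  by (rule at_within_interior)

lemma K_subset: "K \<subseteq> R" by (rule interior_subset)

lemma elem_map_smooth:
  assumes "T \<in> faces S"
  obtains G where "smooth_on G UNIV" "\<And>s. s \<in> R \<Longrightarrow> F T s = G s"
proof -
  obtain G where G: "smooth_on G UNIV" "\<And>x. x \<in> T \<Longrightarrow> Lmap S x = G x"
    by (rule lagrange_interpolatory_smooth[OF face(4)[OF assms]]) (rule that)
  obtain A b where A: "linear A" "ref_map S T = (\<lambda>x. A x + b)" using face(2)[OF assms] by blast
  have "smooth_on (\<lambda>s. A s + b) UNIV"
    using A(1) by (intro smooth_on_add[OF open_UNIV] smooth_on_const[OF open_UNIV] smooth_on_bounded_linear[OF _ open_UNIV])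
      (simp add: linear_conv_bounded_linear)
  then have "smooth_on (\<lambda>s. G (A s + b)) UNIV"
    by (rule smooth_on_compose[OF open_UNIV subset_UNIV _ G(1)])
  moreover have "F T s = G (A s + b)" if "s \<in> R" for s
    using G(2)[of "ref_map S T s"] face(3)[OF assms] that A(2) by (auto simp: elem_map_def)
  ultimately show ?thesis by (rule that)
qed

lemma smooth_F: "T \<in> faces S \<Longrightarrow> smooth_on (F T) K"
proof -
  assume T: "T \<in> faces S"
  obtain G where G: "smooth_on G UNIV" "\<And>s. s \<in> R \<Longrightarrow> F T s = G s"
    by (rule elem_map_smooth[OF T]) (rule that)
  show ?thesis
    by (rule smooth_on_cong[OF open_interior _ smooth_on_subset[OF G(1) subset_UNIV]])
      (use G(2) K_subset in auto)
qed

lemma F_deriv: "T \<in> faces S \<Longrightarrow> s \<in> K \<Longrightarrow> (F T has_derivative DF T s) (at s)"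
  by (rule smooth_on_has_derivative[OF smooth_F])

lemma linear_DF: "T \<in> faces S \<Longrightarrow> s \<in> K \<Longrightarrow> linear (DF T s)"
  by (rule has_derivative_linear[OF F_deriv])

lemma cont_F: "T \<in> faces S \<Longrightarrow> continuous_on R (F T)"
proof -
  assume T: "T \<in> faces S"
  obtain G where G: "smooth_on G UNIV" "\<And>s. s \<in> R \<Longrightarrow> F T s = G s"
    by (rule elem_map_smooth[OF T]) (rule that)
  show ?thesis
    using continuous_on_subset[OF smooth_on_imp_continuous_on[OF G(1)] subset_UNIV, of R] G(2)
    by (simp cong: continuous_on_cong)
qed

lemma F_image: "T \<in> faces S \<Longrightarrow> F T ` R = Lmap S ` T"
  by (simp only: elem_map_def image_comp[symmetric] face(3))

lemma F_in_Gamma: "T \<in> faces S \<Longrightarrow> s \<in> R \<Longrightarrow> F T s \<in> Gamma S"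
  unfolding Gamma_def polyhedron_of_def using F_image[of T] by blast

lemma F_in_strip: "T \<in> faces S \<Longrightarrow> s \<in> R \<Longrightarrow> F T s \<in> strip \<gamma> \<delta>"
  using F_in_Gamma Gamma_strip by blast

lemma Gamma_eq: "Gamma S = (\<Union>T\<in>faces S. F T ` R)"
  using F_image by (auto simp: Gamma_def polyhedron_of_def)

lemma compact_Gamma: "compact (Gamma S)"
  unfolding Gamma_eq
  by (intro compact_UN finite_faces compact_continuous_image cont_F compact_ref_simplex)

lemma face_subset: "T \<in> faces S \<Longrightarrow> T \<subseteq> polyhedron_of S"
  by (auto simp: polyhedron_of_def)

text \<open>A simplex of positive dimension has two points, and \<open>Lmap S\<close> separates
  them. Without this the lower shape bound would say nothing.\<close>

lemma elem_diam_pos: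
  assumes T: "T \<in> faces S"
  shows "elem_diam S T > 0"
proof -
  have ad: "aff_dim T = int CARD('n)" by (rule aff_dim_simplex[OF face(1)[OF T]])
  have "\<exists>p\<in>T. \<exists>q\<in>T. p \<noteq> q"
  proof (rule ccontr)
    assume "\<not> ?thesis"
    then have "\<exists>p. T \<subseteq> {p}" by blast
    then obtain p where "T \<subseteq> {p}" ..
    then have "aff_dim T \<le> aff_dim {p}" by (rule aff_dim_subset)
    then show False using ad by simp
  qed
  then obtain p q where pq: "p \<in> T" "q \<in> T" "p \<noteq> q" by blast
  have "Lmap S p \<noteq> Lmap S q"
    using inj_onD[OF Lmap_inj, of p q] pq face_subset[OF T] by blast
  moreover have "bounded (Lmap S ` T)"
    unfolding F_image[OF T, symmetric]
    by (rule compact_imp_bounded[OF compact_continuous_image[OF cont_F[OF T] compact_ref_simplex]])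
  then have "dist (Lmap S p) (Lmap S q) \<le> elem_diam S T"
    unfolding elem_diam_def using pq by (intro diameter_bounded_bound) auto
  ultimately show ?thesis by (metis dist_pos_lt less_le_trans)
qed

lemma rho_pos: "\<rho> > 0" using shape by (simp add: shape_bounds_def)

lemma DF_lower:
  assumes T: "T \<in> faces S" and s: "s \<in> K"
  shows "\<rho> * elem_diam S T * norm \<xi> \<le> norm (DF T s \<xi>)"
proof -
  have "s \<in> R" using s K_subset by blast
  then have "\<rho> * elem_diam S T * norm \<xi> \<le> norm (frechet_derivative (F T) (at s within R) \<xi>)"
    using shape T unfolding shape_bounds_def Let_def by blast
  then show ?thesis by (simp add: at_K[OF s])
qed

lemma DF_zero:
  assumes "T \<in> faces S" "s \<in> K" "DF T s \<xi> = 0"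
  shows "\<xi> = 0"
proof -
  have "\<rho> * elem_diam S T * norm \<xi> \<le> \<rho> * elem_diam S T * 0"
    using DF_lower[OF assms(1,2), of \<xi>] assms(3) by simp
  then have "norm \<xi> \<le> 0"
    using mult_le_cancel_left_pos[OF mult_pos_pos[OF rho_pos elem_diam_pos[OF assms(1)]]] by blast
  then show ?thesis by simp
qed

lemma inj_DF: "T \<in> faces S \<Longrightarrow> s \<in> K \<Longrightarrow> inj (DF T s)"
  unfolding linear_injective_0[OF linear_DF] using DF_zero by blast

lemma normal_DF: "T \<in> faces S \<Longrightarrow> s \<in> K \<Longrightarrow> normal S (F T s) \<bullet> DF T s \<xi> = 0"
  using normal(2)[of T s \<xi>] by (simp add: at_K)

text \<open>Along a kernel direction of the affine map the element map would be constant, against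
  the lower shape bound at an interior point.\<close>

lemma ref_map_inj:
  assumes T: "T \<in> faces S" and eq: "ref_map S T s = ref_map S T s'"
  shows "s = s'"
proof -
  obtain A b where A: "linear A" "ref_map S T = (\<lambda>x. A x + b)" using face(2)[OF T] by blast
  obtain s0 where s0: "s0 \<in> K" using interior_ref_simplex_nonempty by blast
  have z: "A (s - s') = 0" using eq A by (simp add: linear_diff)
  have c: "F T (s0 + t *\<^sub>R (s - s')) = F T s0" for t
    using z A by (simp add: elem_map_def linear_add linear_cmul)
  have "((\<lambda>t. (F T (s0 + t *\<^sub>R (s - s')) - F T s0) /\<^sub>R t) \<longlongrightarrow> DF T s0 (s - s')) (at 0)"
    by (rule has_derivative_directional[OF F_deriv[OF T s0]])
  then have "((\<lambda>t::real. 0) \<longlongrightarrow> DF T s0 (s - s')) (at 0)" by (simp add: c)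
  then have "DF T s0 (s - s') = 0" using tendsto_unique[OF _ tendsto_const] by (metis at_neq_bot)
  from DF_zero[OF T s0 this] show ?thesis by simp
qed

lemma ref_map_rel_interior:
  assumes T: "T \<in> faces S" and s: "s \<in> K"
  shows "ref_map S T s \<in> rel_interior T"
proof -
  obtain A b where A: "linear A" "ref_map S T = (\<lambda>x. A x + b)" using face(2)[OF T] by blast
  have TA: "T = (\<lambda>x. b + x) ` (A ` R)"
    using face(3)[OF T] A(2) by (simp add: image_comp o_def add.commute)
  have "rel_interior T = (\<lambda>x. b + x) ` (A ` K)"
    unfolding TA rel_interior_translation
    by (simp add: rel_interior_convex_linear_image[OF A(1) convex_ref_simplex, symmetric]
        rel_interior_nonempty_interior[OF interior_ref_simplex_nonempty])
  then show ?thesis using s A(2) by (auto simp: add.commute)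
qed

lemma Phi_eq_imp:
  assumes T: "T \<in> faces S" "T' \<in> faces S" and s: "s \<in> R" "s' \<in> R" and eq: "\<Phi> T s = \<Phi> T' s'"
  shows "ref_map S T s = ref_map S T' s'"
proof -
  have "F T s = F T' s'"
    using inj_onD[OF bij_betw_imp_inj_on[OF cp_bij] eq] F_in_Gamma T s by blast
  then have "Lmap S (ref_map S T s) = Lmap S (ref_map S T' s')" by (simp add: elem_map_def)
  then show ?thesis
    by (rule inj_onD[OF Lmap_inj]) (use face(3) face_subset T s in blast)+
qed

lemma Phi_inj: "T \<in> faces S \<Longrightarrow> inj_on (\<Phi> T) R"
  using Phi_eq_imp ref_map_inj by (meson inj_onI)

text \<open>A common point would lie in the relative interior of both simplices. Their intersection
  is a face of each, and a face that meets the relative interior is the whole simplex.\<close>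

lemma Phi_disjoint:
  assumes T: "T \<in> faces S" "T' \<in> faces S" "T \<noteq> T'"
  shows "\<Phi> T ` K \<inter> \<Phi> T' ` K = {}"
proof (rule ccontr)
  assume "\<not> ?thesis"
  then obtain s s' where s: "s \<in> K" "s' \<in> K" "\<Phi> T s = \<Phi> T' s'" by auto
  let ?p = "ref_map S T s"
  have p: "?p = ref_map S T' s'"
    by (rule Phi_eq_imp[OF T(1,2) _ _ s(3)]) (use s K_subset in auto)
  have r: "?p \<in> rel_interior T" "?p \<in> rel_interior T'"
    using ref_map_rel_interior[OF T(1) s(1)] ref_map_rel_interior[OF T(2) s(2)] p by auto
  then have pi: "?p \<in> T \<inter> T'" using rel_interior_subset by blast
  have f: "T \<inter> T' face_of T" "T' \<inter> T face_of T'"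
    using triang T unfolding triangulation_def by blast+
  have "T \<inter> T' = T" using face_of_disjoint_rel_interior[OF f(1)] r(1) pi by blast
  moreover have "T' \<inter> T = T'" using face_of_disjoint_rel_interior[OF f(2)] r(2) pi by blast
  ultimately show False using T(3) by blast
qed

lemma gamma_eq: "\<gamma> = (\<Union>T\<in>faces S. \<Phi> T ` R)"
proof -
  have "\<gamma> = cp ` Gamma S" using bij_betw_imp_surj_on[OF cp_bij] by simp
  then show ?thesis unfolding Gamma_eq by (simp add: image_UN image_comp o_def)
qed

lemma iota_cp: "x \<in> Gamma S \<Longrightarrow> \<iota> (cp x) = x"
  by (rule inv_into_f_f[OF bij_betw_imp_inj_on[OF cp_bij]])

lemma iota_in: "y \<in> \<gamma> \<Longrightarrow> \<iota> y \<in> Gamma S"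
  using bij_betw_imp_surj_on[OF cp_bij] by (intro inv_into_into) simp

lemma smooth_Phi: "T \<in> faces S \<Longrightarrow> smooth_on (\<Phi> T) K"
  by (rule smooth_on_compose[OF open_interior _ smooth_F smooth_cp]) (use F_in_strip K_subset in blast)+

lemma DPhi:
  assumes T: "T \<in> faces S" and s: "s \<in> K"
  shows "frechet_derivative (\<Phi> T) (at s) \<xi> = Dcp (F T s) (DF T s \<xi>)"
proof -
  have "F T s \<in> strip \<gamma> \<delta>" using F_in_strip[OF T] s K_subset by blast
  from has_derivative_compose[OF F_deriv[OF T s] smooth_on_has_derivative[OF smooth_cp this]]
  have "(\<Phi> T has_derivative (\<lambda>\<xi>. Dcp (F T s) (DF T s \<xi>))) (at s)" .
  from fun_cong[OF frechet_derivative_at[OF this], of \<xi>] show ?thesis by simp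
qed

lemma Phi_deriv: "T \<in> faces S \<Longrightarrow> s \<in> K \<Longrightarrow> (\<Phi> T has_derivative frechet_derivative (\<Phi> T) (at s)) (at s)"
  by (rule smooth_on_has_derivative[OF smooth_Phi])

text \<open>The constant stems from the Lipschitz bound of the inverse projection and so depends on
  the mesh; it serves injectivity, integrability and null sets.\<close>

lemma Dcp_lower:
  obtains c where "c > 0"
    "\<And>T s \<xi>. T \<in> faces S \<Longrightarrow> s \<in> K \<Longrightarrow> c * norm (DF T s \<xi>) \<le> norm (frechet_derivative (\<Phi> T) (at s) \<xi>)"
proof -
  obtain B where B: "lipschitz_on B \<gamma> \<iota>" using inv_lip by blast
  \<comment> \<open>A Lipschitz constant may be zero; it is enlarged in order to be
    inverted.\<close>
  define B' where "B' = B + 1"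
  have B': "B' > 0" "B \<le> B'" using lipschitz_on_nonneg[OF B] by (auto simp: B'_def)
  have "norm (DF T s \<xi>) \<le> B' * norm (frechet_derivative (\<Phi> T) (at s) \<xi>)" if T: "T \<in> faces S" and s: "s \<in> K" for T s \<xi>
  proof (rule derivative_norm_le[OF F_deriv[OF T s] Phi_deriv[OF T s] open_interior s])
    fix z assume z: "z \<in> K"
    have g: "F T z \<in> Gamma S" "F T s \<in> Gamma S" using F_in_Gamma[OF T] z s K_subset by blast+
    have "dist (\<iota> (\<Phi> T z)) (\<iota> (\<Phi> T s)) \<le> B * dist (\<Phi> T z) (\<Phi> T s)"
      by (rule lipschitz_onD[OF B cp_in cp_in])
    also have "\<dots> \<le> B' * dist (\<Phi> T z) (\<Phi> T s)"
      by (rule mult_right_mono[OF B'(2)]) simp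
    finally show "norm (F T z - F T s) \<le> B' * norm (\<Phi> T z - \<Phi> T s)"
      by (simp add: iota_cp[OF g(1)] iota_cp[OF g(2)] dist_norm)
  qed
  then show ?thesis using B'(1) by (intro that[of "inverse B'"]) (auto simp: field_simps)
qed

lemma Dcp_upper:
  obtains C where "C > 0"
    "\<And>x \<xi>. x \<in> Gamma S \<Longrightarrow> norm (Dcp x \<xi>) \<le> C * norm \<xi>"
  by (rule smooth_on_bounded_derivative[OF smooth_cp compact_Gamma Gamma_strip]) (rule that)

lemma inj_DPhi:
  assumes T: "T \<in> faces S" and s: "s \<in> K"
  shows "inj (frechet_derivative (\<Phi> T) (at s))"
proof -
  obtain c where c: "c > 0" "\<And>T s \<xi>. T \<in> faces S \<Longrightarrow> s \<in> K \<Longrightarrow> c * norm (DF T s \<xi>) \<le> norm (frechet_derivative (\<Phi> T) (at s) \<xi>)"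
    by (rule Dcp_lower) (rule that)
  have lin: "linear (frechet_derivative (\<Phi> T) (at s))"
    by (rule has_derivative_linear[OF Phi_deriv[OF T s]])
  show ?thesis
    unfolding linear_injective_0[OF lin]
  proof (intro allI impI)
    fix \<xi> assume z: "frechet_derivative (\<Phi> T) (at s) \<xi> = 0"
    have "c * norm (DF T s \<xi>) \<le> 0" using c(2)[OF T s, of \<xi>] unfolding z by simp
    then have "DF T s \<xi> = 0" using c(1) by (simp add: mult_le_0_iff)
    then show "\<xi> = 0" by (rule DF_zero[OF T s])
  qed
qed

lemma cont_Phi: "T \<in> faces S \<Longrightarrow> continuous_on R (\<Phi> T)"
  by (rule continuous_on_compose2[OF smooth_on_imp_continuous_on[OF smooth_cp] cont_F])
    (use F_in_strip in blast)+

text \<open>In a chart of \<open>\<gamma>\<close> the map \<open>\<Phi> T\<close> becomes a continuous injection between open subsets of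
  \<open>\<real>\<^sup>n\<close>, so invariance of domain applies.\<close>

lemma openin_Phi:
  assumes T: "T \<in> faces S"
  shows "openin (top_of_set \<gamma>) (\<Phi> T ` K)"
proof (subst openin_subopen, intro ballI)
  fix y assume "y \<in> \<Phi> T ` K"
  then obtain s0 where s0: "s0 \<in> K" "y = \<Phi> T s0" by blast
  obtain f :: "real^'n \<Rightarrow> real^'m" and U where f: "local_param \<gamma> f U" "y \<in> f ` U"
    using charts[of y] cp_in s0(2) by blast
  have U: "open U" "openin (top_of_set \<gamma>) (f ` U)" "smooth_on f U" using f(1) by (auto simp: local_param_def)
  obtain g where g: "homeomorphism U (f ` U) f g" using f(1) unfolding local_param_def by blast
  define Q where "Q = K \<inter> \<Phi> T -` (f ` U)"
  obtain W where W: "open W" "f ` U = \<gamma> \<inter> W" using U(2) by (auto simp: openin_open)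
  have cK: "continuous_on K (\<Phi> T)" using continuous_on_subset[OF cont_Phi[OF T] K_subset] .
  have "Q = K \<inter> \<Phi> T -` W" unfolding Q_def W(2) using cp_in by auto
  then have oQ: "open Q" using continuous_open_preimage[OF cK open_interior W(1)] by simp
  have QK: "Q \<subseteq> K" and QU: "\<Phi> T ` Q \<subseteq> f ` U" by (auto simp: Q_def)
  have "continuous_on Q (\<lambda>s. g (\<Phi> T s))"
    by (rule continuous_on_compose2[OF homeomorphism_cont2[OF g] continuous_on_subset[OF cK QK] QU])
  moreover have "inj_on (\<lambda>s. g (\<Phi> T s)) Q"
  proof (rule inj_onI)
    fix s s' assume s: "s \<in> Q" "s' \<in> Q" "g (\<Phi> T s) = g (\<Phi> T s')"
    then have "f (g (\<Phi> T s)) = f (g (\<Phi> T s'))" by simp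
    then have "\<Phi> T s = \<Phi> T s'"
      using homeomorphism_apply2[OF g] QU s(1,2) by (metis image_subset_iff)
    then show "s = s'"
      by (rule inj_onD[OF Phi_inj[OF T]]) (use s QK K_subset in auto)
  qed
  ultimately have oV: "open ((\<lambda>s. g (\<Phi> T s)) ` Q)"
    by (rule invariance_of_domain[OF _ oQ])
  have VU: "(\<lambda>s. g (\<Phi> T s)) ` Q \<subseteq> U" using QU homeomorphism_image2[OF g] by blast
  have "openin (top_of_set U) ((\<lambda>s. g (\<Phi> T s)) ` Q)" using oV VU by (simp add: open_subset)
  then have "openin (top_of_set (f ` U)) (f ` ((\<lambda>s. g (\<Phi> T s)) ` Q))"
    by (rule homeomorphism_imp_open_map[OF g])
  moreover have "f ` ((\<lambda>s. g (\<Phi> T s)) ` Q) = \<Phi> T ` Q"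
    unfolding image_image by (rule image_cong[OF refl]) (use homeomorphism_apply2[OF g] QU in blast)
  ultimately have "openin (top_of_set \<gamma>) (\<Phi> T ` Q)" using openin_trans[OF _ U(2)] by simp
  moreover have "y \<in> \<Phi> T ` Q" using s0 f(2) by (auto simp: Q_def)
  moreover have "\<Phi> T ` Q \<subseteq> \<Phi> T ` K" using QK by (rule image_mono)
  ultimately show "\<exists>V. openin (top_of_set \<gamma>) V \<and> y \<in> V \<and> V \<subseteq> \<Phi> T ` K" by blast
qed

text \<open>Lifted elements are thus admissible charts of \<gamma>, and
  \<open>surface_measure\<close> evaluates \<sigma> on them directly. The inverse is continuous
  because it is so on the image of the compact closed simplex.\<close>

lemma local_param_Phi:
  assumes T: "T \<in> faces S"
  shows "local_param \<gamma> (\<Phi> T) K"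
proof -
  obtain g where "homeomorphism R (\<Phi> T ` R) (\<Phi> T) g"
    using homeomorphism_compact[OF compact_ref_simplex cont_Phi[OF T] refl Phi_inj[OF T]] by blast
  then have "homeomorphism K (\<Phi> T ` K) (\<Phi> T) g"
    by (rule homeomorphism_of_subsets[OF _ K_subset _ refl]) (use image_mono[OF K_subset] in blast)
  then show ?thesis
    unfolding local_param_def
    using smooth_Phi[OF T] inj_DPhi[OF T] openin_Phi[OF T] by blast
qed

lemma space_sigma: "space \<sigma> = \<gamma>" and sets_sigma: "sets \<sigma> = sets (restrict_space borel \<gamma>)"
  using surf by (auto simp: surface_measure_def)

lemma emeasure_sigma:
  fixes f :: "real^'n \<Rightarrow> real^'m"
  assumes "local_param \<gamma> f U" "B \<in> sets borel"
  shows "emeasure \<sigma> (f ` U \<inter> B) =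
    (\<integral>\<^sup>+x. indicator U x * indicator B (f x) * ennreal (area_density U f x) \<partial>lborel)"
  using surf assms unfolding surface_measure_def by blast

lemma sets_sigma_iff: "A \<in> sets \<sigma> \<longleftrightarrow> A \<in> sets borel \<and> A \<subseteq> \<gamma>"
proof -
  have "\<gamma> \<in> sets borel" using compact_\<gamma> by (simp add: borel_compact)
  then show ?thesis unfolding sets_sigma by (subst sets_restrict_space_iff) auto
qed

lemma openin_gamma_sets: "openin (top_of_set \<gamma>) V \<Longrightarrow> V \<in> sets borel"
  using compact_\<gamma> by (auto simp: openin_open borel_compact intro!: sets.Int)

section \<open>The skeleton of the lifted mesh is a null set\<close>

text \<open>Read in a chart, the skeleton is the image of the null set \<open>R - K\<close> under a
  Lipschitz map between spaces of equal dimension: the chart expands distances locally, so its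
  inverse after \<open>\<Phi> T\<close> is Lipschitz.\<close>

lemma skeleton_negligible:
  fixes f :: "real^'n \<Rightarrow> real^'m"
  assumes T: "T \<in> faces S" and f: "local_param \<gamma> f U"
  shows "negligible {x \<in> U. f x \<in> \<Phi> T ` (R - K)}"
proof (rule iffD2[OF locally_negligible_alt], intro ballI)
  let ?E = "{x \<in> U. f x \<in> \<Phi> T ` (R - K)}"
  fix x0 assume x0: "x0 \<in> ?E"
  have U: "open U" "smooth_on f U" "\<And>x. x \<in> U \<Longrightarrow> inj (frechet_derivative f (at x))"
    using f by (auto simp: local_param_def)
  have xU: "x0 \<in> U" using x0 by blast
  obtain r c where rc: "r > 0" "c > 0" "ball x0 r \<subseteq> U"
    "\<And>x y. x \<in> ball x0 r \<Longrightarrow> y \<in> ball x0 r \<Longrightarrow> c * norm (x - y) \<le> norm (f x - f y)"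
    by (rule immersion_locally_expanding[OF U(1) xU U(2) U(3)[OF xU]]) (rule that)
  obtain G where G: "smooth_on G UNIV" "\<And>s. s \<in> R \<Longrightarrow> F T s = G s"
    by (rule elem_map_smooth[OF T]) (rule that)
  define Q where "Q = G -` strip \<gamma> \<delta>"
  have oQ: "open Q"
    unfolding Q_def using continuous_open_preimage[OF smooth_on_imp_continuous_on[OF G(1)] open_UNIV open_strip] by simp
  have RQ: "R \<subseteq> Q" using G(2) F_in_strip[OF T] by (auto simp: Q_def)
  have "smooth_on (\<lambda>s. cp (G s)) Q"
    by (rule smooth_on_compose[OF oQ _ smooth_on_subset[OF G(1) subset_UNIV] smooth_cp]) (auto simp: Q_def)
  then obtain L where L: "L-lipschitz_on R (\<lambda>s. cp (G s))"
    by (rule smooth_on_lipschitz_convex[OF _ compact_ref_simplex convex_ref_simplex RQ]) (rule that)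
  define Z where "Z = {s \<in> R - K. \<Phi> T s \<in> f ` ball x0 r}"
  define g where "g s = inv_into (ball x0 r) f (\<Phi> T s)" for s
  have g: "g s \<in> ball x0 r" "f (g s) = \<Phi> T s" if "s \<in> Z" for s
    using that inv_into_into[of "\<Phi> T s" f "ball x0 r"] f_inv_into_f[of "\<Phi> T s" f "ball x0 r"]
    by (auto simp: Z_def g_def)
  have "negligible (R - K)"
    using negligible_subset[OF negligible_convex_frontier[OF convex_ref_simplex]]
    by (metis Diff_mono closure_subset frontier_def order_refl)
  then have nZ: "negligible Z" by (rule negligible_subset) (auto simp: Z_def)
  have gl: "norm (g s - g s') \<le> (L / c) * norm (s - s')" if s: "s \<in> Z" "s' \<in> Z" for s s'
  proof -
    have sR: "s \<in> R" "s' \<in> R" using s by (auto simp: Z_def)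
    have "c * norm (g s - g s') \<le> norm (\<Phi> T s - \<Phi> T s')"
      using rc(4)[OF g(1)[OF s(1)] g(1)[OF s(2)]] by (simp add: g(2)[OF s(1)] g(2)[OF s(2)])
    also have "\<dots> \<le> L * norm (s - s')"
      using lipschitz_onD[OF L sR] by (simp add: G(2)[OF sR(1)] G(2)[OF sR(2)] dist_norm)
    finally show ?thesis using rc(2) by (simp add: field_simps)
  qed
  have "negligible (g ` Z)"
  proof (rule negligible_locally_Lipschitz_image[OF _ nZ])
    fix s assume "s \<in> Z"
    then show "\<exists>V B. open V \<and> s \<in> V \<and> (\<forall>y\<in>Z \<inter> V. norm (g y - g s) \<le> B * norm (y - s))"
      using gl by (intro exI[of _ UNIV] exI[of _ "L / c"]) auto
  qed simp
  moreover have "?E \<inter> ball x0 r \<subseteq> g ` Z"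
  proof
    fix x assume x: "x \<in> ?E \<inter> ball x0 r"
    then obtain s where s: "s \<in> R - K" "f x = \<Phi> T s" by auto
    have sZ: "s \<in> Z" using s x by (auto simp: Z_def intro: rev_image_eqI)
    have "c * norm (g s - x) \<le> 0"
      using rc(4)[OF g(1)[OF sZ], of x] x g(2)[OF sZ] s(2) by simp
    then have "g s = x" using rc(2) by (simp add: mult_le_0_iff)
    then show "x \<in> g ` Z" using sZ by blast
  qed
  ultimately have "negligible (?E \<inter> ball x0 r)" by (rule negligible_subset)
  moreover have "openin (top_of_set ?E) (?E \<inter> ball x0 r)" by (simp add: openin_open_Int)
  moreover have "x0 \<in> ?E \<inter> ball x0 r" using x0 rc(1) by simp
  ultimately show "\<exists>V. openin (top_of_set ?E) V \<and> x0 \<in> V \<and> negligible V" by blast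
qed

text \<open>\<sigma> is known through charts only; compactness of \<gamma> reduces the claim to
  finitely many of them.\<close>

lemma skeleton_null:
  assumes T: "T \<in> faces S"
  shows "\<Phi> T ` (R - K) \<in> null_sets \<sigma>"
proof -
  let ?Z = "\<Phi> T ` (R - K)"
  have cZ: "compact ?Z"
    by (rule compact_continuous_image[OF continuous_on_subset[OF cont_Phi[OF T]] compact_diff[OF compact_ref_simplex open_interior]]) auto
  then have Zb: "?Z \<in> sets borel" by (rule borel_compact)
  have Zg: "?Z \<subseteq> \<gamma>" using cp_in by blast
  let ?C = "{V. openin (top_of_set \<gamma>) V \<and> V \<inter> ?Z \<in> null_sets \<sigma>}"
  have "\<exists>V\<in>?C. p \<in> V" if p: "p \<in> \<gamma>" for p
  proof -
    obtain f :: "real^'n \<Rightarrow> real^'m" and U where f: "local_param \<gamma> f U" "p \<in> f ` U"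
      using charts[OF p] by blast
    have o: "openin (top_of_set \<gamma>) (f ` U)" using f(1) by (simp add: local_param_def)
    have "{x \<in> U. f x \<in> ?Z} \<in> null_sets lebesgue"
      using skeleton_negligible[OF T f(1)] by (simp add: negligible_iff_null_sets)
    then have "AE x in lebesgue. x \<notin> {x \<in> U. f x \<in> ?Z}" by (rule AE_not_in)
    then have ae: "AE x in lborel. x \<notin> {x \<in> U. f x \<in> ?Z}" by (simp only: AE_completion_iff)
    have "emeasure \<sigma> (f ` U \<inter> ?Z) = (\<integral>\<^sup>+x. indicator U x * indicator ?Z (f x) * ennreal (area_density U f x) \<partial>lborel)"
      by (rule emeasure_sigma[OF f(1) Zb])
    also have "\<dots> = (\<integral>\<^sup>+x. 0 \<partial>(lborel :: (real^'n) measure))"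
      by (rule nn_integral_cong_AE) (use ae in eventually_elim, auto simp: indicator_def)
    finally have "emeasure \<sigma> (f ` U \<inter> ?Z) = 0" by simp
    moreover have "f ` U \<inter> ?Z \<in> sets \<sigma>"
      unfolding sets_sigma_iff using openin_gamma_sets[OF o] Zb Zg by auto
    ultimately show ?thesis using o f(2) by blast
  qed
  then have "\<gamma> \<subseteq> \<Union>?C" by blast
  moreover have "\<forall>V\<in>?C. openin (top_of_set \<gamma>) V" by blast
  ultimately obtain D where D: "D \<subseteq> ?C" "finite D" "\<gamma> \<subseteq> \<Union>D"
    using iffD1[OF compact_eq_openin_cover compact_\<gamma>, THEN spec, of ?C] by blast
  have "(\<Union>V\<in>D. V \<inter> ?Z) \<in> null_sets \<sigma>"
    using D(1,2) by (intro null_sets_UN' countable_finite) auto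
  moreover have "(\<Union>V\<in>D. V \<inter> ?Z) = ?Z" using D(3) Zg by blast
  ultimately show ?thesis by simp
qed

end

section \<open>The measure of the approximate surface\<close>

lemma nn_integral_ge_cmult_measure:
  fixes f :: "'a \<Rightarrow> ennreal"
  assumes sets: "sets M = sets N" and le: "\<And>A. A \<in> sets M \<Longrightarrow> ennreal c * emeasure M A \<le> emeasure N A"
    and f: "f \<in> borel_measurable M"
  shows "ennreal c * (\<integral>\<^sup>+x. f x \<partial>M) \<le> (\<integral>\<^sup>+x. f x \<partial>N)"
proof -
  have "scale_measure (ennreal c) M \<le> N"
    using sets le by (subst le_measure) auto
  then have "(\<integral>\<^sup>+x. f x \<partial>scale_measure (ennreal c) M) \<le> (\<integral>\<^sup>+x. f x \<partial>N)"
    using sets by (intro nn_integral_mono_measure) auto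
  then show ?thesis using f by (simp add: nn_integral_scale_measure)
qed

lemma nn_integral_le_cmult_measure:
  fixes f :: "'a \<Rightarrow> ennreal"
  assumes sets: "sets M = sets N" and le: "\<And>A. A \<in> sets M \<Longrightarrow> emeasure M A \<le> ennreal c * emeasure N A"
    and f: "f \<in> borel_measurable M"
  shows "(\<integral>\<^sup>+x. f x \<partial>M) \<le> ennreal c * (\<integral>\<^sup>+x. f x \<partial>N)"
proof -
  have "M \<le> scale_measure (ennreal c) N"
    using sets le by (subst le_measure) auto
  then have "(\<integral>\<^sup>+x. f x \<partial>M) \<le> (\<integral>\<^sup>+x. f x \<partial>scale_measure (ennreal c) N)"
    using sets by (intro nn_integral_mono_measure) auto
  moreover have "f \<in> borel_measurable N" using f sets by (simp cong: measurable_cong_sets)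
  ultimately show ?thesis by (simp add: nn_integral_scale_measure)
qed

context lifted_mesh
begin

abbreviation JF :: "(real^'m) set \<Rightarrow> real^'n \<Rightarrow> real" where
  "JF T s \<equiv> sqrt (det (gram (DF T s)))"
abbreviation JP :: "(real^'m) set \<Rightarrow> real^'n \<Rightarrow> real" where
  "JP T s \<equiv> sqrt (det (gram (frechet_derivative (\<Phi> T) (at s))))"
abbreviation \<Sigma> :: "(real^'m) measure" where "\<Sigma> \<equiv> Gamma_measure S"
abbreviation \<Gamma>b :: "(real^'m) measure" where "\<Gamma>b \<equiv> restrict_space borel (Gamma S)"

lemma JF_pos: "T \<in> faces S \<Longrightarrow> s \<in> K \<Longrightarrow> 0 < JF T s"
  using det_gram_pos[OF linear_DF inj_DF] by simp

lemma continuous_on_det_gram: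
  assumes "\<And>\<xi>. continuous_on A (\<lambda>s. D s \<xi>)"
  shows "continuous_on A (\<lambda>s. det (gram (D s :: real^'n \<Rightarrow> real^'m)))"
  unfolding det_def gram_def using assms by (simp add: continuous_intros)

lemma cont_JF: "T \<in> faces S \<Longrightarrow> continuous_on K (JF T)"
  by (intro continuous_on_real_sqrt continuous_on_det_gram smooth_on_imp_continuous_on
      smooth_on_frechet_derivative smooth_F)

lemma K_sets: "K \<in> sets borel" by simp

lemma Gamma_borel: "Gamma S \<in> sets borel" using compact_Gamma by (rule borel_compact)

lemma sets_Gammab: "A \<in> sets \<Gamma>b \<longleftrightarrow> A \<in> sets borel \<and> A \<subseteq> Gamma S"
  using Gamma_borel by (subst sets_restrict_space_iff) auto

lemma gamma_nonempty_Gamma: "Gamma S \<noteq> {}"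
  using nonempty bij_betw_imp_surj_on[OF cp_bij] by auto

text \<open>The constant value off \<open>K\<close> is junk.\<close>

definition FK :: "(real^'m) set \<Rightarrow> real^'n \<Rightarrow> real^'m" where
  "FK T s = (if s \<in> K then F T s else (SOME x. x \<in> Gamma S))"

text \<open>As the image of a density, the contribution of a single face is a genuine measure, and
  countable additivity of their sum comes for free.\<close>

definition face_measure :: "(real^'m) set \<Rightarrow> (real^'m) measure" where
  "face_measure T = distr (density lborel (\<lambda>s. indicator K s * ennreal (JF T s))) \<Gamma>b (FK T)"

lemma FK_measurable:
  assumes T: "T \<in> faces S"
  shows "FK T \<in> measurable borel \<Gamma>b"
proof (rule measurable_restrict_space2)
  have "(SOME x. x \<in> Gamma S) \<in> Gamma S" using gamma_nonempty_Gamma by (simp add: some_in_eq)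
  then show "FK T \<in> space borel \<rightarrow> Gamma S"
    using F_in_Gamma[OF T] K_subset by (auto simp: FK_def)
  have "F T \<in> borel_measurable (restrict_space borel K)"
    by (rule borel_measurable_continuous_on_restrict[OF continuous_on_subset[OF cont_F[OF T] K_subset]])
  then show "FK T \<in> borel_measurable borel"
    unfolding FK_def[abs_def] using K_sets
    by (intro measurable_If_restrict_space_iff[THEN iffD2]) auto
qed

lemma JF_measurable:
  assumes T: "T \<in> faces S"
  shows "(\<lambda>s. indicator K s * ennreal (JF T s)) \<in> borel_measurable borel"
proof -
  have "(\<lambda>s. indicator K s *\<^sub>R JF T s) \<in> borel_measurable borel"
    using borel_measurable_continuous_on_restrict[OF cont_JF[OF T]] borel_measurable_restrict_space_iff[of K borel "JF T"] K_sets by simp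
  then have "(\<lambda>s. ennreal (indicator K s *\<^sub>R JF T s)) \<in> borel_measurable borel" by simp
  moreover have "(\<lambda>s. ennreal (indicator K s *\<^sub>R JF T s)) = (\<lambda>s. indicator K s * ennreal (JF T s))"
    by (auto simp: fun_eq_iff indicator_def)
  ultimately show ?thesis by simp
qed

lemma nn_integral_face_measure:
  assumes T: "T \<in> faces S" and f: "f \<in> borel_measurable \<Gamma>b"
  shows "(\<integral>\<^sup>+x. f x \<partial>face_measure T) = (\<integral>\<^sup>+s. indicator K s * f (F T s) * ennreal (JF T s) \<partial>lborel)"
proof -
  have m: "FK T \<in> measurable (density lborel (\<lambda>s. indicator K s * ennreal (JF T s))) \<Gamma>b"
    using FK_measurable[OF T] by simp
  have fm: "(\<lambda>s. f (FK T s)) \<in> borel_measurable lborel"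
    using measurable_compose[OF FK_measurable[OF T] f] by simp
  have "(\<integral>\<^sup>+x. f x \<partial>face_measure T) = (\<integral>\<^sup>+s. f (FK T s) \<partial>density lborel (\<lambda>s. indicator K s * ennreal (JF T s)))"
    unfolding face_measure_def by (rule nn_integral_distr[OF m]) (use f in simp)
  also have "\<dots> = (\<integral>\<^sup>+s. (indicator K s * ennreal (JF T s)) * f (FK T s) \<partial>lborel)"
    by (rule nn_integral_density) (use JF_measurable[OF T] fm in simp_all)
  also have "\<dots> = (\<integral>\<^sup>+s. indicator K s * f (F T s) * ennreal (JF T s) \<partial>lborel)"
    by (rule nn_integral_cong) (auto simp: FK_def indicator_def mult.commute)
  finally show ?thesis .
qed

lemma emeasure_face_measure:
  assumes T: "T \<in> faces S" and B: "B \<in> sets \<Gamma>b"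
  shows "emeasure (face_measure T) B = (\<integral>\<^sup>+s. indicator K s * indicator B (F T s) * ennreal (JF T s) \<partial>lborel)"
proof -
  have "B \<in> sets (face_measure T)" using B by (simp add: face_measure_def)
  then have "emeasure (face_measure T) B = (\<integral>\<^sup>+x. indicator B x \<partial>face_measure T)" by simp
  also have "\<dots> = (\<integral>\<^sup>+s. indicator K s * indicator B (F T s) * ennreal (JF T s) \<partial>lborel)"
    by (rule nn_integral_face_measure[OF T]) (use B in simp)
  finally show ?thesis .
qed

lemma AE_not_boundary: "AE s in lborel. s \<notin> R - K"
proof -
  have "R - K \<subseteq> frontier R" using closure_subset[of R] by (auto simp: frontier_def)
  then have "negligible (R - K)"
    by (rule negligible_subset[OF negligible_convex_frontier[OF convex_ref_simplex]])
  then have "AE s in lebesgue. s \<notin> R - K" by (intro AE_not_in) (simp add: negligible_iff_null_sets)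
  then show ?thesis by (simp only: AE_completion_iff)
qed

text \<open>\<open>Gamma_measure\<close> integrates over the closed simplex with derivatives taken
  within it; off the null boundary these are ordinary derivatives.\<close>

lemma Gamma_measure_face:
  assumes T: "T \<in> faces S" and B: "B \<in> sets \<Gamma>b"
  shows "(\<integral>\<^sup>+s. indicator R s * indicator B (F T s) * ennreal (area_density R (F T) s) \<partial>lborel) = emeasure (face_measure T) B"
  unfolding emeasure_face_measure[OF T B]
proof (rule nn_integral_cong_AE)
  show "AE s in lborel. indicator R s * indicator B (F T s) * ennreal (area_density R (F T) s) =
      indicator K s * indicator B (F T s) * ennreal (JF T s)"
    using AE_not_boundary
  proof eventually_elim
    case (elim s)
    show ?case
    proof (cases "s \<in> K")
      case True
      then have "s \<in> R" using K_subset by blast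
      then show ?thesis using True by (simp add: area_density_eq at_K[OF True])
    next
      case False
      then have "s \<notin> R" using elim by blast
      then show ?thesis using False by simp
    qed
  qed
qed

lemma space_Sigma: "space \<Sigma> = Gamma S" and sets_Sigma: "sets \<Sigma> = sets \<Gamma>b"
proof -
  have "sets \<Gamma>b \<subseteq> Pow (Gamma S)" using sets.sets_into_space[of _ \<Gamma>b] by (auto simp: space_restrict_space)
  then show "space \<Sigma> = Gamma S" "sets \<Sigma> = sets \<Gamma>b"
    using sets.sigma_sets_eq[of \<Gamma>b] by (simp_all add: Gamma_measure_def space_measure_of_conv sets_measure_of_conv space_restrict_space)
qed

text \<open>\<open>measure_of\<close> falls back to the zero measure unless the given set function
  is countably additive; here this property is inherited from the face measures.\<close>

lemma emeasure_Sigma: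
  assumes B: "B \<in> sets \<Sigma>"
  shows "emeasure \<Sigma> B = (\<Sum>T\<in>faces S. emeasure (face_measure T) B)"
proof -
  let ?\<mu> = "\<lambda>B. \<Sum>T\<in>faces S. emeasure (face_measure T) B"
  have "sets \<Gamma>b \<subseteq> Pow (Gamma S)" using sets.sets_into_space[of _ \<Gamma>b] by (auto simp: space_restrict_space)
  then have "\<Sigma> = measure_of (Gamma S) (sets \<Gamma>b) ?\<mu>"
    unfolding Gamma_measure_def
  proof (rule measure_of_eq)
    fix B assume "B \<in> sigma_sets (Gamma S) (sets \<Gamma>b)"
    then have B: "B \<in> sets \<Gamma>b" using sets.sigma_sets_eq[of \<Gamma>b] by (simp add: space_restrict_space)
    show "(\<Sum>T\<in>faces S. \<integral>\<^sup>+x. indicator R x * indicator B (F T x) * ennreal (area_density R (F T) x) \<partial>lborel) = ?\<mu> B"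
      by (rule sum.cong[OF refl]) (rule Gamma_measure_face[OF _ B])
  qed
  then show ?thesis
  proof (rule emeasure_measure_of)
    show "sets \<Gamma>b \<subseteq> Pow (Gamma S)" by fact
    show "B \<in> sets \<Sigma>" by (rule B)
    show "positive (sets \<Sigma>) ?\<mu>" by (simp add: positive_def)
    show "countably_additive (sets \<Sigma>) ?\<mu>"
    proof (rule countably_additiveI)
      fix A :: "nat \<Rightarrow> (real^'m) set"
      assume A: "range A \<subseteq> sets \<Sigma>" "disjoint_family A"
      have "(\<Sum>i. ?\<mu> (A i)) = (\<Sum>T\<in>faces S. \<Sum>i. emeasure (face_measure T) (A i))"
        by (rule suminf_sum) simp
      also have "\<dots> = ?\<mu> (\<Union>i. A i)"
        by (rule sum.cong[OF refl], rule suminf_emeasure) (use A in \<open>simp_all add: sets_Sigma face_measure_def\<close>)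
      finally show "(\<Sum>i. ?\<mu> (A i)) = ?\<mu> (\<Union>i. A i)" .
    qed
  qed
qed

lemma face_measure_le:
  assumes T: "T \<in> faces S" and f: "f \<in> borel_measurable \<Sigma>"
  shows "(\<integral>\<^sup>+s. indicator K s * f (F T s) * ennreal (JF T s) \<partial>lborel) \<le> (\<integral>\<^sup>+x. f x \<partial>\<Sigma>)"
proof -
  have s: "sets (face_measure T) = sets \<Sigma>" by (simp add: face_measure_def sets_Sigma)
  have f': "f \<in> borel_measurable \<Gamma>b" using f sets_Sigma by (simp cong: measurable_cong_sets)
  have "emeasure (face_measure T) A \<le> emeasure \<Sigma> A" if "A \<in> sets \<Sigma>" for A
    unfolding emeasure_Sigma[OF that]
    using sum_mono2[OF finite_faces, of "{T}" "\<lambda>T. emeasure (face_measure T) A"] T by simp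
  then have "face_measure T \<le> \<Sigma>" using s by (subst le_measure) auto
  then have "(\<integral>\<^sup>+x. f x \<partial>face_measure T) \<le> (\<integral>\<^sup>+x. f x \<partial>\<Sigma>)" by (rule nn_integral_mono_measure[OF s])
  then show ?thesis by (simp only: nn_integral_face_measure[OF T f'])
qed

lemma Sigma_AE_I:
  assumes P: "{x \<in> Gamma S. \<not> P x} \<in> sets \<Sigma>"
    and AE: "\<And>T. T \<in> faces S \<Longrightarrow> AE s in lborel. s \<in> K \<longrightarrow> P (F T s)"
  shows "AE x in \<Sigma>. P x"
proof -
  let ?B = "{x \<in> Gamma S. \<not> P x}"
  have Bs: "?B \<in> sets \<Gamma>b" using P sets_Sigma by simp
  have "emeasure (face_measure T) ?B = 0" if T: "T \<in> faces S" for T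
  proof -
    have "(\<integral>\<^sup>+s. indicator K s * indicator ?B (F T s) * ennreal (JF T s) \<partial>lborel) = (\<integral>\<^sup>+s. 0 \<partial>(lborel :: (real^'n) measure))"
      by (rule nn_integral_cong_AE) (use AE[OF T] in eventually_elim, auto simp: indicator_def)
    then show ?thesis unfolding emeasure_face_measure[OF T Bs] by simp
  qed
  then have "emeasure \<Sigma> ?B = 0" unfolding emeasure_Sigma[OF P] by simp
  then show ?thesis using P by (intro AE_I[of _ _ ?B]) (auto simp: space_Sigma)
qed

text \<open>The element map agrees on the simplex with a smooth map of the whole space, whose area
  density is bounded on the compact simplex.\<close>

lemma finite_measure_Sigma: "finite_measure \<Sigma>"
proof (rule finite_measureI)
  have "emeasure (face_measure T) (Gamma S) < \<infinity>" if T: "T \<in> faces S" for T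
  proof -
    obtain G where G: "smooth_on G UNIV" "\<And>s. s \<in> R \<Longrightarrow> F T s = G s"
      by (rule elem_map_smooth[OF T]) (rule that)
    let ?DG = "\<lambda>s. frechet_derivative G (at s)"
    have eq: "DF T s = ?DG s" if s: "s \<in> K" for s
    proof -
      have "(F T has_derivative ?DG s) (at s)"
        by (rule has_derivative_transform_within_open[OF smooth_on_has_derivative[OF G(1) UNIV_I] open_interior s])
          (use G(2) K_subset in auto)
      then show ?thesis by (rule frechet_derivative_at[symmetric])
    qed
    have c: "continuous_on R (\<lambda>s. sqrt (det (gram (?DG s))))"
      by (intro continuous_on_real_sqrt continuous_on_det_gram continuous_on_subset[OF
            smooth_on_imp_continuous_on[OF smooth_on_frechet_derivative[OF G(1)]] subset_UNIV])
    obtain M where M: "\<forall>y\<in>(\<lambda>s. sqrt (det (gram (?DG s)))) ` R. norm y \<le> M"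
      using compact_imp_bounded[OF compact_continuous_image[OF c compact_ref_simplex]]
      unfolding bounded_iff by (rule exE)
    have Gb: "Gamma S \<in> sets \<Gamma>b" using sets_Gammab Gamma_borel by simp
    have "emeasure (face_measure T) (Gamma S) \<le> (\<integral>\<^sup>+s. ennreal M * indicator R s \<partial>(lborel :: (real^'n) measure))"
      unfolding emeasure_face_measure[OF T Gb]
    proof (rule nn_integral_mono)
      fix s
      show "indicator K s * indicator (Gamma S) (F T s) * ennreal (JF T s) \<le> ennreal M * indicator R s"
      proof (cases "s \<in> K")
        case True
        then have sR: "s \<in> R" using K_subset by blast
        have "JF T s \<le> M" using M sR eq[OF True] by (metis abs_le_D1 image_eqI real_norm_def)
        then show ?thesis using True sR by (simp add: indicator_def ennreal_leI)
      qed simp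
    qed
    also have "\<dots> = ennreal M * emeasure lborel R"
      by (rule nn_integral_cmult_indicator) (simp add: borel_compact compact_ref_simplex)
    also have "\<dots> < \<infinity>"
      using emeasure_bounded_finite[OF compact_imp_bounded[OF compact_ref_simplex[where 'n = 'n]]]
      by (simp add: ennreal_mult_less_top)
    finally show ?thesis .
  qed
  moreover have "Gamma S \<in> sets \<Sigma>" using sets_Sigma sets_Gammab Gamma_borel by simp
  ultimately show "emeasure \<Sigma> (space \<Sigma>) \<noteq> \<infinity>"
    using emeasure_Sigma[of "Gamma S"] finite_faces by (simp add: space_Sigma less_top)
qed

lemma surface_space_Sigma: "surface_space \<Sigma> (Gamma S) (normal S)"
proof -
  interpret finite_measure \<Sigma> by (rule finite_measure_Sigma)
  have nm: "normal S \<in> borel_measurable \<Sigma>" using normal_meas sets_Sigma by (simp cong: measurable_cong_sets)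
  show ?thesis
  proof
    show "AE x in \<Sigma>. norm (normal S x) = 1"
    proof (rule Sigma_AE_I)
      have "{x \<in> space \<Sigma>. norm (normal S x) \<noteq> 1} \<in> sets \<Sigma>" using nm by measurable
      then show "{x \<in> Gamma S. norm (normal S x) \<noteq> 1} \<in> sets \<Sigma>" by (simp add: space_Sigma)
    qed (use normal(1) in simp)
  qed (use space_Sigma sets_Sigma compact_Gamma nm in auto)
qed

sublocale G: surface_space \<Sigma> "Gamma S" "normal S" by (rule surface_space_Sigma)

text \<open>The open elements carry the whole measure, and in each of them the chart argument
  applies. Consequently \<open>A_form S\<close> does not depend on the choice made by
  \<open>tgrad\<close>.\<close>

lemma tgrad_unique:
  assumes g: "weak_tgrad \<Sigma> (normal S) v g" "weak_tgrad \<Sigma> (normal S) v g'"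
  shows "AE x in \<Sigma>. g x = g' x"
proof (rule Sigma_AE_I)
  have [measurable]: "g \<in> borel_measurable \<Sigma>" "g' \<in> borel_measurable \<Sigma>"
    using G.weak_tgradD(2)[OF g(1)] G.weak_tgradD(2)[OF g(2)] by (simp_all add: square_integrable_def)
  have "{x \<in> space \<Sigma>. g x \<noteq> g' x} \<in> sets \<Sigma>" by measurable
  then show "{x \<in> Gamma S. g x \<noteq> g' x} \<in> sets \<Sigma>" by (simp add: space_Sigma)
next
  fix T assume T: "T \<in> faces S"
  show "AE s in lborel. s \<in> K \<longrightarrow> g (F T s) = g' (F T s)"
  proof (rule G.weak_tgrad_unique_patch[OF _ open_interior smooth_F[OF T] _ _ _ _ cont_JF[OF T] _ _ g])
    show "DIM(real^'m) = CARD('n) + 1" using dim by simp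
    show "F T ` K \<subseteq> Gamma S" using F_in_Gamma[OF T] K_subset by blast
  qed (use inj_DF[OF T] normal_DF[OF T] normal(1)[OF T] JF_pos[OF T] face_measure_le[OF T] in auto)
qed

section \<open>Comparison of the two surface measures\<close>

text \<open>The lifted open elements are disjoint and exhaust \<gamma> up to the null skeleton; on
  each of them the defining property of \<sigma> holds in the chart \<open>\<Phi> T\<close>.\<close>

lemma emeasure_sigma_faces:
  assumes B: "B \<in> sets \<sigma>"
  shows "emeasure \<sigma> B = (\<Sum>T\<in>faces S. \<integral>\<^sup>+s. indicator K s * indicator B (\<Phi> T s) * ennreal (JP T s) \<partial>lborel)"
proof -
  have Bb: "B \<in> sets borel" "B \<subseteq> \<gamma>" using B sets_sigma_iff by auto
  let ?A = "\<lambda>T. \<Phi> T ` K \<inter> B"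
  let ?Z = "\<Union>T\<in>faces S. \<Phi> T ` (R - K)"
  have A: "?A T \<in> sets \<sigma>" if T: "T \<in> faces S" for T
    using openin_gamma_sets[OF openin_Phi[OF T]] Bb sets_sigma_iff by auto
  have Z: "?Z \<in> null_sets \<sigma>"
    using skeleton_null finite_faces by (intro null_sets_UN' countable_finite) auto
  have UA: "(\<Union>T\<in>faces S. ?A T) \<in> sets \<sigma>" using A finite_faces by (intro sets.finite_UN) auto
  have sub1: "(\<Union>T\<in>faces S. ?A T) \<subseteq> B" by blast
  have sub2: "B \<subseteq> (\<Union>T\<in>faces S. ?A T) \<union> ?Z"
  proof
    fix y assume y: "y \<in> B"
    then have "y \<in> (\<Union>T\<in>faces S. \<Phi> T ` R)" using equalityD1[OF gamma_eq] Bb(2) by blast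
    then show "y \<in> (\<Union>T\<in>faces S. ?A T) \<union> ?Z" using y by blast
  qed
  have "emeasure \<sigma> B \<le> emeasure \<sigma> ((\<Union>T\<in>faces S. ?A T) \<union> ?Z)"
    using sub2 UA Z by (intro emeasure_mono) auto
  also have "\<dots> = emeasure \<sigma> (\<Union>T\<in>faces S. ?A T)"
    by (rule emeasure_Un_null_set[OF UA Z])
  finally have "emeasure \<sigma> B = emeasure \<sigma> (\<Union>T\<in>faces S. ?A T)"
    using emeasure_mono[OF sub1 B] by (rule order.antisym)
  also have "\<dots> = (\<Sum>T\<in>faces S. emeasure \<sigma> (?A T))"
  proof (rule sum_emeasure[symmetric])
    show "?A ` faces S \<subseteq> sets \<sigma>" using A by blast
    show "disjoint_family_on ?A (faces S)"
      unfolding disjoint_family_on_def using Phi_disjoint by blast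
  qed (rule finite_faces)
  also have "\<dots> = (\<Sum>T\<in>faces S. \<integral>\<^sup>+s. indicator K s * indicator B (\<Phi> T s) * ennreal (JP T s) \<partial>lborel)"
  proof (rule sum.cong[OF refl])
    fix T assume T: "T \<in> faces S"
    have "emeasure \<sigma> (?A T) = (\<integral>\<^sup>+s. indicator K s * indicator B (\<Phi> T s) * ennreal (area_density K (\<Phi> T) s) \<partial>lborel)"
      by (rule emeasure_sigma[OF local_param_Phi[OF T] Bb(1)])
    also have "\<dots> = (\<integral>\<^sup>+s. indicator K s * indicator B (\<Phi> T s) * ennreal (JP T s) \<partial>lborel)"
    proof (rule nn_integral_cong)
      fix s
      show "indicator K s * indicator B (\<Phi> T s) * ennreal (area_density K (\<Phi> T) s) =
          indicator K s * indicator B (\<Phi> T s) * ennreal (JP T s)"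
      proof (cases "s \<in> K")
        case True
        show ?thesis by (simp only: area_density_eq at_within_open[OF True open_interior])
      qed simp
    qed
    finally show "emeasure \<sigma> (?A T) = (\<integral>\<^sup>+s. indicator K s * indicator B (\<Phi> T s) * ennreal (JP T s) \<partial>lborel)" .
  qed
  finally show ?thesis .
qed

lemma cp_measurable: "cp \<in> measurable \<Sigma> \<sigma>"
proof -
  have "cp \<in> measurable \<Gamma>b (restrict_space borel \<gamma>)"
    by (rule measurable_restrict_space2)
      (use cp_in in \<open>auto intro!: borel_measurable_continuous_on_restrict
         continuous_on_subset[OF smooth_on_imp_continuous_on[OF smooth_cp] Gamma_strip]\<close>)
  then show ?thesis using measurable_cong_sets[OF sets_Sigma sets_sigma] by simp
qed

abbreviation \<Sigma>' :: "(real^'m) measure" where "\<Sigma>' \<equiv> distr \<Sigma> \<sigma> cp"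

text \<open>Both measures are now integrals over the same reference simplices, so the comparison
  reduces to a pointwise one between the two area densities. A distortion of lengths becomes a
  distortion of area to the power of the dimension.\<close>

lemma measure_bounds:
  assumes c: "c > 0"
    and le: "\<And>T s \<xi>. T \<in> faces S \<Longrightarrow> s \<in> K \<Longrightarrow> c * norm (DF T s \<xi>) \<le> norm (frechet_derivative (\<Phi> T) (at s) \<xi>)"
      "\<And>T s \<xi>. T \<in> faces S \<Longrightarrow> s \<in> K \<Longrightarrow> norm (frechet_derivative (\<Phi> T) (at s) \<xi>) \<le> C * norm (DF T s \<xi>)"
    and C: "C > 0" and B: "B \<in> sets \<sigma>"
  shows "ennreal (c ^ CARD('n)) * emeasure \<Sigma>' B \<le> emeasure \<sigma> B"
    and "emeasure \<sigma> B \<le> ennreal (C ^ CARD('n)) * emeasure \<Sigma>' B"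
proof -
  let ?B = "cp -` B \<inter> Gamma S"
  have Bs: "?B \<in> sets \<Sigma>" using measurable_sets[OF cp_measurable B] by (simp add: space_Sigma)
  then have Bg: "?B \<in> sets \<Gamma>b" by (simp add: sets_Sigma)
  let ?I = "\<lambda>T s. indicator K s * indicator ?B (F T s) * ennreal (JF T s)"
  have im: "?I T \<in> borel_measurable lborel" if T: "T \<in> faces S" for T
  proof -
    have b: "(\<lambda>x. indicator ?B x :: ennreal) \<in> borel_measurable \<Gamma>b" using Bg by simp
    have "(\<lambda>s. indicator ?B (FK T s) * (indicator K s * ennreal (JF T s))) \<in> borel_measurable borel"
      by (intro borel_measurable_times_ennreal measurable_compose[OF FK_measurable[OF T] b] JF_measurable[OF T])
    moreover have "(\<lambda>s. indicator ?B (FK T s) * (indicator K s * ennreal (JF T s))) = ?I T"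
      by (auto simp: fun_eq_iff FK_def indicator_def)
    ultimately show ?thesis by simp
  qed
  have em: "emeasure \<Sigma>' B = (\<Sum>T\<in>faces S. \<integral>\<^sup>+s. ?I T s \<partial>lborel)"
    unfolding emeasure_distr[OF cp_measurable B] space_Sigma emeasure_Sigma[OF Bs]
    by (rule sum.cong[OF refl]) (rule emeasure_face_measure[OF _ Bg])
  have bd: "c ^ CARD('n) * JF T s \<le> JP T s" "JP T s \<le> C ^ CARD('n) * JF T s" if T: "T \<in> faces S" and s: "s \<in> K" for T s
    using sqrt_det_gram_bounds[OF linear_DF[OF T s] inj_DF[OF T s] has_derivative_linear[OF Phi_deriv[OF T s]] c le[OF T s]]
    by auto
  have ind: "(indicator B (\<Phi> T s) :: ennreal) = indicator ?B (F T s)" if T: "T \<in> faces S" and s: "s \<in> K" for T s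
    using F_in_Gamma[OF T] s K_subset by (auto simp: indicator_def)
  have "ennreal (c ^ CARD('n)) * emeasure \<Sigma>' B = (\<Sum>T\<in>faces S. \<integral>\<^sup>+s. ennreal (c ^ CARD('n)) * ?I T s \<partial>lborel)"
    unfolding em sum_distrib_left by (rule sum.cong[OF refl]) (rule nn_integral_cmult[symmetric, OF im])
  also have "\<dots> \<le> emeasure \<sigma> B"
    unfolding emeasure_sigma_faces[OF B]
  proof (intro sum_mono nn_integral_mono)
    fix T s assume T: "T \<in> faces S"
    show "ennreal (c ^ CARD('n)) * ?I T s \<le> indicator K s * indicator B (\<Phi> T s) * ennreal (JP T s)"
    proof (cases "s \<in> K")
      case True
      have "ennreal (c ^ CARD('n)) * ennreal (JF T s) \<le> ennreal (JP T s)"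
        using bd(1)[OF T True] c JF_pos[OF T True] by (simp add: ennreal_mult[symmetric] ennreal_leI)
      then show ?thesis
        using True ind[OF T True] by (cases "F T s \<in> ?B") simp_all
    qed simp
  qed
  finally show "ennreal (c ^ CARD('n)) * emeasure \<Sigma>' B \<le> emeasure \<sigma> B" .
  have "emeasure \<sigma> B \<le> (\<Sum>T\<in>faces S. \<integral>\<^sup>+s. ennreal (C ^ CARD('n)) * ?I T s \<partial>lborel)"
    unfolding emeasure_sigma_faces[OF B]
  proof (intro sum_mono nn_integral_mono)
    fix T s assume T: "T \<in> faces S"
    show "indicator K s * indicator B (\<Phi> T s) * ennreal (JP T s) \<le> ennreal (C ^ CARD('n)) * ?I T s"
    proof (cases "s \<in> K")
      case True
      have "ennreal (JP T s) \<le> ennreal (C ^ CARD('n)) * ennreal (JF T s)"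
        using bd(2)[OF T True] C JF_pos[OF T True] by (simp add: ennreal_mult[symmetric] ennreal_leI)
      then show ?thesis
        using True ind[OF T True] by (cases "F T s \<in> ?B") simp_all
    qed simp
  qed
  also have "\<dots> = ennreal (C ^ CARD('n)) * emeasure \<Sigma>' B"
    unfolding em sum_distrib_left by (rule sum.cong[OF refl]) (rule nn_integral_cmult[OF im])
  finally show "emeasure \<sigma> B \<le> ennreal (C ^ CARD('n)) * emeasure \<Sigma>' B" .
qed

lemma nn_integral_bounds:
  fixes f :: "real^'m \<Rightarrow> ennreal"
  assumes c: "c > 0"
    and le: "\<And>T s \<xi>. T \<in> faces S \<Longrightarrow> s \<in> K \<Longrightarrow> c * norm (DF T s \<xi>) \<le> norm (frechet_derivative (\<Phi> T) (at s) \<xi>)"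
      "\<And>T s \<xi>. T \<in> faces S \<Longrightarrow> s \<in> K \<Longrightarrow> norm (frechet_derivative (\<Phi> T) (at s) \<xi>) \<le> C * norm (DF T s \<xi>)"
    and C: "C > 0" and f: "f \<in> borel_measurable \<sigma>"
  shows "ennreal (c ^ CARD('n)) * (\<integral>\<^sup>+x. f (cp x) \<partial>\<Sigma>) \<le> (\<integral>\<^sup>+y. f y \<partial>\<sigma>)"
    and "(\<integral>\<^sup>+y. f y \<partial>\<sigma>) \<le> ennreal (C ^ CARD('n)) * (\<integral>\<^sup>+x. f (cp x) \<partial>\<Sigma>)"
proof -
  have d: "(\<integral>\<^sup>+y. f y \<partial>\<Sigma>') = (\<integral>\<^sup>+x. f (cp x) \<partial>\<Sigma>)" by (rule nn_integral_distr[OF cp_measurable]) (use f in simp)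
  have "ennreal (c ^ CARD('n)) * (\<integral>\<^sup>+y. f y \<partial>\<Sigma>') \<le> (\<integral>\<^sup>+y. f y \<partial>\<sigma>)"
    by (rule nn_integral_ge_cmult_measure) (use measure_bounds(1)[OF c le C] f in auto)
  then show "ennreal (c ^ CARD('n)) * (\<integral>\<^sup>+x. f (cp x) \<partial>\<Sigma>) \<le> (\<integral>\<^sup>+y. f y \<partial>\<sigma>)" unfolding d .
  have "(\<integral>\<^sup>+y. f y \<partial>\<sigma>) \<le> ennreal (C ^ CARD('n)) * (\<integral>\<^sup>+y. f y \<partial>\<Sigma>')"
    by (rule nn_integral_le_cmult_measure) (use measure_bounds(2)[OF c le C] f in auto)
  then show "(\<integral>\<^sup>+y. f y \<partial>\<sigma>) \<le> ennreal (C ^ CARD('n)) * (\<integral>\<^sup>+x. f (cp x) \<partial>\<Sigma>)" unfolding d .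
qed

end

section \<open>Lifting weak tangential gradients\<close>

text \<open>A compact set may fail to be convex. Close points are joined by a segment in a tube
  around \<open>X\<close> where the derivative is bounded; for distant points boundedness of
  \<open>f\<close> is enough.\<close>

lemma smooth_on_lipschitz_compact:
  fixes f :: "'a::euclidean_space \<Rightarrow> 'b::euclidean_space"
  assumes f: "smooth_on f U" and U: "open U" and X: "compact X" "X \<subseteq> U"
  obtains L where "L-lipschitz_on X f"
proof (cases "X = {}")
  case True
  then show ?thesis using that[of 0] by (simp add: lipschitz_on_def)
next
  case False
  obtain r where r: "r > 0" "(\<Union>x\<in>X. ball x r) \<subseteq> U"
    by (rule compact_subset_open_imp_ball_epsilon_subset[OF X(1) U X(2)]) (rule that)
  let ?Y = "{x. infdist x X \<le> r / 2}"
  have cY: "compact ?Y" using r(1) by (intro compact_infdist_le False X(1)) simp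
  have YU: "?Y \<subseteq> U"
  proof
    fix y assume y: "y \<in> ?Y"
    obtain x where x: "x \<in> X" "infdist y X = dist y x"
      by (rule infdist_attains_inf[OF compact_imp_closed[OF X(1)] False]) (rule that)
    then have "y \<in> ball x r" using y r(1) by (simp add: dist_commute)
    then show "y \<in> U" using r(2) x(1) by blast
  qed
  obtain B where B: "B > 0" "\<And>x v. x \<in> ?Y \<Longrightarrow> norm (frechet_derivative f (at x) v) \<le> B * norm v"
    by (rule smooth_on_bounded_derivative[OF f cY YU]) (rule that)
  have "bounded (f ` X)"
    by (rule compact_imp_bounded[OF compact_continuous_image[OF continuous_on_subset[OF smooth_on_imp_continuous_on[OF f] X(2)] X(1)]])
  then obtain M where M: "\<forall>y\<in>f ` X. norm y \<le> M" unfolding bounded_iff by (rule exE)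
  have M0: "M \<ge> 0" using M False norm_ge_zero order.trans by blast
  \<comment> \<open>\<open>4 * M / r\<close> serves the distant points: values differ by at most
    \<open>2 * M\<close> over a distance larger than \<open>r / 2\<close>.\<close>
  define L where "L = B + 4 * M / r"
  have L: "L \<ge> B" "L \<ge> 4 * M / r" using B(1) M0 r(1) by (simp_all add: L_def)
  have "dist (f x) (f y) \<le> L * dist x y" if xy: "x \<in> X" "y \<in> X" for x y
  proof (cases "dist x y \<le> r / 2")
    case True
    have seg: "z \<in> ?Y" if z: "z \<in> closed_segment x y" for z
    proof -
      have "infdist z X \<le> dist z x" by (rule infdist_le[OF xy(1)])
      also have "\<dots> \<le> dist x y" using dist_in_closed_segment[OF z] by (simp add: dist_commute)
      finally show ?thesis using True by simp
    qed
    have "norm (f x - f y) \<le> B * norm (x - y)"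
    proof (rule differentiable_bound[OF convex_closed_segment, of x y f "\<lambda>x. frechet_derivative f (at x)"])
      fix z assume z: "z \<in> closed_segment x y"
      have zU: "z \<in> U" using seg[OF z] YU by blast
      show "(f has_derivative frechet_derivative f (at z)) (at z within closed_segment x y)"
        by (rule has_derivative_at_withinI[OF smooth_on_has_derivative[OF f zU]])
      show "onorm (frechet_derivative f (at z)) \<le> B" by (rule onorm_le) (rule B(2)[OF seg[OF z]])
    qed auto
    also have "\<dots> \<le> L * norm (x - y)" by (rule mult_right_mono[OF L(1)]) simp
    finally show ?thesis by (simp add: dist_norm)
  next
    case False
    have "norm (f x) \<le> M" "norm (f y) \<le> M" using M xy by auto
    then have "dist (f x) (f y) \<le> 2 * M"
      using norm_triangle_ineq4[of "f x" "f y"] by (simp add: dist_norm)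
    also have "\<dots> = (4 * M / r) * (r / 2)" using r(1) by simp
    also have "\<dots> \<le> (4 * M / r) * dist x y"
      using False M0 r(1) by (intro mult_left_mono) auto
    also have "\<dots> \<le> L * dist x y" by (rule mult_right_mono[OF L(2)]) simp
    finally show ?thesis .
  qed
  then have "L-lipschitz_on X f" using L(1) B(1) by (intro lipschitz_onI) auto
  then show ?thesis by (rule that)
qed

context narrow_tube
begin

text \<open>Multiplication by a piecewise linear function of the distance, equal to 1 up to
  \<open>e0\<close> and to 0 beyond \<open>e1\<close>. Near the surface nothing changes, so
  derivatives there are kept, and a globally Lipschitz function is all that
  \<open>lipschitz_weak_tgrad\<close> asks for.\<close>

lemma cutoff_extension:
  fixes g :: "real^'m \<Rightarrow> real"
  assumes e: "0 < e0" "e0 < e1" and g: "L-lipschitz_on {x. infdist x \<gamma> \<le> e1} g"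
  obtains f L' r where "L'-lipschitz_on UNIV f" "\<And>x. norm x > r \<Longrightarrow> f x = 0"
    "\<And>x. infdist x \<gamma> < e0 \<Longrightarrow> f x = g x"
proof -
  let ?X = "{x. infdist x \<gamma> \<le> e1}"
  have cX: "compact ?X" using e by (intro compact_tube) simp
  have "bounded (g ` ?X)"
    by (rule compact_imp_bounded[OF compact_continuous_image[OF lipschitz_on_continuous_on[OF g] cX]])
  then obtain M where M: "\<forall>y\<in>g ` ?X. norm y \<le> M" unfolding bounded_iff by (rule exE)
  have Mx: "\<bar>g x\<bar> \<le> M" if "x \<in> ?X" for x using M that by auto
  obtain p where "p \<in> \<gamma>" using nonempty by blast
  then have M0: "M \<ge> 0" using Mx[of p] e by simp
  obtain r where r: "\<forall>x\<in>?X. norm x \<le> r" using compact_imp_bounded[OF cX] unfolding bounded_iff by (rule exE)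
  define l where "l = 1 / (e1 - e0)"
  have l: "l > 0" using e by (simp add: l_def)
  define \<theta> where "\<theta> x = min 1 (max 0 (l * (e1 - infdist x \<gamma>)))" for x
  have chi: "0 \<le> \<theta> x" "\<theta> x \<le> 1" for x by (auto simp: \<theta>_def)
  have chil: "\<bar>\<theta> x - \<theta> y\<bar> \<le> l * dist x y" for x y
  proof -
    have "\<bar>\<theta> x - \<theta> y\<bar> \<le> \<bar>l * (e1 - infdist x \<gamma>) - l * (e1 - infdist y \<gamma>)\<bar>"
      unfolding \<theta>_def by linarith
    also have "\<dots> = l * \<bar>infdist x \<gamma> - infdist y \<gamma>\<bar>"
      using l by (simp add: right_diff_distrib[symmetric] abs_mult abs_minus_commute)
    also have "\<dots> \<le> l * dist x y"
      using l infdist_triangle_abs[of x \<gamma> y] by (intro mult_left_mono) auto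
    finally show ?thesis .
  qed
  have chi0: "\<theta> x = 0" if "x \<notin> ?X" for x
  proof -
    have "l * (e1 - infdist x \<gamma>) \<le> 0" using that l by (intro mult_nonneg_nonpos) auto
    then show ?thesis by (simp add: \<theta>_def)
  qed
  have chi1: "\<theta> x = 1" if "infdist x \<gamma> < e0" for x
  proof -
    have "1 = l * (e1 - e0)" using e by (simp add: l_def)
    also have "\<dots> \<le> l * (e1 - infdist x \<gamma>)" using l that by (intro mult_left_mono) auto
    finally show ?thesis by (simp add: \<theta>_def)
  qed
  define f where "f x = \<theta> x * g x" for x
  define L' where "L' = L + l * M"
  have L0: "L \<ge> 0" by (rule lipschitz_on_nonneg[OF g])
  \<comment> \<open>One point lies in the tube, where \<open>g\<close> is controlled. If the other
    does not, its cutoff vanishes and the value of \<open>g\<close> there never enters.\<close>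
  have one: "\<bar>f x - f y\<bar> \<le> L' * dist x y" if x: "x \<in> ?X" for x y
  proof (cases "y \<in> ?X")
    case True
    have "f x - f y = \<theta> x * (g x - g y) + (\<theta> x - \<theta> y) * g y" by (simp add: f_def algebra_simps)
    also have "\<bar>\<dots>\<bar> \<le> \<theta> x * \<bar>g x - g y\<bar> + \<bar>\<theta> x - \<theta> y\<bar> * \<bar>g y\<bar>"
      using chi(1)[of x] by (intro order.trans[OF abs_triangle_ineq]) (simp add: abs_mult)
    also have "\<dots> \<le> 1 * (L * dist x y) + (l * dist x y) * M"
      using lipschitz_onD[OF g x True] chi chil Mx[OF True] l L0
      by (intro add_mono mult_mono) (auto simp: dist_real_def)
    finally show ?thesis by (simp add: L'_def algebra_simps)
  next
    case False
    have "\<bar>f x - f y\<bar> = \<bar>\<theta> x - \<theta> y\<bar> * \<bar>g x\<bar>" by (simp add: f_def chi0[OF False] abs_mult)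
    also have "\<dots> \<le> (l * dist x y) * M"
      using chil Mx[OF x] l by (intro mult_mono) auto
    also have "\<dots> \<le> L' * dist x y" using L0 by (simp add: L'_def algebra_simps)
    finally show ?thesis .
  qed
  have "\<bar>f x - f y\<bar> \<le> L' * dist x y" for x y
  proof (cases "x \<in> ?X")
    case False
    show ?thesis
    proof (cases "y \<in> ?X")
      case True
      from one[OF this, of x] show ?thesis by (simp add: abs_minus_commute dist_commute)
    next
      case False2: False
      have "L' \<ge> 0" using L0 l M0 by (simp add: L'_def)
      then show ?thesis using False False2 by (simp add: f_def chi0)
    qed
  qed (rule one)
  then have "L'-lipschitz_on UNIV f"
    using L0 l M0 by (intro lipschitz_onI) (auto simp: dist_real_def L'_def)
  moreover have "f x = 0" if "norm x > r" for x
  proof -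
    have "x \<notin> ?X" using r that by force
    then show ?thesis by (simp add: f_def chi0)
  qed
  moreover have "f x = g x" if "infdist x \<gamma> < e0" for x by (simp add: f_def chi1[OF that])
  ultimately show ?thesis by (rule that)
qed

end

context lifted_mesh
begin

section \<open>Gradients of lifted functions\<close>

text \<open>The adjoint of \<open>Dcp x\<close>, written in coordinates; \<open>adj_inner\<close> is
  its characterisation.\<close>

definition adj :: "real^'m \<Rightarrow> real^'m \<Rightarrow> real^'m" where
  "adj x q = (\<Sum>b\<in>Basis. (q \<bullet> Dcp x b) *\<^sub>R b)"

text \<open>Maps the tangential gradient of a function on \<open>\<gamma>\<close> to that of its lift to \<open>\<Gamma>\<close>.\<close>

definition lift_grad :: "real^'m \<Rightarrow> real^'m \<Rightarrow> real^'m" where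
  "lift_grad x q = adj x q - (normal S x \<bullet> adj x q) *\<^sub>R normal S x"

lemma linear_Dcp: "x \<in> strip \<gamma> \<delta> \<Longrightarrow> linear (Dcp x)"
  by (rule has_derivative_linear[OF smooth_on_has_derivative[OF smooth_cp]])

lemma adj_inner:
  assumes x: "x \<in> strip \<gamma> \<delta>"
  shows "adj x q \<bullet> \<xi> = q \<bullet> Dcp x \<xi>"
proof -
  have "Dcp x \<xi> = Dcp x (\<Sum>b\<in>Basis. (\<xi> \<bullet> b) *\<^sub>R b)" by (simp add: euclidean_representation)
  also have "\<dots> = (\<Sum>b\<in>Basis. (\<xi> \<bullet> b) *\<^sub>R Dcp x b)"
    by (simp only: linear_sum[OF linear_Dcp[OF x]] linear_cmul[OF linear_Dcp[OF x]])
  finally show ?thesis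
    by (simp add: adj_def inner_sum_left inner_sum_right inner_commute mult.commute)
qed

lemma adj_diff: "adj x (q - q') = adj x q - adj x q'"
  by (simp add: adj_def inner_diff_left scaleR_diff_left sum_subtractf)

lemma lift_grad_diff: "lift_grad x (q - q') = lift_grad x q - lift_grad x q'"
  by (simp add: lift_grad_def adj_diff inner_diff_right scaleR_diff_left)

text \<open>The adjoint inherits the bound of \<open>Dcp x\<close> by pairing it with its own value;
  removing the normal part at most doubles the norm.\<close>

lemma norm_lift_grad:
  obtains C where "C > 0" "\<And>x q. x \<in> Gamma S \<Longrightarrow> norm (normal S x) = 1 \<Longrightarrow> norm (lift_grad x q) \<le> C * norm q"
proof -
  obtain C where C: "C > 0" "\<And>x \<xi>. x \<in> Gamma S \<Longrightarrow> norm (Dcp x \<xi>) \<le> C * norm \<xi>"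
    by (rule Dcp_upper) (rule that)
  have "norm (lift_grad x q) \<le> (2 * C) * norm q" if x: "x \<in> Gamma S" and n: "norm (normal S x) = 1" for x q
  proof -
    let ?a = "adj x q"
    have xs: "x \<in> strip \<gamma> \<delta>" using x Gamma_strip by blast
    have "norm ?a * norm ?a = q \<bullet> Dcp x ?a"
      using adj_inner[OF xs, of q ?a] by (simp add: power2_norm_eq_inner[symmetric] power2_eq_square)
    also have "\<dots> \<le> norm q * norm (Dcp x ?a)" by (rule norm_cauchy_schwarz)
    also have "\<dots> \<le> norm q * (C * norm ?a)" by (rule mult_left_mono[OF C(2)[OF x]]) simp
    finally have "norm ?a * norm ?a \<le> (C * norm q) * norm ?a" by (simp add: mult_ac)
    then have a: "norm ?a \<le> C * norm q"
      using C(1) by (cases "norm ?a = 0") (auto simp: mult_le_cancel_right)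
    have "norm (lift_grad x q) \<le> norm ?a + norm ((normal S x \<bullet> ?a) *\<^sub>R normal S x)"
      unfolding lift_grad_def by (rule norm_triangle_ineq4)
    also have "\<dots> \<le> norm ?a + norm ?a"
      using Cauchy_Schwarz_ineq2[of "normal S x" ?a] n by simp
    finally show ?thesis using a by simp
  qed
  then show ?thesis using C(1) by (intro that[of "2 * C"]) auto
qed

lemma measurable_Sigma_continuous:
  fixes f :: "real^'m \<Rightarrow> 'b::euclidean_space"
  shows "continuous_on (strip \<gamma> \<delta>) f \<Longrightarrow> f \<in> borel_measurable \<Sigma>"
  unfolding measurable_cong_sets[OF sets_Sigma refl]
  by (rule borel_measurable_continuous_on_restrict[OF continuous_on_subset[OF _ Gamma_strip]])

lemma lift_grad_measurable:
  assumes p: "p \<in> borel_measurable \<sigma>"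
  shows "(\<lambda>x. lift_grad x (p (cp x))) \<in> borel_measurable \<Sigma>"
proof -
  have [measurable]: "(\<lambda>x. p (cp x)) \<in> borel_measurable \<Sigma>"
    by (rule measurable_compose[OF cp_measurable p])
  have [measurable]: "(\<lambda>x. Dcp x b) \<in> borel_measurable \<Sigma>" for b
    by (rule measurable_Sigma_continuous[OF smooth_on_imp_continuous_on[OF smooth_on_frechet_derivative[OF smooth_cp]]])
  have [measurable]: "(\<lambda>x. adj x (p (cp x))) \<in> borel_measurable \<Sigma>"
    unfolding adj_def by (intro borel_measurable_sum borel_measurable_scaleR borel_measurable_inner) measurable
  note [measurable] = G.n_measurable
  show ?thesis unfolding lift_grad_def by measurable
qed

lemma basic_bounds:
  obtains c C where "c > 0" "C > 0"
    "\<And>T s \<xi>. T \<in> faces S \<Longrightarrow> s \<in> K \<Longrightarrow> c * norm (DF T s \<xi>) \<le> norm (frechet_derivative (\<Phi> T) (at s) \<xi>)"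
    "\<And>T s \<xi>. T \<in> faces S \<Longrightarrow> s \<in> K \<Longrightarrow> norm (frechet_derivative (\<Phi> T) (at s) \<xi>) \<le> C * norm (DF T s \<xi>)"
proof -
  obtain c where c: "c > 0" "\<And>T s \<xi>. T \<in> faces S \<Longrightarrow> s \<in> K \<Longrightarrow> c * norm (DF T s \<xi>) \<le> norm (frechet_derivative (\<Phi> T) (at s) \<xi>)"
    by (rule Dcp_lower) (rule that)
  obtain C where C: "C > 0" "\<And>x \<xi>. x \<in> Gamma S \<Longrightarrow> norm (Dcp x \<xi>) \<le> C * norm \<xi>"
    by (rule Dcp_upper) (rule that)
  have "norm (frechet_derivative (\<Phi> T) (at s) \<xi>) \<le> C * norm (DF T s \<xi>)" if T: "T \<in> faces S" and s: "s \<in> K" for T s \<xi>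
  proof -
    have "F T s \<in> Gamma S" using F_in_Gamma[OF T] s K_subset by blast
    then show ?thesis unfolding DPhi[OF T s] by (rule C(2))
  qed
  then show ?thesis using c C(1) by (intro that[of c C])
qed

lemma finite_measure_sigma: "finite_measure \<sigma>"
proof (rule finite_measureI)
  obtain c C where b: "c > 0" "C > 0"
    "\<And>T s \<xi>. T \<in> faces S \<Longrightarrow> s \<in> K \<Longrightarrow> c * norm (DF T s \<xi>) \<le> norm (frechet_derivative (\<Phi> T) (at s) \<xi>)"
    "\<And>T s \<xi>. T \<in> faces S \<Longrightarrow> s \<in> K \<Longrightarrow> norm (frechet_derivative (\<Phi> T) (at s) \<xi>) \<le> C * norm (DF T s \<xi>)"
    by (rule basic_bounds) (rule that)
  have "emeasure \<sigma> (space \<sigma>) \<le> ennreal (C ^ CARD('n)) * emeasure \<Sigma>' (space \<sigma>)"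
    by (rule measure_bounds(2)[OF b(1) b(3) b(4) b(2)]) auto
  also have "emeasure \<Sigma>' (space \<sigma>) = emeasure \<Sigma> (cp -` space \<sigma> \<inter> space \<Sigma>)"
    by (rule emeasure_distr[OF cp_measurable]) simp
  also have "ennreal (C ^ CARD('n)) * \<dots> < \<infinity>"
  proof -
    have "emeasure \<Sigma> (cp -` space \<sigma> \<inter> space \<Sigma>) < top"
      by (rule iffD1[OF top.not_eq_extremum G.emeasure_finite[unfolded infinity_ennreal_def]])
    then show ?thesis by (simp only: ennreal_mult_less_top infinity_ennreal_def) simp
  qed
  finally show "emeasure \<sigma> (space \<sigma>) \<noteq> \<infinity>" by simp
qed

text \<open>The constants are left open because two choices are used: the mesh dependent ones of
  \<open>basic_bounds\<close> for integrability and those close to 1 in \<open>close_meshI\<close>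
  for the sharp comparison.\<close>

lemma integrable_lift:
  fixes f :: "real^'m \<Rightarrow> real"
  assumes c: "c > 0" and C: "C > 0"
    and le: "\<And>T s \<xi>. T \<in> faces S \<Longrightarrow> s \<in> K \<Longrightarrow> c * norm (DF T s \<xi>) \<le> norm (frechet_derivative (\<Phi> T) (at s) \<xi>)"
      "\<And>T s \<xi>. T \<in> faces S \<Longrightarrow> s \<in> K \<Longrightarrow> norm (frechet_derivative (\<Phi> T) (at s) \<xi>) \<le> C * norm (DF T s \<xi>)"
    and f: "integrable \<sigma> f" "\<And>x. 0 \<le> f x"
  shows "integrable \<Sigma> (\<lambda>x. f (cp x))"
    and "c ^ CARD('n) * (LINT x|\<Sigma>. f (cp x)) \<le> (LINT y|\<sigma>. f y)"
    and "(LINT y|\<sigma>. f y) \<le> C ^ CARD('n) * (LINT x|\<Sigma>. f (cp x))"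
proof -
  have cn: "c ^ CARD('n) > 0" "C ^ CARD('n) > 0" using c C by auto
  have fm: "f \<in> borel_measurable \<sigma>" using f(1) by simp
  have fm': "(\<lambda>y. ennreal (f y)) \<in> borel_measurable \<sigma>" using fm by simp
  have ef: "(\<integral>\<^sup>+y. ennreal (f y) \<partial>\<sigma>) = ennreal (LINT y|\<sigma>. f y)"
    by (rule nn_integral_eq_integral[OF f(1)]) (use f(2) in auto)
  note b = nn_integral_bounds[OF c le C fm', unfolded ef]
  have mm: "(\<lambda>x. f (cp x)) \<in> borel_measurable \<Sigma>" by (rule measurable_compose[OF cp_measurable fm])
  have "(\<integral>\<^sup>+x. ennreal (f (cp x)) \<partial>\<Sigma>) < \<infinity>"
  proof (rule ccontr)
    assume "\<not> ?thesis"
    then have "(\<integral>\<^sup>+x. ennreal (f (cp x)) \<partial>\<Sigma>) = \<infinity>" by (simp add: not_less top_unique)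
    then show False using b(1) c by (simp add: ennreal_mult_top top_unique)
  qed
  then show i: "integrable \<Sigma> (\<lambda>x. f (cp x))"
    by (intro integrableI_nonneg mm) (use f(2) in auto)
  have eg: "(\<integral>\<^sup>+x. ennreal (f (cp x)) \<partial>\<Sigma>) = ennreal (LINT x|\<Sigma>. f (cp x))"
    by (rule nn_integral_eq_integral[OF i]) (use f(2) in auto)
  have nn: "0 \<le> (LINT x|\<Sigma>. f (cp x))" "0 \<le> (LINT y|\<sigma>. f y)" using f(2) by (auto intro: integral_nonneg)
  show "c ^ CARD('n) * (LINT x|\<Sigma>. f (cp x)) \<le> (LINT y|\<sigma>. f y)"
    using b(1) cn nn unfolding eg by (simp add: ennreal_mult[symmetric])
  show "(LINT y|\<sigma>. f y) \<le> C ^ CARD('n) * (LINT x|\<Sigma>. f (cp x))"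
    using b(2) cn nn unfolding eg by (simp add: ennreal_mult[symmetric])
qed

lemma square_integrable_lift:
  obtains C where "C > 0"
    "\<And>f :: real^'m \<Rightarrow> 'b::euclidean_space. square_integrable \<sigma> f \<Longrightarrow>
      square_integrable \<Sigma> (\<lambda>x. f (cp x)) \<and> (LINT x|\<Sigma>. (norm (f (cp x)))\<^sup>2) \<le> C * (LINT y|\<sigma>. (norm (f y))\<^sup>2)"
proof -
  obtain c C where b: "c > 0" "C > 0"
    "\<And>T s \<xi>. T \<in> faces S \<Longrightarrow> s \<in> K \<Longrightarrow> c * norm (DF T s \<xi>) \<le> norm (frechet_derivative (\<Phi> T) (at s) \<xi>)"
    "\<And>T s \<xi>. T \<in> faces S \<Longrightarrow> s \<in> K \<Longrightarrow> norm (frechet_derivative (\<Phi> T) (at s) \<xi>) \<le> C * norm (DF T s \<xi>)"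
    by (rule basic_bounds) (rule that)
  have cn: "c ^ CARD('n) > 0" using b(1) by simp
  show ?thesis
  proof (rule that[of "inverse (c ^ CARD('n))"])
    show "inverse (c ^ CARD('n)) > 0" using cn by simp
    fix f :: "real^'m \<Rightarrow> 'b::euclidean_space" assume f: "square_integrable \<sigma> f"
    have i: "integrable \<sigma> (\<lambda>y. (norm (f y))\<^sup>2)" and m: "f \<in> borel_measurable \<sigma>" using f by (auto simp: square_integrable_def)
    note l = integrable_lift[OF b(1,2,3,4) i]
    have "square_integrable \<Sigma> (\<lambda>x. f (cp x))"
      unfolding square_integrable_def using l(1) measurable_compose[OF cp_measurable m] by simp
    moreover have "(LINT x|\<Sigma>. (norm (f (cp x)))\<^sup>2) \<le> inverse (c ^ CARD('n)) * (LINT y|\<sigma>. (norm (f y))\<^sup>2)"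
      using l(2) cn by (simp add: field_simps)
    ultimately show "square_integrable \<Sigma> (\<lambda>x. f (cp x)) \<and>
      (LINT x|\<Sigma>. (norm (f (cp x)))\<^sup>2) \<le> inverse (c ^ CARD('n)) * (LINT y|\<sigma>. (norm (f y))\<^sup>2)" by blast
  qed
qed

lemma AE_lift:
  assumes P: "AE y in \<sigma>. P y"
  shows "AE x in \<Sigma>. P (cp x)"
proof -
  obtain A where A: "{y \<in> space \<sigma>. \<not> P y} \<subseteq> A" "emeasure \<sigma> A = 0" "A \<in> sets \<sigma>"
    by (rule AE_E[OF P]) (rule that)
  obtain c C where b: "c > 0" "C > 0"
    "\<And>T s \<xi>. T \<in> faces S \<Longrightarrow> s \<in> K \<Longrightarrow> c * norm (DF T s \<xi>) \<le> norm (frechet_derivative (\<Phi> T) (at s) \<xi>)"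
    "\<And>T s \<xi>. T \<in> faces S \<Longrightarrow> s \<in> K \<Longrightarrow> norm (frechet_derivative (\<Phi> T) (at s) \<xi>) \<le> C * norm (DF T s \<xi>)"
    by (rule basic_bounds) (rule that)
  have "ennreal (c ^ CARD('n)) * emeasure \<Sigma>' A = 0"
    using measure_bounds(1)[OF b(1) b(3) b(4) b(2) A(3)] A(2) by simp
  moreover have "\<not> c ^ CARD('n) \<le> 0" using zero_less_power[OF b(1)] by (simp only: not_le)
  ultimately have "emeasure \<Sigma>' A = 0" by (auto simp: ennreal_eq_0_iff)
  then have z: "emeasure \<Sigma> (cp -` A \<inter> space \<Sigma>) = 0" by (simp add: emeasure_distr[OF cp_measurable A(3)])
  show ?thesis
  proof (rule AE_I[OF _ z measurable_sets[OF cp_measurable A(3)]])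
    show "{x \<in> space \<Sigma>. \<not> P (cp x)} \<subseteq> cp -` A \<inter> space \<Sigma>" using A(1) cp_in by (auto simp: space_sigma)
  qed
qed

lemma AE_in_faces: "AE x in \<Sigma>. \<exists>T\<in>faces S. \<exists>s\<in>K. x = F T s"
proof (rule Sigma_AE_I)
  \<comment> \<open>Measurability is read off through \<open>cp\<close>: the lifted open elements
    are open in \<gamma>, hence Borel.\<close>
  have "{x \<in> Gamma S. \<not> (\<exists>T\<in>faces S. \<exists>s\<in>K. x = F T s)} = Gamma S - (\<Union>T\<in>faces S. cp -` (\<Phi> T ` K) \<inter> Gamma S)"
  proof (intro set_eqI iffI)
    fix x assume x: "x \<in> {x \<in> Gamma S. \<not> (\<exists>T\<in>faces S. \<exists>s\<in>K. x = F T s)}"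
    have "cp x \<notin> \<Phi> T ` K" if T: "T \<in> faces S" for T
    proof
      assume "cp x \<in> \<Phi> T ` K"
      then obtain s where s: "s \<in> K" "cp x = cp (F T s)" by blast
      have "F T s \<in> Gamma S" using F_in_Gamma[OF T] s(1) K_subset by blast
      then have "x = F T s" using inj_onD[OF bij_betw_imp_inj_on[OF cp_bij] s(2)] x by blast
      then show False using x T s(1) by blast
    qed
    then show "x \<in> Gamma S - (\<Union>T\<in>faces S. cp -` (\<Phi> T ` K) \<inter> Gamma S)" using x by blast
  qed blast
  moreover have "(\<Union>T\<in>faces S. cp -` (\<Phi> T ` K) \<inter> Gamma S) \<in> sets \<Sigma>"
  proof (rule sets.finite_UN[OF finite_faces])
    fix T assume T: "T \<in> faces S"
    have "\<Phi> T ` K \<in> sets \<sigma>"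
      unfolding sets_sigma_iff using openin_gamma_sets[OF openin_Phi[OF T]] cp_in by blast
    from measurable_sets[OF cp_measurable this] show "cp -` (\<Phi> T ` K) \<inter> Gamma S \<in> sets \<Sigma>"
      by (simp add: space_Sigma)
  qed
  ultimately show "{x \<in> Gamma S. \<not> (\<exists>T\<in>faces S. \<exists>s\<in>K. x = F T s)} \<in> sets \<Sigma>"
    using sets.Diff[OF sets.top[of \<Sigma>]] by (simp only: space_Sigma)
qed auto

text \<open>\<Gamma> is compact in the open strip, so its largest distance to \<gamma> stays below
  \<delta> and leaves room for a cutoff.\<close>

lemma tube_radii:
  obtains e0 e1 where "0 < e0" "e0 < e1" "e1 < \<delta>" "\<And>x. x \<in> Gamma S \<Longrightarrow> infdist x \<gamma> < e0"
proof -
  have "continuous_on (Gamma S) (\<lambda>x. infdist x \<gamma>)" by (intro continuous_intros)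
  then obtain z where z: "z \<in> Gamma S" "\<And>x. x \<in> Gamma S \<Longrightarrow> infdist x \<gamma> \<le> infdist z \<gamma>"
    using continuous_attains_sup[OF compact_Gamma gamma_nonempty_Gamma] by blast
  define m where "m = infdist z \<gamma>"
  have m: "0 \<le> m" "m < \<delta>" using z(1) Gamma_strip by (auto simp: m_def strip_def infdist_nonneg)
  show ?thesis
  proof (rule that[of "(m + \<delta>) / 2" "(m + 3 * \<delta>) / 4"])
    show "infdist x \<gamma> < (m + \<delta>) / 2" if "x \<in> Gamma S" for x
      using z(2)[OF that] m by (simp add: m_def)
  qed (use m in auto)
qed

text \<open>\<open>w\<close> after \<open>cp\<close> is smooth in the strip only. Cut off, it
  becomes a Lipschitz function on the whole space that is differentiable at every point of \<Gamma>,
  with gradient given by the chain rule. The part of \<open>grad w\<close> along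
  \<open>nu \<gamma>\<close> drops out because the values of \<open>Dcp x\<close> are orthogonal to
  it.\<close>

lemma lift_smooth:
  assumes w: "smooth_on w UNIV"
  obtains g where "weak_tgrad \<Sigma> (normal S) (\<lambda>x. w (cp x)) g"
    "AE x in \<Sigma>. g x = lift_grad x (tangential (nu \<gamma>) w (cp x))"
proof -
  obtain e0 e1 where e: "0 < e0" "e0 < e1" "e1 < \<delta>" "\<And>x. x \<in> Gamma S \<Longrightarrow> infdist x \<gamma> < e0"
    by (rule tube_radii) (rule that)
  have "{x. infdist x \<gamma> \<le> e1} \<subseteq> strip \<gamma> \<delta>" using e(3) by (auto simp: strip_def)
  moreover have "compact {x. infdist x \<gamma> \<le> e1}" using e by (intro compact_tube) simp
  moreover have "smooth_on (\<lambda>x. w (cp x)) (strip \<gamma> \<delta>)"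
    by (rule smooth_on_compose[OF open_strip subset_UNIV smooth_cp w])
  ultimately obtain L where L: "L-lipschitz_on {x. infdist x \<gamma> \<le> e1} (\<lambda>x. w (cp x))"
    using smooth_on_lipschitz_compact[OF _ open_strip] by blast
  obtain f L' r where f: "L'-lipschitz_on UNIV f" "\<And>x. norm x > r \<Longrightarrow> f x = 0"
    "\<And>x. infdist x \<gamma> < e0 \<Longrightarrow> f x = w (cp x)"
    by (rule cutoff_extension[OF e(1,2) L]) (rule that)
  have o: "open {x. infdist x \<gamma> < e0}" by (intro open_Collect_less continuous_intros)
  have d: "(f has_derivative (\<lambda>\<xi>. adj x (tangential (nu \<gamma>) w (cp x)) \<bullet> \<xi>)) (at x)" if x: "x \<in> Gamma S" for x
  proof -
    have xs: "x \<in> strip \<gamma> \<delta>" using x Gamma_strip by blast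
    have "((\<lambda>x. w (cp x)) has_derivative (\<lambda>\<xi>. frechet_derivative w (at (cp x)) (Dcp x \<xi>))) (at x)"
      by (rule has_derivative_compose[OF smooth_on_has_derivative[OF smooth_cp xs] smooth_on_has_derivative[OF w UNIV_I]])
    moreover have "frechet_derivative w (at (cp x)) (Dcp x \<xi>) = adj x (tangential (nu \<gamma>) w (cp x)) \<bullet> \<xi>" for \<xi>
      unfolding adj_inner[OF xs] grad_inner[OF smooth_on_differentiable[OF w], symmetric]
      using nu_Dcp[OF xs, of \<xi>] by (simp add: tangential_def inner_diff_left)
    ultimately have "((\<lambda>x. w (cp x)) has_derivative (\<lambda>\<xi>. adj x (tangential (nu \<gamma>) w (cp x)) \<bullet> \<xi>)) (at x)" by simp
    then show ?thesis
      by (rule has_derivative_transform_within_open[OF _ o]) (use e(4)[OF x] f(3) in auto)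
  qed
  have ae: "AE x in \<Sigma>. f differentiable (at x)"
    using differentiableI[OF d] by (intro AE_I2) (simp add: space_Sigma)
  obtain g where g: "weak_tgrad \<Sigma> (normal S) f g" "AE x in \<Sigma>. g x = tangential (normal S) f x"
  proof (rule G.lipschitz_weak_tgrad[OF f(1) _ ae, of r])
    show "f x = 0" if "r < norm x" for x by (rule f(2)[OF that])
  qed (rule that)
  have "weak_tgrad \<Sigma> (normal S) (\<lambda>x. w (cp x)) g"
    by (rule G.weak_tgrad_cong[OF g(1)]) (use f(3) e(4) in auto)
  moreover have "AE x in \<Sigma>. g x = lift_grad x (tangential (nu \<gamma>) w (cp x))"
    using g(2) AE_space
  proof eventually_elim
    case (elim x)
    then have "x \<in> Gamma S" by (simp add: space_Sigma)
    then have "grad f x = adj x (tangential (nu \<gamma>) w (cp x))" by (intro grad_eqI d)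
    then show ?case using elim(1) by (simp add: tangential_def lift_grad_def)
  qed
  ultimately show ?thesis by (rule that)
qed

lemma sigma_square_integrable_continuous:
  fixes f :: "real^'m \<Rightarrow> 'b::euclidean_space"
  assumes f: "continuous_on \<gamma> f"
  shows "square_integrable \<sigma> f"
proof -
  interpret finite_measure \<sigma> by (rule finite_measure_sigma)
  have m: "f \<in> borel_measurable \<sigma>"
    unfolding measurable_cong_sets[OF sets_sigma refl] by (rule borel_measurable_continuous_on_restrict[OF f])
  obtain B where B: "\<forall>y\<in>f ` \<gamma>. norm y \<le> B"
    using compact_imp_bounded[OF compact_continuous_image[OF f compact_\<gamma>]] unfolding bounded_iff by (rule exE)
  have "AE y in \<sigma>. norm ((norm (f y))\<^sup>2) \<le> B\<^sup>2"
    using B by (intro AE_I2) (auto simp: space_sigma intro!: power_mono)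
  then have "integrable \<sigma> (\<lambda>y. (norm (f y))\<^sup>2)"
    using m by (intro integrable_const_bound) auto
  then show ?thesis using m by (simp add: square_integrable_def)
qed

lemma nu_continuous: "continuous_on \<gamma> (nu \<gamma>)"
  by (rule continuous_on_subset[OF smooth_on_imp_continuous_on[OF smooth_nu] subset_strip])

text \<open>Lift the approximating smooth functions and pass to the limit: composition with
  \<open>cp\<close> and the map \<open>lift_grad\<close> are both bounded in L2.\<close>

lemma lift_weak_tgrad:
  assumes u: "weak_tgrad \<sigma> (nu \<gamma>) u p"
  shows "weak_tgrad \<Sigma> (normal S) (\<lambda>x. u (cp x)) (\<lambda>x. lift_grad x (p (cp x)))"
proof -
  obtain w where w: "\<And>j. smooth_on (w j) UNIV"
    "(\<lambda>j. LINT x|\<sigma>. (norm (w j x - u x))\<^sup>2) \<longlonglongrightarrow> 0"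
    "(\<lambda>j. LINT x|\<sigma>. (norm (tangential (nu \<gamma>) (w j) x - p x))\<^sup>2) \<longlonglongrightarrow> 0"
    using u unfolding weak_tgrad_def by auto
  have su: "square_integrable \<sigma> u" and sp: "square_integrable \<sigma> p" using u by (auto simp: weak_tgrad_def)
  have sw: "square_integrable \<sigma> (w j)" for j
    by (rule sigma_square_integrable_continuous[OF continuous_on_subset[OF smooth_on_imp_continuous_on[OF w(1)] subset_UNIV]])
  have st: "square_integrable \<sigma> (tangential (nu \<gamma>) (w j))" for j
  proof (rule sigma_square_integrable_continuous)
    have "continuous_on \<gamma> (grad (w j))"
      by (rule continuous_on_subset[OF G.continuous_grad[OF w(1)] subset_UNIV])
    then show "continuous_on \<gamma> (tangential (nu \<gamma>) (w j))"
      unfolding tangential_def[abs_def] by (intro continuous_intros nu_continuous)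
  qed
  have "\<exists>g. weak_tgrad \<Sigma> (normal S) (\<lambda>x. w j (cp x)) g \<and> (AE x in \<Sigma>. g x = lift_grad x (tangential (nu \<gamma>) (w j) (cp x)))" for j
    by (rule lift_smooth[OF w(1)[of j]]) blast
  then obtain g where g0: "\<forall>j. weak_tgrad \<Sigma> (normal S) (\<lambda>x. w j (cp x)) (g j) \<and> (AE x in \<Sigma>. g j x = lift_grad x (tangential (nu \<gamma>) (w j) (cp x)))"
    using choice[of "\<lambda>j g. weak_tgrad \<Sigma> (normal S) (\<lambda>x. w j (cp x)) g \<and> (AE x in \<Sigma>. g x = lift_grad x (tangential (nu \<gamma>) (w j) (cp x)))"] by auto
  obtain C where C: "C > 0" "\<And>f :: real^'m \<Rightarrow> real. square_integrable \<sigma> f \<Longrightarrow>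
      square_integrable \<Sigma> (\<lambda>x. f (cp x)) \<and> (LINT x|\<Sigma>. (norm (f (cp x)))\<^sup>2) \<le> C * (LINT y|\<sigma>. (norm (f y))\<^sup>2)"
    by (rule square_integrable_lift[where 'b = real]) (rule that)
  obtain D where D: "D > 0" "\<And>f :: real^'m \<Rightarrow> real^'m. square_integrable \<sigma> f \<Longrightarrow>
      square_integrable \<Sigma> (\<lambda>x. f (cp x)) \<and> (LINT x|\<Sigma>. (norm (f (cp x)))\<^sup>2) \<le> D * (LINT y|\<sigma>. (norm (f y))\<^sup>2)"
    by (rule square_integrable_lift[where 'b = "real^'m"]) (rule that)
  obtain B where B: "B > 0" "\<And>x q. x \<in> Gamma S \<Longrightarrow> norm (normal S x) = 1 \<Longrightarrow> norm (lift_grad x q) \<le> B * norm q"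
    by (rule norm_lift_grad) (rule that)
  have lift2: "square_integrable \<Sigma> (\<lambda>x. lift_grad x (q (cp x))) \<and>
      (LINT x|\<Sigma>. (norm (lift_grad x (q (cp x))))\<^sup>2) \<le> B\<^sup>2 * (D * (LINT y|\<sigma>. (norm (q y))\<^sup>2))"
    if q: "square_integrable \<sigma> q" for q
  proof -
    have m: "(\<lambda>x. lift_grad x (q (cp x))) \<in> borel_measurable \<Sigma>"
      by (rule lift_grad_measurable[OF square_integrable_measurable[OF q]])
    have i: "integrable \<Sigma> (\<lambda>x. (norm (q (cp x)))\<^sup>2)" using D(2)[OF q] by (simp add: square_integrable_def)
    have ae: "AE x in \<Sigma>. (norm (lift_grad x (q (cp x))))\<^sup>2 \<le> B\<^sup>2 * (norm (q (cp x)))\<^sup>2"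
      using G.n_unit AE_space
    proof eventually_elim
      case (elim x)
      have "norm (lift_grad x (q (cp x))) \<le> B * norm (q (cp x))"
        by (rule B(2)) (use elim in \<open>auto simp: space_Sigma\<close>)
      from power_mono[OF this norm_ge_zero, of 2] show ?case by (simp add: power_mult_distrib)
    qed
    have i2: "integrable \<Sigma> (\<lambda>x. (norm (lift_grad x (q (cp x))))\<^sup>2)"
      by (rule Bochner_Integration.integrable_bound[OF integrable_mult_right[OF i, of "B\<^sup>2"]])
        (use m ae in auto)
    have "(LINT x|\<Sigma>. (norm (lift_grad x (q (cp x))))\<^sup>2) \<le> (LINT x|\<Sigma>. B\<^sup>2 * (norm (q (cp x)))\<^sup>2)"
      by (rule integral_mono_AE[OF i2 integrable_mult_right[OF i] ae])
    also have "\<dots> = B\<^sup>2 * (LINT x|\<Sigma>. (norm (q (cp x)))\<^sup>2)" by simp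
    also have "\<dots> \<le> B\<^sup>2 * (D * (LINT y|\<sigma>. (norm (q y))\<^sup>2))"
      using D(2)[OF q] by (intro mult_left_mono) auto
    finally show ?thesis using m i2 by (simp add: square_integrable_def)
  qed
  show ?thesis
  proof (rule G.weak_tgrad_limit)
    show "weak_tgrad \<Sigma> (normal S) (\<lambda>x. w j (cp x)) (g j)" for j using g0 by blast
    show "square_integrable \<Sigma> (\<lambda>x. u (cp x))" using C(2)[OF su] by blast
    show "square_integrable \<Sigma> (\<lambda>x. lift_grad x (p (cp x)))" using lift2[OF sp] by blast
    have b1: "norm (LINT x|\<Sigma>. (norm (w j (cp x) - u (cp x)))\<^sup>2) \<le> C * (LINT y|\<sigma>. (norm (w j y - u y))\<^sup>2)" for j
      using C(2)[OF square_integrable_diff[OF sw[of j] su]] by simp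
    have l1: "(\<lambda>j. C * (LINT y|\<sigma>. (norm (w j y - u y))\<^sup>2)) \<longlonglongrightarrow> C * 0"
      by (intro tendsto_intros w(2))
    show "(\<lambda>j. LINT x|\<Sigma>. (norm (w j (cp x) - u (cp x)))\<^sup>2) \<longlonglongrightarrow> 0"
      by (rule Lim_null_comparison[OF always_eventually[OF allI[OF b1]]]) (use l1 in simp)
    have b2: "norm (LINT x|\<Sigma>. (norm (g j x - lift_grad x (p (cp x))))\<^sup>2) \<le>
        B\<^sup>2 * (D * (LINT y|\<sigma>. (norm (tangential (nu \<gamma>) (w j) y - p y))\<^sup>2))" for j
    proof -
      have "AE x in \<Sigma>. g j x = lift_grad x (tangential (nu \<gamma>) (w j) (cp x))" using g0 by blast
      then have "AE x in \<Sigma>. (norm (g j x - lift_grad x (p (cp x))))\<^sup>2 = (norm (lift_grad x (tangential (nu \<gamma>) (w j) (cp x) - p (cp x))))\<^sup>2"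
        by eventually_elim (simp add: lift_grad_diff)
      moreover have "(\<lambda>x. (norm (g j x - lift_grad x (p (cp x))))\<^sup>2) \<in> borel_measurable \<Sigma>"
      proof -
        have [measurable]: "g j \<in> borel_measurable \<Sigma>"
          using G.weak_tgradD(2)[of _ "g j"] g0 square_integrable_measurable by blast
        note [measurable] = lift_grad_measurable[OF square_integrable_measurable[OF sp]]
        show ?thesis by measurable
      qed
      moreover have "(\<lambda>x. (norm (lift_grad x (tangential (nu \<gamma>) (w j) (cp x) - p (cp x))))\<^sup>2) \<in> borel_measurable \<Sigma>"
        using lift_grad_measurable[OF square_integrable_measurable[OF square_integrable_diff[OF st[of j] sp]]] by simp
      ultimately have "(LINT x|\<Sigma>. (norm (g j x - lift_grad x (p (cp x))))\<^sup>2)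
          = (LINT x|\<Sigma>. (norm (lift_grad x (tangential (nu \<gamma>) (w j) (cp x) - p (cp x))))\<^sup>2)"
        by (intro integral_cong_AE)
      then show ?thesis using lift2[OF square_integrable_diff[OF st[of j] sp]] by simp
    qed
    have l2: "(\<lambda>j. B\<^sup>2 * (D * (LINT y|\<sigma>. (norm (tangential (nu \<gamma>) (w j) y - p y))\<^sup>2))) \<longlonglongrightarrow> B\<^sup>2 * (D * 0)"
      by (intro tendsto_intros w(3))
    show "(\<lambda>j. LINT x|\<Sigma>. (norm (g j x - lift_grad x (p (cp x))))\<^sup>2) \<longlonglongrightarrow> 0"
      by (rule Lim_null_comparison[OF always_eventually[OF allI[OF b2]]]) (use l2 in simp)
  qed
qed

end

section \<open>The consistency error of the eigenvalue equation\<close>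

context lifted_mesh
begin

text \<open>An inverse function theorem on the surface: the derivative is that of the element map
  after a linear left inverse of the derivative of \<open>\<Phi> T\<close>. Since lifted open
  elements are open in \<gamma>, all nearby points of \<gamma> come from the same element; the
  expansion bound converts distances of parameters into distances on \<gamma>.\<close>

lemma iota_has_derivative:
  assumes T: "T \<in> faces S" and s0: "s0 \<in> K"
  obtains A where "(\<iota> has_derivative A) (at (\<Phi> T s0) within \<gamma>)"
proof -
  let ?y = "\<Phi> T s0" and ?DP = "frechet_derivative (\<Phi> T) (at s0)"
  have linP: "linear ?DP" by (rule has_derivative_linear[OF Phi_deriv[OF T s0]])
  obtain \<Psi> where \<Psi>: "linear \<Psi>" "\<Psi> \<circ> ?DP = id"
    using linear_injective_left_inverse[OF linP inj_DPhi[OF T s0]] by blast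
  define A where "A v = DF T s0 (\<Psi> v)" for v
  have linA: "linear A"
    unfolding A_def[abs_def] using linear_compose[OF \<Psi>(1) linear_DF[OF T s0]] by (simp add: o_def)
  have blA: "bounded_linear A" using linA linear_conv_bounded_linear by blast
  obtain B where B: "B > 0" "\<And>v. norm (A v) \<le> B * norm v"
    using bounded_linear.pos_bounded[OF blA] by (auto simp: mult.commute)
  obtain r c where rc: "r > 0" "c > 0" "ball s0 r \<subseteq> K"
    "\<And>x y. x \<in> ball s0 r \<Longrightarrow> y \<in> ball s0 r \<Longrightarrow> c * norm (x - y) \<le> norm (\<Phi> T x - \<Phi> T y)"
    by (rule immersion_locally_expanding[OF open_interior s0 smooth_Phi[OF T] inj_DPhi[OF T s0]]) (rule that)
  obtain g where g: "homeomorphism K (\<Phi> T ` K) (\<Phi> T) g"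
    using local_param_Phi[OF T] unfolding local_param_def by blast
  have alt: "\<exists>d>0. \<forall>z\<in>\<gamma>. norm (z - ?y) < d \<longrightarrow> norm (\<iota> z - \<iota> ?y - A (z - ?y)) \<le> e * norm (z - ?y)"
    if e: "e > 0" for e
  proof -
    \<comment> \<open>The two linearisation errors enter with weights 1 and \<open>B\<close>, and
      \<open>c\<close> converts the parameter distance; the sum is then at most
      \<open>e * norm (z - ?y)\<close>.\<close>
    define \<eta> where "\<eta> = e * c / (1 + B)"
    have eta: "\<eta> > 0" using e rc(2) B(1) by (simp add: \<eta>_def)
    obtain d1 where d1: "d1 > 0" "\<And>s. norm (s - s0) < d1 \<Longrightarrow> norm (F T s - F T s0 - DF T s0 (s - s0)) \<le> \<eta> * norm (s - s0)"
      using F_deriv[OF T s0] eta unfolding has_derivative_at_alt by blast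
    obtain d2 where d2: "d2 > 0" "\<And>s. norm (s - s0) < d2 \<Longrightarrow> norm (\<Phi> T s - ?y - ?DP (s - s0)) \<le> \<eta> * norm (s - s0)"
      using Phi_deriv[OF T s0] eta unfolding has_derivative_at_alt by blast
    define q where "q = min r (min d1 d2)"
    have q: "q > 0" "q \<le> r" "q \<le> d1" "q \<le> d2" using rc(1) d1(1) d2(1) by (auto simp: q_def)
    have qK: "ball s0 q \<subseteq> K" using q(2) rc(3) subset_ball[of q r s0] by blast
    have "openin (top_of_set K) (ball s0 q)" using qK by (simp add: open_subset)
    then have "openin (top_of_set (\<Phi> T ` K)) (\<Phi> T ` ball s0 q)"
      by (rule homeomorphism_imp_open_map[OF g])
    then have "openin (top_of_set \<gamma>) (\<Phi> T ` ball s0 q)"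
      using openin_trans[OF _ openin_Phi[OF T]] by blast
    then obtain W where W: "open W" "\<Phi> T ` ball s0 q = \<gamma> \<inter> W" by (auto simp: openin_open)
    have "?y \<in> W" using W(2) q(1) centre_in_ball[of s0 q] by blast
    then obtain d where d: "d > 0" "ball ?y d \<subseteq> W" using W(1) openE by blast
    have "norm (\<iota> z - \<iota> ?y - A (z - ?y)) \<le> e * norm (z - ?y)" if z: "z \<in> \<gamma>" "norm (z - ?y) < d" for z
    proof -
      have "z \<in> \<gamma> \<inter> W" using z d(2) by (auto simp: dist_norm norm_minus_commute subset_iff)
      then obtain s where s: "s \<in> ball s0 q" "z = \<Phi> T s" using W(2) by blast
      have sK: "s \<in> K" using s(1) qK by blast
      have G: "F T s \<in> Gamma S" "F T s0 \<in> Gamma S" using F_in_Gamma[OF T] sK s0 K_subset by blast+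
      have n: "norm (s - s0) < q" using s(1) by (simp add: dist_norm norm_minus_commute)
      let ?r1 = "\<Phi> T s - ?y - ?DP (s - s0)" and ?r2 = "F T s - F T s0 - DF T s0 (s - s0)"
      have AD: "A (?DP (s - s0)) = DF T s0 (s - s0)"
        using fun_cong[OF \<Psi>(2), of "s - s0"] by (simp add: A_def)
      have "z - ?y = ?DP (s - s0) + ?r1" using s(2) by simp
      then have "A (z - ?y) = DF T s0 (s - s0) + A ?r1" by (simp only: linear_add[OF linA] AD)
      moreover have "\<iota> z = F T s" "\<iota> ?y = F T s0" by (simp_all only: s(2) iota_cp[OF G(1)] iota_cp[OF G(2)])
      ultimately have eq: "\<iota> z - \<iota> ?y - A (z - ?y) = ?r2 - A ?r1" by simp
      have "norm ?r2 \<le> \<eta> * norm (s - s0)" using d1(2) n q(3) by simp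
      moreover have "norm (A ?r1) \<le> B * (\<eta> * norm (s - s0))"
        using order.trans[OF B(2) mult_left_mono[OF d2(2), of s B]] n q(4) B(1) by simp
      ultimately have "norm (\<iota> z - \<iota> ?y - A (z - ?y)) \<le> (1 + B) * \<eta> * norm (s - s0)"
        unfolding eq using norm_triangle_ineq4[of ?r2 "A ?r1"] by (simp add: algebra_simps)
      also have "\<dots> = e * (c * norm (s - s0))" using B(1) by (simp add: \<eta>_def)
      also have "\<dots> \<le> e * norm (z - ?y)"
        using rc(4)[of s s0] s q(2) rc(1) e by (intro mult_left_mono) auto
      finally show ?thesis .
    qed
    then show ?thesis using d(1) by blast
  qed
  have "(\<iota> has_derivative A) (at ?y within \<gamma>)"
    unfolding has_derivative_within_alt using blA alt by blast
  then show ?thesis by (rule that)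
qed

text \<open>The inverse projection is a function on \<gamma> alone; composed with \<open>cp\<close>
  it is given on a full neighbourhood, where ambient differentiability makes sense.\<close>

lemma iota_cp_differentiable:
  assumes T: "T \<in> faces S" and s: "s \<in> K"
  shows "(\<lambda>z. \<iota> (cp z)) differentiable (at (\<Phi> T s))"
proof -
  let ?y = "\<Phi> T s"
  obtain A where A: "(\<iota> has_derivative A) (at ?y within \<gamma>)" by (rule iota_has_derivative[OF T s]) (rule that)
  have c: "(cp has_derivative Dcp ?y) (at ?y)" by (rule smooth_on_has_derivative[OF smooth_cp cp_strip])
  have "(\<iota> has_derivative A) (at (cp ?y) within range cp)"
    unfolding cp_on[OF cp_in] by (rule has_derivative_subset[OF A]) (use cp_in in auto)
  from has_derivative_in_compose[OF c this] show ?thesis by (rule differentiableI)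
qed

lemma sigma_AE_in_faces: "AE y in \<sigma>. \<exists>T\<in>faces S. \<exists>s\<in>K. y = \<Phi> T s"
proof (rule AE_I')
  show "(\<Union>T\<in>faces S. \<Phi> T ` (R - K)) \<in> null_sets \<sigma>"
    using skeleton_null finite_faces by (intro null_sets_UN' countable_finite) auto
  show "{y \<in> space \<sigma>. \<not> (\<exists>T\<in>faces S. \<exists>s\<in>K. y = \<Phi> T s)} \<subseteq> (\<Union>T\<in>faces S. \<Phi> T ` (R - K))"
  proof
    fix y assume y: "y \<in> {y \<in> space \<sigma>. \<not> (\<exists>T\<in>faces S. \<exists>s\<in>K. y = \<Phi> T s)}"
    then have "y \<in> \<gamma>" by (simp add: space_sigma)
    then have "y \<in> (\<Union>T\<in>faces S. \<Phi> T ` R)" by (rule subsetD[OF equalityD1[OF gamma_eq]])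
    then show "y \<in> (\<Union>T\<in>faces S. \<Phi> T ` (R - K))" using y by blast
  qed
qed

text \<open>The unit length is passed as a hypothesis: on the surface it follows only once
  \<open>nu \<gamma>\<close> is known not to vanish, which closeness to \<open>normal S\<close>
  provides on fine meshes.\<close>

lemma surface_space_sigma:
  assumes "\<And>T s. T \<in> faces S \<Longrightarrow> s \<in> K \<Longrightarrow> norm (nu \<gamma> (\<Phi> T s)) = 1"
  shows "surface_space \<sigma> \<gamma> (nu \<gamma>)"
proof -
  interpret finite_measure \<sigma> by (rule finite_measure_sigma)
  show ?thesis
  proof
    show "nu \<gamma> \<in> borel_measurable \<sigma>"
      unfolding measurable_cong_sets[OF sets_sigma refl]
      by (rule borel_measurable_continuous_on_restrict[OF nu_continuous])
    show "AE y in \<sigma>. norm (nu \<gamma> y) = 1"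
      using sigma_AE_in_faces by eventually_elim (use assms in auto)
  qed (use space_sigma sets_sigma compact_\<gamma> in auto)
qed

text \<open>The counterpart of \<open>lift_smooth\<close>, with the difference that the inverse
  projection is only Lipschitz across element boundaries. It is differentiable in the open lifted
  elements, hence \<sigma>-almost everywhere. The gradient \<open>q\<close> remains anonymous; what
  counts is its lift, which uniqueness on \<Gamma> identifies later.\<close>

lemma pushdown_H1:
  assumes unit: "\<And>T s. T \<in> faces S \<Longrightarrow> s \<in> K \<Longrightarrow> norm (nu \<gamma> (\<Phi> T s)) = 1"
    and w: "smooth_on w UNIV"
  obtains q where "weak_tgrad \<sigma> (nu \<gamma>) (\<lambda>y. w (\<iota> y)) q"
proof -
  interpret s: surface_space \<sigma> \<gamma> "nu \<gamma>" by (rule surface_space_sigma[OF unit])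
  let ?X = "{x. infdist x \<gamma> \<le> \<delta> / 2}"
  have X: "?X \<subseteq> strip \<gamma> \<delta>" "compact ?X"
    using delta_pos compact_tube[of "\<delta> / 2"] by (auto simp: strip_def)
  obtain L1 where L1: "L1-lipschitz_on ?X cp"
    by (rule smooth_on_lipschitz_compact[OF smooth_cp open_strip X(2,1)]) (rule that)
  obtain L2 where L2: "L2-lipschitz_on \<gamma> \<iota>" using inv_lip by blast
  obtain L3 where L3: "L3-lipschitz_on (Gamma S) w"
    by (rule smooth_on_lipschitz_compact[OF w open_UNIV compact_Gamma subset_UNIV]) (rule that)
  have "(L2 * L1)-lipschitz_on ?X (\<lambda>x. \<iota> (cp x))"
    by (rule lipschitz_on_compose2[OF L1 lipschitz_on_subset[OF L2]]) (use cp_in in auto)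
  then have Lw: "(L3 * (L2 * L1))-lipschitz_on ?X (\<lambda>x. w (\<iota> (cp x)))"
    by (rule lipschitz_on_compose2[OF _ lipschitz_on_subset[OF L3]]) (use cp_in iota_in in auto)
  obtain f L' r where f: "L'-lipschitz_on UNIV f" "\<And>x. norm x > r \<Longrightarrow> f x = 0"
    "\<And>x. infdist x \<gamma> < \<delta> / 4 \<Longrightarrow> f x = w (\<iota> (cp x))"
  proof (rule cutoff_extension[OF _ _ Lw, of "\<delta> / 4"])
    show "0 < \<delta> / 4" "\<delta> / 4 < \<delta> / 2" using delta_pos by auto
  qed (rule that)
  have o: "open {x. infdist x \<gamma> < \<delta> / 4}" by (intro open_Collect_less continuous_intros)
  have ae: "AE y in \<sigma>. f differentiable (at y)"
    using sigma_AE_in_faces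
  proof eventually_elim
    case (elim y)
    then obtain T s where Ts: "T \<in> faces S" "s \<in> K" "y = \<Phi> T s" by blast
    have "((\<lambda>z. \<iota> (cp z)) has_derivative frechet_derivative (\<lambda>z. \<iota> (cp z)) (at y)) (at y)"
      using iota_cp_differentiable[OF Ts(1,2)] unfolding Ts(3) frechet_derivative_works .
    from has_derivative_compose[OF this smooth_on_has_derivative[OF w UNIV_I]]
    have "((\<lambda>z. w (\<iota> (cp z))) has_derivative (\<lambda>v. frechet_derivative w (at (\<iota> (cp y))) (frechet_derivative (\<lambda>z. \<iota> (cp z)) (at y) v))) (at y)" .
    then have "(f has_derivative (\<lambda>v. frechet_derivative w (at (\<iota> (cp y))) (frechet_derivative (\<lambda>z. \<iota> (cp z)) (at y) v))) (at y)"
      by (rule has_derivative_transform_within_open[OF _ o]) (use f(3) Ts(3) cp_in delta_pos in auto)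
    then show ?case by (rule differentiableI)
  qed
  obtain q where q: "weak_tgrad \<sigma> (nu \<gamma>) f q" "AE x in \<sigma>. q x = tangential (nu \<gamma>) f x"
  proof (rule s.lipschitz_weak_tgrad[OF f(1) _ ae, of r])
    show "f x = 0" if "r < norm x" for x by (rule f(2)[OF that])
  qed (rule that)
  have "weak_tgrad \<sigma> (nu \<gamma>) (\<lambda>y. w (\<iota> y)) q"
    by (rule s.weak_tgrad_cong[OF q(1)]) (use f(3) cp_on delta_pos in auto)
  then show ?thesis by (rule that)
qed

end

section \<open>Meshes on which lifting is almost isometric\<close>

text \<open>The interface between geometry and analysis: one relative error
  \<open>\<epsilon>\<close> for the measures and for products of tangential gradients. The bound 1/2
  turns lower comparisons into ones with absolute constants.\<close>

locale close_mesh = lifted_mesh \<gamma> \<delta> \<sigma> k S \<rho>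
  for \<gamma> :: "(real^'m) set" and \<delta> and \<sigma> and k and S :: "('n::finite, 'm) discrete_surface" and \<rho> +
  fixes \<epsilon> :: real
  assumes eps: "0 \<le> \<epsilon>" "\<epsilon> \<le> 1 / 2"
    and measure_close: "\<And>f. integrable \<sigma> f \<Longrightarrow> (\<And>x. 0 \<le> f x) \<Longrightarrow>
      (1 - \<epsilon>) * (LINT x|Gamma_measure S. f (closest_point \<gamma> x)) \<le> (LINT y|\<sigma>. f y) \<and>
      (LINT y|\<sigma>. f y) \<le> (1 + \<epsilon>) * (LINT x|Gamma_measure S. f (closest_point \<gamma> x))"
    and grad_close: "\<And>T s p q. T \<in> faces S \<Longrightarrow> s \<in> interior ref_simplex \<Longrightarrow>
      nu \<gamma> (closest_point \<gamma> (elem_map S T s)) \<bullet> p = 0 \<Longrightarrow> nu \<gamma> (closest_point \<gamma> (elem_map S T s)) \<bullet> q = 0 \<Longrightarrow>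
      \<bar>lift_grad (elem_map S T s) p \<bullet> lift_grad (elem_map S T s) q - p \<bullet> q\<bar> \<le> \<epsilon> * norm p * norm q"
    and nu_unit: "\<And>T s. T \<in> faces S \<Longrightarrow> s \<in> interior ref_simplex \<Longrightarrow> norm (nu \<gamma> (closest_point \<gamma> (elem_map S T s))) = 1"
begin

sublocale s: surface_space \<sigma> \<gamma> "nu \<gamma>" by (rule surface_space_sigma[OF nu_unit])

lemma integrable_cp:
  fixes f :: "real^'m \<Rightarrow> real"
  assumes "integrable \<sigma> f" "\<And>x. 0 \<le> f x"
  shows "integrable \<Sigma> (\<lambda>x. f (cp x))"
proof -
  obtain c C where b: "c > 0" "C > 0"
    "\<And>T s \<xi>. T \<in> faces S \<Longrightarrow> s \<in> K \<Longrightarrow> c * norm (DF T s \<xi>) \<le> norm (frechet_derivative (\<Phi> T) (at s) \<xi>)"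
    "\<And>T s \<xi>. T \<in> faces S \<Longrightarrow> s \<in> K \<Longrightarrow> norm (frechet_derivative (\<Phi> T) (at s) \<xi>) \<le> C * norm (DF T s \<xi>)"
    by (rule basic_bounds) (rule that)
  show ?thesis by (rule integrable_lift(1)[OF b(1,2,3,4) assms])
qed

lemma square_integrable_cp:
  fixes f :: "real^'m \<Rightarrow> 'b::euclidean_space"
  assumes "square_integrable \<sigma> f"
  shows "square_integrable \<Sigma> (\<lambda>x. f (cp x))"
  using assms integrable_cp[of "\<lambda>x. (norm (f x))\<^sup>2"] measurable_compose[OF cp_measurable]
  by (auto simp: square_integrable_def)

text \<open>\<open>measure_close\<close> speaks of nonnegative functions; adding its instances for
  the positive and the negative part produces the absolute value on the right.\<close>

lemma integral_close:
  fixes f :: "real^'m \<Rightarrow> real"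
  assumes f: "integrable \<sigma> f"
  shows "\<bar>(LINT y|\<sigma>. f y) - (LINT x|\<Sigma>. f (cp x))\<bar> \<le> \<epsilon> * (LINT x|\<Sigma>. \<bar>f (cp x)\<bar>)"
proof -
  define P where "P x = max 0 (f x)" for x
  define Q where "Q x = max 0 (- f x)" for x
  have i: "integrable \<sigma> P" "integrable \<sigma> Q"
    unfolding P_def[abs_def] Q_def[abs_def] using f by (auto intro!: integrable_max)
  have pos: "0 \<le> P x" "0 \<le> Q x" for x by (simp_all add: P_def Q_def)
  have ic: "integrable \<Sigma> (\<lambda>x. P (cp x))" "integrable \<Sigma> (\<lambda>x. Q (cp x))"
    using integrable_cp i pos by auto
  have fPQ: "f x = P x - Q x" "\<bar>f x\<bar> = P x + Q x" for x by (auto simp: P_def Q_def)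
  have e1: "(LINT y|\<sigma>. f y) = (LINT y|\<sigma>. P y) - (LINT y|\<sigma>. Q y)" unfolding fPQ(1) using i by simp
  have e2: "(LINT x|\<Sigma>. f (cp x)) = (LINT x|\<Sigma>. P (cp x)) - (LINT x|\<Sigma>. Q (cp x))" unfolding fPQ(1) using ic by simp
  have e3: "(LINT x|\<Sigma>. \<bar>f (cp x)\<bar>) = (LINT x|\<Sigma>. P (cp x)) + (LINT x|\<Sigma>. Q (cp x))" unfolding fPQ(2) using ic by simp
  have "\<bar>(LINT y|\<sigma>. P y) - (LINT x|\<Sigma>. P (cp x))\<bar> \<le> \<epsilon> * (LINT x|\<Sigma>. P (cp x))"
    using measure_close[OF i(1) pos(1)] by (simp add: abs_le_iff algebra_simps)
  moreover have "\<bar>(LINT y|\<sigma>. Q y) - (LINT x|\<Sigma>. Q (cp x))\<bar> \<le> \<epsilon> * (LINT x|\<Sigma>. Q (cp x))"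
    using measure_close[OF i(2) pos(2)] by (simp add: abs_le_iff algebra_simps)
  ultimately show ?thesis unfolding e1 e2 e3 distrib_left by linarith
qed

lemma integral_inner_close:
  fixes f g :: "real^'m \<Rightarrow> 'b::euclidean_space"
  assumes f: "square_integrable \<sigma> f" and g: "square_integrable \<sigma> g"
  shows "\<bar>(LINT y|\<sigma>. f y \<bullet> g y) - (LINT x|\<Sigma>. f (cp x) \<bullet> g (cp x))\<bar>
    \<le> \<epsilon> * (sqrt (LINT x|\<Sigma>. (norm (f (cp x)))\<^sup>2) * sqrt (LINT x|\<Sigma>. (norm (g (cp x)))\<^sup>2))"
    and "(LINT x|\<Sigma>. norm (f (cp x)) * norm (g (cp x)))
    \<le> sqrt (LINT x|\<Sigma>. (norm (f (cp x)))\<^sup>2) * sqrt (LINT x|\<Sigma>. (norm (g (cp x)))\<^sup>2)"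
    and "integrable \<Sigma> (\<lambda>x. norm (f (cp x)) * norm (g (cp x)))"
proof -
  note sf = square_integrable_cp[OF f] and sg = square_integrable_cp[OF g]
  have nf: "square_integrable \<Sigma> (\<lambda>x. norm (f (cp x)))" and ng: "square_integrable \<Sigma> (\<lambda>x. norm (g (cp x)))"
    using sf sg unfolding square_integrable_def by (auto intro: borel_measurable_norm)
  show i: "integrable \<Sigma> (\<lambda>x. norm (f (cp x)) * norm (g (cp x)))" by (rule square_integrable_times[OF nf ng])
  show le: "(LINT x|\<Sigma>. norm (f (cp x)) * norm (g (cp x)))
    \<le> sqrt (LINT x|\<Sigma>. (norm (f (cp x)))\<^sup>2) * sqrt (LINT x|\<Sigma>. (norm (g (cp x)))\<^sup>2)"
    using integral_inner_Cauchy_Schwarz[OF nf ng] by (simp add: abs_le_iff)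
  have "(LINT x|\<Sigma>. \<bar>f (cp x) \<bullet> g (cp x)\<bar>) \<le> (LINT x|\<Sigma>. norm (f (cp x)) * norm (g (cp x)))"
    by (rule integral_mono[OF integrable_abs[OF square_integrable_inner[OF sf sg]] i]) (rule Cauchy_Schwarz_ineq2)
  then have "(LINT x|\<Sigma>. \<bar>f (cp x) \<bullet> g (cp x)\<bar>)
    \<le> sqrt (LINT x|\<Sigma>. (norm (f (cp x)))\<^sup>2) * sqrt (LINT x|\<Sigma>. (norm (g (cp x)))\<^sup>2)" using le by (rule order.trans)
  from mult_left_mono[OF this eps(1)] integral_close[OF square_integrable_inner[OF f g]]
  show "\<bar>(LINT y|\<sigma>. f y \<bullet> g y) - (LINT x|\<Sigma>. f (cp x) \<bullet> g (cp x))\<bar>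
    \<le> \<epsilon> * (sqrt (LINT x|\<Sigma>. (norm (f (cp x)))\<^sup>2) * sqrt (LINT x|\<Sigma>. (norm (g (cp x)))\<^sup>2))" by (rule order.trans[rotated])
qed

text \<open>One \<open>\<epsilon>\<close> is spent on the product of the gradients, the other on
  exchanging the measures.\<close>

lemma lift_grad_close:
  assumes p: "weak_tgrad \<sigma> (nu \<gamma>) u p" and q: "weak_tgrad \<sigma> (nu \<gamma>) v q"
  shows "\<bar>(LINT x|\<Sigma>. lift_grad x (p (cp x)) \<bullet> lift_grad x (q (cp x))) - (LINT y|\<sigma>. p y \<bullet> q y)\<bar>
    \<le> 2 * \<epsilon> * (sqrt (LINT x|\<Sigma>. (norm (p (cp x)))\<^sup>2) * sqrt (LINT x|\<Sigma>. (norm (q (cp x)))\<^sup>2))"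
proof -
  note sp = s.weak_tgradD(2)[OF p] and sq = s.weak_tgradD(2)[OF q]
  note lp = G.weak_tgradD(2)[OF lift_weak_tgrad[OF p]] and lq = G.weak_tgradD(2)[OF lift_weak_tgrad[OF q]]
  have ae: "AE x in \<Sigma>. \<bar>lift_grad x (p (cp x)) \<bullet> lift_grad x (q (cp x)) - p (cp x) \<bullet> q (cp x)\<bar>
      \<le> \<epsilon> * (norm (p (cp x)) * norm (q (cp x)))"
    using AE_in_faces AE_lift[OF s.weak_tgrad_normal[OF p]] AE_lift[OF s.weak_tgrad_normal[OF q]]
  proof eventually_elim
    case (elim x)
    then obtain T s where Ts: "T \<in> faces S" "s \<in> K" "x = F T s" by blast
    show ?case using grad_close[OF Ts(1,2), of "p (cp x)" "q (cp x)"] elim(2,3) by (simp add: Ts(3) mult.assoc)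
  qed
  have i1: "integrable \<Sigma> (\<lambda>x. lift_grad x (p (cp x)) \<bullet> lift_grad x (q (cp x)))" by (rule square_integrable_inner[OF lp lq])
  have i2: "integrable \<Sigma> (\<lambda>x. p (cp x) \<bullet> q (cp x))"
    by (rule square_integrable_inner[OF square_integrable_cp[OF sp] square_integrable_cp[OF sq]])
  have "\<bar>(LINT x|\<Sigma>. lift_grad x (p (cp x)) \<bullet> lift_grad x (q (cp x))) - (LINT x|\<Sigma>. p (cp x) \<bullet> q (cp x))\<bar>
      = \<bar>LINT x|\<Sigma>. lift_grad x (p (cp x)) \<bullet> lift_grad x (q (cp x)) - p (cp x) \<bullet> q (cp x)\<bar>"
    using i1 i2 by simp
  also have "\<dots> \<le> (LINT x|\<Sigma>. \<epsilon> * (norm (p (cp x)) * norm (q (cp x))))"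
    by (rule order.trans[OF integral_abs_bound integral_mono_AE[OF integrable_abs[OF Bochner_Integration.integrable_diff[OF i1 i2]]
            integrable_mult_right[OF integral_inner_close(3)[OF sp sq]] ae]])
  also have "\<dots> = \<epsilon> * (LINT x|\<Sigma>. norm (p (cp x)) * norm (q (cp x)))" by simp
  also have "\<dots> \<le> \<epsilon> * (sqrt (LINT x|\<Sigma>. (norm (p (cp x)))\<^sup>2) * sqrt (LINT x|\<Sigma>. (norm (q (cp x)))\<^sup>2))"
    by (rule mult_left_mono[OF integral_inner_close(2)[OF sp sq] eps(1)])
  finally show ?thesis using integral_inner_close(1)[OF sp sq] by linarith
qed

lemma lift_grad_norm_lower:
  assumes q: "weak_tgrad \<sigma> (nu \<gamma>) v q"
  shows "(LINT x|\<Sigma>. (norm (q (cp x)))\<^sup>2) \<le> 2 * (LINT x|\<Sigma>. (norm (lift_grad x (q (cp x))))\<^sup>2)"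
proof -
  note sq = square_integrable_cp[OF s.weak_tgradD(2)[OF q]] and lq = G.weak_tgradD(2)[OF lift_weak_tgrad[OF q]]
  have ae: "AE x in \<Sigma>. (norm (q (cp x)))\<^sup>2 \<le> 2 * (norm (lift_grad x (q (cp x))))\<^sup>2"
    using AE_in_faces AE_lift[OF s.weak_tgrad_normal[OF q]]
  proof eventually_elim
    case (elim x)
    then obtain T s where Ts: "T \<in> faces S" "s \<in> K" "x = F T s" by blast
    let ?a = "(norm (lift_grad x (q (cp x))))\<^sup>2" and ?b = "(norm (q (cp x)))\<^sup>2"
    have "\<bar>?a - ?b\<bar> \<le> \<epsilon> * ?b"
      using grad_close[OF Ts(1,2), of "q (cp x)" "q (cp x)"] elim(2)
      by (simp add: Ts(3) mult.assoc power2_norm_eq_inner[symmetric]) (simp add: power2_eq_square mult.assoc)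
    also have "\<dots> \<le> (1 / 2) * ?b" by (rule mult_right_mono[OF eps(2)]) simp
    finally show ?case using abs_ge_minus_self[of "?a - ?b"] by linarith
  qed
  have "(LINT x|\<Sigma>. (norm (q (cp x)))\<^sup>2) \<le> (LINT x|\<Sigma>. 2 * (norm (lift_grad x (q (cp x))))\<^sup>2)"
    by (rule integral_mono_AE[OF _ _ ae]) (use sq lq in \<open>auto simp: square_integrable_def\<close>)
  then show ?thesis by simp
qed

text \<open>The eigenvalue equation is tested on \<gamma> with the pushed down \<open>w\<close>,
  corrected by its mean. Lifted back, the gradient of this test function is the tangential gradient
  of \<open>w\<close>, so both sides of the equation can be compared with their analogues on
  \<Gamma>.\<close>

lemma key_estimate_smooth:
  assumes l: "l > 0" and u: "eigenfunction \<sigma> (nu \<gamma>) l u" and p: "weak_tgrad \<sigma> (nu \<gamma>) u p" "p = tgrad \<sigma> (nu \<gamma>) u"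
    and w: "smooth_on w UNIV"
  shows "\<bar>(LINT x|\<Sigma>. lift_grad x (p (cp x)) \<bullet> tangential (normal S) w x) - l * (LINT x|\<Sigma>. u (cp x) * w x)\<bar>
    \<le> 6 * \<epsilon> * (sqrt l * sqrt (LINT x|\<Sigma>. (u (cp x))\<^sup>2) * sqrt (LINT x|\<Sigma>. (norm (tangential (normal S) w x))\<^sup>2)
        + l * sqrt (LINT x|\<Sigma>. (u (cp x))\<^sup>2) * sqrt (LINT x|\<Sigma>. (w x)\<^sup>2))"
proof -
  define v where "v y = w (\<iota> y)" for y
  obtain q0 where q0': "weak_tgrad \<sigma> (nu \<gamma>) (\<lambda>y. w (\<iota> y)) q0"
  proof (rule pushdown_H1[OF _ w])
    show "norm (nu \<gamma> (\<Phi> T s)) = 1" if ts: "T \<in> faces S" "s \<in> K" for T s by (rule nu_unit[OF ts])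
  qed (rule that)
  then have q0: "weak_tgrad \<sigma> (nu \<gamma>) v q0" by (simp only: v_def[abs_def])
  \<comment> \<open>Test functions must have mean zero on \<gamma>. Subtracting the mean changes
    neither the lifted gradient nor the product with \<open>u\<close>, which has mean zero
    itself.\<close>
  define m where "m = (LINT y|\<sigma>. v y) / measure \<sigma> (space \<sigma>)"
  define v0 where "v0 y = v y - m" for y
  have su: "square_integrable \<sigma> u" and sv: "square_integrable \<sigma> v"
    using s.weak_tgradD(1)[OF p(1)] s.weak_tgradD(1)[OF q0] .
  have s1: "square_integrable \<sigma> (\<lambda>y. 1::real)" by (simp add: square_integrable_def)
  have iv: "integrable \<sigma> v" using square_integrable_times[OF sv s1] by simp
  have iu: "integrable \<sigma> u" using square_integrable_times[OF su s1] by simp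
  have uH: "u \<in> H1_zero_mean \<sigma> (nu \<gamma>)" "\<And>v. v \<in> H1_zero_mean \<sigma> (nu \<gamma>) \<Longrightarrow> stiffness \<sigma> (nu \<gamma>) u v = l * mass \<sigma> u v"
    using u by (auto simp: eigenfunction_def)
  have u0: "(LINT y|\<sigma>. u y) = 0" using uH(1) by (simp add: H1_zero_mean_def)
  have "weak_tgrad \<sigma> (nu \<gamma>) (\<lambda>y. 1 * v y + (- m) * 1) (\<lambda>y. 1 *\<^sub>R q0 y + (- m) *\<^sub>R tangential (nu \<gamma>) (\<lambda>y. 1) y)"
    by (rule s.weak_tgrad_linear_combination[OF q0 s.weak_tgrad_smooth[OF smooth_on_const[OF open_UNIV]]])
  then have "v0 \<in> H1 \<sigma> (nu \<gamma>)" unfolding H1_def v0_def[abs_def] by auto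
  moreover have "(LINT y|\<sigma>. v0 y) = 0"
  proof (cases "measure \<sigma> (space \<sigma>) = 0")
    \<comment> \<open>The mean is then a quotient by zero, that is 0, but all integrals over a null
      measure vanish.\<close>
    case True
    then have "space \<sigma> \<in> null_sets \<sigma>" by (auto simp: null_sets_def s.emeasure_eq_measure)
    then have "AE y in \<sigma>. v0 y = 0" by (rule AE_I') auto
    then show ?thesis by (rule integral_eq_zero_AE)
  next
    case False
    then show ?thesis using iv by (simp add: v0_def m_def)
  qed
  ultimately have v0H: "v0 \<in> H1_zero_mean \<sigma> (nu \<gamma>)" by (simp add: H1_zero_mean_def)
  define q where "q = tgrad \<sigma> (nu \<gamma>) v0"
  have q: "weak_tgrad \<sigma> (nu \<gamma>) v0 q"
    using v0H someI_ex[of "weak_tgrad \<sigma> (nu \<gamma>) v0"] unfolding q_def tgrad_def H1_zero_mean_def H1_def by blast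
  have eig: "(LINT y|\<sigma>. p y \<bullet> q y) = l * (LINT y|\<sigma>. u y * v y)"
  proof -
    have "(LINT y|\<sigma>. p y \<bullet> q y) = l * (LINT y|\<sigma>. u y * v0 y)"
      using uH(2)[OF v0H] by (simp add: stiffness_def mass_def p(2) q_def)
    also have "(LINT y|\<sigma>. u y * v0 y) = (LINT y|\<sigma>. u y * v y - m * u y)"
      by (simp add: v0_def algebra_simps)
    also have "\<dots> = (LINT y|\<sigma>. u y * v y)"
      using square_integrable_times[OF su sv] iu u0 by simp
    finally show ?thesis .
  qed
  \<comment> \<open>Testing with \<open>u\<close> itself expresses its energy by its mass; the
    factor \<open>sqrt l\<close> in the estimate originates here.\<close>
  have eiguu: "(LINT y|\<sigma>. (norm (p y))\<^sup>2) = l * (LINT y|\<sigma>. (u y)\<^sup>2)"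
  proof -
    have sq: "(LINT y|\<sigma>. (u y)\<^sup>2) = (LINT y|\<sigma>. u y * u y)" by (simp add: power2_eq_square)
    show ?thesis
      unfolding power2_norm_eq_inner sq using uH(2)[OF uH(1)] by (simp add: stiffness_def mass_def p(2)[symmetric])
  qed
  \<comment> \<open>Both sides are weak gradients on \<Gamma> of the same function
    \<open>w - m\<close>: one as the lift of the chosen \<open>q\<close>, the other because
    \<open>w\<close> is smooth.\<close>
  have lift: "AE x in \<Sigma>. lift_grad x (q (cp x)) = tangential (normal S) w x"
  proof -
    have "weak_tgrad \<Sigma> (normal S) (\<lambda>x. w x - m) (\<lambda>x. lift_grad x (q (cp x)))"
      by (rule G.weak_tgrad_cong[OF lift_weak_tgrad[OF q]]) (simp add: v0_def v_def iota_cp)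
    moreover have "smooth_on (\<lambda>x. w x - m) UNIV"
      by (rule smooth_on_diff[OF open_UNIV w smooth_on_const[OF open_UNIV]])
    then have "weak_tgrad \<Sigma> (normal S) (\<lambda>x. w x - m) (tangential (normal S) (\<lambda>x. w x - m))"
      by (rule G.weak_tgrad_smooth)
    moreover have "tangential (normal S) (\<lambda>x. w x - m) = tangential (normal S) w"
    proof -
      have "grad (\<lambda>x. w x - m) x = grad w x" for x
      proof (rule grad_eqI)
        have "(w has_derivative (\<lambda>h. grad w x \<bullet> h)) (at x)"
          using smooth_on_has_derivative[OF w UNIV_I] by (simp add: grad_inner[OF smooth_on_differentiable[OF w]])
        from has_derivative_diff[OF this has_derivative_const[of m]]
        show "((\<lambda>x. w x - m) has_derivative (\<bullet>) (grad w x)) (at x)" by simp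
      qed
      then show ?thesis by (simp add: tangential_def[abs_def])
    qed
    ultimately show ?thesis using tgrad_unique by simp
  qed
  let ?U = "sqrt (LINT x|\<Sigma>. (u (cp x))\<^sup>2)" and ?W = "sqrt (LINT x|\<Sigma>. (w x)\<^sup>2)"
    and ?P = "sqrt (LINT x|\<Sigma>. (norm (p (cp x)))\<^sup>2)" and ?Q = "sqrt (LINT x|\<Sigma>. (norm (q (cp x)))\<^sup>2)"
    and ?g = "sqrt (LINT x|\<Sigma>. (norm (tangential (normal S) w x))\<^sup>2)"
  have vw: "v (cp x) = w x" if "x \<in> Gamma S" for x by (simp add: v_def iota_cp[OF that])
  have lp: "square_integrable \<Sigma> (\<lambda>x. lift_grad x (p (cp x)))" by (rule G.weak_tgradD(2)[OF lift_weak_tgrad[OF p(1)]])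
  have lq: "square_integrable \<Sigma> (\<lambda>x. lift_grad x (q (cp x)))" by (rule G.weak_tgradD(2)[OF lift_weak_tgrad[OF q]])
  have lw: "square_integrable \<Sigma> (tangential (normal S) w)" by (rule G.square_integrable_tangential[OF w])
  have e1: "(LINT x|\<Sigma>. lift_grad x (p (cp x)) \<bullet> lift_grad x (q (cp x))) = (LINT x|\<Sigma>. lift_grad x (p (cp x)) \<bullet> tangential (normal S) w x)"
  proof (rule integral_cong_AE)
    show "AE x in \<Sigma>. lift_grad x (p (cp x)) \<bullet> lift_grad x (q (cp x)) = lift_grad x (p (cp x)) \<bullet> tangential (normal S) w x"
      using lift by eventually_elim simp
  qed (use lp lq lw in \<open>auto simp: square_integrable_def intro: borel_measurable_inner\<close>)
  have e2: "(LINT x|\<Sigma>. (norm (lift_grad x (q (cp x))))\<^sup>2) = (LINT x|\<Sigma>. (norm (tangential (normal S) w x))\<^sup>2)"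
  proof (rule integral_cong_AE)
    show "AE x in \<Sigma>. (norm (lift_grad x (q (cp x))))\<^sup>2 = (norm (tangential (normal S) w x))\<^sup>2"
      using lift by eventually_elim simp
  qed (use lq lw in \<open>auto simp: square_integrable_def\<close>)
  have e3: "(LINT x|\<Sigma>. u (cp x) * v (cp x)) = (LINT x|\<Sigma>. u (cp x) * w x)"
    by (rule Bochner_Integration.integral_cong[OF refl]) (simp add: space_Sigma vw)
  have e4: "(LINT x|\<Sigma>. (norm (v (cp x)))\<^sup>2) = (LINT x|\<Sigma>. (w x)\<^sup>2)"
    by (rule Bochner_Integration.integral_cong[OF refl]) (simp add: space_Sigma vw)
  have nn: "0 \<le> ?U" "0 \<le> ?W" "0 \<le> ?g" "0 \<le> ?P" "0 \<le> ?Q" by (auto intro!: integral_nonneg)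
  have Q: "?Q \<le> sqrt 2 * ?g"
    using lift_grad_norm_lower[OF q] unfolding e2 real_sqrt_mult[symmetric] by (rule real_sqrt_le_mono)
  have P: "?P \<le> 2 * (sqrt l * ?U)"
  proof -
    have ip: "integrable \<sigma> (\<lambda>y. (norm (p y))\<^sup>2)" using s.weak_tgradD(2)[OF p(1)] by (simp add: square_integrable_def)
    have iu2: "integrable \<sigma> (\<lambda>y. (u y)\<^sup>2)" using su by (simp add: square_integrable_def)
    have n1: "0 \<le> (LINT x|\<Sigma>. (norm (p (cp x)))\<^sup>2)" "0 \<le> (LINT x|\<Sigma>. (u (cp x))\<^sup>2)" by (auto intro: integral_nonneg)
    \<comment> \<open>The energy of \<open>u\<close> is carried to \<sigma>, replaced by
      \<open>l\<close> times the mass, and carried back; each passage costs at most a factor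
      2.\<close>
    have "(1 / 2) * (LINT x|\<Sigma>. (norm (p (cp x)))\<^sup>2) \<le> (1 - \<epsilon>) * (LINT x|\<Sigma>. (norm (p (cp x)))\<^sup>2)"
      using eps n1(1) by (intro mult_right_mono) auto
    also have "\<dots> \<le> l * (LINT y|\<sigma>. (u y)\<^sup>2)"
      using measure_close[OF ip] unfolding eiguu by simp
    also have "\<dots> \<le> l * ((1 + \<epsilon>) * (LINT x|\<Sigma>. (u (cp x))\<^sup>2))"
      using measure_close[OF iu2] l by (intro mult_left_mono) auto
    also have "\<dots> \<le> l * (2 * (LINT x|\<Sigma>. (u (cp x))\<^sup>2))"
      using eps n1(2) l by (intro mult_left_mono mult_right_mono) auto
    finally have "(LINT x|\<Sigma>. (norm (p (cp x)))\<^sup>2) \<le> 4 * (l * (LINT x|\<Sigma>. (u (cp x))\<^sup>2))" by simp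
    then have "?P \<le> sqrt (4 * (l * (LINT x|\<Sigma>. (u (cp x))\<^sup>2)))" by (rule real_sqrt_le_mono)
    then show ?thesis by (simp add: real_sqrt_mult)
  qed
  have m1: "\<bar>(LINT x|\<Sigma>. lift_grad x (p (cp x)) \<bullet> tangential (normal S) w x) - l * (LINT y|\<sigma>. u y * v y)\<bar> \<le> 2 * \<epsilon> * (?P * ?Q)"
    using lift_grad_close[OF p(1) q] unfolding e1 eig .
  have m2: "\<bar>(LINT y|\<sigma>. u y * v y) - (LINT x|\<Sigma>. u (cp x) * w x)\<bar> \<le> \<epsilon> * (?U * ?W)"
    using integral_inner_close(1)[OF su sv] unfolding e4 by (simp add: e3)
  have "?P * ?Q \<le> (2 * (sqrt l * ?U)) * (sqrt 2 * ?g)"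
    using P Q nn l by (intro mult_mono) auto
  also have "\<dots> \<le> 3 * (sqrt l * ?U * ?g)"
  proof -
    \<comment> \<open>The 2 comes from \<open>P\<close>, the root from \<open>Q\<close>; doubling
      the 3 gives the 6 of the estimate.\<close>
    have "2 * sqrt 2 \<le> (3::real)"
      using real_sqrt_le_mono[of 2 "(3/2)\<^sup>2 :: real"] by (simp add: power2_eq_square real_sqrt_divide)
    then have "(2 * sqrt 2) * (sqrt l * ?U * ?g) \<le> 3 * (sqrt l * ?U * ?g)"
      using nn l by (intro mult_right_mono) auto
    then show ?thesis by (simp add: mult_ac)
  qed
  finally have m3: "2 * \<epsilon> * (?P * ?Q) \<le> 2 * \<epsilon> * (3 * (sqrt l * ?U * ?g))"
    using eps by (intro mult_left_mono) auto
  have m4: "\<bar>l * (LINT y|\<sigma>. u y * v y) - l * (LINT x|\<Sigma>. u (cp x) * w x)\<bar> \<le> 6 * \<epsilon> * (l * ?U * ?W)"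
  proof -
    have "\<bar>l * (LINT y|\<sigma>. u y * v y) - l * (LINT x|\<Sigma>. u (cp x) * w x)\<bar> = l * \<bar>(LINT y|\<sigma>. u y * v y) - (LINT x|\<Sigma>. u (cp x) * w x)\<bar>"
      using l by (simp add: right_diff_distrib[symmetric] abs_mult)
    also have "\<dots> \<le> l * (\<epsilon> * (?U * ?W))" using m2 l by (intro mult_left_mono) auto
    also have "\<dots> \<le> 6 * \<epsilon> * (l * ?U * ?W)"
      using mult_right_mono[of 1 6 "\<epsilon> * (l * ?U * ?W)"] eps nn l by (simp add: mult_ac)
    finally show ?thesis .
  qed
  show ?thesis
    using m1 m3 m4 unfolding distrib_left by linarith
qed

text \<open>Every term is continuous along the smooth approximations in the definition of the weak
  gradient, so the inequality passes to the limit.\<close>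

lemma key_estimate:
  assumes l: "l > 0" and u: "eigenfunction \<sigma> (nu \<gamma>) l u" and p: "weak_tgrad \<sigma> (nu \<gamma>) u p" "p = tgrad \<sigma> (nu \<gamma>) u"
    and V: "weak_tgrad \<Sigma> (normal S) V g"
  shows "\<bar>(LINT x|\<Sigma>. lift_grad x (p (cp x)) \<bullet> g x) - l * (LINT x|\<Sigma>. u (cp x) * V x)\<bar>
    \<le> 6 * \<epsilon> * (sqrt l * sqrt (LINT x|\<Sigma>. (u (cp x))\<^sup>2) * sqrt (LINT x|\<Sigma>. (norm (g x))\<^sup>2)
        + l * sqrt (LINT x|\<Sigma>. (u (cp x))\<^sup>2) * sqrt (LINT x|\<Sigma>. (V x)\<^sup>2))"
proof -
  obtain w where w: "\<And>j. smooth_on (w j) UNIV"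
    "(\<lambda>j. LINT x|\<Sigma>. (norm (w j x - V x))\<^sup>2) \<longlonglongrightarrow> 0"
    "(\<lambda>j. LINT x|\<Sigma>. (norm (tangential (normal S) (w j) x - g x))\<^sup>2) \<longlonglongrightarrow> 0"
    by (rule G.weak_tgradE[OF V]) (rule that)
  note sV = G.weak_tgradD[OF V] and lu = G.weak_tgradD[OF lift_weak_tgrad[OF p(1)]]
  have sw: "square_integrable \<Sigma> (w j)" for j by (rule G.square_integrable_smooth[OF w(1)])
  have st: "square_integrable \<Sigma> (tangential (normal S) (w j))" for j by (rule G.square_integrable_tangential[OF w(1)])
  have t1: "(\<lambda>j. LINT x|\<Sigma>. lift_grad x (p (cp x)) \<bullet> tangential (normal S) (w j) x) \<longlonglongrightarrow> (LINT x|\<Sigma>. lift_grad x (p (cp x)) \<bullet> g x)"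
    using tendsto_integral_inner[OF sV(2) st w(3) lu(2)] by (simp add: inner_commute)
  have t2: "(\<lambda>j. LINT x|\<Sigma>. u (cp x) * w j x) \<longlonglongrightarrow> (LINT x|\<Sigma>. u (cp x) * V x)"
    using tendsto_integral_inner[OF sV(1) sw w(2) lu(1)] by (simp add: mult.commute)
  have t3: "(\<lambda>j. LINT x|\<Sigma>. (norm (tangential (normal S) (w j) x))\<^sup>2) \<longlonglongrightarrow> (LINT x|\<Sigma>. (norm (g x))\<^sup>2)"
    by (rule tendsto_integral_norm_sq[OF sV(2) st w(3)])
  have t4: "(\<lambda>j. LINT x|\<Sigma>. (w j x)\<^sup>2) \<longlonglongrightarrow> (LINT x|\<Sigma>. (V x)\<^sup>2)"
    using tendsto_integral_norm_sq[OF sV(1) sw w(2)] by simp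
  show ?thesis
  proof (rule LIMSEQ_le)
    show "(\<lambda>j. \<bar>(LINT x|\<Sigma>. lift_grad x (p (cp x)) \<bullet> tangential (normal S) (w j) x) - l * (LINT x|\<Sigma>. u (cp x) * w j x)\<bar>)
      \<longlonglongrightarrow> \<bar>(LINT x|\<Sigma>. lift_grad x (p (cp x)) \<bullet> g x) - l * (LINT x|\<Sigma>. u (cp x) * V x)\<bar>"
      by (intro tendsto_rabs tendsto_diff tendsto_mult tendsto_const t1 t2)
    show "(\<lambda>j. 6 * \<epsilon> * (sqrt l * sqrt (LINT x|\<Sigma>. (u (cp x))\<^sup>2) * sqrt (LINT x|\<Sigma>. (norm (tangential (normal S) (w j) x))\<^sup>2)
        + l * sqrt (LINT x|\<Sigma>. (u (cp x))\<^sup>2) * sqrt (LINT x|\<Sigma>. (w j x)\<^sup>2)))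
      \<longlonglongrightarrow> 6 * \<epsilon> * (sqrt l * sqrt (LINT x|\<Sigma>. (u (cp x))\<^sup>2) * sqrt (LINT x|\<Sigma>. (norm (g x))\<^sup>2)
        + l * sqrt (LINT x|\<Sigma>. (u (cp x))\<^sup>2) * sqrt (LINT x|\<Sigma>. (V x)\<^sup>2))"
      by (intro tendsto_mult tendsto_add tendsto_const tendsto_real_sqrt t3 t4)
    show "\<exists>N. \<forall>j\<ge>N. \<bar>(LINT x|\<Sigma>. lift_grad x (p (cp x)) \<bullet> tangential (normal S) (w j) x) - l * (LINT x|\<Sigma>. u (cp x) * w j x)\<bar>
      \<le> 6 * \<epsilon> * (sqrt l * sqrt (LINT x|\<Sigma>. (u (cp x))\<^sup>2) * sqrt (LINT x|\<Sigma>. (norm (tangential (normal S) (w j) x))\<^sup>2)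
        + l * sqrt (LINT x|\<Sigma>. (u (cp x))\<^sup>2) * sqrt (LINT x|\<Sigma>. (w j x)\<^sup>2))"
      by (rule exI[of _ 0], intro allI impI) (rule key_estimate_smooth[OF l u p w(1)])
  qed
qed

end

section \<open>Fine meshes\<close>

lemma one_plus_power_le:
  fixes t :: real
  assumes "0 \<le> t" "t \<le> 1"
  shows "(1 + t) ^ n \<le> 1 + 2 ^ n * t"
proof (induction n)
  case (Suc n)
  have "(1 + t) ^ Suc n = (1 + t) ^ n + t * (1 + t) ^ n" by (simp add: algebra_simps)
  also have "(1 + t) ^ n \<le> 2 ^ n" using assms by (intro power_mono) auto
  then have "t * (1 + t) ^ n \<le> t * 2 ^ n" using assms(1) by (rule mult_left_mono)
  then have "(1 + t) ^ n + t * (1 + t) ^ n \<le> (1 + 2 ^ n * t) + t * 2 ^ n" by (rule add_mono[OF Suc])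
  also have "\<dots> = 1 + 2 ^ Suc n * t" by simp
  finally show ?case .
qed (use assms in simp)

lemma one_minus_power_ge:
  fixes t :: real
  assumes "0 \<le> t" "t \<le> 1"
  shows "1 - 2 ^ n * t \<le> (1 - t) ^ n"
proof -
  have "1 + real n * (- t) \<le> (1 + (- t)) ^ n" by (rule Bernoulli_inequality) (use assms in simp)
  moreover have "real n * t \<le> 2 ^ n * t"
    using assms(1) of_nat_mono[OF less_imp_le[OF less_exp[of n]], where 'a = real] by (intro mult_right_mono) auto
  ultimately show ?thesis by simp
qed

text \<open>Expanding the square shows that removing a component of relative size \<open>t\<close>
  changes the length only by a multiple of the square of \<open>t\<close>. This is why the error of
  the normals enters squared. The bound 2 on \<open>v\<close> leaves room for \<open>nu\<close>
  before it is known to be a unit vector.\<close>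

lemma norm_minus_component:
  fixes \<xi> v :: "'a::real_inner"
  assumes v: "norm v \<le> 2" and c: "\<bar>v \<bullet> \<xi>\<bar> \<le> t * norm \<xi>" and t: "0 \<le> t" "2 * t\<^sup>2 \<le> 1"
  shows "(1 - 2 * t\<^sup>2) * norm \<xi> \<le> norm (\<xi> - (v \<bullet> \<xi>) *\<^sub>R v)"
    and "norm (\<xi> - (v \<bullet> \<xi>) *\<^sub>R v) \<le> (1 + 2 * t\<^sup>2) * norm \<xi>"
proof -
  let ?s = "(v \<bullet> \<xi>)\<^sup>2" and ?n = "norm (\<xi> - (v \<bullet> \<xi>) *\<^sub>R v)"
  have eq: "?n\<^sup>2 = (norm \<xi>)\<^sup>2 - 2 * ?s + ?s * (norm v)\<^sup>2"
    unfolding power2_norm_eq_inner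
    by (simp add: inner_diff_left inner_diff_right inner_commute power2_eq_square algebra_simps)
  have s: "?s \<le> t\<^sup>2 * (norm \<xi>)\<^sup>2"
    using power_mono[OF c abs_ge_zero, of 2] by (simp add: power_mult_distrib)
  have v2: "(norm v)\<^sup>2 \<le> 4" using power_mono[OF v norm_ge_zero, of 2] by simp
  have "?s * (norm v)\<^sup>2 \<le> (t\<^sup>2 * (norm \<xi>)\<^sup>2) * 4"
    using s v2 by (intro mult_mono) auto
  then have "?n\<^sup>2 \<le> (1 + 4 * t\<^sup>2) * (norm \<xi>)\<^sup>2"
    unfolding eq by (simp add: algebra_simps) (smt (verit) zero_le_power2)
  also have "\<dots> \<le> ((1 + 2 * t\<^sup>2)\<^sup>2) * (norm \<xi>)\<^sup>2"
  proof (rule mult_right_mono)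
    have "(1 + 2 * t\<^sup>2)\<^sup>2 = 1 + 4 * t\<^sup>2 + 4 * (t\<^sup>2)\<^sup>2" by (simp add: power2_sum power_mult_distrib)
    then show "1 + 4 * t\<^sup>2 \<le> (1 + 2 * t\<^sup>2)\<^sup>2" by simp
  qed simp
  finally have "?n\<^sup>2 \<le> ((1 + 2 * t\<^sup>2) * norm \<xi>)\<^sup>2" by (simp add: power_mult_distrib)
  then show "?n \<le> (1 + 2 * t\<^sup>2) * norm \<xi>"
    by (rule power2_le_imp_le) simp
  have "((1 - 2 * t\<^sup>2) * norm \<xi>)\<^sup>2 = (1 - 2 * t\<^sup>2)\<^sup>2 * (norm \<xi>)\<^sup>2" by (simp add: power_mult_distrib)
  \<comment> \<open>A number in the unit interval is at least its own square.\<close>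
  also have "\<dots> \<le> (1 - 2 * t\<^sup>2) * (norm \<xi>)\<^sup>2"
    using t(2) by (intro mult_right_mono) (auto simp: power2_eq_square[of "1 - 2 * t\<^sup>2"] intro!: mult_left_le)
  also have "\<dots> \<le> ?n\<^sup>2"
  proof -
    have "0 \<le> ?s * (norm v)\<^sup>2" by simp
    moreover have "(1 - 2 * t\<^sup>2) * (norm \<xi>)\<^sup>2 = (norm \<xi>)\<^sup>2 - 2 * (t\<^sup>2 * (norm \<xi>)\<^sup>2)"
      by (simp add: algebra_simps)
    ultimately show ?thesis unfolding eq using s by linarith
  qed
  finally show "(1 - 2 * t\<^sup>2) * norm \<xi> \<le> ?n" by (rule power2_le_imp_le) simp
qed

text \<open>Lengths are distorted by \<open>2 * t\<^sup>2\<close> through the component along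
  \<open>nu\<close> and by \<open>H * d\<close> through the Hessian term; the factor
  \<open>2 ^ CARD('n)\<close> passes from lengths to areas. For gradients, the adjoint is within
  \<open>3 * (H * d)\<close> of the identity on vectors tangent at the projected point, which three
  error terms turn into 9, and the normal components removed by \<open>lift_grad\<close> appear as a
  product of two small numbers.\<close>

lemma (in lifted_mesh) close_meshI:
  assumes H: "H > 0" "\<And>x \<xi>. infdist x \<gamma> \<le> \<delta> / 2 \<Longrightarrow> norm (Dnu x \<xi>) \<le> H * norm \<xi>"
      "\<And>x. infdist x \<gamma> \<le> \<delta> / 2 \<Longrightarrow> norm (nu \<gamma> x - nu \<gamma> (cp x)) \<le> H * \<bar>sd x\<bar>"
    and d: "\<And>x. x \<in> Gamma S \<Longrightarrow> \<bar>sd x\<bar> \<le> d" "d \<le> \<delta> / 2" "H * d \<le> 1 / 16"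
    and n: "\<And>T s. T \<in> faces S \<Longrightarrow> s \<in> K \<Longrightarrow> norm (nu \<gamma> (F T s) - normal S (F T s)) \<le> t" "0 \<le> t" "t \<le> 1 / 4"
    and e: "2 ^ CARD('n) * (2 * t\<^sup>2 + H * d) \<le> \<epsilon>" "9 * (H * d) + (t + 4 * (H * d))\<^sup>2 \<le> \<epsilon>" "\<epsilon> \<le> 1 / 2"
  shows "close_mesh \<gamma> \<delta> \<sigma> k S \<rho> \<epsilon>"
proof -
  obtain x0 where "x0 \<in> Gamma S" using gamma_nonempty_Gamma by blast
  then have d0: "0 \<le> d" using d(1)[of x0] by simp
  then have hd0: "0 \<le> H * d" using H(1) by simp
  define \<theta> where "\<theta> = 2 * t\<^sup>2 + H * d"
  have t2: "t\<^sup>2 \<le> 1 / 16" using power_mono[OF n(3) n(2), of 2] by (simp add: power2_eq_square)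
  have th: "0 \<le> \<theta>" "\<theta> \<le> 1 / 2" using hd0 t2 d(3) by (auto simp: \<theta>_def)
  have loc: "F T s \<in> strip \<gamma> \<delta> \<and> infdist (F T s) \<gamma> \<le> \<delta> / 2 \<and> \<bar>sd (F T s)\<bar> \<le> d \<and>
      norm (nu \<gamma> (F T s)) \<le> 2 \<and> norm (nu \<gamma> (F T s) - nu \<gamma> (\<Phi> T s)) \<le> H * d \<and> norm (normal S (F T s)) = 1"
    if T: "T \<in> faces S" and s: "s \<in> K" for T s
  proof -
    have G: "F T s \<in> Gamma S" using F_in_Gamma[OF T] s K_subset by blast
    have i: "infdist (F T s) \<gamma> \<le> \<delta> / 2" using d(1)[OF G] d(2) by (simp add: abs_sdist)
    have "norm (nu \<gamma> (F T s)) \<le> norm (normal S (F T s)) + norm (nu \<gamma> (F T s) - normal S (F T s))"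
      by (rule norm_triangle_sub)
    then have "norm (nu \<gamma> (F T s)) \<le> 2" using n(1)[OF T s] n(3) normal(1)[OF T s] by simp
    moreover have "norm (nu \<gamma> (F T s) - nu \<gamma> (\<Phi> T s)) \<le> H * d"
      by (rule order.trans[OF H(3)[OF i] mult_left_mono[OF d(1)[OF G]]]) (use H(1) in simp)
    ultimately show ?thesis using G Gamma_strip i d(1)[OF G] normal(1)[OF T s] by blast
  qed
  have bounds: "(1 - \<theta>) * norm (DF T s \<xi>) \<le> norm (frechet_derivative (\<Phi> T) (at s) \<xi>) \<and>
      norm (frechet_derivative (\<Phi> T) (at s) \<xi>) \<le> (1 + \<theta>) * norm (DF T s \<xi>)"
    if T: "T \<in> faces S" and s: "s \<in> K" for T s \<xi>
  proof -
    let ?x = "F T s" and ?\<xi> = "DF T s \<xi>"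
    note l = loc[OF T s]
    \<comment> \<open>The tangent vector is orthogonal to the normal of \<Gamma>, so
      \<open>nu\<close> sees it only through the deviation of the two normals.\<close>
    have "nu \<gamma> ?x \<bullet> ?\<xi> = (nu \<gamma> ?x - normal S ?x) \<bullet> ?\<xi>" using normal_DF[OF T s, of \<xi>] by (simp add: inner_diff_left)
    also have "\<bar>\<dots>\<bar> \<le> norm (nu \<gamma> ?x - normal S ?x) * norm ?\<xi>" by (rule Cauchy_Schwarz_ineq2)
    also have "\<dots> \<le> t * norm ?\<xi>" by (rule mult_right_mono[OF n(1)[OF T s]]) simp
    finally have c: "\<bar>nu \<gamma> ?x \<bullet> ?\<xi>\<bar> \<le> t * norm ?\<xi>" .
    note b = norm_minus_component[OF _ c n(2)]
    have "norm (sd ?x *\<^sub>R Dnu ?x ?\<xi>) \<le> d * (H * norm ?\<xi>)"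
      using l H(2)[of ?x ?\<xi>] d0 by (simp add: mult_mono)
    then have r: "norm (sd ?x *\<^sub>R Dnu ?x ?\<xi>) \<le> H * d * norm ?\<xi>" by (simp add: mult_ac)
    have eq: "frechet_derivative (\<Phi> T) (at s) \<xi> = (?\<xi> - (nu \<gamma> ?x \<bullet> ?\<xi>) *\<^sub>R nu \<gamma> ?x) - sd ?x *\<^sub>R Dnu ?x ?\<xi>"
      unfolding DPhi[OF T s] using Dcp_eq l by blast
    have t2': "2 * t\<^sup>2 \<le> 1" using t2 by simp
    have n2: "norm (nu \<gamma> ?x) \<le> 2" using l by blast
    show ?thesis
      unfolding eq using b(1)[OF n2 t2'] b(2)[OF n2 t2'] r
        norm_triangle_ineq2[of "?\<xi> - (nu \<gamma> ?x \<bullet> ?\<xi>) *\<^sub>R nu \<gamma> ?x" "sd ?x *\<^sub>R Dnu ?x ?\<xi>"]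
        norm_triangle_ineq4[of "?\<xi> - (nu \<gamma> ?x \<bullet> ?\<xi>) *\<^sub>R nu \<gamma> ?x" "sd ?x *\<^sub>R Dnu ?x ?\<xi>"]
      by (simp add: \<theta>_def algebra_simps)
  qed
  have pw: "1 - \<epsilon> \<le> (1 - \<theta>) ^ CARD('n)" "(1 + \<theta>) ^ CARD('n) \<le> 1 + \<epsilon>"
    using one_minus_power_ge[of \<theta> "CARD('n)"] one_plus_power_le[of \<theta> "CARD('n)"] th e(1) by (auto simp: \<theta>_def)
  show ?thesis
  proof
    show "0 \<le> \<epsilon>" using e(2) hd0 zero_le_power2[of "t + 4 * (H * d)"] by linarith
    show "\<epsilon> \<le> 1 / 2" by (rule e(3))
    fix f :: "real^'m \<Rightarrow> real" assume f: "integrable \<sigma> f" "\<And>x. 0 \<le> f x"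
    have th1: "1 - \<theta> > 0" "1 + \<theta> > 0" using th by auto
    note il = integrable_lift[OF th1 conjunct1[OF bounds] conjunct2[OF bounds] f]
    have nn: "0 \<le> (LINT x|\<Sigma>. f (cp x))" using f(2) by (auto intro: integral_nonneg)
    show "(1 - \<epsilon>) * (LINT x|\<Sigma>. f (cp x)) \<le> (LINT y|\<sigma>. f y) \<and> (LINT y|\<sigma>. f y) \<le> (1 + \<epsilon>) * (LINT x|\<Sigma>. f (cp x))"
      using order.trans[OF mult_right_mono[OF pw(1) nn] il(2)] order.trans[OF il(3) mult_right_mono[OF pw(2) nn]] by blast
  next
    fix T s assume T: "T \<in> faces S" and s: "s \<in> K"
    note l = loc[OF T s]
    have "norm (normal S (F T s)) \<le> norm (nu \<gamma> (\<Phi> T s)) + norm (normal S (F T s) - nu \<gamma> (\<Phi> T s))"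
      by (rule norm_triangle_sub)
    moreover have "norm (normal S (F T s) - nu \<gamma> (\<Phi> T s)) \<le> norm (nu \<gamma> (F T s) - normal S (F T s)) + norm (nu \<gamma> (F T s) - nu \<gamma> (\<Phi> T s))"
      using norm_triangle_ineq4[of "nu \<gamma> (F T s) - nu \<gamma> (\<Phi> T s)" "nu \<gamma> (F T s) - normal S (F T s)"] by simp
    \<comment> \<open>\<open>narrow_strip\<close> leaves open whether \<open>nu \<gamma>\<close>
      vanishes on the surface. Being within 5/16 of a unit vector it does not, and then
      \<open>norm_nu_on\<close> gives length one.\<close>
    ultimately have "0 < norm (nu \<gamma> (\<Phi> T s))" using n(1)[OF T s] n(3) d(3) l by linarith
    then have "nu \<gamma> (\<Phi> T s) \<noteq> 0" by simp
    then show "norm (nu \<gamma> (\<Phi> T s)) = 1" by (rule norm_nu_on[OF cp_in])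
    fix p q assume pq: "nu \<gamma> (\<Phi> T s) \<bullet> p = 0" "nu \<gamma> (\<Phi> T s) \<bullet> q = 0"
    \<comment> \<open>\<open>?b\<close> collects \<open>2 * (H * d)\<close> from the component along
      \<open>nu\<close>, of length at most 2, and \<open>H * d\<close> from the Hessian
      term.\<close>
    let ?x = "F T s" and ?N = "normal S (F T s)" and ?b = "3 * (H * d)"
    have xs: "?x \<in> strip \<gamma> \<delta>" using l by blast
    have adj: "norm (adj ?x v - v) \<le> ?b * norm v \<and> \<bar>?N \<bullet> adj ?x v\<bar> \<le> (t + 4 * (H * d)) * norm v"
      if v: "nu \<gamma> (\<Phi> T s) \<bullet> v = 0" for v
    proof -
      let ?e = "adj ?x v - v"
      have "nu \<gamma> ?x \<bullet> v = (nu \<gamma> ?x - nu \<gamma> (\<Phi> T s)) \<bullet> v" using v by (simp add: inner_diff_left)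
      also have "\<bar>\<dots>\<bar> \<le> norm (nu \<gamma> ?x - nu \<gamma> (\<Phi> T s)) * norm v" by (rule Cauchy_Schwarz_ineq2)
      also have "\<dots> \<le> (H * d) * norm v" by (rule mult_right_mono) (use l in auto)
      finally have nv: "\<bar>nu \<gamma> ?x \<bullet> v\<bar> \<le> (H * d) * norm v" .
      have "adj ?x v \<bullet> ?e = v \<bullet> ?e - (nu \<gamma> ?x \<bullet> ?e) * (nu \<gamma> ?x \<bullet> v) - sd ?x * (v \<bullet> Dnu ?x ?e)"
        unfolding adj_inner[OF xs] Dcp_eq[OF xs] by (simp add: inner_diff_right inner_commute)
      then have "(norm ?e)\<^sup>2 = - (nu \<gamma> ?x \<bullet> ?e) * (nu \<gamma> ?x \<bullet> v) - sd ?x * (v \<bullet> Dnu ?x ?e)"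
        unfolding power2_norm_eq_inner by (simp only: inner_diff_left)
      also have "\<dots> \<le> \<bar>nu \<gamma> ?x \<bullet> ?e\<bar> * \<bar>nu \<gamma> ?x \<bullet> v\<bar> + \<bar>sd ?x\<bar> * \<bar>v \<bullet> Dnu ?x ?e\<bar>"
        unfolding abs_mult[symmetric] by linarith
      also have "\<dots> \<le> (2 * norm ?e) * ((H * d) * norm v) + d * (norm v * (H * norm ?e))"
      proof (intro add_mono mult_mono)
        have "\<bar>nu \<gamma> ?x \<bullet> ?e\<bar> \<le> norm (nu \<gamma> ?x) * norm ?e" by (rule Cauchy_Schwarz_ineq2)
        also have "\<dots> \<le> 2 * norm ?e" by (rule mult_right_mono) (use l in auto)
        finally show "\<bar>nu \<gamma> ?x \<bullet> ?e\<bar> \<le> 2 * norm ?e" .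
        have "\<bar>v \<bullet> Dnu ?x ?e\<bar> \<le> norm v * norm (Dnu ?x ?e)" by (rule Cauchy_Schwarz_ineq2)
        also have "\<dots> \<le> norm v * (H * norm ?e)" by (rule mult_left_mono[OF H(2)]) (use l in auto)
        finally show "\<bar>v \<bullet> Dnu ?x ?e\<bar> \<le> norm v * (H * norm ?e)" .
      qed (use nv l d0 in auto)
      also have "\<dots> = (?b * norm v) * norm ?e" by (simp add: algebra_simps)
      finally have "norm ?e * norm ?e \<le> (?b * norm v) * norm ?e" by (simp add: power2_eq_square)
      then have e1: "norm ?e \<le> ?b * norm v"
        using hd0 by (cases "norm ?e = 0") (auto simp: mult_le_cancel_right)
      \<comment> \<open>Three contributions: \<open>t\<close> from the two normals,
        \<open>H * d\<close> from moving \<open>nu\<close> to the projected point, and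
        \<open>?b\<close> from the adjoint.\<close>
      have "?N \<bullet> adj ?x v = (?N - nu \<gamma> ?x) \<bullet> v + nu \<gamma> ?x \<bullet> v + ?N \<bullet> ?e" by (simp add: inner_diff_left inner_diff_right)
      then have "\<bar>?N \<bullet> adj ?x v\<bar> \<le> \<bar>(?N - nu \<gamma> ?x) \<bullet> v\<bar> + \<bar>nu \<gamma> ?x \<bullet> v\<bar> + \<bar>?N \<bullet> ?e\<bar>" by linarith
      moreover have "\<bar>(?N - nu \<gamma> ?x) \<bullet> v\<bar> \<le> t * norm v"
        by (rule order.trans[OF Cauchy_Schwarz_ineq2 mult_right_mono[OF n(1)[OF T s, unfolded norm_minus_commute[of "nu \<gamma> ?x"]] norm_ge_zero]])
      moreover have "\<bar>?N \<bullet> ?e\<bar> \<le> ?b * norm v"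
        by (rule order.trans[OF Cauchy_Schwarz_ineq2]) (use e1 l in auto)
      ultimately have "\<bar>?N \<bullet> adj ?x v\<bar> \<le> (t + 4 * (H * d)) * norm v" using nv by (simp add: algebra_simps)
      then show ?thesis using e1 by blast
    qed
    have NN: "?N \<bullet> ?N = 1" using l by (simp add: dot_square_norm)
    let ?ep = "adj ?x p - p" and ?eq = "adj ?x q - q"
    have "lift_grad ?x p \<bullet> lift_grad ?x q = adj ?x p \<bullet> adj ?x q - (?N \<bullet> adj ?x p) * (?N \<bullet> adj ?x q)"
      unfolding lift_grad_def by (simp add: inner_diff_left inner_diff_right NN inner_commute algebra_simps)
    moreover have "adj ?x p \<bullet> adj ?x q - p \<bullet> q = p \<bullet> ?eq + ?ep \<bullet> q + ?ep \<bullet> ?eq"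
      by (simp add: inner_diff_left inner_diff_right)
    ultimately have eq: "lift_grad ?x p \<bullet> lift_grad ?x q - p \<bullet> q = p \<bullet> ?eq + ?ep \<bullet> q + ?ep \<bullet> ?eq - (?N \<bullet> adj ?x p) * (?N \<bullet> adj ?x q)"
      by simp
    let ?m = "norm p * norm q"
    have b1: "\<bar>p \<bullet> ?eq\<bar> \<le> ?b * ?m"
      using order.trans[OF Cauchy_Schwarz_ineq2[of p ?eq] mult_left_mono[OF conjunct1[OF adj[OF pq(2)]] norm_ge_zero]]
      by (simp add: mult_ac)
    have b2: "\<bar>?ep \<bullet> q\<bar> \<le> ?b * ?m"
      using order.trans[OF Cauchy_Schwarz_ineq2[of ?ep q] mult_right_mono[OF conjunct1[OF adj[OF pq(1)]] norm_ge_zero]]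
      by (simp add: mult_ac)
    have b3: "\<bar>?ep \<bullet> ?eq\<bar> \<le> ?b * ?m"
    proof -
      have "\<bar>?ep \<bullet> ?eq\<bar> \<le> norm ?ep * norm ?eq" by (rule Cauchy_Schwarz_ineq2)
      also have "\<dots> \<le> (?b * norm p) * (1 * norm q)"
      proof (intro mult_mono)
        \<comment> \<open>As \<open>?b\<close> is at most 3/16, one of the two small factors is
          replaced by 1 to keep the bound linear.\<close>
        have "?b * norm q \<le> 1 * norm q" using d(3) by (intro mult_right_mono) auto
        then show "norm ?eq \<le> 1 * norm q" using conjunct1[OF adj[OF pq(2)]] by linarith
      qed (use conjunct1[OF adj[OF pq(1)]] hd0 in auto)
      finally show ?thesis by (simp add: mult_ac)
    qed
    have b4: "\<bar>(?N \<bullet> adj ?x p) * (?N \<bullet> adj ?x q)\<bar> \<le> (t + 4 * (H * d))\<^sup>2 * ?m"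
    proof -
      have "\<bar>?N \<bullet> adj ?x p\<bar> * \<bar>?N \<bullet> adj ?x q\<bar> \<le> ((t + 4 * (H * d)) * norm p) * ((t + 4 * (H * d)) * norm q)"
        using adj[OF pq(1)] adj[OF pq(2)] n(2) hd0 by (intro mult_mono) auto
      then show ?thesis by (simp add: abs_mult power2_eq_square mult_ac)
    qed
    have "\<bar>lift_grad ?x p \<bullet> lift_grad ?x q - p \<bullet> q\<bar> \<le> 3 * (?b * ?m) + (t + 4 * (H * d))\<^sup>2 * ?m"
      unfolding eq using b1 b2 b3 b4 by linarith
    also have "\<dots> = (9 * (H * d) + (t + 4 * (H * d))\<^sup>2) * ?m" by (simp add: algebra_simps)
    also have "\<dots> \<le> \<epsilon> * ?m" by (rule mult_right_mono[OF e(2)]) simp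
    finally show "\<bar>lift_grad ?x p \<bullet> lift_grad ?x q - p \<bullet> q\<bar> \<le> \<epsilon> * norm p * norm q" by (simp add: mult.assoc)
  qed
qed

text \<open>\<open>close_meshI\<close> is used with \<open>d\<close> of order \<open>k + 1\<close>
  and \<open>t\<close> of order \<open>k\<close> in the mesh size. Both constants are fixed before
  the mesh, since \<open>H\<close> belongs to the tube and \<open>C0\<close> to the standing
  bounds.\<close>

lemma (in narrow_tube) close_mesh_eventually:
  fixes C0 :: real and k :: nat
  assumes k: "k \<ge> 1"
  obtains C h0 where "C > 0" "h0 > 0"
    "\<And>\<sigma> (S :: ('n::finite, 'm) discrete_surface) \<rho>. lifted_mesh \<gamma> \<delta> \<sigma> k S \<rho> \<Longrightarrow> standing_bounds \<gamma> k C0 S \<Longrightarrow>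
      0 \<le> mesh_size S \<Longrightarrow> mesh_size S \<le> h0 \<Longrightarrow> close_mesh \<gamma> \<delta> \<sigma> k S \<rho> (C * mesh_size S ^ (k + 1))"
proof -
  obtain H where H: "H > 0" "\<And>x \<xi>. infdist x \<gamma> \<le> \<delta> / 2 \<Longrightarrow> norm (Dnu x \<xi>) \<le> H * norm \<xi>"
    "\<And>x. infdist x \<gamma> \<le> \<delta> / 2 \<Longrightarrow> norm (nu \<gamma> x - nu \<gamma> (cp x)) \<le> H * \<bar>sd x\<bar>"
    by (rule Dnu_bound) (rule that)
  \<comment> \<open>\<open>C0\<close> is an arbitrary real; the maximum makes it a usable positive
    constant.\<close>
  define c where "c = max C0 1"
  have c: "c \<ge> 1" "C0 \<le> c" by (auto simp: c_def)
  \<comment> \<open>A sum of positive parts that dominates each requirement: the area condition, the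
    linear gradient terms, and the squared normal components. The 16 also accommodates the cross
    terms and the condition \<open>H * d \<le> 1 / 16\<close>.\<close>
  define C where "C = 2 ^ CARD('n) * (2 * c\<^sup>2 + H * c) + 16 * (H * c) + (2 * c\<^sup>2 + 32 * (H * c)\<^sup>2)"
  have Hc: "0 < H * c" using H(1) c(1) by simp
  have parts: "0 < 2 ^ CARD('n) * (2 * c\<^sup>2 + H * c)" "0 < 2 * c\<^sup>2 + 32 * (H * c)\<^sup>2"
    using Hc c(1) by (auto intro!: add_pos_pos mult_pos_pos)
  have C: "C > 0" using parts Hc by (simp add: C_def)
  \<comment> \<open>The entries ensure in turn \<open>h \<le> 1\<close>,
    \<open>t \<le> 1 / 4\<close>, \<open>d \<le> \<delta> / 2\<close> and
    \<open>\<epsilon> \<le> 1 / 2\<close>; higher powers of \<open>h\<close> are first bounded by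
    \<open>h\<close> itself.\<close>
  define h0 where "h0 = min 1 (min (1 / (4 * c)) (min (\<delta> / (2 * c)) (1 / (2 * C))))"
  have h0: "h0 > 0" using c(1) C delta_pos by (simp add: h0_def)
  have "close_mesh \<gamma> \<delta> \<sigma> k S \<rho> (C * mesh_size S ^ (k + 1))"
    if M: "lifted_mesh \<gamma> \<delta> \<sigma> k S \<rho>" and sb: "standing_bounds \<gamma> k C0 S"
      and hh: "0 \<le> mesh_size S" "mesh_size S \<le> h0" for \<sigma> and S :: "('n, 'm) discrete_surface" and \<rho>
  proof -
    interpret lifted_mesh \<gamma> \<delta> \<sigma> k S \<rho> by (rule M)
    define h where "h = mesh_size S"
    define e where "e = h ^ (k + 1)"
    have h: "0 \<le> h" "h \<le> 1" "h * (4 * c) \<le> 1" "h * (2 * c) \<le> \<delta>" "h * (2 * C) \<le> 1"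
    proof -
      show "0 \<le> h" "h \<le> 1" using hh by (auto simp: h_def h0_def)
      have "h \<le> 1 / (4 * c)" "h \<le> \<delta> / (2 * c)" "h \<le> 1 / (2 * C)" using hh by (auto simp: h_def h0_def)
      then show "h * (4 * c) \<le> 1" "h * (2 * c) \<le> \<delta>" "h * (2 * C) \<le> 1" using c(1) C by (auto simp: pos_le_divide_eq)
    qed
    have hk: "h ^ k \<le> h" using power_decreasing[of 1 k h] k h by simp
    have e: "0 \<le> e" "e \<le> h" "e \<le> 1"
      using power_decreasing[of 1 "k + 1" h] h by (auto simp: e_def)
    \<comment> \<open>This is where \<open>k \<ge> 1\<close> is decisive: \<open>2 * k\<close> is at
      least \<open>k + 1\<close>, so the squared error of the normals has the order of the
      distance.\<close>
    have ee: "(h ^ k)\<^sup>2 \<le> e"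
      unfolding e_def power_mult[symmetric] using k h by (intro power_decreasing) auto
    have e2: "e\<^sup>2 \<le> e" using e by (simp add: power2_eq_square mult_left_le)
    have sbs: "\<bar>sd x\<bar> \<le> C0 * e" if "x \<in> Gamma S" for x
      using sb that unfolding standing_bounds_def Let_def e_def h_def by blast
    have nb: "norm (nu \<gamma> (F T s) - normal S (F T s)) \<le> C0 * h ^ k" if "T \<in> faces S" "s \<in> K" for T s
      using sb that unfolding standing_bounds_def Let_def h_def by blast
    have Ce: "C * e \<le> 1 / 2"
    proof -
      have "C * e \<le> C * h" using C e(2) by (intro mult_left_mono) auto
      moreover have "2 * (C * h) \<le> 1" using h(5) by (simp add: mult_ac)
      ultimately show ?thesis by linarith
    qed
    have s1: "2 ^ CARD('n) * (2 * c\<^sup>2 + H * c) * e \<le> C * e" "16 * (H * c) * e \<le> C * e"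
      "(16 * (H * c) + (2 * c\<^sup>2 + 32 * (H * c)\<^sup>2)) * e \<le> C * e"
      using parts Hc e(1) by (auto simp: C_def intro!: mult_right_mono)
    have tt: "(c * h ^ k)\<^sup>2 \<le> c\<^sup>2 * e" using ee by (simp add: power_mult_distrib mult_left_mono)
    show ?thesis
      unfolding h_def[symmetric] e_def[symmetric]
    proof (rule close_meshI[OF H, where d = "c * e" and t = "c * h ^ k"])
      show "\<bar>sd x\<bar> \<le> c * e" if "x \<in> Gamma S" for x
        using sbs[OF that] mult_right_mono[OF c(2) e(1)] by linarith
      show "c * e \<le> \<delta> / 2" proof -
        have "c * e \<le> c * h" by (rule mult_left_mono[OF e(2)]) (use c(1) in simp)
        moreover have "2 * (c * h) \<le> \<delta>" using h(4) by (simp add: mult_ac)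
        ultimately show ?thesis by linarith
      qed
      show "H * (c * e) \<le> 1 / 16" using s1(2) Ce by (simp add: mult_ac)
      show "norm (nu \<gamma> (F T s) - normal S (F T s)) \<le> c * h ^ k" if "T \<in> faces S" "s \<in> K" for T s
        using nb[OF that] mult_right_mono[OF c(2), of "h ^ k"] h(1) by (simp add: order.trans)
      show "0 \<le> c * h ^ k" using c(1) h(1) by simp
      show "c * h ^ k \<le> 1 / 4" proof -
        have "c * h ^ k \<le> c * h" by (rule mult_left_mono[OF hk]) (use c(1) in simp)
        moreover have "4 * (c * h) \<le> 1" using h(3) by (simp add: mult_ac)
        ultimately show ?thesis by linarith
      qed
      have "2 * (c * h ^ k)\<^sup>2 + H * (c * e) \<le> (2 * c\<^sup>2 + H * c) * e"
        using tt by (simp add: algebra_simps)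
      then have "2 ^ CARD('n) * (2 * (c * h ^ k)\<^sup>2 + H * (c * e)) \<le> 2 ^ CARD('n) * ((2 * c\<^sup>2 + H * c) * e)"
        by (rule mult_left_mono) simp
      then show "2 ^ CARD('n) * (2 * (c * h ^ k)\<^sup>2 + H * (c * e)) \<le> C * e"
        using s1(1)[unfolded mult.assoc[of "2 ^ CARD('n)"]] by (rule order.trans)
      have "(c * h ^ k + 4 * (H * (c * e)))\<^sup>2 \<le> 2 * (c * h ^ k)\<^sup>2 + 2 * (4 * (H * (c * e)))\<^sup>2"
        using zero_le_power2[of "c * h ^ k - 4 * (H * (c * e))"] by (simp add: power2_eq_square algebra_simps)
      also have "\<dots> = 2 * (c * h ^ k)\<^sup>2 + 32 * (H * c)\<^sup>2 * e\<^sup>2" by (simp add: power_mult_distrib power2_eq_square)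
      also have "\<dots> \<le> 2 * (c\<^sup>2 * e) + 32 * (H * c)\<^sup>2 * e"
        using tt e2 by (intro add_mono mult_left_mono) auto
      finally have "9 * (H * (c * e)) + (c * h ^ k + 4 * (H * (c * e)))\<^sup>2 \<le> (16 * (H * c) + (2 * c\<^sup>2 + 32 * (H * c)\<^sup>2)) * e"
        using mult_nonneg_nonneg[OF less_imp_le[OF Hc] e(1)] by (simp add: algebra_simps)
      then show "9 * (H * (c * e)) + (c * h ^ k + 4 * (H * (c * e)))\<^sup>2 \<le> C * e" using s1(3) by linarith
      show "C * e \<le> 1 / 2" by (rule Ce)
    qed
  qed
  then show ?thesis using C h0 by (intro that[of C h0]) auto
qed

section \<open>Clusters of discrete eigenvalues\<close>

text \<open>Functions are total on the ambient space but matter on \<open>X\<close> only, so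
  equality is replaced by agreement on \<open>X\<close>. Definiteness is left out: null functions,
  and constants for the stiffness form, have zero norm.\<close>

locale semi_inner =
  fixes X :: "'a set" and V :: "('a \<Rightarrow> real) set" and B :: "('a \<Rightarrow> real) \<Rightarrow> ('a \<Rightarrow> real) \<Rightarrow> real"
  assumes in_cong: "v \<in> V \<Longrightarrow> (\<And>x. x \<in> X \<Longrightarrow> v x = w x) \<Longrightarrow> w \<in> V"
    and const_in: "(\<lambda>x. c) \<in> V"
    and comb_in: "v \<in> V \<Longrightarrow> w \<in> V \<Longrightarrow> (\<lambda>x. a * v x + b * w x) \<in> V"
    and B_comb: "v \<in> V \<Longrightarrow> w \<in> V \<Longrightarrow> z \<in> V \<Longrightarrow> B (\<lambda>x. a * v x + b * w x) z = a * B v z + b * B w z"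
    and B_sym: "v \<in> V \<Longrightarrow> w \<in> V \<Longrightarrow> B v w = B w v"
    and B_nonneg: "v \<in> V \<Longrightarrow> 0 \<le> B v v"
    and B_cong: "v \<in> V \<Longrightarrow> (\<And>x. x \<in> X \<Longrightarrow> v x = w x) \<Longrightarrow> z \<in> V \<Longrightarrow> B v z = B w z"
begin

lemma add_in: "v \<in> V \<Longrightarrow> w \<in> V \<Longrightarrow> (\<lambda>x. v x + w x) \<in> V"
  using comb_in[of v w 1 1] by simp

lemma diff_in: "v \<in> V \<Longrightarrow> w \<in> V \<Longrightarrow> (\<lambda>x. v x - w x) \<in> V"
  using comb_in[of v w 1 "-1"] by simp

lemma B_add: "v \<in> V \<Longrightarrow> w \<in> V \<Longrightarrow> z \<in> V \<Longrightarrow> B (\<lambda>x. v x + w x) z = B v z + B w z"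
  using B_comb[of v w z 1 1] by simp

lemma B_diff: "v \<in> V \<Longrightarrow> w \<in> V \<Longrightarrow> z \<in> V \<Longrightarrow> B (\<lambda>x. v x - w x) z = B v z - B w z"
  using B_comb[of v w z 1 "-1"] by simp

lemma B_scale: "v \<in> V \<Longrightarrow> z \<in> V \<Longrightarrow> B (\<lambda>x. a * v x) z = a * B v z"
  using B_comb[of v v z a 0] by simp

lemma B_add_right: "v \<in> V \<Longrightarrow> w \<in> V \<Longrightarrow> z \<in> V \<Longrightarrow> B z (\<lambda>x. v x + w x) = B z v + B z w"
  by (simp add: B_sym[of z] add_in B_add)

lemma B_const: "z \<in> V \<Longrightarrow> B (\<lambda>x. c) z = c * B (\<lambda>x. 1) z"
  using B_scale[OF const_in[of 1], of z c] by simp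

lemma sum_in: "finite I \<Longrightarrow> (\<And>i. i \<in> I \<Longrightarrow> U i \<in> V) \<Longrightarrow> (\<lambda>x. \<Sum>i\<in>I. c i * U i x) \<in> V"
proof (induction I rule: finite_induct)
  case (insert i I)
  then show ?case using comb_in[of "U i" "\<lambda>x. \<Sum>i\<in>I. c i * U i x" "c i" 1] by simp
qed (simp add: const_in)

lemma B_sum:
  "finite I \<Longrightarrow> (\<And>i. i \<in> I \<Longrightarrow> U i \<in> V) \<Longrightarrow> z \<in> V \<Longrightarrow> B (\<lambda>x. \<Sum>i\<in>I. c i * U i x) z = (\<Sum>i\<in>I. c i * B (U i) z)"
proof (induction I rule: finite_induct)
  case empty
  then show ?case using B_const[of z 0] by simp
next
  case (insert i I)
  then show ?case
    using B_comb[of "U i" "\<lambda>x. \<Sum>i\<in>I. c i * U i x" z "c i" 1] sum_in[of I U c] by simp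
qed

lemma B_sum_right:
  assumes "finite I" "\<And>i. i \<in> I \<Longrightarrow> U i \<in> V" "z \<in> V"
  shows "B z (\<lambda>x. \<Sum>i\<in>I. c i * U i x) = (\<Sum>i\<in>I. c i * B z (U i))"
proof -
  have "B z (\<lambda>x. \<Sum>i\<in>I. c i * U i x) = (\<Sum>i\<in>I. c i * B (U i) z)"
    using B_sym[OF assms(3) sum_in[where U = U, OF assms(1,2)]] B_sum[where U = U, OF assms] by simp
  also have "\<dots> = (\<Sum>i\<in>I. c i * B z (U i))" by (intro sum.cong refl) (simp add: B_sym assms)
  finally show ?thesis .
qed

text \<open>The weights \<open>\<kappa>\<close> serve both forms at once: 1 for the mass and the
  eigenvalues for the stiffness.\<close>

lemma B_sum_orthogonal:
  assumes I: "finite I" "\<And>i. i \<in> I \<Longrightarrow> U i \<in> V"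
    and U: "\<And>i j. i \<in> I \<Longrightarrow> j \<in> I \<Longrightarrow> B (U i) (U j) = \<kappa> j * of_bool (i = j)"
  shows "j \<in> I \<Longrightarrow> B (\<lambda>x. \<Sum>i\<in>I. c i * U i x) (U j) = \<kappa> j * c j"
    and "B (\<lambda>x. \<Sum>i\<in>I. c i * U i x) (\<lambda>x. \<Sum>i\<in>I. c i * U i x) = (\<Sum>i\<in>I. \<kappa> i * (c i)\<^sup>2)"
proof -
  show *: "B (\<lambda>x. \<Sum>i\<in>I. c i * U i x) (U j) = \<kappa> j * c j" if j: "j \<in> I" for j
  proof -
    have "B (\<lambda>x. \<Sum>i\<in>I. c i * U i x) (U j) = (\<Sum>i\<in>I. c i * B (U i) (U j))"
      by (rule B_sum[where U = U, OF I I(2)[OF j]])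
    also have "\<dots> = (\<Sum>i\<in>I. if i = j then \<kappa> j * c j else 0)"
      by (intro sum.cong refl) (simp add: U j)
    finally show ?thesis using j I(1) by simp
  qed
  show "B (\<lambda>x. \<Sum>i\<in>I. c i * U i x) (\<lambda>x. \<Sum>i\<in>I. c i * U i x) = (\<Sum>i\<in>I. \<kappa> i * (c i)\<^sup>2)"
    by (simp only: B_sum_right[where U = U, OF I sum_in[where U = U, OF I]], intro sum.cong refl)
      (simp add: * power2_eq_square)
qed

lemma B_Cauchy:
  assumes v: "v \<in> V" and w: "w \<in> V"
  shows "\<bar>B v w\<bar> \<le> sqrt (B v v) * sqrt (B w w)"
proof -
  have pos: "0 \<le> B v v - 2 * t * B v w + t\<^sup>2 * B w w" for t
  proof -
    have "0 \<le> B (\<lambda>x. 1 * v x + (- t) * w x) (\<lambda>x. 1 * v x + (- t) * w x)"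
      by (rule B_nonneg[OF comb_in[OF v w]])
    also have "\<dots> = B v (\<lambda>x. 1 * v x + (- t) * w x) - t * B w (\<lambda>x. 1 * v x + (- t) * w x)"
      using B_comb[OF v w comb_in[OF v w], of 1 "- t" 1 "- t"] by simp
    also have "B v (\<lambda>x. 1 * v x + (- t) * w x) = B v v - t * B v w"
      using B_sym[OF v comb_in[OF v w], of 1 "- t"] B_comb[OF v w v, of 1 "- t"] B_sym[OF w v] by simp
    also have "B w (\<lambda>x. 1 * v x + (- t) * w x) = B v w - t * B w w"
      using B_sym[OF w comb_in[OF v w], of 1 "- t"] B_comb[OF v w w, of 1 "- t"] by simp
    finally show ?thesis by (simp add: power2_eq_square algebra_simps)
  qed
  have nn: "0 \<le> B v v" "0 \<le> B w w" using v w by (simp_all add: B_nonneg)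
  have "(B v w)\<^sup>2 \<le> B v v * B w w"
  proof (cases "B w w = 0")
    case True
    have "B v w = 0"
    proof (rule ccontr)
      assume n: "B v w \<noteq> 0"
      have "0 \<le> B v v - 2 * ((B v v + 1) / (2 * B v w)) * B v w"
        using pos[of "(B v v + 1) / (2 * B v w)"] True by simp
      also have "\<dots> = - 1" using n by (simp add: field_simps)
      finally show False by simp
    qed
    then show ?thesis using True by simp
  next
    case False
    with nn have p: "0 < B w w" by simp
    have "0 \<le> B w w * (B v v - 2 * (B v w / B w w) * B v w + (B v w / B w w)\<^sup>2 * B w w)"
      using pos[of "B v w / B w w"] p by (intro mult_nonneg_nonneg) auto
    also have "\<dots> = B v v * B w w - (B v w)\<^sup>2" using p by (simp add: field_simps power2_eq_square)
    finally show ?thesis by simp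
  qed
  then have "sqrt ((B v w)\<^sup>2) \<le> sqrt (B v v * B w w)" by (rule real_sqrt_le_mono)
  then show ?thesis by (simp add: real_sqrt_mult)
qed

lemma B_triangle:
  assumes v: "v \<in> V" and w: "w \<in> V"
  shows "sqrt (B (\<lambda>x. v x + w x) (\<lambda>x. v x + w x)) \<le> sqrt (B v v) + sqrt (B w w)"
proof (rule real_le_lsqrt)
  have "B (\<lambda>x. v x + w x) (\<lambda>x. v x + w x) = B v v + 2 * B v w + B w w"
    using B_add[OF v w add_in[OF v w]] B_add_right[OF v w v] B_add_right[OF v w w] B_sym[OF w v] by simp
  also have "\<dots> \<le> (sqrt (B v v) + sqrt (B w w))\<^sup>2"
    using B_Cauchy[OF v w] B_nonneg[OF v] B_nonneg[OF w] by (simp add: power2_sum)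
  finally show "B (\<lambda>x. v x + w x) (\<lambda>x. v x + w x) \<le> (sqrt (B v v) + sqrt (B w w))\<^sup>2" .
qed (simp add: B_nonneg v w)

text \<open>\<open>form_projection\<close> is a choice. Existence of a representer is shown by the
  explicit expansion; orthogonality with nonzero weights then fixes the coefficients of whichever
  representer was chosen.\<close>

lemma form_projection_eq:
  assumes I: "finite I" "\<And>i. i \<in> I \<Longrightarrow> U i \<in> V"
    and U: "\<And>i j. i \<in> I \<Longrightarrow> j \<in> I \<Longrightarrow> B (U i) (U j) = \<kappa> j * of_bool (i = j)"
    and \<kappa>: "\<And>j. j \<in> I \<Longrightarrow> \<kappa> j \<noteq> 0"
    and Y: "\<And>c. (\<lambda>x. \<Sum>i\<in>I. c i * U i x) \<in> Y" "\<And>w. w \<in> Y \<Longrightarrow> \<exists>c. \<forall>x\<in>X. w x = (\<Sum>i\<in>I. c i * U i x)"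
    and v: "v \<in> V" and x: "x \<in> X"
  shows "form_projection B Y v x = (\<Sum>j\<in>I. B v (U j) / \<kappa> j * U j x)"
proof -
  define w where "w = form_projection B Y v"
  let ?w0 = "\<lambda>x. \<Sum>j\<in>I. B v (U j) / \<kappa> j * U j x"
  have ex: "?w0 \<in> Y \<and> (\<forall>z\<in>Y. B ?w0 z = B v z)"
  proof (intro conjI ballI)
    show "?w0 \<in> Y" by (rule Y(1))
    fix z assume "z \<in> Y"
    then obtain c where c: "\<forall>x\<in>X. z x = (\<Sum>i\<in>I. c i * U i x)" using Y(2) by blast
    have z: "B y z = (\<Sum>i\<in>I. c i * B y (U i))" if y: "y \<in> V" for y
    proof -
      have zc: "(\<lambda>x. \<Sum>i\<in>I. c i * U i x) \<in> V" by (rule sum_in[where U = U, OF I])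
      have "z \<in> V" by (rule in_cong[OF zc]) (use c in simp)
      then have "B y z = B z y" using y B_sym by blast
      also have "\<dots> = B (\<lambda>x. \<Sum>i\<in>I. c i * U i x) y" by (rule B_cong[OF zc _ y, symmetric]) (use c in simp)
      also have "\<dots> = (\<Sum>i\<in>I. c i * B y (U i))"
        using B_sym[OF zc y] B_sum_right[where U = U, OF I y, where c = c] by simp
      finally show ?thesis .
    qed
    show "B ?w0 z = B v z"
    proof (simp only: z[OF sum_in[where U = U, OF I]] z[OF v], intro sum.cong refl arg_cong2[where f = "(*)"])
      fix i assume i: "i \<in> I"
      have "B ?w0 (U i) = \<kappa> i * (B v (U i) / \<kappa> i)" by (rule B_sum_orthogonal(1)[where U = U, OF I U i])
      then show "B ?w0 (U i) = B v (U i)" using \<kappa>[OF i] by simp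
    qed
  qed
  have w: "w \<in> Y \<and> (\<forall>z\<in>Y. B w z = B v z)"
    unfolding w_def form_projection_def by (rule someI[of "\<lambda>w. w \<in> Y \<and> (\<forall>z\<in>Y. B w z = B v z)", OF ex])
  then obtain c where c: "\<forall>x\<in>X. w x = (\<Sum>i\<in>I. c i * U i x)" using Y(2) by blast
  have "c j = B v (U j) / \<kappa> j" if j: "j \<in> I" for j
  proof -
    \<comment> \<open>A single coefficient puts \<open>U j\<close> itself into \<open>Y\<close> as a
      test function.\<close>
    have "(\<lambda>x. \<Sum>i\<in>I. of_bool (i = j) * U i x) = U j" using j I(1) by (simp add: fun_eq_iff if_distrib if_distribR of_bool_def cong: if_cong)
    then have "U j \<in> Y" using Y(1)[of "\<lambda>i. of_bool (i = j)"] by simp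
    then have "B v (U j) = B w (U j)" using w by simp
    also have "\<dots> = B (\<lambda>x. \<Sum>i\<in>I. c i * U i x) (U j)"
      by (rule B_cong[OF sum_in[where U = U, OF I] _ I(2)[OF j], symmetric]) (simp_all add: c)
    also have "\<dots> = \<kappa> j * c j" by (rule B_sum_orthogonal(1)[where U = U, OF I U j])
    finally show ?thesis using \<kappa>[OF j] by simp
  qed
  then show ?thesis using c x by (simp add: w_def)
qed

end

lemma le_if_mult_self_le:
  fixes x y :: real
  assumes "x * x \<le> y * x" "0 \<le> y" "0 \<le> x"
  shows "x \<le> y"
  using assms by (cases "x = 0") (auto simp: mult_le_cancel_right)

text \<open>The last assumption is the zero mean condition, by which constants are invisible to the
  coefficients \<open>M v (U j)\<close>.\<close>

locale discrete_spectrum =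
  M: semi_inner X V M + A: semi_inner X V A
  for X :: "'a set" and V and M and A +
  fixes d :: nat and \<Lambda> :: "nat \<Rightarrow> real" and U :: "nat \<Rightarrow> 'a \<Rightarrow> real"
  assumes U_in: "\<And>j. j \<in> {1..d} \<Longrightarrow> U j \<in> V"
    and \<Lambda>_pos: "\<And>j. j \<in> {1..d} \<Longrightarrow> 0 < \<Lambda> j"
    and M_U: "\<And>i j. i \<in> {1..d} \<Longrightarrow> j \<in> {1..d} \<Longrightarrow> M (U i) (U j) = of_bool (i = j)"
    and A_U: "\<And>i j. i \<in> {1..d} \<Longrightarrow> j \<in> {1..d} \<Longrightarrow> A (U i) (U j) = \<Lambda> j * of_bool (i = j)"
    and M_one: "\<And>j. j \<in> {1..d} \<Longrightarrow> M (\<lambda>x. 1) (U j) = 0"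
begin

abbreviation nrm :: "('a \<Rightarrow> real) \<Rightarrow> real" where "nrm v \<equiv> sqrt (M v v)"

lemma nrm_nonneg: "v \<in> V \<Longrightarrow> 0 \<le> nrm v"
  by (simp add: M.B_nonneg)

lemma M_minus_const: "v \<in> V \<Longrightarrow> j \<in> {1..d} \<Longrightarrow> M (\<lambda>x. v x - c) (U j) = M v (U j)"
  using M.B_diff[of v "\<lambda>x. c" "U j"] M.B_const[of "U j" c] by (simp add: U_in M_one M.const_in)

lemma projection_best_approximation:
  assumes u: "u \<in> V" and J: "J \<subseteq> {1..d}"
  shows "nrm (\<lambda>x. u x - (\<Sum>j\<in>J. M u (U j) * U j x) - \<alpha>) \<le> nrm (\<lambda>x. u x - (\<Sum>j\<in>J. b j * U j x) - \<alpha>)"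
proof -
  let ?P = "\<lambda>x. \<Sum>j\<in>J. M u (U j) * U j x" and ?D = "\<lambda>x. \<Sum>j\<in>J. (M u (U j) - b j) * U j x"
  let ?f = "\<lambda>x. u x - ?P x - \<alpha>"
  have J': "finite J" "\<And>j. j \<in> J \<Longrightarrow> U j \<in> V" using J U_in finite_subset by auto
  have MJ: "M (U i) (U j) = 1 * of_bool (i = j)" if "i \<in> J" "j \<in> J" for i j using M_U[OF subsetD[OF J] subsetD[OF J], of i j] that by simp
  have P: "?P \<in> V" by (rule M.sum_in[where U = U, OF J'])
  have D: "?D \<in> V" by (rule M.sum_in[where U = U, OF J'])
  have uP: "(\<lambda>x. u x - ?P x) \<in> V" by (rule M.diff_in[OF u P])
  then have f: "?f \<in> V" by (rule M.diff_in[OF _ M.const_in])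
  have "M ?f (U j) = 0" if j: "j \<in> J" for j
  proof -
    have "M ?f (U j) = M (\<lambda>x. u x - ?P x) (U j)" using M_minus_const[OF uP, of j] j J by auto
    also have "\<dots> = M u (U j) - M ?P (U j)" by (rule M.B_diff[OF u P J'(2)[OF j]])
    also have "M ?P (U j) = 1 * M u (U j)" by (rule M.B_sum_orthogonal(1)[where U = U, OF J' MJ j])
    finally show ?thesis by simp
  qed
  then have orth: "M ?f ?D = 0" by (simp add: M.B_sum_right[where U = U, OF J' f])
  have eq: "(\<lambda>x. u x - (\<Sum>j\<in>J. b j * U j x) - \<alpha>) = (\<lambda>x. ?f x + ?D x)"
    by (simp add: fun_eq_iff left_diff_distrib sum_subtractf)
  have "M (\<lambda>x. ?f x + ?D x) (\<lambda>x. ?f x + ?D x) = M ?f ?f + M ?D ?D"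
    using M.B_add[OF f D M.add_in[OF f D]] M.B_add_right[OF f D f] M.B_add_right[OF f D D] orth M.B_sym[OF D f] by simp
  then show ?thesis unfolding eq using M.B_nonneg[OF D] by simp
qed

context
  fixes u :: "'a \<Rightarrow> real" and \<alpha> :: real and J :: "nat set"
  assumes u: "u \<in> V" and J: "J \<subseteq> {1..d}"
begin

definition coef :: "nat \<Rightarrow> real" where "coef j = A u (U j) / \<Lambda> j"

definition err :: "'a \<Rightarrow> real" where "err x = u x - (\<Sum>j\<in>{1..d}. coef j * U j x) - \<alpha>"

definition rest :: "'a \<Rightarrow> real" where "rest x = (\<Sum>j\<in>{1..d} - J. coef j * U j x)"

lemma rest_index: "finite ({1..d} - J)" "\<And>j. j \<in> {1..d} - J \<Longrightarrow> U j \<in> V"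
    "\<And>i j. i \<in> {1..d} - J \<Longrightarrow> j \<in> {1..d} - J \<Longrightarrow> M (U i) (U j) = 1 * of_bool (i = j)"
    "\<And>i j. i \<in> {1..d} - J \<Longrightarrow> j \<in> {1..d} - J \<Longrightarrow> A (U i) (U j) = \<Lambda> j * of_bool (i = j)"
  using U_in M_U A_U by auto

lemma all_index: "finite {1..d}" "\<And>i j. i \<in> {1..d} \<Longrightarrow> j \<in> {1..d} \<Longrightarrow> M (U i) (U j) = 1 * of_bool (i = j)"
  using M_U by auto

lemma err_in: "err \<in> V" and rest_in: "rest \<in> V"
proof -
  have "(\<lambda>x. u x - (\<Sum>j\<in>{1..d}. coef j * U j x) - \<alpha>) \<in> V"
    by (rule M.diff_in[OF M.diff_in[OF u M.sum_in[where U = U, OF all_index(1) U_in]] M.const_in])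
  then show "err \<in> V" by (simp add: err_def[abs_def])
  show "rest \<in> V" unfolding rest_def[abs_def] by (rule M.sum_in[where U = U, OF rest_index(1,2)])
qed

lemma M_err: "j \<in> {1..d} \<Longrightarrow> M err (U j) = M u (U j) - coef j"
proof -
  assume j: "j \<in> {1..d}"
  let ?G = "\<lambda>x. \<Sum>j\<in>{1..d}. coef j * U j x"
  have G: "?G \<in> V" by (rule M.sum_in[where U = U, OF all_index(1) U_in])
  have "M err (U j) = M (\<lambda>x. u x - ?G x) (U j)"
    using M_minus_const[OF M.diff_in[OF u G] j, of \<alpha>] by (simp add: err_def[abs_def])
  also have "\<dots> = M u (U j) - M ?G (U j)" by (rule M.B_diff[OF u G U_in[OF j]])
  also have "M ?G (U j) = 1 * coef j" by (rule M.B_sum_orthogonal(1)[where U = U, OF all_index(1) U_in all_index(2) j])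
  finally show ?thesis by simp
qed

lemma M_rest: "M rest rest = (\<Sum>j\<in>{1..d} - J. (coef j)\<^sup>2)"
  by (simp only: rest_def[abs_def] M.B_sum_orthogonal(2)[where U = U, OF rest_index(1-3)]) simp

lemma ritz_error_split: "nrm (\<lambda>x. u x - (\<Sum>j\<in>J. coef j * U j x) - \<alpha>) \<le> nrm err + nrm rest"
proof -
  have "(\<Sum>j\<in>{1..d}. coef j * U j x) = (\<Sum>j\<in>{1..d} - J. coef j * U j x) + (\<Sum>j\<in>J. coef j * U j x)" for x
    by (rule sum.subset_diff[OF J]) simp
  then have "(\<lambda>x. u x - (\<Sum>j\<in>J. coef j * U j x) - \<alpha>) = (\<lambda>x. err x + rest x)"
    by (simp add: fun_eq_iff err_def rest_def)
  then show ?thesis using M.B_triangle[OF err_in rest_in] by simp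
qed

text \<open>A triangle inequality alone would leave \<alpha> on the right. Testing the Ritz
  projection with itself, which is orthogonal to constants, bounds it by the norms of
  \<open>u\<close> and of the error; no eigenvalue enters.\<close>

lemma ritz_error_coarse: "nrm (\<lambda>x. u x - (\<Sum>j\<in>J. coef j * U j x) - \<alpha>) \<le> 2 * nrm err + nrm u"
proof -
  let ?G = "\<lambda>x. \<Sum>j\<in>{1..d}. coef j * U j x"
  have G: "?G \<in> V" by (rule M.sum_in[where U = U, OF all_index(1) U_in])
  have MG: "M ?G ?G = (\<Sum>j\<in>{1..d}. (coef j)\<^sup>2)"
    by (simp only: M.B_sum_orthogonal(2)[where U = U, OF all_index(1) U_in all_index(2)]) simp
  have "M rest rest \<le> M ?G ?G"
    unfolding M_rest MG by (rule sum_mono2) auto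
  then have rG: "nrm rest \<le> nrm ?G" by simp
  have "M ?G ?G = (\<Sum>j\<in>{1..d}. coef j * (M u (U j) - M err (U j)))"
    unfolding MG by (intro sum.cong refl) (simp add: M_err power2_eq_square)
  also have "\<dots> = M u ?G - M err ?G"
    by (simp only: M.B_sum_right[where U = U, OF all_index(1) U_in u] M.B_sum_right[where U = U, OF all_index(1) U_in err_in])
      (simp add: sum_subtractf right_diff_distrib)
  finally have "nrm ?G * nrm ?G \<le> (nrm u + nrm err) * nrm ?G"
    using M.B_Cauchy[OF u G] M.B_Cauchy[OF err_in G] M.B_nonneg[OF G] by (simp add: distrib_right)
  then have "nrm ?G \<le> nrm u + nrm err"
    by (rule le_if_mult_self_le) (use nrm_nonneg[OF G] nrm_nonneg[OF u] nrm_nonneg[OF err_in] in linarith)+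
  then show ?thesis using ritz_error_split rG by linarith
qed

text \<open>All geometry is condensed in \<open>key\<close>, so the rest is algebra of coefficients.
  The weights on the right of \<open>key\<close> are homogeneous in \<open>l\<close>, which lets
  \<open>l\<close> cancel.\<close>

lemma ritz_error_fine:
  assumes l: "l > 0" and \<mu>: "\<And>j. j \<in> {1..d} - J \<Longrightarrow> \<Lambda> j \<noteq> l \<and> \<bar>l / (\<Lambda> j - l)\<bar> \<le> \<mu>" "0 \<le> \<mu>"
    and \<epsilon>: "0 \<le> \<epsilon>"
    and key: "\<And>w. w \<in> V \<Longrightarrow> \<bar>A u w - l * M u w\<bar> \<le> \<epsilon> * (sqrt l * nrm u * sqrt (A w w) + l * nrm u * nrm w)"
  shows "nrm (\<lambda>x. u x - (\<Sum>j\<in>J. coef j * U j x) - \<alpha>) \<le> (1 + \<mu>) * nrm err + 2 * \<epsilon> * (1 + \<mu>) * nrm u"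
proof -
  let ?I = "{1..d} - J"
  define \<xi> where xi_def: "\<xi> j = l / (\<Lambda> j - l)" for j
  define g where "g j = \<xi> j * coef j" for j
  define w where "w x = (\<Sum>j\<in>?I. g j * U j x)" for x
  have w: "w \<in> V" unfolding w_def[abs_def] by (rule M.sum_in[where U = U, OF rest_index(1,2)])
  have xi: "\<bar>\<xi> j\<bar> \<le> \<mu>" if "j \<in> ?I" for j using \<mu>(1)[OF that] unfolding xi_def by blast
  have xi2: "(\<xi> j)\<^sup>2 \<le> \<mu>\<^sup>2" if "j \<in> ?I" for j
    using power_mono[OF xi[OF that] abs_ge_zero, of 2] by (simp only: power2_abs)
  have xiL: "(\<Lambda> j - l) * \<xi> j = l" if "j \<in> ?I" for j using \<mu>(1)[OF that] by (simp add: xi_def)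
  have Mw: "M w w \<le> \<mu>\<^sup>2 * M rest rest"
  proof (simp only: w_def[abs_def] M_rest M.B_sum_orthogonal(2)[where U = U, OF rest_index(1-3)] sum_distrib_left,
      rule sum_mono)
    fix j assume j: "j \<in> ?I"
    show "1 * (g j)\<^sup>2 \<le> \<mu>\<^sup>2 * (coef j)\<^sup>2"
      using mult_right_mono[OF xi2[OF j], of "(coef j)\<^sup>2"] by (simp add: g_def power_mult_distrib)
  qed
  have Aw: "A w w \<le> (l * (1 + \<mu>)\<^sup>2) * M rest rest"
  proof (simp only: w_def[abs_def] M_rest A.B_sum_orthogonal(2)[where U = U, OF rest_index(1,2,4)] sum_distrib_left,
      rule sum_mono)
    fix j assume j: "j \<in> ?I"
    \<comment> \<open>Splitting \<open>\<Lambda> j\<close> into \<open>l\<close> and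
      \<open>\<Lambda> j - l\<close> and using \<open>(\<Lambda> j - l) * \<xi> j = l\<close> bounds
      the energy of \<open>w\<close> although the discrete eigenvalues themselves are unbounded as
      the mesh is refined.\<close>
    have "\<Lambda> j * (\<xi> j)\<^sup>2 = l * (\<xi> j)\<^sup>2 + ((\<Lambda> j - l) * \<xi> j) * \<xi> j" by (simp add: power2_eq_square algebra_simps)
    also have "\<dots> = l * ((\<xi> j)\<^sup>2 + \<xi> j)" unfolding xiL[OF j] by (simp add: algebra_simps)
    also have "\<dots> \<le> l * (1 + \<mu>)\<^sup>2"
    proof (rule mult_left_mono)
      have "\<xi> j \<le> \<mu>" by (rule abs_le_D1[OF xi[OF j]])
      then show "(\<xi> j)\<^sup>2 + \<xi> j \<le> (1 + \<mu>)\<^sup>2" using xi2[OF j] \<mu>(2) by (simp add: power2_sum)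
    qed (use l in simp)
    finally show "\<Lambda> j * (g j)\<^sup>2 \<le> (l * (1 + \<mu>)\<^sup>2) * (coef j)\<^sup>2"
      using mult_right_mono[of "\<Lambda> j * (\<xi> j)\<^sup>2" "l * (1 + \<mu>)\<^sup>2" "(coef j)\<^sup>2"] by (simp add: g_def power_mult_distrib mult.assoc)
  qed
  have "l * M rest rest = (\<Sum>j\<in>?I. l * (coef j)\<^sup>2)" unfolding M_rest by (simp add: sum_distrib_left)
  also have "\<dots> = (\<Sum>j\<in>?I. g j * A u (U j) - l * (g j * M u (U j)) + l * (g j * M err (U j)))"
  proof (intro sum.cong refl)
    fix j assume j: "j \<in> ?I"
    have "A u (U j) = \<Lambda> j * coef j" using \<Lambda>_pos[of j] j by (simp add: coef_def)
    then have "g j * A u (U j) - l * (g j * M u (U j)) + l * (g j * M err (U j)) = ((\<Lambda> j - l) * \<xi> j) * (coef j)\<^sup>2"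
      unfolding g_def M_err[OF DiffD1[OF j]] by (simp add: power2_eq_square algebra_simps)
    then show "l * (coef j)\<^sup>2 = g j * A u (U j) - l * (g j * M u (U j)) + l * (g j * M err (U j))"
      unfolding xiL[OF j] by simp
  qed
  also have "\<dots> = (A u w - l * M u w) + l * M err w"
    by (simp only: w_def[abs_def] A.B_sum_right[where U = U, OF rest_index(1,2) u] M.B_sum_right[where U = U, OF rest_index(1,2) u]
      M.B_sum_right[where U = U, OF rest_index(1,2) err_in]) (simp add: sum_subtractf sum.distrib sum_distrib_left)
  finally have eq: "l * M rest rest = (A u w - l * M u w) + l * M err w" .
  have nw: "nrm w \<le> \<mu> * nrm rest"
    using real_sqrt_le_mono[OF Mw] \<mu>(2) by (simp add: real_sqrt_mult)
  have nA: "sqrt (A w w) \<le> sqrt l * ((1 + \<mu>) * nrm rest)"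
    using real_sqrt_le_mono[OF Aw] \<mu>(2) by (simp add: real_sqrt_mult mult.assoc)
  let ?R = "nrm rest" and ?E = "nrm err"
  have nn: "0 \<le> ?R" "0 \<le> ?E" "0 \<le> nrm u" by (simp_all add: M.B_nonneg rest_in err_in u)
  have nw': "nrm w \<le> (1 + \<mu>) * ?R" using nw nn(1) unfolding distrib_right by linarith
  have "sqrt l * nrm u * sqrt (A w w) \<le> sqrt l * nrm u * (sqrt l * ((1 + \<mu>) * ?R))"
    using nA l nn(3) by (intro mult_left_mono) auto
  \<comment> \<open>The root belonging to the energy of \<open>u\<close> meets the one from the
    energy of \<open>w\<close>; every term now carries the factor \<open>l\<close>.\<close>
  also have "\<dots> = (sqrt l * sqrt l) * (nrm u * (1 + \<mu>) * ?R)" by (simp only: mult_ac)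
  also have "sqrt l * sqrt l = l" using l by simp
  finally have t1: "sqrt l * nrm u * sqrt (A w w) \<le> l * (nrm u * (1 + \<mu>) * ?R)" .
  have t2: "l * nrm u * nrm w \<le> l * nrm u * ((1 + \<mu>) * ?R)"
    using nw' l nn(3) by (intro mult_left_mono) auto
  have "A u w - l * M u w \<le> \<epsilon> * (sqrt l * nrm u * sqrt (A w w) + l * nrm u * nrm w)" using key[OF w] by linarith
  also have "\<dots> \<le> \<epsilon> * (l * (nrm u * (1 + \<mu>) * ?R) + l * nrm u * ((1 + \<mu>) * ?R))"
    by (rule mult_left_mono[OF add_mono[OF t1 t2] \<epsilon>])
  also have "\<dots> = l * (2 * \<epsilon> * (1 + \<mu>) * nrm u * ?R)" by (simp add: algebra_simps)
  finally have k1: "A u w - l * M u w \<le> l * (2 * \<epsilon> * (1 + \<mu>) * nrm u * ?R)" .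
  have "M err w \<le> ?E * nrm w" using M.B_Cauchy[OF err_in w] by linarith
  also have "\<dots> \<le> ?E * (\<mu> * ?R)" by (rule mult_left_mono[OF nw nn(2)])
  finally have k2: "l * M err w \<le> l * (?E * (\<mu> * ?R))" using l by simp
  have "l * (?R * ?R) \<le> l * ((2 * \<epsilon> * (1 + \<mu>) * nrm u + \<mu> * ?E) * ?R)"
    using eq k1 k2 M.B_nonneg[OF rest_in] by (simp add: algebra_simps)
  \<comment> \<open>After division by \<open>l\<close> one factor \<open>?R\<close> cancels as well,
    which leaves a linear bound for the remainder.\<close>
  then have "?R * ?R \<le> (2 * \<epsilon> * (1 + \<mu>) * nrm u + \<mu> * ?E) * ?R" using l by (simp only: mult_le_cancel_left_pos)
  moreover have "0 \<le> 2 * \<epsilon> * (1 + \<mu>) * nrm u + \<mu> * ?E" using nn \<epsilon> \<mu>(2) by simp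
  ultimately have "?R \<le> 2 * \<epsilon> * (1 + \<mu>) * nrm u + \<mu> * ?E"
    using nn(1) by (rule le_if_mult_self_le)
  then show ?thesis using ritz_error_split by (simp add: distrib_right)
qed

end

end

section \<open>The error of the cluster projections\<close>

lemma poly_on_sum:
  assumes "\<And>j. j \<in> I \<Longrightarrow> poly_on r T (f j)"
  shows "poly_on r T (\<lambda>x. \<Sum>j\<in>I. c j * f j x)"
proof -
  have "\<forall>j\<in>I. \<exists>a. \<forall>x\<in>T. f j x = (\<Sum>b | sum b UNIV \<le> r. a b * (\<Prod>i\<in>UNIV. (x $ i) ^ b i))"
    using assms unfolding poly_on_def by blast
  then obtain a where a: "\<forall>j\<in>I. \<forall>x\<in>T. f j x = (\<Sum>b | sum b UNIV \<le> r. a j b * (\<Prod>i\<in>UNIV. (x $ i) ^ b i))"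
    by (rule bchoice[THEN exE])
  have "(\<Sum>j\<in>I. c j * f j x) = (\<Sum>b | sum b UNIV \<le> r. (\<Sum>j\<in>I. c j * a j b) * (\<Prod>i\<in>UNIV. (x $ i) ^ b i))"
    if x: "x \<in> T" for x
  proof -
    have "(\<Sum>j\<in>I. c j * f j x) = (\<Sum>j\<in>I. \<Sum>b | sum b UNIV \<le> r. c j * a j b * (\<Prod>i\<in>UNIV. (x $ i) ^ b i))"
      using a x by (intro sum.cong refl) (simp add: sum_distrib_left mult.assoc)
    also have "\<dots> = (\<Sum>b | sum b UNIV \<le> r. \<Sum>j\<in>I. c j * a j b * (\<Prod>i\<in>UNIV. (x $ i) ^ b i))"
      by (rule sum.swap)
    finally show ?thesis by (simp only: sum_distrib_right)
  qed
  then show ?thesis unfolding poly_on_def by (intro exI[of _ "\<lambda>b. \<Sum>j\<in>I. c j * a j b"] ballI)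
qed

lemma cluster_mu_bound:
  assumes fin: "cluster_mu J d lam \<Lambda> < \<infinity>" and i: "i \<in> J" "lam i > 0" and j: "j \<in> {1..d} - J"
  shows "\<Lambda> j \<noteq> lam i \<and> \<bar>lam i / (\<Lambda> j - lam i)\<bar> \<le> enn2real (cluster_mu J d lam \<Lambda>)"
proof -
  let ?q = "ennreal \<bar>lam i\<bar> / ennreal \<bar>\<Lambda> j - lam i\<bar>"
  have "?q \<le> (SUP j\<in>{1..d} - J. ennreal \<bar>lam i\<bar> / ennreal \<bar>\<Lambda> j - lam i\<bar>)" by (rule SUP_upper[OF j])
  also have "\<dots> \<le> cluster_mu J d lam \<Lambda>" unfolding cluster_mu_def by (rule SUP_upper[OF i(1)])
  finally have q: "?q \<le> cluster_mu J d lam \<Lambda>" .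
  have ne: "\<Lambda> j \<noteq> lam i"
  proof
    assume "\<Lambda> j = lam i"
    \<comment> \<open>A positive numerator over zero is infinite, so finiteness of the maximum
      separates the eigenvalues.\<close>
    then have "?q = top" using i(2) by (simp add: ennreal_divide_zero)
    then show False using q fin by (simp add: top_unique)
  qed
  then have "?q = ennreal \<bar>lam i / (\<Lambda> j - lam i)\<bar>" by (subst divide_ennreal) (auto simp: abs_divide)
  then have "enn2real ?q = \<bar>lam i / (\<Lambda> j - lam i)\<bar>" by (simp only: enn2real_ennreal abs_ge_zero)
  then show ?thesis using enn2real_mono[OF q] fin ne by simp
qed

lemma weak_tgrad_tgrad: "v \<in> H1 \<mu> n \<Longrightarrow> weak_tgrad \<mu> n v (tgrad \<mu> n v)"
  unfolding H1_def tgrad_def mem_Collect_eq by (rule someI_ex[where P = "weak_tgrad \<mu> n v"])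

context lifted_mesh
begin

text \<open>By \<open>tgrad_unique\<close> any weak gradient may replace the chosen one, so
  linearity of the form can be read off explicit gradients.\<close>

lemma A_form_eq:
  assumes v: "weak_tgrad \<Sigma> (normal S) v p" and w: "weak_tgrad \<Sigma> (normal S) w q"
  shows "A_form S v w = (LINT x|\<Sigma>. p x \<bullet> q x)"
proof -
  have tv: "weak_tgrad \<Sigma> (normal S) v (tgrad \<Sigma> (normal S) v)"
    by (rule weak_tgrad_tgrad) (use v in \<open>auto simp: H1_def\<close>)
  have tw: "weak_tgrad \<Sigma> (normal S) w (tgrad \<Sigma> (normal S) w)"
    by (rule weak_tgrad_tgrad) (use w in \<open>auto simp: H1_def\<close>)
  show ?thesis
    unfolding stiffness_def
  proof (rule integral_cong_AE)
    show "(\<lambda>x. tgrad \<Sigma> (normal S) v x \<bullet> tgrad \<Sigma> (normal S) w x) \<in> borel_measurable \<Sigma>"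
      by (rule borel_measurable_integrable[OF square_integrable_inner[OF G.weak_tgradD(2)[OF tv] G.weak_tgradD(2)[OF tw]]])
    show "(\<lambda>x. p x \<bullet> q x) \<in> borel_measurable \<Sigma>"
      by (rule borel_measurable_integrable[OF square_integrable_inner[OF G.weak_tgradD(2)[OF v] G.weak_tgradD(2)[OF w]]])
    show "AE x in \<Sigma>. tgrad \<Sigma> (normal S) v x \<bullet> tgrad \<Sigma> (normal S) w x = p x \<bullet> q x"
      using tgrad_unique[OF tv v] tgrad_unique[OF tw w] by eventually_elim simp
  qed
qed

lemma H1E:
  assumes "v \<in> H1 \<Sigma> (normal S)"
  obtains p where "weak_tgrad \<Sigma> (normal S) v p"
  using assms unfolding H1_def by blast

lemma H1_I: "weak_tgrad \<Sigma> (normal S) v p \<Longrightarrow> v \<in> H1 \<Sigma> (normal S)"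
  unfolding H1_def by blast

lemma H1_cong:
  assumes "v \<in> H1 \<Sigma> (normal S)" "\<And>x. x \<in> Gamma S \<Longrightarrow> v x = w x"
  shows "w \<in> H1 \<Sigma> (normal S)"
proof -
  obtain p where "weak_tgrad \<Sigma> (normal S) v p" by (rule H1E[OF assms(1)])
  then show ?thesis by (rule H1_I[OF G.weak_tgrad_cong[OF _ assms(2)]])
qed

lemma H1_const: "(\<lambda>x. c) \<in> H1 \<Sigma> (normal S)"
  by (rule H1_I[OF G.weak_tgrad_smooth[OF smooth_on_const[OF open_UNIV]]])

lemma H1_comb:
  assumes "v \<in> H1 \<Sigma> (normal S)" "w \<in> H1 \<Sigma> (normal S)"
  shows "(\<lambda>x. a * v x + b * w x) \<in> H1 \<Sigma> (normal S)"
proof -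
  obtain p where "weak_tgrad \<Sigma> (normal S) v p" by (rule H1E[OF assms(1)])
  moreover obtain q where "weak_tgrad \<Sigma> (normal S) w q" by (rule H1E[OF assms(2)])
  ultimately show ?thesis by (rule H1_I[OF G.weak_tgrad_linear_combination])
qed

lemma H1_square_integrable: "v \<in> H1 \<Sigma> (normal S) \<Longrightarrow> square_integrable \<Sigma> v"
  unfolding H1_def weak_tgrad_def by blast

sublocale M: semi_inner "Gamma S" "H1 \<Sigma> (normal S)" "M_form S"
proof
  fix v w z assume v: "v \<in> H1 \<Sigma> (normal S)" and w: "w \<in> H1 \<Sigma> (normal S)" and z: "z \<in> H1 \<Sigma> (normal S)"
  fix a b :: real
  have "M_form S (\<lambda>x. a * v x + b * w x) z = (LINT x|\<Sigma>. a * (v x * z x) + b * (w x * z x))"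
    unfolding mass_def by (simp add: algebra_simps)
  also have "\<dots> = a * M_form S v z + b * M_form S w z"
    unfolding mass_def
    using square_integrable_times[OF H1_square_integrable[OF v] H1_square_integrable[OF z]]
      square_integrable_times[OF H1_square_integrable[OF w] H1_square_integrable[OF z]]
    by (subst Bochner_Integration.integral_add) simp_all
  finally show "M_form S (\<lambda>x. a * v x + b * w x) z = a * M_form S v z + b * M_form S w z" .
next
  fix v w z :: "real^'m \<Rightarrow> real" assume "\<And>x. x \<in> Gamma S \<Longrightarrow> v x = w x"
  then show "M_form S v z = M_form S w z"
    unfolding mass_def by (intro Bochner_Integration.integral_cong refl) (simp add: space_Sigma)
qed (auto simp: mass_def mult.commute intro: H1_const H1_comb elim: H1_cong)

sublocale A: semi_inner "Gamma S" "H1 \<Sigma> (normal S)" "A_form S"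
proof
  fix v w z assume v: "v \<in> H1 \<Sigma> (normal S)" and w: "w \<in> H1 \<Sigma> (normal S)" and z: "z \<in> H1 \<Sigma> (normal S)"
  fix a b :: real
  obtain p where p: "weak_tgrad \<Sigma> (normal S) v p" by (rule H1E[OF v])
  obtain q where q: "weak_tgrad \<Sigma> (normal S) w q" by (rule H1E[OF w])
  obtain s where s: "weak_tgrad \<Sigma> (normal S) z s" by (rule H1E[OF z])
  have "A_form S (\<lambda>x. a * v x + b * w x) z = (LINT x|\<Sigma>. a * (p x \<bullet> s x) + b * (q x \<bullet> s x))"
    unfolding A_form_eq[OF G.weak_tgrad_linear_combination[OF p q] s] by (simp add: inner_add_left)
  also have "\<dots> = a * A_form S v z + b * A_form S w z"
    unfolding A_form_eq[OF p s] A_form_eq[OF q s]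
    using square_integrable_inner[OF G.weak_tgradD(2)[OF p] G.weak_tgradD(2)[OF s]]
      square_integrable_inner[OF G.weak_tgradD(2)[OF q] G.weak_tgradD(2)[OF s]]
    by (subst Bochner_Integration.integral_add) simp_all
  finally show "A_form S (\<lambda>x. a * v x + b * w x) z = a * A_form S v z + b * A_form S w z" .
next
  fix v w z assume v: "v \<in> H1 \<Sigma> (normal S)" and e: "\<And>x. x \<in> Gamma S \<Longrightarrow> v x = w x" and z: "z \<in> H1 \<Sigma> (normal S)"
  obtain p where p: "weak_tgrad \<Sigma> (normal S) v p" by (rule H1E[OF v])
  obtain s where s: "weak_tgrad \<Sigma> (normal S) z s" by (rule H1E[OF z])
  show "A_form S v z = A_form S w z"
    by (rule trans[OF A_form_eq[OF p s] A_form_eq[OF G.weak_tgrad_cong[OF p e] s, symmetric]])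
qed (auto simp: stiffness_def inner_commute intro: H1_const H1_comb elim: H1_cong)

lemma M_norm_cong: "(\<And>x. x \<in> Gamma S \<Longrightarrow> v x = w x) \<Longrightarrow> M_norm S v = M_norm S w"
  unfolding mass_norm_def mass_def
  by (intro arg_cong[where f = sqrt] Bochner_Integration.integral_cong refl) (simp add: space_Sigma)

lemma M_norm_sqrt: "M_norm S v = sqrt (LINT x|\<Sigma>. (v x)\<^sup>2)"
  by (simp add: mass_norm_def mass_def power2_eq_square)

lemma mesh_size_nonneg: "0 \<le> mesh_size S"
proof -
  have "faces S \<noteq> {}" using gamma_nonempty_Gamma by (auto simp: Gamma_eq)
  then obtain T where T: "T \<in> faces S" by blast
  have "0 < elem_diam S T" by (rule elem_diam_pos[OF T])
  also have "elem_diam S T \<le> mesh_size S"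
    unfolding mesh_size_def by (rule Max_ge) (use T finite_faces in auto)
  finally show ?thesis by simp
qed

context
  fixes r d :: nat and \<Lambda> :: "nat \<Rightarrow> real" and U :: "nat \<Rightarrow> real^'m \<Rightarrow> real"
  assumes disc: "discrete_eigenpairs r S d \<Lambda> U"
begin

lemma eigenpairs:
  assumes "j \<in> {1..d}"
  shows "0 < \<Lambda> j" "U j \<in> fe_space_zero_mean r S" "U j \<in> H1 \<Sigma> (normal S)" "(LINT x|\<Sigma>. U j x) = 0"
    "\<And>T. T \<in> faces S \<Longrightarrow> poly_on r T (U j \<circ> Lmap S)"
  using assms disc unfolding discrete_eigenpairs_def fe_space_zero_mean_def fe_space_def by blast+

lemma M_U: "i \<in> {1..d} \<Longrightarrow> j \<in> {1..d} \<Longrightarrow> M_form S (U i) (U j) = of_bool (i = j)"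
  using disc unfolding discrete_eigenpairs_def by blast

lemma A_U: "i \<in> {1..d} \<Longrightarrow> j \<in> {1..d} \<Longrightarrow> A_form S (U i) (U j) = \<Lambda> j * of_bool (i = j)"
proof -
  assume ij: "i \<in> {1..d}" "j \<in> {1..d}"
  have "A_form S (U i) (U j) = \<Lambda> i * M_form S (U i) (U j)"
    using disc eigenpairs(2)[OF ij(2)] ij(1) unfolding discrete_eigenpairs_def by blast
  then show ?thesis unfolding M_U[OF ij] by auto
qed

lemma discrete_spectrum: "discrete_spectrum (Gamma S) (H1 \<Sigma> (normal S)) (M_form S) (A_form S) d \<Lambda> U"
proof
  fix j assume j: "j \<in> {1..d}"
  show "M_form S (\<lambda>x. 1) (U j) = 0" using eigenpairs(4)[OF j] by (simp add: mass_def)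
qed (use eigenpairs(1,3) M_U A_U in auto)

text \<open>On \<Gamma> the zero mean finite element space is the span of all \<open>U j\<close>:
  combinations stay polynomial, in \<open>H1\<close> and of mean zero, and the converse is part of
  \<open>discrete_eigenpairs\<close>.\<close>

lemma ritz_projection_eq:
  assumes v: "v \<in> H1 \<Sigma> (normal S)" and x: "x \<in> Gamma S"
  shows "form_projection (A_form S) (fe_space_zero_mean r S) v x = (\<Sum>j\<in>{1..d}. A_form S v (U j) / \<Lambda> j * U j x)"
proof (rule A.form_projection_eq[where U = U and \<kappa> = \<Lambda>, OF _ _ A_U _ _ _ v x])
  fix c :: "nat \<Rightarrow> real"
  have H: "(\<lambda>x. \<Sum>i\<in>{1..d}. c i * U i x) \<in> H1 \<Sigma> (normal S)"
    by (rule M.sum_in[where U = U]) (use eigenpairs(3) in auto)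
  have "(LINT x|\<Sigma>. (\<Sum>i\<in>{1..d}. c i * U i x)) = M_form S (\<lambda>x. 1) (\<lambda>x. \<Sum>i\<in>{1..d}. c i * U i x)"
    by (simp add: mass_def)
  also have "\<dots> = (\<Sum>i\<in>{1..d}. c i * M_form S (\<lambda>x. 1) (U i))"
    by (rule M.B_sum_right[where U = U]) (use eigenpairs(3) H1_const in auto)
  also have "\<dots> = 0" using eigenpairs(4) by (simp add: mass_def)
  finally have I: "(LINT x|\<Sigma>. (\<Sum>i\<in>{1..d}. c i * U i x)) = 0" .
  have "poly_on r T ((\<lambda>x. \<Sum>i\<in>{1..d}. c i * U i x) \<circ> Lmap S)" if "T \<in> faces S" for T
    using poly_on_sum[of "{1..d}" r T "\<lambda>i. U i \<circ> Lmap S" c] eigenpairs(5) that by (simp add: comp_def)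
  then show "(\<lambda>x. \<Sum>i\<in>{1..d}. c i * U i x) \<in> fe_space_zero_mean r S"
    using H I by (simp add: fe_space_zero_mean_def fe_space_def)
next
  fix w assume "w \<in> fe_space_zero_mean r S"
  then show "\<exists>c. \<forall>x\<in>Gamma S. w x = (\<Sum>i\<in>{1..d}. c i * U i x)"
    using disc unfolding discrete_eigenpairs_def span_on_Gamma_def by blast
qed (use eigenpairs(1,3) in \<open>auto simp: less_imp_neq[symmetric]\<close>)

lemma cluster_projection_eq:
  assumes J: "J \<subseteq> {1..d}" and v: "v \<in> H1 \<Sigma> (normal S)" and x: "x \<in> Gamma S"
  shows "form_projection (A_form S) (span_on_Gamma S U J) v x = (\<Sum>j\<in>J. A_form S v (U j) / \<Lambda> j * U j x)"
    and "form_projection (M_form S) (span_on_Gamma S U J) v x = (\<Sum>j\<in>J. M_form S v (U j) * U j x)"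
proof -
  have fJ: "finite J" using J finite_subset by blast
  have UJ: "U j \<in> H1 \<Sigma> (normal S)" if "j \<in> J" for j using eigenpairs(3) J that by blast
  have A: "A_form S (U i) (U j) = \<Lambda> j * of_bool (i = j)" if "i \<in> J" "j \<in> J" for i j
    by (rule A_U) (use J that in auto)
  have M: "M_form S (U i) (U j) = 1 * of_bool (i = j)" if "i \<in> J" "j \<in> J" for i j
    using M_U[OF subsetD[OF J] subsetD[OF J], of i j] that by simp
  have n: "\<Lambda> j \<noteq> 0" if "j \<in> J" for j using eigenpairs(1)[of j] J that by auto
  have s1: "(\<lambda>x. \<Sum>i\<in>J. c i * U i x) \<in> span_on_Gamma S U J" for c
    unfolding span_on_Gamma_def by blast
  have s2: "\<exists>c. \<forall>x\<in>Gamma S. w x = (\<Sum>i\<in>J. c i * U i x)" if "w \<in> span_on_Gamma S U J" for w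
    using that unfolding span_on_Gamma_def by blast
  show "form_projection (A_form S) (span_on_Gamma S U J) v x = (\<Sum>j\<in>J. A_form S v (U j) / \<Lambda> j * U j x)"
    by (rule A.form_projection_eq[where U = U and \<kappa> = \<Lambda>, OF fJ UJ A n s1 s2 v x])
  have "form_projection (M_form S) (span_on_Gamma S U J) v x = (\<Sum>j\<in>J. M_form S v (U j) / 1 * U j x)"
    by (rule M.form_projection_eq[where U = U and \<kappa> = "\<lambda>_. 1", OF fJ UJ M _ s1 s2 v x]) simp_all
  then show "form_projection (M_form S) (span_on_Gamma S U J) v x = (\<Sum>j\<in>J. M_form S v (U j) * U j x)"
    by simp
qed

text \<open>The third bound keeps its own premises because the almost satisfied eigenvalue equation
  is available on fine meshes only, whereas the first two hold on every mesh.\<close>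

lemma cluster_error:
  fixes J v \<alpha>
  defines "Gv \<equiv> form_projection (A_form S) (fe_space_zero_mean r S) v"
    and "Zv \<equiv> form_projection (A_form S) (span_on_Gamma S U J) v"
    and "Pv \<equiv> form_projection (M_form S) (span_on_Gamma S U J) v"
  assumes J: "J \<subseteq> {1..d}" and v: "v \<in> H1 \<Sigma> (normal S)"
  shows "M_norm S (\<lambda>x. v x - Pv x - \<alpha>) \<le> M_norm S (\<lambda>x. v x - Zv x - \<alpha>)"
    and "M_norm S (\<lambda>x. v x - Zv x - \<alpha>) \<le> 2 * M_norm S (\<lambda>x. v x - Gv x - \<alpha>) + M_norm S v"
    and "\<lbrakk>l > 0; \<And>j. j \<in> {1..d} - J \<Longrightarrow> \<Lambda> j \<noteq> l \<and> \<bar>l / (\<Lambda> j - l)\<bar> \<le> \<mu>; 0 \<le> \<mu>; 0 \<le> \<epsilon>;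
      \<And>w. w \<in> H1 \<Sigma> (normal S) \<Longrightarrow> \<bar>A_form S v w - l * M_form S v w\<bar>
        \<le> \<epsilon> * (sqrt l * M_norm S v * sqrt (A_form S w w) + l * M_norm S v * M_norm S w)\<rbrakk> \<Longrightarrow>
      M_norm S (\<lambda>x. v x - Zv x - \<alpha>) \<le> (1 + \<mu>) * M_norm S (\<lambda>x. v x - Gv x - \<alpha>) + 2 * \<epsilon> * (1 + \<mu>) * M_norm S v"
proof -
  interpret D: discrete_spectrum "Gamma S" "H1 \<Sigma> (normal S)" "M_form S" "A_form S" d \<Lambda> U
    by (rule discrete_spectrum)
  have coef: "D.coef v j = A_form S v (U j) / \<Lambda> j" for j by (rule D.coef_def[OF v J])
  have err: "D.err v \<alpha> x = v x - (\<Sum>j\<in>{1..d}. D.coef v j * U j x) - \<alpha>" for x by (rule D.err_def[OF v J])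
  have P: "M_norm S (\<lambda>x. v x - Pv x - \<alpha>) = M_norm S (\<lambda>x. v x - (\<Sum>j\<in>J. M_form S v (U j) * U j x) - \<alpha>)"
    by (rule M_norm_cong) (simp add: Pv_def cluster_projection_eq(2)[OF J v])
  have Z: "M_norm S (\<lambda>x. v x - Zv x - \<alpha>) = M_norm S (\<lambda>x. v x - (\<Sum>j\<in>J. D.coef v j * U j x) - \<alpha>)"
    by (rule M_norm_cong) (simp add: Zv_def coef cluster_projection_eq(1)[OF J v])
  have E: "M_norm S (\<lambda>x. v x - Gv x - \<alpha>) = M_norm S (D.err v \<alpha>)"
    by (rule M_norm_cong) (simp add: Gv_def err coef ritz_projection_eq[OF v])
  show "M_norm S (\<lambda>x. v x - Pv x - \<alpha>) \<le> M_norm S (\<lambda>x. v x - Zv x - \<alpha>)"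
    unfolding P Z unfolding mass_norm_def by (rule D.projection_best_approximation[OF v J])
  show "M_norm S (\<lambda>x. v x - Zv x - \<alpha>) \<le> 2 * M_norm S (\<lambda>x. v x - Gv x - \<alpha>) + M_norm S v"
    unfolding Z E unfolding mass_norm_def by (rule D.ritz_error_coarse[OF v J])
  assume h: "l > 0" "\<And>j. j \<in> {1..d} - J \<Longrightarrow> \<Lambda> j \<noteq> l \<and> \<bar>l / (\<Lambda> j - l)\<bar> \<le> \<mu>" "0 \<le> \<mu>" "0 \<le> \<epsilon>"
    "\<And>w. w \<in> H1 \<Sigma> (normal S) \<Longrightarrow> \<bar>A_form S v w - l * M_form S v w\<bar>
        \<le> \<epsilon> * (sqrt l * M_norm S v * sqrt (A_form S w w) + l * M_norm S v * M_norm S w)"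
  show "M_norm S (\<lambda>x. v x - Zv x - \<alpha>) \<le> (1 + \<mu>) * M_norm S (\<lambda>x. v x - Gv x - \<alpha>) + 2 * \<epsilon> * (1 + \<mu>) * M_norm S v"
    unfolding Z E unfolding mass_norm_def
    by (rule D.ritz_error_fine[OF v J h(1-4) h(5)[unfolded mass_norm_def]])
qed

end

end

text \<open>\<open>key_estimate\<close> rewritten in terms of the forms: by uniqueness the lifted
  gradient may be used to evaluate \<open>A_form S\<close>. The result is the premise that
  \<open>cluster_error\<close> asks for, with 6 times the geometric error.\<close>

lemma (in close_mesh) eigenfunction_almost_discrete:
  assumes l: "l > 0" and u: "eigenfunction \<sigma> (nu \<gamma>) l u" and w: "w \<in> H1 \<Sigma> (normal S)"
  defines "v \<equiv> u \<circ> cp"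
  shows "\<bar>A_form S v w - l * M_form S v w\<bar>
    \<le> 6 * \<epsilon> * (sqrt l * M_norm S v * sqrt (A_form S w w) + l * M_norm S v * M_norm S w)"
proof -
  define p where "p = tgrad \<sigma> (nu \<gamma>) u"
  have p: "weak_tgrad \<sigma> (nu \<gamma>) u p"
    unfolding p_def by (rule weak_tgrad_tgrad) (use u in \<open>simp add: eigenfunction_def H1_zero_mean_def\<close>)
  have v: "weak_tgrad \<Sigma> (normal S) v (\<lambda>x. lift_grad x (p (cp x)))"
    using lift_weak_tgrad[OF p] by (simp add: v_def comp_def)
  obtain g where g: "weak_tgrad \<Sigma> (normal S) w g" by (rule H1E[OF w])
  show ?thesis
    using key_estimate[OF l u p p_def g]
    unfolding A_form_eq[OF v g] A_form_eq[OF g g] M_norm_sqrt mass_def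
    by (simp add: v_def power2_norm_eq_inner)
qed

section \<open>One constant for fine and coarse meshes\<close>

theorem theorem4p2:
  fixes \<gamma> :: "(real^'m) set" and \<sigma> :: "(real^'m) measure"
    and \<delta> \<rho> \<eta> C0 :: real and k r :: nat
  assumes "CARD('m) = CARD('n::finite) + 1"
    and "smooth_closed_surface TYPE('n) \<gamma>" and "orientable_surface TYPE('n) \<gamma>"
    and "surface_measure TYPE('n) \<gamma> \<sigma>"
    and "narrow_strip \<gamma> \<delta>"
    and "k \<ge> 1" and "r \<ge> 1" and "\<rho> > 0"
  shows "\<exists>C>0. \<forall>(S :: ('n, 'm) discrete_surface) \<rho>' \<eta>' lam d \<Lambda> U n N J i u \<alpha>.
    discrete_surface_of \<gamma> \<delta> k S \<and> standing_bounds \<gamma> k C0 S \<and>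
    shape_regularity_constant S \<rho>' \<and> \<rho> \<le> \<rho>' \<and>
    quasi_uniformity_constant S \<eta>' \<and> \<eta>' \<le> \<eta> \<and>
    laplace_eigenvalues \<sigma> (nu \<gamma>) lam \<and> discrete_eigenpairs r S d \<Lambda> U \<and>
    1 \<le> n \<and> n + N \<le> d \<and> J = {n..n + N} \<and>
    lam (n - 1) < lam n \<and> lam (n + N) < lam (n + N + 1) \<and>
    cluster_mu J d lam \<Lambda> < \<infinity> \<and>
    i \<in> J \<and> eigenfunction \<sigma> (nu \<gamma>) (lam i) u
    \<longrightarrow>
    (let h = mesh_size S;
         mu = enn2real (cluster_mu J d lam \<Lambda>);
         u_lift = u \<circ> closest_point \<gamma>;
         W = span_on_Gamma S U J;
         Gu = form_projection (A_form S) (fe_space_zero_mean r S) u_lift;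
         Pu = form_projection (M_form S) W u_lift;
         Zu = form_projection (A_form S) W u_lift
     in M_norm S (\<lambda>x. u_lift x - Pu x - \<alpha>) \<le> M_norm S (\<lambda>x. u_lift x - Zu x - \<alpha>) \<and>
        M_norm S (\<lambda>x. u_lift x - Zu x - \<alpha>)
          \<le> C * (1 + mu) * M_norm S (\<lambda>x. u_lift x - Gu x - \<alpha>)
            + C * (1 + mu) * h ^ (k + 1) * M_norm S u_lift)"
proof -
  interpret narrow_tube \<gamma> \<delta>
    using assms(2,5) by unfold_locales (simp_all add: smooth_closed_surface_def)
  \<comment> \<open>These constants are fixed before the mesh, the eigenpairs and \<open>u\<close>,
    which is what makes the final constant uniform.\<close>
  obtain C h0 where C: "C > 0" "h0 > 0"
    and close: "\<And>\<sigma> (S :: ('n, 'm) discrete_surface) \<rho>. lifted_mesh \<gamma> \<delta> \<sigma> k S \<rho> \<Longrightarrow> standing_bounds \<gamma> k C0 S \<Longrightarrow>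
      0 \<le> mesh_size S \<Longrightarrow> mesh_size S \<le> h0 \<Longrightarrow> close_mesh \<gamma> \<delta> \<sigma> k S \<rho> (C * mesh_size S ^ (k + 1))"
    by (rule close_mesh_eventually[where 'n = 'n and ?C0.0 = C0, OF assms(6)]) (rule that)
  \<comment> \<open>2 is the factor of the error in the coarse bound, \<open>12 * C\<close> is
    \<open>2 * (6 * C)\<close> from the fine one, and the last entry makes \<open>D * ?h\<close> at
    least 1 on coarse meshes.\<close>
  define D where "D = max 2 (max (12 * C) (1 / h0 ^ (k + 1)))"
  have D: "2 \<le> D" "12 * C \<le> D" "1 / h0 ^ (k + 1) \<le> D" by (auto simp: D_def)
  show ?thesis
    unfolding Let_def
  proof (intro exI[of _ D] conjI allI impI)
    show "0 < D" using D(1) by simp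
    fix S :: "('n, 'm) discrete_surface" and \<rho>' \<eta>' lam d \<Lambda> U n N J i u \<alpha>
    assume a: "discrete_surface_of \<gamma> \<delta> k S \<and> standing_bounds \<gamma> k C0 S \<and>
      shape_regularity_constant S \<rho>' \<and> \<rho> \<le> \<rho>' \<and>
      quasi_uniformity_constant S \<eta>' \<and> \<eta>' \<le> \<eta> \<and>
      laplace_eigenvalues \<sigma> (nu \<gamma>) lam \<and> discrete_eigenpairs r S d \<Lambda> U \<and>
      1 \<le> n \<and> n + N \<le> d \<and> J = {n..n + N} \<and>
      lam (n - 1) < lam n \<and> lam (n + N) < lam (n + N + 1) \<and>
      cluster_mu J d lam \<Lambda> < \<infinity> \<and>
      i \<in> J \<and> eigenfunction \<sigma> (nu \<gamma>) (lam i) u"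
    then have disc: "discrete_eigenpairs r S d \<Lambda> U" and sb: "standing_bounds \<gamma> k C0 S"
      and fin: "cluster_mu J d lam \<Lambda> < \<infinity>" and iJ: "i \<in> J" and eig: "eigenfunction \<sigma> (nu \<gamma>) (lam i) u"
      by blast+
    have J: "J \<subseteq> {1..d}" using a by auto
    have M: "lifted_mesh \<gamma> \<delta> \<sigma> k S \<rho>'"
      using assms(1,2,4) a by unfold_locales (auto simp: smooth_closed_surface_def shape_regularity_constant_def)
    interpret lifted_mesh \<gamma> \<delta> \<sigma> k S \<rho>' by (rule M)
    have "mono lam" "0 < lam 1" using a by (simp_all add: laplace_eigenvalues_def)
    moreover have "1 \<le> i" using J iJ by auto
    ultimately have l: "0 < lam i" by (meson monoD less_le_trans)
    have "u \<in> H1 \<sigma> (nu \<gamma>)" using eig by (simp add: eigenfunction_def H1_zero_mean_def)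
    from H1_I[OF lift_weak_tgrad[OF weak_tgrad_tgrad[OF this]]]
    have v: "u \<circ> cp \<in> H1 \<Sigma> (normal S)" by (simp add: comp_def)
    let ?\<mu> = "enn2real (cluster_mu J d lam \<Lambda>)" and ?v = "u \<circ> cp"
    let ?E = "M_norm S (\<lambda>x. ?v x - form_projection (A_form S) (fe_space_zero_mean r S) ?v x - \<alpha>)"
      and ?Z = "M_norm S (\<lambda>x. ?v x - form_projection (A_form S) (span_on_Gamma S U J) ?v x - \<alpha>)"
      and ?h = "mesh_size S ^ (k + 1)" and ?N = "M_norm S ?v"
    note err = cluster_error[OF disc J v]
    show "M_norm S (\<lambda>x. ?v x - form_projection (M_form S) (span_on_Gamma S U J) ?v x - \<alpha>) \<le> ?Z"
      by (rule err(1))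
    have nn: "0 \<le> ?E" "0 \<le> ?N" "0 \<le> ?\<mu>" "0 \<le> ?h" using mesh_size_nonneg by (simp_all add: M_norm_sqrt)
    show "?Z \<le> D * (1 + ?\<mu>) * ?E + D * (1 + ?\<mu>) * ?h * ?N"
    proof (cases "mesh_size S \<le> h0")
      case True
      interpret close_mesh \<gamma> \<delta> \<sigma> k S \<rho>' "C * ?h" by (rule close[OF M sb mesh_size_nonneg True])
      have "?Z \<le> (1 + ?\<mu>) * ?E + 2 * (6 * (C * ?h)) * (1 + ?\<mu>) * ?N"
      proof (rule err(3)[OF l cluster_mu_bound[OF fin iJ l] nn(3)])
        show "0 \<le> 6 * (C * ?h)" using C(1) nn(4) by simp
      qed (assumption | rule eigenfunction_almost_discrete[OF l eig])+
      also have "\<dots> = 1 * ((1 + ?\<mu>) * ?E) + (12 * C) * ((1 + ?\<mu>) * ?h * ?N)" by (simp add: algebra_simps)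
      also have "\<dots> \<le> D * ((1 + ?\<mu>) * ?E) + D * ((1 + ?\<mu>) * ?h * ?N)"
        using D nn by (intro add_mono mult_right_mono) auto
      finally show ?thesis by (simp only: mult.assoc)
    next
      case False
      then have "h0 ^ (k + 1) \<le> ?h" using C(2) by (intro power_mono) auto
      \<comment> \<open>On coarse meshes the norm of \<open>u\<close> itself can thus be absorbed
        into the consistency term.\<close>
      then have "1 / h0 ^ (k + 1) * h0 ^ (k + 1) \<le> D * ?h"
        using D(1,3) C(2) by (intro mult_mono) auto
      then have Dh: "1 \<le> D * ?h" using C(2) by simp
      have "?Z \<le> 2 * ?E + 1 * ?N" using err(2)[of \<alpha>] by simp
      also have "\<dots> \<le> (D * (1 + ?\<mu>)) * ?E + (D * ?h * (1 + ?\<mu>)) * ?N"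
      proof (intro add_mono mult_right_mono nn)
        show "2 \<le> D * (1 + ?\<mu>)" using mult_mono[of 2 D 1 "1 + ?\<mu>"] D(1) nn(3) by simp
        show "1 \<le> D * ?h * (1 + ?\<mu>)" using mult_mono[of 1 "D * ?h" 1 "1 + ?\<mu>"] Dh nn(3) by simp
      qed
      finally show ?thesis by (simp only: mult_ac)
    qed
  qed
qed

end
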